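(* Assume either (H1) or (H1)$'$, and suppose $K\in\mathbb{R}^{r\times n}$ is picked such that the structure conditions (S) hold for some invertible $M_1,N_1$, together with the initial condition (I) on $x_0$ (all stated in the context). Then Problem (FSP) has a unique optimal control-state pair $(\bar u(\cdot),\bar x(\cdot))$, and it can be expressed linearly by the solution $(\bar x_1(\cdot),p(\cdot),q(\cdot))$ to the forward-backward stochastic differential equation $$\left\{\begin{aligned} d\bar x_1(t)=&\big[(A_1-B_1\hat R^{-1}S)\bar x_1+B_1\hat R^{-1}B_1^{\mathrm T}p+B_1\hat R^{-1}\tilde D_1^{\mathrm T}q\big]dt \\ &+\big[(C_{11}-\tilde D_1\hat R^{-1}S)\bar x_1+\tilde D_1\hat R^{-1}B_1^{\mathrm T}p+\tilde D_1\hat R^{-1}\tilde D_1^{\mathrm T}q\big]dW(t), \\ dp(t)=&-\big[(A_1-B_1\hat R^{-1}S)^{\mathrm T}p+(C_{11}-\tilde D_1\hat R^{-1}S)^{\mathrm T}q+(S^{\mathrm T}\hat R^{-1}S-\hat Q)\bar x_1\big]dt+q\,dW(t), \\ \bar x_1(0)=&\,x_{10},\qquad p(T)=-\hat H\bar x_1(T),\end{aligned}\right.$$ where $x_{10}=\begin{pmatrix}I_h&\mathbf{0}_{h\times(n-h)}\end{pmatrix}M_1x_0$; that is, there is a constant matrix $\Gamma$ (depending only on the coefficients) such that $\begin{pmatrix} \bar x \\ \bar u \end{pmatrix}=\Gamma\begin{pmatrix} \bar x_1 \\ p \\ q \end{pmatrix}$.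
   Context: Probability setting: $(\Omega,\mathcal{F},\{\mathcal{F}_t\},\mathbb{P})$ is a complete filtered probability space with a one-dimensional standard Brownian motion $W$ and its augmented natural filtration; $L^2_{\mathcal{F}_t}(0,T;\mathbb{R}^k)$ is the space of adapted $\mathbb{R}^k$-valued processes with $\mathbb{E}\int_0^T|x(t)|^2dt<\infty$; $L^2_{\mathcal{F}_t}(\Omega;C([0,T];\mathbb{R}^k))$ is the space of adapted continuous processes with $\mathbb{E}\sup_{0\le t\le T}|x(t)|^2<\infty$. $T>0$ is fixed. All matrices are constant; $X>0$ ($X\ge0$) means $X$ is symmetric positive definite (semi-definite). State equation: $E\,dx(t)=[Ax(t)+Bu(t)]dt+[Cx(t)+Du(t)]dW(t)$, $t\in(0,T]$, $Ex(0)=x_0$, with $E,A,C\in\mathbb{R}^{n\times n}$, $\mathrm{rank}(E)=m<n$, $B,D\in\mathbb{R}^{n\times r}$, $x_0\in\mathbb{R}^n$. $\mathcal{J}_{ad}[0,T]$ is the set of pairs $(u(\cdot),x(\cdot))$ such that $u(\cdot)\in L^2_{\mathcal{F}_t}(0,T;\mathbb{R}^r)$ is such that the state equation admits a unique solution $x(\cdot)\in L^2_{\mathcal{F}_t}(0,T;\mathbb{R}^n)$ under certain initial conditions (here: the given $x_0$, subject to the condition (I) below). Cost: $J(u,x)=\frac12\mathbb{E}\int_0^T(x^{\mathrm T}Qx+u^{\mathrm T}Ru)dt+\frac12\mathbb{E}[x^{\mathrm T}(T)E^{\mathrm T}HEx(T)]$, $Q,H\in\mathbb{R}^{n\times n}$,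 $R\in\mathbb{R}^{r\times r}$. Problem (FSP): for given $x_0$, find $(\bar u,\bar x)\in\mathcal{J}_{ad}[0,T]$ attaining $V(0,x_0):=\inf_{\mathcal{J}_{ad}[0,T]}J(u,x)$. Feedback: controls are written $u=Kx+v$, $v(\cdot)\in L^2_{\mathcal{F}_t}(0,T;\mathbb{R}^r)$. Conditions (S) on $K$: there are invertible $M_1,N_1\in\mathbb{R}^{n\times n}$ with $M_1EN_1=\mathrm{diag}(I_h,G)$, $M_1(A+BK)N_1=\mathrm{diag}(A_1,I_{n-h})$, $M_1B=\begin{pmatrix} B_1 \\ B_2 \end{pmatrix}$, $M_1(C+DK)N_1=\begin{pmatrix} C_{11}&C_{12} \\ \mathbf{0}_{(n-h)\times h}&C_{22} \end{pmatrix}$, $M_1D=\begin{pmatrix} D_1 \\ D_2 \end{pmatrix}$, where $C_{22}B_2=D_2$; $G=\mathrm{diag}(G_1,\dots,G_l)$ with $G_k\in\mathbb{R}^{m_k\times m_k}$ having $1$ on the first superdiagonal and $0$ elsewhere, $\sum_km_k=n-h$; $A_1,C_{11}\in\mathbb{R}^{h\times h}$, $C_{12}\in\mathbb{R}^{h\times(n-h)}$, $C_{22}\in\mathbb{R}^{(n-h)\times(n-h)}$, $B_1,D_1\in\mathbb{R}^{h\times r}$, $B_2,D_2\in\mathbb{R}^{(n-h)\times r}$; $B_2=(B_{21}^{\mathrm T},\dots,B_{2l}^{\mathrm T})^{\mathrm T}$ with each $B_{2k}\in\mathbb{R}^{m_k\times r}$ having only its first row possibly nonzero. Condition (I): $\begin{pmatrix}\mathbf{0}_{(n-h)\times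 h}&I_{n-h}\end{pmatrix}M_1x_0=\mathbf{0}_{(n-h)\times1}$. Notation: $\tilde D_1=D_1-C_{12}B_2$; $\begin{pmatrix} \hat Q&S^{\mathrm T} \\ S&\hat R \end{pmatrix}=\Theta^{\mathrm T}\begin{pmatrix} Q&\mathbf{0} \\ \mathbf{0}&R \end{pmatrix}\Theta$ with $\Theta=\begin{pmatrix} N_1&\mathbf{0}_{n\times r} \\ KN_1&I_r \end{pmatrix}\begin{pmatrix} I_h&\mathbf{0}_{h\times r} \\ \mathbf{0}_{(n-h)\times h}&-B_2 \\ \mathbf{0}_{r\times h}&I_r \end{pmatrix}$; $\hat H=\begin{pmatrix}I_h&\mathbf{0}\end{pmatrix}(M_1^{-1})^{\mathrm T}HM_1^{-1}\begin{pmatrix} I_h \\ \mathbf{0} \end{pmatrix}$. (H1): $Q>0$, $R>0$, $H\ge0$. (H1)$'$: $Q\ge0$, $\mathrm{rank}\Big(I_r+KN_1\begin{pmatrix} \mathbf{0}_{h\times r} \\ -B_2 \end{pmatrix}\Big)=r$, $R>0$, $H\ge0$. The solution of the forward-backward equation is the one in $L^2_{\mathcal{F}_t}(\Omega;C([0,T];\mathbb{R}^h))\times L^2_{\mathcal{F}_t}(\Omega;C([0,T];\mathbb{R}^h))\times L^2_{\mathcal{F}_t}(0,T;\mathbb{R}^h)$ (it exists and is unique under the stated assumptions).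
   Formalization: Under (H1), J_ad consists of controls u = Kx + v for which the state equation has a unique solution given v; with uniqueness required for given u the class can be empty, so no optimal pair exists. Whenever that class is nonempty the two coincide. Under (H1)' both classes are covered. *)

theory Defs
  imports
    "HOL-Probability.Probability"
    "Jordan_Normal_Form.Jordan_Normal_Form"
    "Jordan_Normal_Form.Gauss_Jordan_Elimination"
    "Jordan_Normal_Form.DL_Rank"
begin

(* Vectors and matrices are those of Jordan_Normal_Form, with dimensions given by
   carriers, since the block sizes h and m_k are part of the statement. *)
unbundle no inner_syntax
unbundle no vec_syntax

type_synonym 'a vproc = "real \<Rightarrow> 'a \<Rightarrow> real vec"

section \<open>Matrices\<close>

definition pos_def :: "nat \<Rightarrow> real mat \<Rightarrow> bool" where
  "pos_def k X \<longleftrightarrow> X \<in> carrier_mat k k \<and> transpose_mat X = X \<and>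
     (\<forall>v \<in> carrier_vec k. v \<noteq> 0\<^sub>v k \<longrightarrow> 0 < v \<bullet> (X *\<^sub>v v))"

definition pos_semidef :: "nat \<Rightarrow> real mat \<Rightarrow> bool" where
  "pos_semidef k X \<longleftrightarrow> X \<in> carrier_mat k k \<and> transpose_mat X = X \<and>
     (\<forall>v \<in> carrier_vec k. 0 \<le> v \<bullet> (X *\<^sub>v v))"

abbreviation mat_rank :: "nat \<Rightarrow> real mat \<Rightarrow> nat" where
  "mat_rank nr X \<equiv> vec_space.rank nr X"

(* Only meaningful for invertible X. *)
abbreviation minv :: "real mat \<Rightarrow> real mat" where
  "minv X \<equiv> the (mat_inverse X)"

(* The rows of X are split into consecutive blocks of heights given by the list ms;
   in each block, all rows but the first vanish. *)
definition only_first_rows :: "nat list \<Rightarrow> real mat \<Rightarrow> bool" where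
  "only_first_rows ms X \<longleftrightarrow>
     (\<forall>k < length ms. \<forall>i. 0 < i \<and> i < ms ! k \<longrightarrow>
        (\<forall>j < dim_col X. X $$ (sum_list (take k ms) + i, j) = 0))"

section \<open>Brownian motion, its augmented filtration, and spaces of processes\<close>

definition brownian_motion :: "'a measure \<Rightarrow> (real \<Rightarrow> 'a \<Rightarrow> real) \<Rightarrow> bool" where
  "brownian_motion M W \<longleftrightarrow>
     prob_space M \<and>
     (\<forall>t \<ge> 0. W t \<in> borel_measurable M) \<and>
     (AE \<omega> in M. W 0 \<omega> = 0) \<and>
     (AE \<omega> in M. continuous_on {0..} (\<lambda>t. W t \<omega>)) \<and>
     (\<forall>s t. 0 \<le> s \<and> s < t \<longrightarrow>
        distributed M lborel (\<lambda>\<omega>. W t \<omega> - W s \<omega>) (\<lambda>x. ennreal (normal_density 0 (sqrt (t - s)) x))) \<and>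
     (\<forall>\<tau> :: nat \<Rightarrow> real. \<forall>k. 0 \<le> \<tau> 0 \<and> mono \<tau> \<longrightarrow>
        prob_space.indep_vars M (\<lambda>_. borel) (\<lambda>i \<omega>. W (\<tau> (Suc i)) \<omega> - W (\<tau> i) \<omega>) {..<k})"

definition aug_filt :: "'a measure \<Rightarrow> (real \<Rightarrow> 'a \<Rightarrow> real) \<Rightarrow> real \<Rightarrow> 'a measure" where
  "aug_filt M W t =
     sigma (space M) ((\<Union>s\<in>{0..t}. sets (vimage_algebra (space M) (W s) borel)) \<union> null_sets M)"

definition adapted :: "'a measure \<Rightarrow> (real \<Rightarrow> 'a \<Rightarrow> real) \<Rightarrow> real \<Rightarrow> nat \<Rightarrow> 'a vproc \<Rightarrow> bool" where
  "adapted M W T k X \<longleftrightarrow>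
     (\<forall>t \<in> {0..T}. (\<forall>\<omega> \<in> space M. X t \<omega> \<in> carrier_vec k) \<and>
        (\<forall>i < k. (\<lambda>\<omega>. X t \<omega> $ i) \<in> borel_measurable (aug_filt M W t)))"

(* L^2_F(0,T;R^k). Joint measurability, implicit in the time integral, is explicit here. *)
definition L2_proc :: "'a measure \<Rightarrow> (real \<Rightarrow> 'a \<Rightarrow> real) \<Rightarrow> real \<Rightarrow> nat \<Rightarrow> 'a vproc set" where
  "L2_proc M W T k = {X. adapted M W T k X \<and>
     (\<forall>i < k. (\<lambda>(t, \<omega>). X t \<omega> $ i) \<in> borel_measurable (restrict_space borel {0..T} \<Otimes>\<^sub>M M)) \<and>
     (\<integral>\<^sup>+\<omega>. (\<integral>\<^sup>+t\<in>{0..T}. ennreal (X t \<omega> \<bullet> X t \<omega>) \<partial>lborel) \<partial>M) < \<infinity>}"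

(* L^2_F(Omega;C([0,T];R^k)) *)
definition L2_cont :: "'a measure \<Rightarrow> (real \<Rightarrow> 'a \<Rightarrow> real) \<Rightarrow> real \<Rightarrow> nat \<Rightarrow> 'a vproc set" where
  "L2_cont M W T k = {X. adapted M W T k X \<and>
     (\<forall>\<omega> \<in> space M. \<forall>i < k. continuous_on {0..T} (\<lambda>t. X t \<omega> $ i)) \<and>
     (\<integral>\<^sup>+\<omega>. (SUP t\<in>{0..T}. ennreal (X t \<omega> \<bullet> X t \<omega>)) \<partial>M) < \<infinity>}"

(* Equality in L^2_F(0,T;R^k): almost everywhere for dt x dP. *)
definition eq_L2 :: "'a measure \<Rightarrow> real \<Rightarrow> 'a vproc \<Rightarrow> 'a vproc \<Rightarrow> bool" where
  "eq_L2 M T X Y \<longleftrightarrow> (AE (t, \<omega>) in restrict_space lborel {0..T} \<Otimes>\<^sub>M M. X t \<omega> = Y t \<omega>)"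

definition indist :: "'a measure \<Rightarrow> real \<Rightarrow> 'a vproc \<Rightarrow> 'a vproc \<Rightarrow> bool" where
  "indist M T X Y \<longleftrightarrow> (AE \<omega> in M. \<forall>t\<in>{0..T}. X t \<omega> = Y t \<omega>)"

section \<open>The Ito integral\<close>

(* Simple integrands  sum_{i<k} xi_i 1_{(tau_i, tau_{i+1}]}  on [0,t]. *)
definition simple_integrand ::
  "'a measure \<Rightarrow> (real \<Rightarrow> 'a \<Rightarrow> real) \<Rightarrow> real \<Rightarrow> nat \<Rightarrow> (nat \<Rightarrow> real) \<Rightarrow> (nat \<Rightarrow> 'a \<Rightarrow> real) \<Rightarrow> bool" where
  "simple_integrand M W t k \<tau> \<xi> \<longleftrightarrow>
     0 \<le> \<tau> 0 \<and> (\<forall>i < k. \<tau> i \<le> \<tau> (Suc i)) \<and> \<tau> k \<le> t \<and>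
     (\<forall>i < k. \<xi> i \<in> borel_measurable (aug_filt M W (\<tau> i)) \<and> (\<exists>c. \<forall>\<omega> \<in> space M. \<bar>\<xi> i \<omega>\<bar> \<le> c))"

definition simple_fun :: "nat \<Rightarrow> (nat \<Rightarrow> real) \<Rightarrow> (nat \<Rightarrow> 'a \<Rightarrow> real) \<Rightarrow> real \<Rightarrow> 'a \<Rightarrow> real" where
  "simple_fun k \<tau> \<xi> s \<omega> = (\<Sum>i<k. \<xi> i \<omega> * indicator {\<tau> i<..\<tau> (Suc i)} s)"

definition simple_int ::
  "(real \<Rightarrow> 'a \<Rightarrow> real) \<Rightarrow> nat \<Rightarrow> (nat \<Rightarrow> real) \<Rightarrow> (nat \<Rightarrow> 'a \<Rightarrow> real) \<Rightarrow> 'a \<Rightarrow> real" where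
  "simple_int W k \<tau> \<xi> \<omega> = (\<Sum>i<k. \<xi> i \<omega> * (W (\<tau> (Suc i)) \<omega> - W (\<tau> i) \<omega>))"

(* Z is (a version of) the integral of f dW over [0,t], as an L^2 limit. *)
definition has_ito_integral ::
  "'a measure \<Rightarrow> (real \<Rightarrow> 'a \<Rightarrow> real) \<Rightarrow> real \<Rightarrow> (real \<Rightarrow> 'a \<Rightarrow> real) \<Rightarrow> ('a \<Rightarrow> real) \<Rightarrow> bool" where
  "has_ito_integral M W t f Z \<longleftrightarrow>
     Z \<in> borel_measurable M \<and>
     (\<exists>k \<tau> \<xi>. (\<forall>j :: nat. simple_integrand M W t (k j) (\<tau> j) (\<xi> j)) \<and>
        (\<lambda>j. \<integral>\<^sup>+\<omega>. (\<integral>\<^sup>+s\<in>{0..t}. ennreal ((simple_fun (k j) (\<tau> j) (\<xi> j) s \<omega> - f s \<omega>)\<^sup>2) \<partial>lborel) \<partial>M)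
          \<longlonglongrightarrow> 0 \<and>
        (\<lambda>j. \<integral>\<^sup>+\<omega>. ennreal ((simple_int W (k j) (\<tau> j) (\<xi> j) \<omega> - Z \<omega>)\<^sup>2) \<partial>M) \<longlonglongrightarrow> 0)"

(* dX = b dt + s dW on [0,T] in R^k, in integral form: for every t almost surely. *)
definition has_differential ::
  "'a measure \<Rightarrow> (real \<Rightarrow> 'a \<Rightarrow> real) \<Rightarrow> real \<Rightarrow> nat \<Rightarrow> 'a vproc \<Rightarrow> 'a vproc \<Rightarrow> 'a vproc \<Rightarrow> bool" where
  "has_differential M W T k X b s \<longleftrightarrow>
     (\<forall>t \<in> {0..T}. \<forall>i < k. \<exists>Z. has_ito_integral M W t (\<lambda>r \<omega>. s r \<omega> $ i) Z \<and>
        (AE \<omega> in M. X t \<omega> $ i = X 0 \<omega> $ i + (LINT r:{0..t}|lborel. b r \<omega> $ i) + Z \<omega>))"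

section \<open>The singular linear-quadratic problem\<close>

definition state_solution ::
  "'a measure \<Rightarrow> (real \<Rightarrow> 'a \<Rightarrow> real) \<Rightarrow> real \<Rightarrow> nat \<Rightarrow> real mat \<Rightarrow> real mat \<Rightarrow> real mat \<Rightarrow> real mat \<Rightarrow>
    real mat \<Rightarrow> real vec \<Rightarrow> 'a vproc \<Rightarrow> 'a vproc \<Rightarrow> bool" where
  "state_solution M W T n E A B C D x0 u x \<longleftrightarrow>
     x \<in> L2_proc M W T n \<and>
     (AE \<omega> in M. E *\<^sub>v x 0 \<omega> = x0) \<and>
     has_differential M W T n (\<lambda>t \<omega>. E *\<^sub>v x t \<omega>)
       (\<lambda>t \<omega>. A *\<^sub>v x t \<omega> + B *\<^sub>v u t \<omega>) (\<lambda>t \<omega>. C *\<^sub>v x t \<omega> + D *\<^sub>v u t \<omega>)"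

(* J_ad[0,T] for controls of the form u = F x + v: given the input v, the state equation
   under the control F x + v has x as its unique solution (unique in L^2).  For F = 0 this
   says that x is the unique solution for the control u itself.  Uniqueness for u depends
   only on the homogeneous equation, so the class for F = 0 is either the same as that for a
   gain F = K satisfying the structure conditions, or empty.  The latter can happen: with
   n = 2, r = 1, E = diag(1,0), A = C = D = 0, B = (0,1)^T, K = (0,1), the state equation is
   solvable only for u = 0, and then x_2 is arbitrary, whereas each v determines x
   (x_2 = -v) under the control K x + v. *)
definition J_ad ::
  "'a measure \<Rightarrow> (real \<Rightarrow> 'a \<Rightarrow> real) \<Rightarrow> real \<Rightarrow> nat \<Rightarrow> nat \<Rightarrow> real mat \<Rightarrow> real mat \<Rightarrow> real mat \<Rightarrow> real mat \<Rightarrow>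
    real mat \<Rightarrow> real vec \<Rightarrow> real mat \<Rightarrow> ('a vproc \<times> 'a vproc) set" where
  "J_ad M W T n r E A B C D x0 F = {(u, x).
     u \<in> L2_proc M W T r \<and> x \<in> L2_proc M W T n \<and>
     (\<exists>v \<in> L2_proc M W T r.
        (\<forall>t \<in> {0..T}. \<forall>\<omega> \<in> space M. u t \<omega> = F *\<^sub>v x t \<omega> + v t \<omega>) \<and>
        state_solution M W T n E A B C D x0 (\<lambda>t \<omega>. F *\<^sub>v x t \<omega> + v t \<omega>) x \<and>
        (\<forall>y. state_solution M W T n E A B C D x0 (\<lambda>t \<omega>. F *\<^sub>v y t \<omega> + v t \<omega>) y \<longrightarrow> eq_L2 M T y x))}"

definition cost ::
  "'a measure \<Rightarrow> real \<Rightarrow> real mat \<Rightarrow> real mat \<Rightarrow> real mat \<Rightarrow> real mat \<Rightarrow> 'a vproc \<Rightarrow> 'a vproc \<Rightarrow> real" where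
  "cost M T E Q R H u x =
     1/2 * (\<integral>\<omega>. (LINT t:{0..T}|lborel. x t \<omega> \<bullet> (Q *\<^sub>v x t \<omega>) + u t \<omega> \<bullet> (R *\<^sub>v u t \<omega>)) \<partial>M) +
     1/2 * (\<integral>\<omega>. x T \<omega> \<bullet> ((transpose_mat E * H * E) *\<^sub>v x T \<omega>) \<partial>M)"

definition optimal_pair ::
  "'a measure \<Rightarrow> real \<Rightarrow> real mat \<Rightarrow> real mat \<Rightarrow> real mat \<Rightarrow> real mat \<Rightarrow> ('a vproc \<times> 'a vproc) set \<Rightarrow>
    'a vproc \<Rightarrow> 'a vproc \<Rightarrow> bool" where
  "optimal_pair M T E Q R H \<A> u x \<longleftrightarrow>
     (u, x) \<in> \<A> \<and> cost M T E Q R H u x = (INF (u', x') \<in> \<A>. cost M T E Q R H u' x')"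

section \<open>The forward-backward equation\<close>

(* Dt, Qh, Rh, Hh are the matrices with tilde resp. hat. *)
definition fbsde_solution ::
  "'a measure \<Rightarrow> (real \<Rightarrow> 'a \<Rightarrow> real) \<Rightarrow> real \<Rightarrow> nat \<Rightarrow> real mat \<Rightarrow> real mat \<Rightarrow> real mat \<Rightarrow> real mat \<Rightarrow>
    real mat \<Rightarrow> real mat \<Rightarrow> real mat \<Rightarrow> real mat \<Rightarrow> real vec \<Rightarrow> 'a vproc \<Rightarrow> 'a vproc \<Rightarrow> 'a vproc \<Rightarrow> bool" where
  "fbsde_solution M W T h A1 B1 C11 Dt Qh Rh S Hh x10 x1 p q \<longleftrightarrow>
     x1 \<in> L2_cont M W T h \<and> p \<in> L2_cont M W T h \<and> q \<in> L2_proc M W T h \<and>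
     (let A' = A1 - B1 * minv Rh * S; C' = C11 - Dt * minv Rh * S in
        has_differential M W T h x1
          (\<lambda>t \<omega>. A' *\<^sub>v x1 t \<omega> + (B1 * minv Rh * transpose_mat B1) *\<^sub>v p t \<omega>
                 + (B1 * minv Rh * transpose_mat Dt) *\<^sub>v q t \<omega>)
          (\<lambda>t \<omega>. C' *\<^sub>v x1 t \<omega> + (Dt * minv Rh * transpose_mat B1) *\<^sub>v p t \<omega>
                 + (Dt * minv Rh * transpose_mat Dt) *\<^sub>v q t \<omega>) \<and>
        has_differential M W T h p
          (\<lambda>t \<omega>. - (transpose_mat A' *\<^sub>v p t \<omega> + transpose_mat C' *\<^sub>v q t \<omega>
                   + (transpose_mat S * minv Rh * S - Qh) *\<^sub>v x1 t \<omega>))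
          q) \<and>
     (AE \<omega> in M. x1 0 \<omega> = x10) \<and>
     (AE \<omega> in M. p T \<omega> = - (Hh *\<^sub>v x1 T \<omega>))"

end

(* The Weierstrass form splits the state into a slow part y, which solves a linear stochastic
   equation, and a fast part, which is forced to be -B2 v since G is nilpotent and only the first
   rows of the blocks of B2 are nonzero. The cost becomes a quadratic functional of (y, v) with the
   weights Qh, S, Rh, Hh. The forward-backward equation is solved by p = - P y, where P solves the
   matrix Riccati equation. By the Ito product formula for y and p, every admissible pair costs as
   much as the candidate plus the cost of the difference of the reduced pairs. This gives the
   optimality and the uniqueness of the optimal pair, and also that of (y, p, q). *)
theory Submission
 imports Defs
begin

text \<open>Passing from \<open>has_ito_integral\<close> to the linear closure \<open>ito\<close>
  works for every jointly measurable integrand, but the way back rests on explicit grid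
  approximations and covers continuous integrands with a square-integrable majorant. This is what
  the Riccati equation buys: \<open>q\<close> and the optimal input become linear functions, with
  coefficients continuous in time, of a continuous state, so the candidate satisfies the equations
  in the strict sense. All stochastic calculus is done in mean. Only E[X Y] is ever computed;
  uniqueness, optimality and even the product of a process with a deterministic factor follow from
  the vanishing of an expected square. An admissible state is determined only up to dt x dP null
  sets. Hence the fast part cannot be handled at single times, and one needs that an Ito process
  started at 0 and vanishing almost everywhere has vanishing drift and diffusion. Both hypotheses on
  the weights act through one fact: where the integrand of the reduced cost vanishes at (y, v), v is
  a linear function of y. At y = 0 it makes \<open>Rh\<close> positive definite; along the
  difference of two optimal pairs it leaves a homogeneous linear equation.\<close>

abbreviation BM where "BM == borel_measurable"
abbreviation tr where "tr == transpose_mat"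
abbreviation NI where "NI == nn_integral"
abbreviation uc where "uc f p == f (fst p) (snd p)"
abbreviation hv :: "real mat => real mat => real mat => real vec => real vec => real vec" where "hv R B D x y == minv R *\<^sub>v (tr B *\<^sub>v x + tr D *\<^sub>v y)"
no_notation matrix_vector_mult (infixl "*v" 70)
notation mult_mat_vec (infixl "*v" 70) and scalar_prod (infix "*." 70) and append_vec (infixr "@v" 65) and zero_vec ("0v") and LIMSEQ (infixr "---->" 60)
lemmas icong = Bochner_Integration.integral_cong and iadd = Bochner_Integration.integrable_add
 and isum = Bochner_Integration.integrable_sum and ibound = Bochner_Integration.integrable_bound and ible_cong = Bochner_Integration.integrable_cong
 and Isum = Bochner_Integration.integral_sum and Iadd = Bochner_Integration.integral_add

section \<open>Square-integrable functions\<close>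

definition sqi :: "'b measure => ('b => real) => bool" where
 "sqi N f \<longleftrightarrow> f : BM N & integrable N (%x. (f x)^2)"

lemma sqi_measurable: "sqi N f ==> f : BM N"
 and sqi_integrable: "sqi N f ==> integrable N (%x. (f x)^2)" by (auto simp: sqi_def)

lemma abs_mult_le_squares: "abs (a * b) <= a^2 + (b::real)^2"
proof -
 have "0 <= (abs a - abs b)^2" by simp
 then have "2 * (abs a * abs b) <= a^2 + b^2" by (simp add: power2_diff)
 moreover have "0 <= a^2 + b^2" by simp
 ultimately show ?thesis unfolding abs_mult by linarith
qed

lemma sqi_mult:
 assumes "sqi N f" "sqi N g" shows "integrable N (%x. f x * g x)" using assms unfolding sqi_def
 by (intro ibound[of N "%x. (f x)^2 + (g x)^2" "%x. f x * g x"]) (auto simp: abs_mult_le_squares)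

lemma square_add_le: "(a + b)^2 <= 2 * a^2 + 2 * (b::real)^2" using sum_squares_bound[of a b] by (simp add: power2_sum)

lemma sqi_add:
 assumes "sqi N f" "sqi N g" shows "sqi N (%x. f x + g x)" using assms sqi_mult[OF assms] unfolding sqi_def by (auto simp: power2_sum mult.assoc)

lemma sqi_cmult: "sqi N f ==> sqi N (%x. c * f x)" unfolding sqi_def by (auto simp: power_mult_distrib)

lemma sqi_uminus: "sqi N f ==> sqi N (%x. - f x)" unfolding sqi_def by auto

lemma sqi_diff:
 assumes "sqi N f" "sqi N g" shows "sqi N (%x. f x - g x)" using sqi_add[OF assms(1) sqi_uminus[OF assms(2)]] by simp

lemma sqi_zero: "sqi N (%x. 0)" unfolding sqi_def by auto

lemma sqi_sum: "(!!i. i : I ==> sqi N (f i)) ==> sqi N (%x. \<Sum>i\<in>I. f i x)"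
 by (induction I rule: infinite_finite_induct) (auto intro: sqi_add sqi_zero)

lemma sqi_bound:
 assumes "sqi N g" "f : BM N" "AE x in N. abs (f x) <= abs (g x)" shows "sqi N f"
proof -
 have "integrable N (%x. (f x)^2)" using assms unfolding sqi_def by (intro ibound[of N "%x. (g x)^2" "%x. (f x)^2"]) (auto simp: abs_le_square_iff)
 then show ?thesis using assms by (auto simp: sqi_def)
qed

lemma sqi_cong_AE:
 assumes "sqi N g" "f : BM N" "AE x in N. g x = f x" shows "sqi N f" by (rule sqi_bound[OF assms(1,2)]) (use assms(3) in auto)

lemma sqi_const: "finite_measure N ==> sqi N (%x. c)" unfolding sqi_def by (auto simp: finite_measure.integrable_const)

lemma sqi_bounded:
 "finite_measure N ==> f : BM N ==> (!!x. x : space N ==> abs (f x) <= c) ==> sqi N f" by (rule sqi_bound[OF sqi_const[of _ c]]) force+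

lemma sqi_imp_integrable:
 assumes "finite_measure N" "sqi N f" shows "integrable N f" using sqi_mult[OF assms(2) sqi_const[OF assms(1), of 1]] by simp

text \<open>The quadratic form s^2 a + 2 s t b + t^2 c is the integral of a square. At (c, -b) it
  equals c (c a - b^2), which settles c > 0; for c = 0 it is affine in t, so b must vanish.\<close>

lemma Cauchy_Schwarz_sqi:
 assumes f: "sqi N f" and g: "sqi N g" shows "(LINT x|N. f x * g x)^2 <= (LINT x|N. (f x)^2) * (LINT x|N. (g x)^2)"
proof -
 let ?a = "LINT x|N. (f x)^2" and ?b = "LINT x|N. f x * g x" and ?c = "LINT x|N. (g x)^2"
 have q: "0 <= s^2 * ?a + 2 * s * t * ?b + t^2 * ?c" for s t proof -
  have "0 <= (LINT x|N. (s * f x + t * g x)^2)" by (intro integral_nonneg_AE) auto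
  also have "... = (LINT x|N. s^2 * (f x)^2 + 2 * s * t * (f x * g x) + t^2 * (g x)^2)" by (intro icong) (auto simp: power2_eq_square algebra_simps)
  also have "... = s^2 * ?a + 2 * s * t * ?b + t^2 * ?c" using sqi_mult[OF f g] sqi_integrable[OF f] sqi_integrable[OF g] by simp
  finally show ?thesis .
 qed
 have c0: "0 <= ?c" by (intro integral_nonneg_AE) auto
 show ?thesis proof (cases "?c = 0")
  case False
  then have "0 < ?c" using c0 by linarith
  have "0 <= ?c * (?c * ?a - ?b^2)" using q[of ?c "- ?b"] by (simp add: power2_eq_square algebra_simps)
  then have "0 <= ?c * ?a - ?b^2" using \<open>0 < ?c\<close> by (simp add: zero_le_mult_iff)
  then show ?thesis by (simp add: mult.commute)
 next
  case True
  have "?b = 0" proof (rule ccontr)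
  assume b: "?b ~= 0"
  \<comment> \<open>For c = 0 and s = 1 this choice of t makes the form equal to -1.\<close>
  have "0 <= ?a + 2 * (- (?a + 1) / (2 * ?b)) * ?b" using q[of 1 "- (?a + 1) / (2 * ?b)"] True by simp
  also have "... = -1" using b by (simp add: field_simps)
  finally show False by simp
  qed
  then show ?thesis using True by simp
 qed
qed

text \<open>Square integrability is part of the notion: the Bochner integral of a nonintegrable
  function is 0, so convergence of the integrals alone would prove nothing.\<close>

definition L2lim :: "'b measure => (nat => 'b => real) => ('b => real) => bool" where
 "L2lim N fs f \<longleftrightarrow> (ALL j. sqi N (fs j)) & sqi N f & (%j. LINT x|N. (fs j x - f x)^2) ----> 0"

lemma L2lim_const: "sqi N f ==> sqi N g ==> AE x in N. f x = g x ==> L2lim N (%_. f) g"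
proof -
 assume a: "sqi N f" "sqi N g" "AE x in N. f x = g x"
 have "(LINT x|N. (f x - g x)^2) = 0" by (rule integral_eq_zero_AE) (use a(3) in auto)
 then show ?thesis using a by (simp add: L2lim_def)
qed

lemma L2lim_mult_left:
 assumes g: "sqi N g" and f: "L2lim N fs f" shows "(%j. LINT x|N. g x * fs j x) ----> (LINT x|N. g x * f x)"
proof -
 have fs: "sqi N (fs j)" and ff: "sqi N f" for j using f by (auto simp: L2lim_def)
 have "(%j. ((LINT x|N. g x * fs j x) - (LINT x|N. g x * f x))^2) ----> 0" proof (rule tendsto_sandwich[OF _ _ tendsto_const])
  show "\<forall>\<^sub>F j in sequentially. ((LINT x|N. g x * fs j x) - (LINT x|N. g x * f x))^2
  <= (LINT x|N. (g x)^2) * (LINT x|N. (fs j x - f x)^2)" proof (intro always_eventually allI)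
  fix j
  have "(LINT x|N. g x * fs j x) - (LINT x|N. g x * f x) = (LINT x|N. g x * (fs j x - f x))"
  using sqi_mult[OF g fs[of j]] sqi_mult[OF g ff] by (simp add: right_diff_distrib)
  then show "((LINT x|N. g x * fs j x) - (LINT x|N. g x * f x))^2
  <= (LINT x|N. (g x)^2) * (LINT x|N. (fs j x - f x)^2)" using Cauchy_Schwarz_sqi[OF g sqi_diff[OF fs[of j] ff]] by simp
  qed
  show "(%j. (LINT x|N. (g x)^2) * (LINT x|N. (fs j x - f x)^2)) ----> 0" using f by (auto simp: L2lim_def intro: tendsto_mult_right_zero)
 qed auto
 then have "(%j. sqrt (((LINT x|N. g x * fs j x) - (LINT x|N. g x * f x))^2)) ----> sqrt 0" by (rule tendsto_real_sqrt)
 then have "(%j. (LINT x|N. g x * fs j x) - (LINT x|N. g x * f x)) ----> 0" by (simp add: tendsto_rabs_zero_iff)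
 then show ?thesis by (simp add: LIM_zero_iff)
qed

lemma L2lim_cmult: "L2lim N fs f ==> L2lim N (%j x. c * fs j x) (%x. c * f x)"
proof -
 assume f: "L2lim N fs f"
 have "(%j. c^2 * (LINT x|N. (fs j x - f x)^2)) ----> 0" using f by (auto simp: L2lim_def intro: tendsto_mult_right_zero)
 also have "(%j. c^2 * (LINT x|N. (fs j x - f x)^2)) = (%j. LINT x|N. (c * fs j x - c * f x)^2)"
  by (auto simp: power_mult_distrib simp flip: right_diff_distrib)
 finally show ?thesis using f by (auto simp: L2lim_def intro: sqi_cmult)
qed

lemma L2lim_dominated:
 assumes w: "sqi N w" and f: "f : BM N" and fs: "!!j. fs j : BM N"
  and bnd: "!!j. AE x in N. abs (fs j x) <= abs (w x)"
  and lim: "AE x in N. (%j. fs j x) ----> f x" shows "L2lim N fs f"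
proof -
 have fsq: "sqi N (fs j)" for j using sqi_bound[OF w fs bnd] .
 have "AE x in N. ALL j. abs (fs j x) <= abs (w x)" using bnd by (simp add: AE_all_countable)
 then have fb: "AE x in N. abs (f x) <= abs (w x)" using lim proof eventually_elim
  case (elim x)
  have "(%j. abs (fs j x)) ----> abs (f x)" using elim by (intro tendsto_rabs) auto
  then show ?case by (rule LIMSEQ_le_const2) (use elim in auto)
 qed
 have fq: "sqi N f" using sqi_bound[OF w f fb] .
 have "(%j. LINT x|N. (fs j x - f x)^2) ----> (LINT x|N. 0)" proof (rule integral_dominated_convergence[where w = "%x. 4 * (w x)^2"])
  show "AE x in N. (%j. (fs j x - f x)^2) ----> 0" using lim proof eventually_elim
  case (elim x)
  have "(%j. (fs j x - f x)^2) ----> (f x - f x)^2" using elim by (intro tendsto_intros)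
  then show ?case by simp
  qed
  show "AE x in N. norm ((fs j x - f x)^2) <= 4 * (w x)^2" for j using bnd[of j] fb proof eventually_elim
  case (elim x)
  then have "abs (fs j x - f x) <= abs (2 * w x)" by linarith
  then have "(fs j x - f x)^2 <= (2 * w x)^2" by (simp only: abs_le_square_iff)
  then show ?case by (simp add: power_mult_distrib)
  qed
 qed (use w f fs in "auto simp: sqi_def")
 then show ?thesis using fsq fq by (auto simp: L2lim_def)
qed

lemma sqi_nn_finite:
 assumes "f : BM N" shows "sqi N f \<longleftrightarrow> (NI N (%x. ennreal ((f x)^2))) < \<infinity>"
 using assms by (auto simp: sqi_def integrable_iff_bounded)

lemma sqi_nn_integral: "sqi N f ==> (NI N (%x. ennreal ((f x)^2))) = ennreal (LINT x|N. (f x)^2)"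
 by (rule nn_integral_eq_integral) (auto simp: sqi_def)

text \<open>A finite distance to a single member makes the limit square integrable, after which the
  extended integrals become real ones.\<close>

lemma L2lim_from_nn:
 assumes f: "f : BM N" and fs: "!!j. sqi N (fs j)"
  and lim: "(%j. NI N (%x. ennreal ((fs j x - f x)^2))) ----> 0" shows "L2lim N fs f"
proof -
 have "\<forall>\<^sub>F j in sequentially. (NI N (%x. ennreal ((fs j x - f x)^2))) < \<infinity>" using lim by (rule order_tendstoD) simp
 then obtain j where "(NI N (%x. ennreal ((fs j x - f x)^2))) < \<infinity>" by (auto simp: eventually_sequentially)
 then have "sqi N (%x. fs j x - f x)" using fs[of j] f by (subst sqi_nn_finite) (auto simp: sqi_def)
 from sqi_diff[OF fs[of j] this] have fq: "sqi N f" by simp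
 have "(%j. ennreal (LINT x|N. (fs j x - f x)^2)) ----> ennreal 0" using lim sqi_nn_integral[OF sqi_diff[OF fs fq]] by simp
 then have "(%j. LINT x|N. (fs j x - f x)^2) ----> 0" by (subst (asm) tendsto_ennreal_iff) (auto intro!: always_eventually integral_nonneg_AE)
 then show ?thesis using fs fq by (auto simp: L2lim_def)
qed

lemma L2lim_nn:
 assumes "L2lim N fs f" shows "(%j. NI N (%x. ennreal ((fs j x - f x)^2))) ----> 0"
proof -
 have "(NI N (%x. ennreal ((fs j x - f x)^2))) = ennreal (LINT x|N. (fs j x - f x)^2)" for j
  using assms by (intro sqi_nn_integral sqi_diff) (auto simp: L2lim_def)
 moreover have "(%j. ennreal (LINT x|N. (fs j x - f x)^2)) ----> ennreal 0" using assms by (intro tendsto_ennrealI) (auto simp: L2lim_def)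
 ultimately show ?thesis by simp
qed

lemma sqi_zero_AE:
 assumes "sqi N f" "(LINT x|N. (f x)^2) <= 0" shows "AE x in N. f x = 0"
proof -
 have "(LINT x|N. (f x)^2) = 0" using assms(2) by (intro antisym integral_nonneg_AE) auto
 then have "AE x in N. (f x)^2 = 0" using integral_nonneg_eq_0_iff_AE[OF sqi_integrable[OF assms(1)]] by simp
 then show ?thesis by simp
qed

section \<open>Independence of Brownian increments from the past\<close>

locale wiener =
 fixes M :: "'a measure" and W :: "real => 'a => real"
 assumes bm: "brownian_motion M W" and compl: "complete_measure M"
begin

abbreviation "EE == integral\<^sup>L M"

sublocale prob_space M using bm by (simp add: brownian_motion_def)

abbreviation F :: "real => 'a measure" where "F == aug_filt M W"

lemma W_measurable: "0 <= t ==> W t : BM M" using bm by (auto simp: brownian_motion_def)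

definition gens :: "real => 'a set set" where
 "gens t = (\<Union>s\<in>{0..t}. sets (vimage_algebra (space M) (W s) borel)) Un null_sets M"

lemma gens_sub: "gens t <= sets M"
proof -
 have "sets (vimage_algebra (space M) (W s) borel) <= sets M" if "0 <= s" for s using measurable_sets[OF W_measurable[OF that]]
  by (auto simp: sets_vimage_algebra intro!: sets.sigma_sets_subset)
 then show ?thesis unfolding gens_def by (fastforce dest: subsetD)
qed

lemma gens_Pow: "gens t <= Pow (space M)" using gens_sub sets.sets_into_space by blast

lemma F_gens: "F t = sigma (space M) (gens t)" by (simp add: aug_filt_def gens_def)

lemma space_F [simp]: "space (F t) = space M" unfolding F_gens by (rule space_measure_of) (rule gens_Pow)

lemma sets_F: "sets (F t) = sigma_sets (space M) (gens t)" unfolding F_gens by (rule sets_measure_of) (rule gens_Pow)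

lemma sets_F_sub: "sets (F t) <= sets M" unfolding sets_F by (rule sets.sigma_sets_subset[OF gens_sub])

lemma subalgebra_F: "subalgebra M (F t)" by (simp add: subalgebra_def sets_F_sub)

lemma measurable_F_M: "f : BM (F t) ==> f : BM M" by (rule measurable_from_subalg[OF subalgebra_F])

lemma sets_F_mono: "s <= t ==> sets (F s) <= sets (F t)" unfolding sets_F gens_def by (rule sigma_sets_mono') fastforce

lemma measurable_F_mono: "s <= t ==> f : BM (F s) ==> f : BM (F t)" by (rule measurable_from_subalg) (auto simp: subalgebra_def sets_F_mono)

lemma W_measurable_F:
 assumes "0 <= s" "s <= t" shows "W s : BM (F t)"
proof (rule measurableI)
 fix A :: "real set" assume A: "A : sets borel"
 have "W s -` A Int space M : gens t" using A assms by (auto simp: gens_def intro!: bexI[of _ s] in_vimage_algebra)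
 then show "W s -` A Int space (F t) : sets (F t)" by (auto simp: sets_F)
qed simp

lemma null_sets_F: "N : null_sets M ==> N : sets (F t)" by (auto simp: sets_F gens_def)

lemma null_set_complete: "S <= N ==> N : null_sets M ==> S : null_sets M"
 using complete_measure.complete[OF compl, of S N] null_sets_subset[of N M S] by auto

text \<open>Completeness puts every subset of a null set into the augmented filtration, so changes
  on null sets do not affect adaptedness.\<close>

lemma measurable_F_AE:
 fixes f g :: "'a => real"
 assumes f: "f : BM (F t)" and eq: "AE w in M. f w = g w" shows "g : BM (F t)"
proof -
 obtain N where N: "N : null_sets M" "{w:space M. f w ~= g w} <= N" using eq by (auto simp: eventually_ae_filter)
 show ?thesis proof (rule measurableI)
  fix A :: "real set" assume A: "A : sets borel"
  have fA: "f -` A Int space M : sets (F t)" using measurable_sets[OF f A] by simp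
  have gN: "g -` A Int N Int space M : sets (F t)" by (rule null_sets_F, rule null_set_complete[OF _ N(1)]) auto
  have "g -` A Int space (F t) = (f -` A Int space M - N) Un (g -` A Int N Int space M)" using N(2) by auto
  then show "g -` A Int space (F t) : sets (F t)" using fA gN null_sets_F[OF N(1)] by auto
 qed simp
qed

text \<open>Events about W at finitely many times up to a. Together with the null sets they form an
  intersection-stable generator of the augmented sigma-algebra, so independence need only be checked
  on them.\<close>

definition cyls :: "real => 'a set set" where
 "cyls a = {C. EX S X. finite S & S <= {0..a} & (ALL s:S. X s : sets borel) &
  C = {w:space M. ALL s:S. W s w : X s}}"

lemma cyls_events: assumes "C : cyls a" shows "C : sets M"
proof -
 obtain S X where S: "finite S" "S <= {0..a}" "ALL s:S. X s : sets borel"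
  and C: "C = {w:space M. ALL s:S. W s w : X s}" using assms by (auto simp: cyls_def)
 have "{w:space M. W s w : X s} : sets M" if "s : S" for s proof -
  have "W s -` X s Int space M : sets M" using S that by (intro measurable_sets[OF W_measurable]) auto
  then show ?thesis by (simp add: vimage_def Int_def conj_commute)
 qed
 then show ?thesis unfolding C using S(1) by (intro sets.sets_Collect_finite_All) auto
qed

lemma Int_stable_cyls: "Int_stable (cyls a Un null_sets M)"
proof (rule Int_stableI)
 fix C D assume CD: "C : cyls a Un null_sets M" "D : cyls a Un null_sets M"
 show "C Int D : cyls a Un null_sets M" proof (cases "C : null_sets M \<or> D : null_sets M")
  case True
  then have "C Int D : null_sets M" by (meson Int_lower1 Int_lower2 null_set_complete)
  then show ?thesis by simp
 next
  case False
  then obtain S X S' X' where S: "finite S" "S <= {0..a}" "ALL s:S. X s : sets borel"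
  and C: "C = {w:space M. ALL s:S. W s w : X s}"
  and S': "finite S'" "S' <= {0..a}" "ALL s:S'. X' s : sets borel"
  and D: "D = {w:space M. ALL s:S'. W s w : X' s}" using CD by (auto simp: cyls_def)
  define Y where "Y s = (if s : S then X s else UNIV) Int (if s : S' then X' s else UNIV)" for s
  have "C Int D = {w:space M. ALL s:S Un S'. W s w : Y s}" unfolding C D Y_def by auto
  moreover have "ALL s:S Un S'. Y s : sets borel" using S S' by (auto simp: Y_def)
  ultimately have "C Int D : cyls a" using S S' unfolding cyls_def by (intro CollectI exI[of _ "S Un S'"] exI[of _ Y]) auto
  then show ?thesis by simp
 qed
qed

lemma gens_cyls: "gens a <= sigma_sets (space M) (cyls a Un null_sets M)"
proof -
 have "sets (vimage_algebra (space M) (W s) borel) <= cyls a" if "0 <= s" "s <= a" for s proof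
  fix A assume "A : sets (vimage_algebra (space M) (W s) borel)"
  then obtain B where B: "B : sets borel" "A = W s -` B Int space M" by (subst (asm) sets_vimage_algebra2) auto
  then show "A : cyls a" using that unfolding cyls_def by (intro CollectI exI[of _ "{s}"] exI[of _ "%_. B"]) auto
 qed
 then have "gens a <= cyls a Un null_sets M" unfolding gens_def by (fastforce dest: subsetD)
 then show ?thesis by (auto intro: sigma_sets.Basic)
qed

text \<open>Up to a null set the cylinder is an event about the increments of W along a grid from 0
  to a; the step from a to b is the next increment of the same grid, hence independent of the
  earlier ones.\<close>

lemma incr_cyl_indep:
 assumes ab: "0 <= a" "a < b" and C: "C : cyls a" and B: "B : sets borel"
 shows "prob (C Int ((%w. W b w - W a w) -` B Int space M)) = prob C * prob ((%w. W b w - W a w) -` B Int space M)"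
proof -
 obtain S X where S: "finite S" "S <= {0..a}" "ALL s:S. X s : sets borel"
  and Ceq: "C = {w:space M. ALL s:S. W s w : X s}" using C by (auto simp: cyls_def)
 \<comment> \<open>Inserting 0 and a makes the grid start at 0, where W vanishes almost surely, and
   end at a.\<close>
 define l where "l = sorted_list_of_set (insert 0 (insert a S))"
 define n where "n = length l - 1"
 have fin: "finite (insert 0 (insert a S))" using S by simp
 have sl: "sorted l" "distinct l" "set l = insert 0 (insert a S)"
  unfolding l_def using fin by (simp_all only: sorted_sorted_list_of_set distinct_sorted_list_of_set set_sorted_list_of_set)
 have len: "length l = Suc n" using sl(3) by (cases l) (auto simp: n_def)
 have l0: "l ! 0 = 0" proof -
  obtain i where "i < length l" "l ! i = 0" using sl(3) by (metis in_set_conv_nth insertI1)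
  then have "l ! 0 <= 0" using sl(1) sorted_nth_mono[of l 0 i] by auto
  moreover have "l ! 0 : set l" using len by (intro nth_mem) auto
  then have "0 <= l ! 0" using sl(3) S(2) ab by auto
  ultimately show ?thesis by simp
 qed
 have ln: "l ! n = a" proof -
  obtain i where i: "i < length l" "l ! i = a" using sl(3) by (metis in_set_conv_nth insertI1 insertI2)
  then have "a <= l ! n" using sl(1) sorted_nth_mono[of l i n] len by auto
  moreover have "l ! n : set l" using len by (intro nth_mem) auto
  then have "l ! n <= a" using sl(3) S(2) ab by auto
  ultimately show ?thesis by simp
 qed
 \<comment> \<open>All later points are b. So t is monotone on all natural numbers, as the
   definition of Brownian motion demands, and the n-th increment is W b - W a.\<close>
 define t where "t i = (if i <= n then l ! i else b)" for i
 have mono: "mono t" proof (rule monoI)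
  fix i j :: nat assume ij: "i <= j"
  show "t i <= t j" proof (cases "j <= n")
  case True then show ?thesis using ij sl(1) len by (auto simp: t_def intro: sorted_nth_mono)
  next
  case False
  have "l ! i <= b" if "i <= n" using that sorted_nth_mono[OF sl(1), of i n] len ln ab by auto
  then show ?thesis using False ij by (auto simp: t_def)
  qed
 qed
 have t0: "0 <= t 0" using l0 by (simp add: t_def)
 let ?\<Delta> = "%i w. W (t (Suc i)) w - W (t i) w"
 have ind: "indep_vars (%_. borel) ?\<Delta> {..<Suc n}" using bm mono t0 unfolding brownian_motion_def by blast
 have D: "?\<Delta> n = (%w. W b w - W a w)" by (auto simp: t_def ln)
 have iv: "indep_var (PiM {..<n} (%_. borel)) (%w. restrict (%i. ?\<Delta> i w) {..<n})
  (PiM {n} (%_. borel)) (%w. restrict (%i. ?\<Delta> i w) {n})" by (rule indep_var_restrict[OF ind]) auto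
 \<comment> \<open>Partial sums of increments recover the values of W at the grid points.\<close>
 define E where "E = {f : space (PiM {..<n} (%_. borel::real measure)). ALL j:{j. j <= n & l ! j : S}. (\<Sum>i<j. f i) : X (l ! j)}"
 have Es: "E : sets (PiM {..<n} (%_. borel))" unfolding E_def proof (intro sets.sets_Collect_finite_All)
  fix j assume j: "j : {j. j <= n & l ! j : S}"
  have "(%f. \<Sum>i<j. f i) : BM (PiM {..<n} (%_. borel::real measure))" using j by (intro borel_measurable_sum measurable_component_singleton) auto
  then have "(%f. \<Sum>i<j. f i) -` X (l ! j) Int space (PiM {..<n} (%_. borel)) : sets (PiM {..<n} (%_. borel::real measure))"
  using j S(3) by (intro measurable_sets[of _ _ borel]) auto
  then show "{f : space (PiM {..<n} (%_. borel::real measure)). (\<Sum>i<j. f i) : X (l ! j)} : sets (PiM {..<n} (%_. borel))"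
  by (simp add: vimage_def Int_def conj_commute)
 qed simp
 define B' where "B' = {f : space (PiM {n} (%_. borel::real measure)). f n : B}"
 have B's: "B' : sets (PiM {n} (%_. borel))" proof -
  have "(%f. f n) -` B Int space (PiM {n} (%_. borel::real measure)) : sets (PiM {n} (%_. borel))"
  using B by (intro measurable_sets[of _ _ borel] measurable_component_singleton) auto
  then show ?thesis by (simp add: B'_def vimage_def Int_def conj_commute)
 qed
 let ?A = "%w. restrict (%i. ?\<Delta> i w) {..<n}" and ?N = "%w. restrict (%i. ?\<Delta> i w) {n}"
 have Bp: "?N -` B' Int space M = (%w. W b w - W a w) -` B Int space M" unfolding B'_def D[symmetric] by (auto simp: space_PiM)
 have W0: "AE w in M. W 0 w = 0" using bm by (simp add: brownian_motion_def)
 have AEC: "AE w in M. w : C \<longleftrightarrow> w : ?A -` E Int space M" using W0 AE_space proof eventually_elim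
  case (elim w)
  have tele: "(\<Sum>i<j. ?\<Delta> i w) = W (l ! j) w" if "j <= n" for j
  using that sum_lessThan_telescope[of "%i. W (t i) w" j] elim(1) l0 by (simp add: t_def)
  have r: "(\<Sum>i<j. ?A w i) = W (l ! j) w" if "j <= n" for j proof -
  have "(\<Sum>i<j. ?A w i) = (\<Sum>i<j. ?\<Delta> i w)" by (rule sum.cong) (use that in auto)
  then show ?thesis using tele[OF that] by simp
  qed
  have "(ALL s:S. W s w : X s) \<longleftrightarrow> (ALL j:{j. j <= n & l ! j : S}. W (l ! j) w : X (l ! j))" proof safe
  fix s assume *: "ALL j:{j. j <= n & l ! j : S}. W (l ! j) w : X (l ! j)" "s : S"
  then obtain j where "j < length l" "l ! j = s" using sl(3) by (metis in_set_conv_nth insertI2)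
  then show "W s w : X s" using * len by auto
  qed auto
  then show ?case using elim(2) r by (auto simp: Ceq E_def space_PiM)
 qed
 have As: "?A -` E Int space M : sets M" "?N -` B' Int space M : sets M"
  using indep_var_rv1[OF iv] indep_var_rv2[OF iv] Es B's by (auto intro: measurable_sets)
 have "prob (C Int (?N -` B' Int space M)) = prob ((?A -` E Int space M) Int (?N -` B' Int space M))"
  using AEC As cyls_events[OF C] by (intro finite_measure_eq_AE) auto
 also have "(?A -` E Int space M) Int (?N -` B' Int space M) = (%x. (?A x, ?N x)) -` (E \<times> B') Int space M" by auto
 also have "prob ... = prob (?A -` E Int space M) * prob (?N -` B' Int space M)" by (rule indep_varD[OF iv Es B's])
 also have "prob (?A -` E Int space M) = prob C" using AEC As cyls_events[OF C] by (intro finite_measure_eq_AE) auto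
 finally show ?thesis unfolding Bp .
qed

lemma incr_measurable: "0 <= a ==> 0 <= b ==> (%w. W b w - W a w) : BM M" by (intro borel_measurable_diff W_measurable)

text \<open>Independence passes from intersection-stable generators to the sigma-algebras that they
  generate.\<close>

lemma incr_indep:
 assumes ab: "0 <= a" "a < b" and x: "x : BM (F a)" shows "indep_var borel x borel (%w. W b w - W a w)"
proof -
 let ?D = "%w. W b w - W a w"
 let ?B = "{?D -` B Int space M |B. B : sets borel}"
 have Dm: "?D : BM M" using ab by (intro incr_measurable) auto
 have "indep_set (cyls a Un null_sets M) ?B" proof (rule indep_setI)
  show "cyls a Un null_sets M <= events" using cyls_events by auto
  show "?B <= events" using measurable_sets[OF Dm] by auto
  fix C E assume C: "C : cyls a Un null_sets M" and E: "E : ?B"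
  then obtain B where B: "B : sets borel" "E = ?D -` B Int space M" by auto
  show "prob (C Int E) = prob C * prob E" proof (cases "C : null_sets M")
  case True
  moreover have "C Int E : null_sets M" by (rule null_set_complete[OF _ True]) auto
  ultimately show ?thesis by (simp add: measure_def null_setsD1)
  next
  case False
  then have "C : cyls a" using C by simp
  from incr_cyl_indep[OF ab this B(1)] show ?thesis unfolding B(2) .
  qed
 qed
 then have "indep_set (sigma_sets (space M) (cyls a Un null_sets M)) (sigma_sets (space M) ?B)"
 proof (rule indep_set_sigma_sets[OF _ Int_stable_cyls])
  show "Int_stable ?B" proof (rule Int_stableI)
  fix E E' assume "E : ?B" "E' : ?B"
  then obtain B B' where B: "B : sets borel" "E = ?D -` B Int space M" "B' : sets borel" "E' = ?D -` B' Int space M" by blast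
  then have "E Int E' = ?D -` (B Int B') Int space M" by auto
  then show "E Int E' : ?B" using B by blast
  qed
 qed
 then have "indep_set (sigma_sets (space M) {x -` A Int space M |A. A : sets borel}) (sigma_sets (space M) ?B)" unfolding indep_set_def
 proof (rule indep_sets_mono_sets)
  fix i :: bool
  have "{x -` A Int space M |A. A : sets borel} <= sigma_sets (space M) (gens a)" using measurable_sets[OF x] by (auto simp: sets_F)
  also have "... <= sigma_sets (space M) (cyls a Un null_sets M)" by (rule sigma_sets_mono[OF gens_cyls])
  finally have "sigma_sets (space M) {x -` A Int space M |A. A : sets borel} <= sigma_sets (space M) (cyls a Un null_sets M)"
  by (rule sigma_sets_mono)
  then show "case_bool (sigma_sets (space M) {x -` A Int space M |A. A : sets borel}) (sigma_sets (space M) ?B) i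
  <= case_bool (sigma_sets (space M) (cyls a Un null_sets M)) (sigma_sets (space M) ?B) i" by (auto split: bool.split)
 qed
 then show ?thesis unfolding indep_var_eq using Dm measurable_F_M[OF x] by auto
qed

lemma incr_moments:
 assumes "0 <= a" "a < b" shows "integrable M (%w. W b w - W a w)" "EE (%w. W b w - W a w) = 0"
  "integrable M (%w. (W b w - W a w)^2)" "EE (%w. (W b w - W a w)^2) = b - a"
proof -
 let ?s = "sqrt (b - a)"
 have s: "0 < ?s" using assms by simp
 have D: "distributed M lborel (%w. W b w - W a w) (%x. ennreal (normal_density 0 ?s x))" using bm assms unfolding brownian_motion_def by blast
 show "integrable M (%w. W b w - W a w)" using distributed_integrable[OF D, of "%x. x"] integrable_normal_moment[OF s, of 0 1] by simp
 show e: "EE (%w. W b w - W a w) = 0" by (rule normal_distributed_expectation[OF s D])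
 show "integrable M (%w. (W b w - W a w)^2)" using distributed_integrable[OF D, of "%x. x^2"] integrable_normal_moment[OF s, of 0 2] by simp
 show "EE (%w. (W b w - W a w)^2) = b - a" using normal_distributed_variance[OF s D] assms unfolding e by simp
qed

lemma incr_mult:
 assumes ab: "0 <= a" "a <= b" and e: "e : BM (F a)" "integrable M e"
 shows "integrable M (%w. e w * (W b w - W a w)) & EE (%w. e w * (W b w - W a w)) = 0 &
  integrable M (%w. e w * (W b w - W a w)^2) &
  EE (%w. e w * (W b w - W a w)^2) = (b - a) * EE e"
proof (cases "a = b")
 case False
 then have ab': "a < b" using ab by simp
 note i = incr_indep[OF ab(1) ab' e(1)] and m = incr_moments[OF ab(1) ab']
 have "indep_var borel (id \<circ> e) borel ((%x. x^2) \<circ> (%w. W b w - W a w))" by (rule indep_var_compose[OF i]) auto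
 then have i2: "indep_var borel e borel (%w. (W b w - W a w)^2)" by (simp add: comp_def)
 show ?thesis using indep_var_integrable[OF i e(2) m(1)] indep_var_lebesgue_integral[OF i e(2) m(1)]
  indep_var_integrable[OF i2 e(2) m(3)] indep_var_lebesgue_integral[OF i2 e(2) m(3)] m(2,4) by simp
qed simp

end

section \<open>The time-probability product space\<close>

abbreviation lb :: "real => real measure" where
 "lb t == restrict_space lborel {0..t}"

lemma fin_lb: "finite_measure (lb t)"
 by (rule finite_measureI) (auto simp: space_restrict_space emeasure_restrict_space emeasure_lborel_Icc_eq)

lemma space_lb [simp]: "space (lb t) = {0..t}" by (simp add: space_restrict_space)

lemma set_integral_lb: "(LINT r:{0..t}|lborel. f r) = (LINT r|lb t. f r)" for f :: "real => real"
 by (simp add: set_lebesgue_integral_def integral_restrict_space)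

lemma set_nn_integral_lb: "(\<integral>\<^sup>+r\<in>{0..t}. f r \<partial>lborel) = (NI (lb t) (%r. f r))" by (simp add: nn_integral_restrict_space)

lemma measurable_lb: "f : BM borel ==> f : BM (lb t)" by (rule measurable_restrict_space1) simp

lemma emeasure_lb: "0 <= t ==> emeasure (lb t) {0..t} = ennreal t" by (simp add: emeasure_restrict_space)

lemma measure_lb: "0 <= t ==> measure (lb t) {0..t} = t" by (simp add: measure_def emeasure_lb)

context wiener
begin

definition Q :: "real => (real \<times> 'a) measure" where "Q t = lb t \<Otimes>\<^sub>M M"

lemma pair_sf: "pair_sigma_finite (lb t) M" by (intro pair_sigma_finite.intro finite_measure.axioms(1) fin_lb sigma_finite_measure_axioms)

lemma finite_measure_Q: "finite_measure (Q t)" unfolding Q_def by (intro finite_measure_pair_measure fin_lb finite_measure_axioms)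

lemma space_Q: "space (Q t) = {0..t} \<times> space M" by (simp add: Q_def space_pair_measure)

lemma sets_Q_borel: "sets (Q t) = sets (restrict_space borel {0..t} \<Otimes>\<^sub>M M)"
 unfolding Q_def by (intro sets_pair_measure_cong sets_restrict_space_cong) auto

lemma measurable_Q_borel: "f : measurable (Q t) N \<longleftrightarrow> f : measurable (restrict_space borel {0..t} \<Otimes>\<^sub>M M) N"
 by (rule arg_cong[where f="%X. f : X"]) (rule measurable_cong_sets[OF sets_Q_borel refl])

text \<open>Exhibits the product measures for all horizons as restrictions of one measure; this is
  what lets \<open>Q s\<close> and \<open>Q t\<close> be compared for s <= t.\<close>

lemma Q_restrict: "Q t = restrict_space (lborel \<Otimes>\<^sub>M M) ({0..t} \<times> UNIV)"
proof -
 let ?R = "restrict_space (lborel \<Otimes>\<^sub>M M) ({0..t} \<times> UNIV)"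
 have R: "({0..t} \<times> UNIV) Int space (lborel \<Otimes>\<^sub>M M) = {0..t} \<times> space M" by (auto simp: space_pair_measure)
 have Rs: "{0..t} \<times> space M : sets (lborel \<Otimes>\<^sub>M M)" by auto
 have sf: "sigma_finite_measure (lb t)" using fin_lb by (rule finite_measure.axioms)
 interpret P: pair_sigma_finite lborel M ..
 show ?thesis unfolding Q_def proof (rule pair_measure_eqI[OF sf sigma_finite_measure_axioms])
  show "sets (lb t \<Otimes>\<^sub>M M) = sets ?R" proof (rule antisym)
  show "sets (lb t \<Otimes>\<^sub>M M) <= sets ?R" proof -
  have "sigma_sets ({0..t} \<times> space M) {A \<times> B |A B. A : sets (lb t) & B : sets M}
  <= sets ?R" proof -
  have sp: "space ?R = {0..t} \<times> space M" by (auto simp: space_restrict_space space_pair_measure)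
  have sub: "{A \<times> B |A B. A : sets (lb t) & B : sets M} <= sets ?R" proof safe
  fix A B assume AB: "A : sets (lb t)" "B : sets M"
  then have "A <= {0..t}" "A : sets lborel" by (auto simp: sets_restrict_space_iff)
  then show "A \<times> B : sets ?R" using AB(2) Rs R by (subst sets_restrict_space_iff) auto
  qed
  show ?thesis using sets.sigma_sets_subset[OF sub] unfolding sp .
  qed
  then show ?thesis by (simp add: sets_pair_measure)
  qed
  show "sets ?R <= sets (lb t \<Otimes>\<^sub>M M)" proof
  fix X assume "X : sets ?R"
  then have X: "X <= {0..t} \<times> UNIV" "X : sets (lborel \<Otimes>\<^sub>M M)" using Rs R by (auto simp: sets_restrict_space_iff)
  have "(%x. x) : measurable (lb t) lborel" by (rule measurable_restrict_space1) simp
  then have "(%p. (fst p, snd p)) : measurable (lb t \<Otimes>\<^sub>M M) (lborel \<Otimes>\<^sub>M M)"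
  by (intro measurable_Pair measurable_compose[OF measurable_fst] measurable_snd) auto
  from measurable_sets[OF this X(2)]
  have "(%p. (fst p, snd p)) -` X Int space (lb t \<Otimes>\<^sub>M M) : sets (lb t \<Otimes>\<^sub>M M)" .
  also have "(%p. (fst p, snd p)) -` X Int space (lb t \<Otimes>\<^sub>M M) = X"
  using X(1) sets.sets_into_space[OF X(2)] by (auto simp: space_pair_measure)
  finally show "X : sets (lb t \<Otimes>\<^sub>M M)" .
  qed
  qed
  fix A B assume AB: "A : sets (lb t)" "B : sets M"
  then have A: "A <= {0..t}" "A : sets lborel" by (auto simp: sets_restrict_space_iff)
  have "emeasure ?R (A \<times> B) = emeasure (lborel \<Otimes>\<^sub>M M) (A \<times> B)" by (rule emeasure_restrict_space) (use A Rs R in auto)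
  also have "... = emeasure lborel A * emeasure M B" using A AB by (intro emeasure_pair_measure_Times) auto
  also have "emeasure lborel A = emeasure (lb t) A" by (rule emeasure_restrict_space[symmetric]) (use A in auto)
  finally show "emeasure (lb t) A * emeasure M B = emeasure ?R (A \<times> B)" ..
 qed
qed

lemma Times_sets: "({0..t::real} \<times> UNIV) Int space (lborel \<Otimes>\<^sub>M M) : sets (lborel \<Otimes>\<^sub>M M)"
proof -
 have "({0..t} \<times> UNIV) Int space (lborel \<Otimes>\<^sub>M M) = {0..t} \<times> space M" by (auto simp: space_pair_measure)
 moreover have "{0..t} \<times> space M : sets (lborel \<Otimes>\<^sub>M M)" by (intro pair_measureI) auto
 ultimately show ?thesis by (simp only:)
qed

lemma Q_restrict_Q: assumes "s <= t" shows "Q s = restrict_space (Q t) ({0..s} \<times> UNIV)"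
proof -
 have "({0..t} \<times> UNIV) Int ({0..s} \<times> UNIV) = ({0..s} \<times> (UNIV :: 'a set))" using assms by auto
 then show ?thesis unfolding Q_restrict by (simp only: restrict_restrict_space[OF Times_sets Times_sets])
qed

lemma Q_sub_sets: "s <= t ==> ({0..s} \<times> UNIV) Int space (Q t) : sets (Q t)"
proof -
 assume "s <= t"
 then have "({0..s} \<times> UNIV) Int space (Q t) = {0..s} \<times> space M" by (auto simp: space_Q)
 moreover have "{0..s} : sets (lb t)" using \<open>s <= t\<close> by (simp add: sets_restrict_space_iff)
 ultimately show ?thesis unfolding Q_def by simp
qed

lemma measurable_Q_mono: "s <= t ==> f : BM (Q t) ==> f : BM (Q s)" unfolding Q_restrict_Q by (rule measurable_restrict_space1)

lemma integrable_Q_sub: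
 fixes f :: "real \<times> 'a => real" assumes "s <= t"
 shows "integrable (Q s) f \<longleftrightarrow> integrable (Q t) (%p. indicator {0..s} (fst p) * f p)"
 and "(LINT p|Q s. f p) = (LINT p|Q t. indicator {0..s} (fst p) * f p)" unfolding Q_restrict_Q[OF assms] using Q_sub_sets[OF assms]
 by (auto simp: integrable_restrict_space integral_restrict_space indicator_times)

lemma indicator_fst_Q: "(%p. indicator A (fst p) :: real) : BM (Q t)" if "A : sets borel" unfolding Q_def using that
 by (intro measurable_compose[OF measurable_fst measurable_lb]) auto

lemma integrable_Q_mono:
 fixes f :: "real \<times> 'a => real" shows "s <= t ==> integrable (Q t) f ==> integrable (Q s) f" by (subst integrable_Q_sub(1)[of s t], assumption,
  rule ibound[of _ f]) (auto intro!: borel_measurable_times indicator_fst_Q split: split_indicator)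

lemma sqi_Q_mono: "s <= t ==> sqi (Q t) f ==> sqi (Q s) f" by (auto simp: sqi_def intro: integrable_Q_mono measurable_Q_mono)

lemma integral_Q_mono:
 fixes f :: "real \<times> 'a => real"
 assumes "s <= t" "integrable (Q t) f" "!!p. 0 <= f p" shows "(LINT p|Q s. f p) <= (LINT p|Q t. f p)" unfolding integrable_Q_sub(2)[OF assms(1)]
 using assms integrable_Q_mono[OF assms(1,2)] integrable_Q_sub(1)[OF assms(1)] by (intro integral_mono) (auto simp: indicator_def)

lemma AE_Q_mono: "s <= t ==> AE p in Q t. P p ==> AE p in Q s. P p"
 unfolding Q_restrict_Q[of s t] by (subst AE_restrict_space_iff) (auto simp: Q_sub_sets)

lemma integral_Q_fst:
 fixes f :: "real \<times> 'a => real" assumes f: "integrable (Q t) f" shows "(LINT p|Q t. f p) = (LINT s|lb t. (LINT w|M. f (s, w)))"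
  "AE s in lb t. integrable M (%w. f (s, w))" "integrable (lb t) (%s. LINT w|M. f (s, w))"
proof -
 interpret pair_sigma_finite "lb t" M by (rule pair_sf)
 show "(LINT p|Q t. f p) = (LINT s|lb t. (LINT w|M. f (s, w)))"
  "AE s in lb t. integrable M (%w. f (s, w))" "integrable (lb t) (%s. LINT w|M. f (s, w))"
  using integral_fst'[of f] AE_integrable_fst'[of f] integrable_fst'[of f] f unfolding Q_def by auto
qed

lemma integral_Q_snd:
 fixes f :: "real \<times> 'a => real" assumes f: "integrable (Q t) f" shows "(LINT p|Q t. f p) = (LINT w|M. (LINT s|lb t. f (s, w)))"
  "AE w in M. integrable (lb t) (%s. f (s, w))" "integrable M (%w. LINT s|lb t. f (s, w))"
proof -
 interpret pair_sigma_finite "lb t" M by (rule pair_sf)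
 have f': "integrable (lb t \<Otimes>\<^sub>M M) (case_prod (%s w. f (s, w)))" using f unfolding Q_def by simp
 show "(LINT p|Q t. f p) = (LINT w|M. (LINT s|lb t. f (s, w)))"
  "AE w in M. integrable (lb t) (%s. f (s, w))" "integrable M (%w. LINT s|lb t. f (s, w))"
  using integral_snd[OF f'] AE_integrable_snd[OF f'] integrable_snd[OF f'] unfolding Q_def by auto
qed

lemma nn_integral_Q_fst:
 assumes "f : BM (Q t)" shows "(NI (Q t) (%p. f p)) = (NI (lb t) (%s. (NI M (%w. f (s, w)))))"
 using nn_integral_fst[of f "lb t"] assms by (simp add: Q_def)

lemma nn_integral_Q_snd:
 assumes "f : BM (Q t)" shows "(NI (Q t) (%p. f p)) = (NI M (%w. (NI (lb t) (%s. f (s, w)))))"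
proof -
 interpret pair_sigma_finite "lb t" M by (rule pair_sf)
 show ?thesis using nn_integral_snd[of f] assms by (simp add: Q_def)
qed

lemma measurable_Q_snd: "x : BM M ==> (%p. x (snd p)) : BM (Q t)" unfolding Q_def by (rule measurable_compose[OF measurable_snd])

lemma measurable_Q_section:
 assumes "f : BM (Q t)" "s : {0..t}" shows "(%w. f (s, w)) : BM M"
 using assms unfolding Q_def by (intro measurable_compose[OF measurable_Pair1']) auto

lemma measurable_Q_section2:
 assumes "f : BM (Q t)" "w : space M" shows "(%s. f (s, w)) : BM (lb t)"
 using assms unfolding Q_def by (intro measurable_compose[OF measurable_Pair2']) auto

lemma sqi_Q_snd: assumes "sqi M x" shows "sqi (Q t) (%p. x (snd p))"
proof -
 have m: "(%p. x (snd p)) : BM (Q t)" using assms by (intro measurable_Q_snd) (simp add: sqi_def)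
 have "(NI (Q t) (%p. ennreal ((x (snd p))^2))) = (NI (lb t) (%s. (NI M (%w. ennreal ((x w)^2)))))" using m by (subst nn_integral_Q_fst) auto
 also have "... < \<infinity>" using assms finite_measure.emeasure_finite[OF fin_lb, of t]
  by (auto simp: sqi_nn_integral ennreal_mult_less_top less_top)
 finally show ?thesis using m by (simp add: sqi_nn_finite)
qed

lemma Q_integral_prod:
 fixes h :: "real => real" and g :: "'a => real"
 assumes h: "integrable (lb t) h" and g: "integrable M g" shows "integrable (Q t) (%p. h (fst p) * g (snd p))"
  "(LINT p|Q t. h (fst p) * g (snd p)) = (LINT s|lb t. h s) * EE g"
proof -
 interpret pair_sigma_finite "lb t" M by (rule pair_sf)
 have "integrable (lb t \<Otimes>\<^sub>M M) (%p. h (fst p) * g (snd p))" proof (rule Fubini_integrable)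
  show "(%p. h (fst p) * g (snd p)) : BM (lb t \<Otimes>\<^sub>M M)"
  using h g by (intro borel_measurable_times measurable_compose[OF measurable_fst] measurable_compose[OF measurable_snd]) auto
  show "integrable (lb t) (%x. LINT y|M. norm (h (fst (x, y)) * g (snd (x, y))))" using h by (simp add: abs_mult)
  show "AE x in lb t. integrable M (%y. h (fst (x, y)) * g (snd (x, y)))" using g by simp
 qed
 then show i: "integrable (Q t) (%p. h (fst p) * g (snd p))" unfolding Q_def .
 show "(LINT p|Q t. h (fst p) * g (snd p)) = (LINT s|lb t. h s) * EE g" using integral_Q_fst(1)[OF i] by simp
qed

end

section \<open>The Ito integral as an isometry\<close>

context wiener
begin

text \<open>The closure under sums and mean-square limits of single-step integrands; in contrast to
 partitions, no common refinements are needed for linearity.\<close>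

inductive ito :: "real => (real => 'a => real) => ('a => real) => bool" for t where
 step: "0 <= a ==> a <= b ==> b <= t ==> x : BM (F a) ==> sqi M x ==>
  ito t (%s w. x w * indicator {a<..b} s) (%w. x w * (W b w - W a w))"
| add: "ito t f Z ==> ito t g Y ==> ito t (%s w. f s w + g s w) (%w. Z w + Y w)"
| lim: "(ALL j::nat. ito t (fs j) (Zs j)) ==>
  L2lim (Q t) (%j p. uc (fs j) p) (uc f) ==> L2lim M Zs Z ==> ito t f Z"

lemma incr_sqi:
 assumes "0 <= a" "a <= b" "x : BM (F a)" "sqi M x" shows "sqi M (%w. x w * (W b w - W a w))"
  "EE (%w. (x w * (W b w - W a w))^2) = (b - a) * EE (%w. (x w)^2)"
proof -
 have m: "(%w. (x w)^2) : BM (F a)" using assms(3) by simp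
 note i = incr_mult[OF assms(1,2) m sqi_integrable[OF assms(4)]]
 then show "EE (%w. (x w * (W b w - W a w))^2) = (b - a) * EE (%w. (x w)^2)" by (simp add: power_mult_distrib)
 have "(%w. x w * (W b w - W a w)) : BM M" using assms by (intro borel_measurable_times measurable_F_M[OF assms(3)] incr_measurable) auto
 then show "sqi M (%w. x w * (W b w - W a w))" using i by (simp add: sqi_def power_mult_distrib)
qed

lemma incr_F: "0 <= a ==> 0 <= b ==> a <= c ==> b <= c ==> (%w. W b w - W a w) : BM (F c)" by (intro borel_measurable_diff W_measurable_F)

lemma incr_orth:
 assumes "0 <= c" "c <= d" "e : BM (F c)" "sqi M e" "z : BM (F c)" "sqi M z" shows "EE (%w. z w * (e w * (W d w - W c w))) = 0"
 using incr_mult[OF assms(1,2), of "%w. z w * e w"] assms sqi_mult[OF assms(6,4)] by (simp add: mult.assoc)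

text \<open>Cut both increments at c and at e = min b d. Pieces over disjoint intervals are
  orthogonal, because the later increment is independent of everything before it; only the overlap
  from c to e contributes. As e is b or d, one of the last pieces is empty.\<close>

lemma incr_pair_le:
 assumes a: "0 <= a" "a <= b" "x : BM (F a)" "sqi M x"
  and c: "a <= c" "c <= d" "y : BM (F c)" "sqi M y" shows "EE (%w. (x w * (W b w - W a w)) * (y w * (W d w - W c w)))
  = EE (%w. x w * y w) * max 0 (min b d - c)"
proof (cases "b <= c")
 case True
 have m: "(%w. x w * (W b w - W a w)) : BM (F c)" using a c True by (intro borel_measurable_times measurable_F_mono[OF c(1) a(3)] incr_F) auto
 show ?thesis using True a c incr_orth[OF _ c(2,3,4) m incr_sqi(1)[OF a]] by simp
next
 case False
 define e where "e = min b d"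
 have e: "c <= e" "e <= b" "e <= d" "e = b \<or> e = d" using False c by (auto simp: e_def)
 have c0: "0 <= c" "0 <= e" using a c e by auto
 have xc: "x : BM (F c)" by (rule measurable_F_mono[OF c(1) a(3)])
 have xe: "x : BM (F e)" "y : BM (F e)" using measurable_F_mono[OF e(1)] xc c by auto
 let ?X = "%u v w. x w * (W v w - W u w)" and ?Y = "%u v w. y w * (W v w - W u w)"
 have s1: "sqi M (?X a c)" by (rule incr_sqi(1)) (use a c in auto)
 have s2: "sqi M (?X c e)" by (rule incr_sqi(1)) (use a c0 e xc in auto)
 have s3: "sqi M (?X e b)" by (rule incr_sqi(1)) (use a c0 e xe in auto)
 have t1: "sqi M (?Y c e)" by (rule incr_sqi(1)) (use c c0 e in auto)
 have t2: "sqi M (?Y e d)" by (rule incr_sqi(1)) (use c c0 e xe in auto)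
 have t3: "sqi M (?Y c d)" by (rule incr_sqi(1)) (use c c0 e in auto)
 have X1m: "?X a c : BM (F c)" using a c c0 xc by (intro borel_measurable_times incr_F) auto
 have X2m: "?X c e : BM (F e)" using e c0 xe by (intro borel_measurable_times incr_F) auto
 have Y1m: "?Y c e : BM (F e)" using e c0 xe by (intro borel_measurable_times incr_F) auto
 have E1: "EE (%w. ?X a c w * ?Y c d w) = 0" by (rule incr_orth[OF c0(1) c(2) c(3,4) X1m s1])
 have E2: "EE (%w. ?X c e w * ?Y c e w) = (e - c) * EE (%w. x w * y w)"
  using incr_mult[OF c0(1) e(1), of "%w. x w * y w"] xc c(3) sqi_mult[OF a(4) c(4)] by (simp add: power2_eq_square ac_simps)
 have E3: "EE (%w. ?X c e w * ?Y e d w) = 0" by (rule incr_orth[OF c0(2) e(3) xe(2) c(4) X2m s2])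
 have E4: "EE (%w. ?X e b w * ?Y c e w) = 0" using incr_orth[OF c0(2) e(2) xe(1) a(4) Y1m t1] by (simp add: mult.commute)
 have "EE (%w. ?X a b w * ?Y c d w) = EE (%w. ?X a c w * ?Y c d w
  + (?X c e w * ?Y c e w + (?X c e w * ?Y e d w + ?X e b w * ?Y c e w)))" using e(4) by (intro icong) (auto simp: algebra_simps)
 also have "... = (e - c) * EE (%w. x w * y w)" using E1 E2 E3 E4 sqi_mult[OF s1 t3] sqi_mult[OF s2 t1] sqi_mult[OF s2 t2] sqi_mult[OF s3 t1]
  by (simp only: Iadd iadd add_0_left add_0_right)
 finally show ?thesis using e by (simp add: e_def mult.commute)
qed

lemma integral_indicator_Ioc_lb:
 assumes "0 <= a" "a <= b" "b <= t" shows "(LINT s|lb t. indicator {a<..b} s) = b - (a::real)" "integrable (lb t) (%s. indicator {a<..b} s :: real)"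
proof -
 have s: "{a<..b} : sets (lb t)" using assms by (auto simp: sets_restrict_space_iff)
 have "measure (lb t) {a<..b} = b - a" using assms by (subst measure_restrict_space) auto
 then show "(LINT s|lb t. indicator {a<..b} s) = b - a" using s assms by (simp add: Int_absorb2 subset_iff)
 show "integrable (lb t) (%s. indicator {a<..b} s :: real)" using s finite_measure.emeasure_finite[OF fin_lb, of t "{a<..b}"]
  by (auto simp: less_top)
qed

text \<open>Both sides equal E[x y] times the length of the overlap of the two intervals.\<close>

lemma incr_pair:
 assumes a: "0 <= a" "a <= b" "b <= t" "x : BM (F a)" "sqi M x"
  and c: "0 <= c" "c <= d" "d <= t" "y : BM (F c)" "sqi M y" shows "EE (%w. (x w * (W b w - W a w)) * (y w * (W d w - W c w)))
  = (LINT p|Q t. (x (snd p) * indicator {a<..b} (fst p)) * (y (snd p) * indicator {c<..d} (fst p)))"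
proof -
 have eq: "(%s. indicator {a<..b} s * indicator {c<..d} s :: real) = indicator {max a c<..min b d}" by (auto simp: fun_eq_iff split: split_indicator)
 have int: "integrable (lb t) (%s. indicator {max a c<..min b d} s :: real) &
  (LINT s|lb t. indicator {max a c<..min b d} s) = max 0 (min b d - max a c)" proof (cases "max a c <= min b d")
  case True
  then show ?thesis using integral_indicator_Ioc_lb[of "max a c" "min b d" t] a c by auto
 next
  case False
  then have e: "{max a c<..min b d} = {}" by auto
  show ?thesis unfolding e using False by auto
 qed
 have "(LINT p|Q t. (x (snd p) * indicator {a<..b} (fst p)) * (y (snd p) * indicator {c<..d} (fst p)))
  = (LINT p|Q t. (indicator {max a c<..min b d} (fst p)) * (x (snd p) * y (snd p)))" unfolding eq[symmetric] by (intro icong) (auto simp: ac_simps)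
 also have "... = max 0 (min b d - max a c) * EE (%w. x w * y w)" using Q_integral_prod(2)[of t "indicator {max a c<..min b d}" "%w. x w * y w"] int
  sqi_mult[OF a(5) c(5)] by simp
 also have "... = EE (%w. (x w * (W b w - W a w)) * (y w * (W d w - W c w)))" proof (cases "a <= c")
  case True
  then show ?thesis using incr_pair_le[OF a(1,2,4,5) True c(2,4,5)] by (simp add: mult.commute max_def)
 next
  case False
  then have ca: "c <= a" by simp
  have "EE (%w. (x w * (W b w - W a w)) * (y w * (W d w - W c w)))
  = EE (%w. (y w * (W d w - W c w)) * (x w * (W b w - W a w)))" by (simp add: mult.commute)
  also have "... = EE (%w. y w * x w) * max 0 (min d b - a)" by (rule incr_pair_le[OF c(1,2,4,5) ca a(2,4,5)])
  finally show ?thesis using ca False by (simp add: mult.commute max_def min.commute)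
 qed
 finally show ?thesis ..
qed

lemma ito_sqi:
 assumes "ito t f Z" shows "sqi (Q t) (uc f)" "sqi M Z"
proof -
 have "sqi (Q t) (uc f) & sqi M Z" using assms proof induction
  case (step a b x)
  have "sqi (Q t) (%p. x (snd p) * indicator {a<..b} (fst p))" by (rule sqi_bound[OF sqi_Q_snd[OF step(5)]])
  (auto intro!: borel_measurable_times indicator_fst_Q measurable_Q_snd measurable_F_M[OF step(4)]
  split: split_indicator)
  then show ?case using incr_sqi(1)[OF step(1,2,4,5)] by simp
 next
  case (add f Z g Y)
  then show ?case using sqi_add[of "Q t" "%p. uc f p" "%p. uc g p"] sqi_add[of M Z Y] by simp
 next
  case (lim fs Zs f Z)
  then show ?case by (simp add: L2lim_def)
 qed
 then show "sqi (Q t) (uc f)" "sqi M Z" by auto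
qed

text \<open>The polarized isometry against a fixed step integrand, by induction on the other
  argument; a second induction, on the first argument, then gives the general case.\<close>

lemma ito_inner_step:
 assumes "ito t g Y" and a: "0 <= a" "a <= b" "b <= t" "x : BM (F a)" "sqi M x" shows "EE (%w. (x w * (W b w - W a w)) * Y w)
  = (LINT p|Q t. (x (snd p) * indicator {a<..b} (fst p)) * uc g p)" using assms(1)
proof induction
 case (step c d e)
 show ?case by (rule incr_pair) fact+
next
 case (add f Z g Y)
 note st = ito_sqi[OF ito.step[OF a]]
 have i: "integrable (Q t) (%p. (x (snd p) * indicator {a<..b} (fst p)) * uc f p)"
  "integrable (Q t) (%p. (x (snd p) * indicator {a<..b} (fst p)) * uc g p)"
  "integrable M (%w. (x w * (W b w - W a w)) * Z w)" "integrable M (%w. (x w * (W b w - W a w)) * Y w)"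
  using st ito_sqi[OF add(1)] ito_sqi[OF add(2)] by (auto intro: sqi_mult)
 show ?case unfolding distrib_left using add(3,4) i by (simp only: Iadd)
next
 case (lim fs Zs f Z)
 note st = ito_sqi[OF ito.step[OF a]]
 have "(%j. EE (%w. (x w * (W b w - W a w)) * Zs j w)) ----> EE (%w. (x w * (W b w - W a w)) * Z w)" by (rule L2lim_mult_left[OF st(2) lim(3)])
 moreover have "(%j. (LINT p|Q t. (x (snd p) * indicator {a<..b} (fst p)) * uc (fs j) p))
  ----> (LINT p|Q t. (x (snd p) * indicator {a<..b} (fst p)) * uc f p)" by (rule L2lim_mult_left[OF st(1) lim(2)])
 moreover have "!!j. EE (%w. (x w * (W b w - W a w)) * Zs j w)
  = (LINT p|Q t. (x (snd p) * indicator {a<..b} (fst p)) * uc (fs j) p)" using lim(1) by blast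
 ultimately show ?case using LIMSEQ_unique by auto
qed

lemma ito_inner:
 assumes "ito t f Z" and g: "ito t g Y" shows "EE (%w. Z w * Y w) = (LINT p|Q t. uc f p * uc g p)" using assms(1)
proof induction
 case (step a b x)
 show ?case by (rule ito_inner_step[OF g step])
next
 case (add f1 Z1 f2 Z2)
 have i: "integrable (Q t) (%p. uc f1 p * uc g p)"
  "integrable (Q t) (%p. uc f2 p * uc g p)"
  "integrable M (%w. Z1 w * Y w)" "integrable M (%w. Z2 w * Y w)" using ito_sqi[OF add(1)] ito_sqi[OF add(2)] ito_sqi[OF g] by (auto intro: sqi_mult)
 show ?case unfolding distrib_right using add(3,4) i by (simp only: Iadd)
next
 case (lim fs Zs f Z)
 note st = ito_sqi[OF g]
 have "(%j. EE (%w. Y w * Zs j w)) ----> EE (%w. Y w * Z w)" by (rule L2lim_mult_left[OF st(2) lim(3)])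
 moreover have "(%j. (LINT p|Q t. uc g p * uc (fs j) p))
  ----> (LINT p|Q t. uc g p * uc f p)" by (rule L2lim_mult_left[OF st(1) lim(2)])
 moreover have "!!j. EE (%w. Zs j w * Y w) = (LINT p|Q t. uc (fs j) p * uc g p)" using lim(1) by blast
 ultimately show ?case using LIMSEQ_unique by (auto simp: mult.commute)
qed

lemma ito_isometry: "ito t f Z ==> EE (%w. (Z w)^2) = (LINT p|Q t. (uc f p)^2)" using ito_inner[of t f Z f Z] by (simp add: power2_eq_square)

lemma ito_cmult: "ito t f Z ==> ito t (%s w. c * f s w) (%w. c * Z w)"
proof (induction rule: ito.induct)
 case (step a b x)
 have "ito t (%s w. (c * x w) * indicator {a<..b} s) (%w. (c * x w) * (W b w - W a w))" using step by (intro ito.step) (auto intro: sqi_cmult)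
 then show ?case by (simp add: mult.assoc)
next
 case (add f Z g Y)
 show ?case using ito.add[OF add(3,4)] by (simp add: distrib_left)
next
 case (lim fs Zs f Z)
 show ?case by (rule ito.lim[where fs = "%j s w. c * fs j s w" and Zs = "%j w. c * Zs j w"]) (use lim in "auto intro: L2lim_cmult")
qed

lemma ito_diff: "ito t f Z ==> ito t g Y ==> ito t (%s w. f s w - g s w) (%w. Z w - Y w)" using ito.add[OF _ ito_cmult[of t g Y "-1"]] by simp

lemma ito_zero: "0 <= t ==> ito t (%s w. 0) (%w. 0)" using ito.step[of 0 0 t "%_. 0"] by (simp add: sqi_zero)

lemma ito_sum:
 assumes "0 <= t" "!!i. i : I ==> ito t (f i) (Z i)" shows "ito t (%s w. \<Sum>i\<in>I. f i s w) (%w. \<Sum>i\<in>I. Z i w)"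
 using assms by (induction I rule: infinite_finite_induct) (auto intro: ito_zero ito.add)

text \<open>A constant sequence in the limit rule exchanges integrand and integral for other
  versions.\<close>

lemma ito_cong_AE:
 assumes "ito t f Z" "(uc g) : BM (Q t)" "Y : BM M"
  "AE p in Q t. uc f p = uc g p" "AE w in M. Z w = Y w" shows "ito t g Y"
proof (rule ito.lim[where fs = "%_. f" and Zs = "%_. Z"])
 have "sqi (Q t) (uc g)" using ito_sqi(1)[OF assms(1)] assms(2,4) by (rule sqi_cong_AE)
 then show "L2lim (Q t) (%_ p. uc f p) (uc g)" using ito_sqi[OF assms(1)] assms(4) by (intro L2lim_const)
 have "sqi M Y" using ito_sqi(2)[OF assms(1)] assms(3,5) by (rule sqi_cong_AE)
 then show "L2lim M (%_. Z) Y" using ito_sqi[OF assms(1)] assms(5) by (intro L2lim_const)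
qed (use assms(1) in simp)

lemma ito_unique:
 assumes "ito t f Z" "ito t g Y" "AE p in Q t. uc f p = uc g p" shows "AE w in M. Z w = Y w"
proof -
 have d: "ito t (%s w. f s w - g s w) (%w. Z w - Y w)" using assms by (intro ito_diff)
 have "EE (%w. (Z w - Y w)^2) = 0" unfolding ito_isometry[OF d] by (rule integral_eq_zero_AE) (use assms(3) in auto)
 then show ?thesis using sqi_zero_AE[OF ito_sqi(2)[OF d]] by simp
qed

lemma ito_zero_time: "ito 0 f Z ==> AE w in M. Z w = 0"
proof -
 assume f: "ito 0 f Z"
 have "AE p in Q 0. uc f p = 0" proof -
  have "emeasure (Q 0) (space (Q 0)) = 0" unfolding space_Q unfolding Q_def using emeasure_lb[of 0]
  by (subst emeasure_pair_measure_Times) (auto simp: sets_restrict_space_iff)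
  then have "space (Q 0) : null_sets (Q 0)" by auto
  then show ?thesis by (rule AE_I') auto
 qed
 then show ?thesis using ito_unique[OF f ito_zero] by simp
qed

end

section \<open>Uniform grids\<close>

text \<open>The i with s in the interval from t i/N (excluded) to t (i+1)/N (included). The
  intervals of simple integrands are open on the left, hence a ceiling minus one.\<close>

definition grid_index :: "nat => real => real => nat" where
 "grid_index N t s = nat (\<lceil>s * real N / t\<rceil> - 1)"

definition grid :: "nat => real => nat => real" where
 "grid N t i = t * real i / real N"

lemma grid_mono: "0 <= t ==> i <= j ==> grid N t i <= grid N t j" by (auto simp: grid_def intro!: divide_right_mono mult_left_mono)

lemma grid_0 [simp]: "grid N t 0 = 0" by (simp add: grid_def)

lemma grid_N [simp]: "0 < N ==> grid N t N = t" by (simp add: grid_def)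

lemma grid_nonneg: "0 <= t ==> 0 <= grid N t i" by (simp add: grid_def)

lemma grid_le: "0 <= t ==> i <= N ==> grid N t i <= t" using grid_mono[of t i N N] by (cases "N = 0") auto

lemma grid_Suc: "0 < N ==> grid N t (Suc i) = grid N t i + t / real N" by (simp add: grid_def field_simps)

lemma grid_indicator:
 assumes "0 < N" "0 < s" "s <= t" shows "indicator {grid N t i<..grid N t (Suc i)} s = (if i = grid_index N t s then 1 else 0 :: real)"
  "grid_index N t s < N"
proof -
 have t: "0 < t" using assms by linarith
 define x where "x = s * real N / t"
 have x: "0 < x" "x <= real N" using assms t by (auto simp: x_def field_simps)
 then have c: "1 <= \<lceil>x\<rceil>" "\<lceil>x\<rceil> <= int N" by (linarith, simp add: ceiling_le_iff)
 show "grid_index N t s < N" using c assms(1) unfolding grid_index_def x_def[symmetric] by linarith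
 have "s : {grid N t i<..grid N t (Suc i)} \<longleftrightarrow> real i < x & x <= real i + 1"
  using assms t by (auto simp: grid_def x_def field_simps)
 also have "... \<longleftrightarrow> \<lceil>x\<rceil> = int i + 1" by (auto simp: ceiling_eq_iff)
 also have "... \<longleftrightarrow> i = grid_index N t s" using c by (auto simp: grid_index_def x_def[symmetric])
 finally show "indicator {grid N t i<..grid N t (Suc i)} s = (if i = grid_index N t s then 1 else 0 :: real)" by (simp add: indicator_def)
qed

lemma grid_sum:
 fixes c :: "nat => real"
 assumes "0 < N" "0 < s" "s <= t" shows "(\<Sum>i<N. c i * indicator {grid N t i<..grid N t (Suc i)} s) = c (grid_index N t s)"
 by (simp add: grid_indicator[OF assms] if_distrib[of "%x. _ * x"] sum.delta cong: if_cong)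

lemma grid_index_bounds:
 assumes "0 < N" "0 < s" "s <= t" shows "grid N t (grid_index N t s) < s" "s <= grid N t (Suc (grid_index N t s))"
  "s - t / real N <= grid N t (grid_index N t s)"
proof -
 have "s : {grid N t (grid_index N t s)<..grid N t (Suc (grid_index N t s))}"
  using grid_indicator(1)[OF assms, of "grid_index N t s"] by (auto simp: indicator_def split: if_splits)
 then show "grid N t (grid_index N t s) < s" "s <= grid N t (Suc (grid_index N t s))" by auto
 then show "s - t / real N <= grid N t (grid_index N t s)" using assms by (simp add: grid_Suc)
qed

lemma grid_index_tendsto:
 assumes "0 < s" "s <= t" shows "(%j. grid (Suc j) t (grid_index (Suc j) t s)) ----> s"
proof (rule tendsto_sandwich[OF _ _ _ tendsto_const])
 have "(%j. s - t * inverse (real (Suc j))) ----> s - t * 0" by (intro tendsto_intros LIMSEQ_inverse_real_of_nat)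
 then show "(%j. s - t / real (Suc j)) ----> s" by (simp add: field_simps)
 show "\<forall>\<^sub>F j in sequentially. s - t / real (Suc j) <= grid (Suc j) t (grid_index (Suc j) t s)"
  using grid_index_bounds(3)[OF _ assms] by (intro always_eventually allI) blast
 show "\<forall>\<^sub>F j in sequentially. grid (Suc j) t (grid_index (Suc j) t s) <= s"
  using grid_index_bounds(1)[OF _ assms] by (intro always_eventually allI less_imp_le) blast
qed

section \<open>The martingale property and the two notions of Ito integral\<close>

context wiener
begin

lemma finite_measure_subalgebra_F: "finite_measure_subalgebra M (F s)"
 by (intro finite_measure_subalgebra.intro finite_measure_axioms finite_measure_subalgebra_axioms.intro subalgebra_F)

lemma cond_exp_sqi:
 assumes X: "sqi M X" shows "sqi M (real_cond_exp M (F s) X)" "EE (%w. (real_cond_exp M (F s) X w)^2) <= EE (%w. (X w)^2)"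
proof -
 interpret C: finite_measure_subalgebra M "F s" by (rule finite_measure_subalgebra_F)
 note i = sqi_imp_integrable[OF finite_measure_axioms X] and i2 = sqi_integrable[OF X]
 have J: "AE x in M. (real_cond_exp M (F s) X x)^2 <= real_cond_exp M (F s) (%x. (X x)^2) x"
  by (rule C.real_cond_exp_jensens_inequality(2)[OF i, where I = UNIV and q = "%x. x^2"]) (simp_all add: i2 convex_power2)
 have sq: "integrable M (%x. (real_cond_exp M (F s) X x)^2)"
  by (rule ibound[OF C.real_cond_exp_int(1)[OF i2]]) (use J in "auto elim!: eventually_mono")
 then show "sqi M (real_cond_exp M (F s) X)" by (simp add: sqi_def)
 show "EE (%w. (real_cond_exp M (F s) X w)^2) <= EE (%w. (X w)^2)"
  using integral_mono_AE[OF sq C.real_cond_exp_int(1)[OF i2] J] C.real_cond_exp_int(2)[OF i2] by simp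
qed

text \<open>Conditioning on F s cuts the integral off at time s. For a step this is the independence
  of the later increment, and limits are preserved because conditional expectation is a contraction
  in mean square.\<close>

lemma ito_cond_exp:
 assumes "ito t f Z" and s: "0 <= s" "s <= t" shows "ito s f (real_cond_exp M (F s) Z)" using assms(1)
proof induction
 interpret C: finite_measure_subalgebra M "F s" by (rule finite_measure_subalgebra_F)
 case (step a b x)
 \<comment> \<open>The part of the step interval before s ends at c; the maximum makes it empty if s
   < a.\<close>
 define c where "c = max a (min b s)"
 have c: "0 <= a" "a <= c" "c <= b" "0 <= c" using step by (auto simp: c_def)
 let ?Z = "%w. x w * (W b w - W a w)" and ?Y = "%w. x w * (W c w - W a w)"
 have Y: "ito s (%r w. x w * indicator {a<..c} r) ?Y" proof (cases "a <= s")
  case False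
  then have "c = a" by (simp add: c_def)
  then show ?thesis using ito_zero[OF s(1)] by simp
 qed (use step c in "auto intro!: ito.step simp: c_def")
 have YF: "?Y : BM (F s)" proof (cases "a <= s")
  case True
  then show ?thesis using c step by (intro borel_measurable_times measurable_F_mono[OF True] incr_F) (auto simp: c_def)
 qed (simp add: c_def)
 note iZ = sqi_imp_integrable[OF finite_measure_axioms incr_sqi(1)[OF step(1,2,4,5)]]
  and iY = sqi_imp_integrable[OF finite_measure_axioms incr_sqi(1)[OF c(1,2) step(4,5)]]
  and iU = sqi_imp_integrable[OF finite_measure_axioms incr_sqi(1)[OF c(4,3) measurable_F_mono[OF c(2) step(4)] step(5)]]
 have "AE w in M. real_cond_exp M (F s) ?Z w = ?Y w" proof (rule C.real_cond_exp_charact[OF _ iZ iY YF])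
  fix A assume A: "A : sets (F s)"
  then have AM: "A : sets M" using sets_F_sub by blast
  have z: "EE (%w. indicator A w * (x w * (W b w - W c w))) = 0" proof (cases "b <= s")
  case False
  then have sc: "s <= c" by (auto simp: c_def)
  show ?thesis by (rule incr_orth[OF c(4,3) measurable_F_mono[OF c(2) step(4)] step(5) measurable_F_mono[OF sc]])
  (use A AM in "auto intro!: sqi_bounded[OF finite_measure_axioms, of _ 1] simp: indicator_def")
  qed (use step in "simp add: c_def")
  have eq: "(%w. indicator A w * ?Z w) = (%w. indicator A w * ?Y w + indicator A w * (x w * (W b w - W c w)))" by (simp add: fun_eq_iff algebra_simps)
  have "EE (%w. indicator A w * ?Z w) = EE (%w. indicator A w * ?Y w)"
  unfolding eq using z integrable_mult_indicator[OF AM iY] integrable_mult_indicator[OF AM iU] by (subst Iadd) auto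
  then show "(LINT w:A|M. ?Z w) = (LINT w:A|M. ?Y w)" by (simp add: set_lebesgue_integral_def)
 qed
 moreover have "AE p in Q s. x (snd p) * indicator {a<..c} (fst p) = x (snd p) * indicator {a<..b} (fst p)"
  using AE_space by eventually_elim (use step in "auto simp: space_Q c_def indicator_def")
 moreover have "(%p. x (snd p) * indicator {a<..b} (fst p)) : BM (Q s)"
  by (intro borel_measurable_times measurable_Q_snd measurable_F_M[OF step(4)] indicator_fst_Q) auto
 ultimately show ?case by (intro ito_cong_AE[OF Y]) (auto elim: eventually_mono)
next
 interpret C: finite_measure_subalgebra M "F s" by (rule finite_measure_subalgebra_F)
 case (add f Z g Y)
 note i = sqi_imp_integrable[OF finite_measure_axioms ito_sqi(2)[OF add(1)]] sqi_imp_integrable[OF finite_measure_axioms ito_sqi(2)[OF add(2)]]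
 note a = ito.add[OF add(3,4)]
 show ?case by (rule ito_cong_AE[OF a sqi_measurable[OF ito_sqi(1)[OF a]]]) (use C.real_cond_exp_add[OF i] in "auto elim: eventually_mono")
next
 interpret C: finite_measure_subalgebra M "F s" by (rule finite_measure_subalgebra_F)
 case (lim fs Zs f Z)
 let ?V = "real_cond_exp M (F s)"
 show ?case proof (rule ito.lim[where fs = fs and Zs = "%j. ?V (Zs j)"])
  show "ALL j. ito s (fs j) (?V (Zs j))" using lim(1) by blast
  have q: "sqi (Q t) (uc (fs j))" "sqi (Q t) (uc f)" for j using lim(2) by (auto simp: L2lim_def)
  have "(%j. LINT p|Q s. (uc (fs j) p - uc f p)^2) ----> 0"
  by (rule tendsto_sandwich[OF _ _ tendsto_const, of _ _ _ "%j. LINT p|Q t. (uc (fs j) p - uc f p)^2"])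
  (use lim(2) integral_Q_mono[OF s(2) sqi_integrable[OF sqi_diff[OF q]]] in "auto simp: L2lim_def")
  then show "L2lim (Q s) (%j p. uc (fs j) p) (uc f)" unfolding L2lim_def using sqi_Q_mono[OF s(2) q(1)] sqi_Q_mono[OF s(2) q(2)] by blast
  have z: "sqi M (Zs j)" "sqi M Z" for j using lim(3) by (auto simp: L2lim_def)
  have le: "EE (%w. (?V (Zs j) w - ?V Z w)^2) <= EE (%w. (Zs j w - Z w)^2)" for j proof -
  note c = cond_exp_sqi[OF sqi_diff[OF z(1)[of j] z(2)]]
  have "EE (%w. (?V (Zs j) w - ?V Z w)^2) = EE (%w. (?V (%w. Zs j w - Z w) w)^2)"
  using C.real_cond_exp_diff[OF sqi_imp_integrable[OF finite_measure_axioms z(1)] sqi_imp_integrable[OF finite_measure_axioms z(2)], of j]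
  by (intro integral_cong_AE) (auto elim: eventually_mono)
  then show ?thesis using c(2) by simp
  qed
  have "(%j. EE (%w. (?V (Zs j) w - ?V Z w)^2)) ----> 0"
  by (rule tendsto_sandwich[OF always_eventually always_eventually tendsto_const conjunct2[OF conjunct2[OF lim(3)[unfolded L2lim_def]]]]) (simp_all add: le)
  then show "L2lim M (%j. ?V (Zs j)) (?V Z)" using cond_exp_sqi(1)[OF z(1)] cond_exp_sqi(1)[OF z(2)] by (simp add: L2lim_def)
 qed
qed

lemma ito_martingale:
 assumes f: "ito t f Z" "ito s f Z'" and s: "0 <= s" "s <= t"
  and z: "z : BM (F s)" "sqi M z" shows "EE (%w. z w * Z w) = EE (%w. z w * Z' w)"
proof -
 interpret C: finite_measure_subalgebra M "F s" by (rule finite_measure_subalgebra_F)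
 have "AE w in M. real_cond_exp M (F s) Z w = Z' w" by (rule ito_unique[OF ito_cond_exp[OF f(1) s] f(2)]) simp
 then have "EE (%w. z w * real_cond_exp M (F s) Z w) = EE (%w. z w * Z' w)"
  using sqi_measurable[OF z(2)] sqi_measurable[OF ito_sqi(2)[OF f(2)]] by (intro integral_cong_AE) (auto elim: eventually_mono)
 then show ?thesis using C.real_cond_exp_intg(2)[OF sqi_mult[OF z(2) ito_sqi(2)[OF f(1)]] z(1) sqi_measurable[OF ito_sqi(2)[OF f(1)]]] by simp
qed

lemma ito_mean_zero:
 assumes f: "ito t f Z" "0 <= t" and z: "z : BM (F 0)" "sqi M z" shows "EE (%w. z w * Z w) = 0"
proof -
 have r: "sqi (Q 0) (uc f)" using ito_sqi(1)[OF f(1)] f(2) by (rule sqi_Q_mono[rotated])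
 have "ito 0 f (%_. 0)" proof (rule ito_cong_AE[OF ito_zero[OF order_refl]])
  show "AE p in Q 0. 0 = uc f p" proof -
  have "emeasure (Q 0) (space (Q 0)) = 0" unfolding space_Q unfolding Q_def using emeasure_lb[of 0]
  by (subst emeasure_pair_measure_Times) (auto simp: sets_restrict_space_iff)
  then have "space (Q 0) : null_sets (Q 0)" by auto
  then show ?thesis by (rule AE_I') auto
  qed
 qed (use r in "auto simp: sqi_def")
 from ito_martingale[OF f(1) this order_refl f(2) z] show ?thesis by simp
qed

text \<open>The simple integrands in the definition are sums of steps, so its approximating
  sequences are instances of the limit rule. Joint measurability lets the iterated integral be read
  as one over the product space.\<close>

lemma has_ito_imp_ito:
 assumes h: "has_ito_integral M W t f Z" and t: "0 <= t"
  and f: "(uc f) : BM (Q t)" shows "ito t f Z"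
proof -
 from h[unfolded has_ito_integral_def]
 obtain k u x where s: "ALL j::nat. simple_integrand M W t (k j) (u j) (x j)"
  and l1: "(%j. NI M (%w. (\<integral>\<^sup>+s\<in>{0..t}. ennreal ((simple_fun (k j) (u j) (x j) s w - f s w)^2) \<partial>lborel))) ----> 0"
  and l2: "(%j. NI M (%w. ennreal ((simple_int W (k j) (u j) (x j) w - Z w)^2))) ----> 0"
  and Z: "Z : BM M" by (elim conjE exE)
 have i: "ito t (simple_fun (k j) (u j) (x j)) (simple_int W (k j) (u j) (x j))" for j proof -
  have sj: "0 <= u j 0" "u j (k j) <= t" "!!i. i < k j ==> u j i <= u j (Suc i)"
  "!!i. i < k j ==> x j i : BM (F (u j i))"
  and sb: "!!i. i < k j ==> EX c. ALL w:space M. abs (x j i w) <= c" using s[rule_format, of j] unfolding simple_integrand_def by blast+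
  have lo: "i <= k j ==> 0 <= u j i" for i proof (induction i)
  case (Suc i)
  then have "0 <= u j i" "u j i <= u j (Suc i)" using sj(3)[of i] by auto
  then show ?case by linarith
  qed (use sj(1) in auto)
  \<comment> \<open>Counts down from the last partition point, the one that is bounded by t.\<close>
  have up: "u j (k j - i) <= t" for i proof (induction i)
  case (Suc i)
  have "u j (k j - Suc i) <= u j (k j - i)" proof (cases "i < k j")
  case True
  then have e: "Suc (k j - Suc i) = k j - i" and "k j - Suc i < k j" by auto
  then have "u j (k j - Suc i) <= u j (Suc (k j - Suc i))" using sj(3) by blast
  then show ?thesis unfolding e .
  qed simp
  then show ?case using Suc by linarith
  qed (use sj(2) in simp)
  have up': "i <= k j ==> u j i <= t" for i using up[of "k j - i"] by simp
  show ?thesis unfolding simple_fun_def[abs_def] simple_int_def[abs_def] proof (intro ito_sum t ito.step)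
  fix i assume i: "i : {..<k j}"
  then have i': "i < k j" "i <= k j" "Suc i <= k j" by auto
  show "0 <= u j i" "u j i <= u j (Suc i)" "u j (Suc i) <= t" "x j i : BM (F (u j i))" by (rule lo[OF i'(2)] up'[OF i'(3)] sj(3,4)[OF i'(1)])+
  from sb[OF i'(1)] obtain c where "ALL w:space M. abs (x j i w) <= c" by (rule exE)
  then show "sqi M (x j i)" by (intro sqi_bounded[of M _ c] finite_measure_axioms measurable_F_M[OF sj(4)[OF i'(1)]]) auto
  qed
 qed
 show ?thesis proof (rule ito.lim[where fs = "%j. simple_fun (k j) (u j) (x j)" and Zs = "%j. simple_int W (k j) (u j) (x j)"])
  show "L2lim M (%j. simple_int W (k j) (u j) (x j)) Z" using l2 Z ito_sqi(2)[OF i] by (intro L2lim_from_nn)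
  show "L2lim (Q t) (%j p. simple_fun (k j) (u j) (x j) (fst p) (snd p)) (uc f)" proof (intro L2lim_from_nn f ito_sqi(1)[OF i])
  have "(NI (Q t) (%p. ennreal ((simple_fun (k j) (u j) (x j) (fst p) (snd p) - uc f p)^2)))
  = (NI M (%w. (\<integral>\<^sup>+s\<in>{0..t}. ennreal ((simple_fun (k j) (u j) (x j) s w - f s w)^2) \<partial>lborel)))" for j
  unfolding set_nn_integral_lb using sqi_measurable[OF ito_sqi(1)[OF i]] f by (subst nn_integral_Q_snd) auto
  then show "(%j. NI (Q t) (%p. ennreal ((simple_fun (k j) (u j) (x j) (fst p) (snd p) - uc f p)^2))) ----> 0" using l1 by simp
  qed
 qed (use i in simp)
qed

text \<open>Path continuity makes f the pointwise limit of left-endpoint step functions on the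
  grids, which are jointly measurable.\<close>

lemma jointly_measurable_continuous:
 fixes f :: "real => 'a => real"
 assumes m: "!!s. s : {0..t} ==> f s : BM M"
  and c: "!!w. w : space M ==> continuous_on {0..t} (%s. f s w)" shows "(uc f) : BM (Q t)"
proof (rule borel_measurable_LIMSEQ_real)
 \<comment> \<open>The grid intervals are open on the left and miss time 0, which the last summand
   supplies.\<close>
 define h where "h j p = (\<Sum>i<Suc j. f (grid (Suc j) t i) (snd p) * indicator {grid (Suc j) t i<..grid (Suc j) t (Suc i)} (fst p))
  + f 0 (snd p) * indicator {0} (fst p)" for j and p :: "real \<times> 'a"
 show "h j : BM (Q t)" for j proof (cases "0 <= t")
  case True
  then show ?thesis unfolding h_def by (intro borel_measurable_add borel_measurable_sum borel_measurable_times measurable_Q_snd m indicator_fst_Q)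
  (auto simp: grid_nonneg intro: grid_le)
 next
  case False
  then have "space (Q t) = {}" by (auto simp: space_Q)
  then show ?thesis by (simp add: measurable_def)
 qed
 fix p assume "p : space (Q t)"
 then obtain s w where p: "p = (s, w)" "0 <= s" "s <= t" "w : space M" by (auto simp: space_Q)
 show "(%j. h j p) ----> f (fst p) (snd p)" proof (cases "s = 0")
  case True
  have "indicator {grid (Suc j) t i<..grid (Suc j) t (Suc i)} 0 = (0::real)" for i j using p by (auto simp: indicator_def not_less grid_nonneg)
  then show ?thesis using True p by (simp add: h_def)
 next
  case False
  then have s: "0 < s" "s <= t" using p by auto
  have hj: "h j p = f (grid (Suc j) t (grid_index (Suc j) t s)) w" for j
  using grid_sum[OF _ s, of "Suc j" "%i. f (grid (Suc j) t i) w"] s by (simp add: h_def p)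
  have "(%j. f (grid (Suc j) t (grid_index (Suc j) t s)) w) ----> f s w"
  proof (rule continuous_on_tendsto_compose[OF c[OF p(4)] grid_index_tendsto[OF s]])
  show "\<forall>\<^sub>F j in sequentially. grid (Suc j) t (grid_index (Suc j) t s) : {0..t}" proof (intro always_eventually allI)
  fix j
  have "grid_index (Suc j) t s <= Suc j" using grid_indicator(2)[OF _ s, of "Suc j"] by simp
  then show "grid (Suc j) t (grid_index (Suc j) t s) : {0..t}" using s by (simp add: grid_nonneg grid_le)
  qed
  qed (use s in auto)
  then show ?thesis unfolding hj by (simp add: p)
 qed
qed

lemma AE_Q_pos: "AE p in Q t. 0 < fst p"
proof -
 have n: "({0} \<times> space M) Int space (Q t) : null_sets (Q t)" proof (cases "0 <= t")
  case True
  then have "emeasure (lb t) {0} = 0" by (subst emeasure_restrict_space) auto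
  moreover have s: "{0} : sets (lb t)" using True by (auto simp: sets_restrict_space_iff)
  ultimately have "emeasure (Q t) ({0} \<times> space M) = 0" "{0} \<times> space M : sets (Q t)"
  unfolding Q_def by (auto simp: emeasure_pair_measure_Times)
  then show ?thesis using True by (auto simp: null_sets_def space_Q Int_absorb2 subset_iff)
 qed (auto simp: space_Q)
 show ?thesis by (rule AE_I'[OF n]) (auto simp: space_Q)
qed

lemma AE_Q_snd:
 assumes "AE w in M. P w" shows "AE p in Q t. P (snd p)"
proof -
 obtain N where N: "N : null_sets M" "{w : space M. \<not> P w} <= N" using assms by (auto simp: eventually_ae_filter)
 have "{0..t} : sets (lb t)" by (auto simp: sets_restrict_space_iff)
 then have "{0..t} \<times> N : null_sets (Q t)" using N(1) unfolding Q_def by (auto simp: null_sets_def emeasure_pair_measure_Times)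
 then show ?thesis by (rule AE_I') (use N(2) in "auto simp: space_Q")
qed

text \<open>Simple integrands must be bounded, hence the truncation at level j. It is eventually
  inactive along each path, and the majorant w makes the convergence dominated.\<close>

lemma grid_L2lim:
 fixes f :: "real => 'a => real"
 assumes t: "0 <= t" and m: "!!s. s : {0..t} ==> f s : BM M"
  and c: "!!v. v : space M ==> continuous_on {0..t} (%s. f s v)"
  and w: "sqi M w" "AE v in M. ALL s:{0..t}. abs (f s v) <= w v"
 shows "L2lim (Q t) (%j p. \<Sum>i<Suc j. max (- real j) (min (real j) (f (grid (Suc j) t i) (snd p)))
  * indicator {grid (Suc j) t i<..grid (Suc j) t (Suc i)} (fst p)) (uc f)"
proof (rule L2lim_dominated[OF sqi_Q_snd[OF w(1)]])
 show "(uc f) : BM (Q t)" by (rule jointly_measurable_continuous[OF m c])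
 show "(%p. \<Sum>i<Suc j. max (- real j) (min (real j) (f (grid (Suc j) t i) (snd p)))
  * indicator {grid (Suc j) t i<..grid (Suc j) t (Suc i)} (fst p)) : BM (Q t)" for j
  using t by (intro borel_measurable_sum borel_measurable_times indicator_fst_Q borel_measurable_max borel_measurable_min
  measurable_Q_snd m) (auto simp: grid_nonneg intro: grid_le)
 have val: "(\<Sum>i<Suc j. max (- real j) (min (real j) (f (grid (Suc j) t i) (snd p)))
  * indicator {grid (Suc j) t i<..grid (Suc j) t (Suc i)} (fst p))
  = max (- real j) (min (real j) (f (grid (Suc j) t (grid_index (Suc j) t (fst p))) (snd p)))"
  if "0 < fst p" "fst p <= t" for j and p :: "real \<times> 'a" by (rule grid_sum[OF _ that]) simp
 have gi: "grid (Suc j) t (grid_index (Suc j) t s) : {0..t}" if "0 < s" "s <= t" for s j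
  using grid_indicator(2)[OF _ that, of "Suc j"] t by (auto simp: grid_nonneg intro!: grid_le)
 show "AE p in Q t. abs (\<Sum>i<Suc j. max (- real j) (min (real j) (f (grid (Suc j) t i) (snd p)))
  * indicator {grid (Suc j) t i<..grid (Suc j) t (Suc i)} (fst p)) <= abs (w (snd p))" for j using AE_Q_snd[OF w(2)] AE_Q_pos AE_space
 proof eventually_elim
  case (elim p)
  then have p: "0 < fst p" "fst p <= t" "snd p : space M" by (auto simp: space_Q)
  show ?case unfolding val[OF p(1,2)] using elim(1)[rule_format, OF gi[OF p(1,2), of j]] by auto
 qed
 show "AE p in Q t. (%j. \<Sum>i<Suc j. max (- real j) (min (real j) (f (grid (Suc j) t i) (snd p)))
  * indicator {grid (Suc j) t i<..grid (Suc j) t (Suc i)} (fst p)) ----> f (fst p) (snd p)" using AE_Q_snd[OF w(2)] AE_Q_pos AE_space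
 proof eventually_elim
  case (elim p)
  then have p: "0 < fst p" "fst p <= t" "snd p : space M" by (auto simp: space_Q)
  have wp: "!!s. s : {0..t} ==> abs (f s (snd p)) <= w (snd p)" using elim(1) by blast
  have l: "(%j. f (grid (Suc j) t (grid_index (Suc j) t (fst p))) (snd p)) ----> f (fst p) (snd p)"
  using p gi[OF p(1,2)] by (intro continuous_on_tendsto_compose[OF c[OF p(3)] grid_index_tendsto]) auto
  obtain J :: nat where J: "w (snd p) <= real J" using real_arch_simple by blast
  have "\<forall>\<^sub>F j in sequentially. max (- real j) (min (real j) (f (grid (Suc j) t (grid_index (Suc j) t (fst p))) (snd p)))
  = f (grid (Suc j) t (grid_index (Suc j) t (fst p))) (snd p)" using eventually_ge_at_top[of J] proof eventually_elim
  case (elim j)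
  then show ?case using wp[OF gi[OF p(1,2), of j]] J by auto
  qed
  then show ?case unfolding val[OF p(1,2)] using l by (simp add: tendsto_cong)
 qed
qed

text \<open>For a continuous integrand with a majorant the truncated left-endpoint grids are
  explicit simple approximants, and the isometry carries their convergence over to the
  integrals.\<close>

lemma ito_imp_has_ito:
 fixes f :: "real => 'a => real"
 assumes t: "0 <= t" and f: "ito t f Z" and m: "!!s. s : {0..t} ==> f s : BM (F s)"
  and c: "!!v. v : space M ==> continuous_on {0..t} (%s. f s v)"
  and w: "sqi M w" "AE v in M. ALL s:{0..t}. abs (f s v) <= w v" shows "has_ito_integral M W t f Z"
proof -
 define x where "x j i v = max (- real j) (min (real j) (f (grid (Suc j) t i) v))" for j i v
 let ?fs = "%j. simple_fun (Suc j) (grid (Suc j) t) (x j)" and ?Zs = "%j. simple_int W (Suc j) (grid (Suc j) t) (x j)"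
 have xm: "x j i : BM (F (grid (Suc j) t i))" if "i < Suc j" for i j unfolding x_def using that t
  by (intro borel_measurable_max borel_measurable_min m borel_measurable_const) (auto simp: grid_nonneg intro: grid_le)
 have xb: "abs (x j i v) <= real j" for i j v by (auto simp: x_def)
 have si: "simple_integrand M W t (Suc j) (grid (Suc j) t) (x j)" for j unfolding simple_integrand_def proof (intro conjI allI impI)
  show "EX c. ALL v:space M. abs (x j i v) <= c" for i by (intro exI[of _ "real j"] ballI xb)
 qed (use t in "auto intro: xm grid_mono")
 have i: "ito t (?fs j) (?Zs j)" for j unfolding simple_fun_def[abs_def] simple_int_def[abs_def]
  by (intro ito_sum t ito.step xm sqi_bounded[OF finite_measure_axioms, of _ "real j"] measurable_F_M[OF xm] xb grid_mono grid_nonneg)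
  (auto intro!: grid_le t)
 have L: "L2lim (Q t) (%j p. uc (?fs j) p) (uc f)" unfolding simple_fun_def x_def by (rule grid_L2lim[OF t measurable_F_M[OF m] c w])
 have "(%j. NI (Q t) (%p. ennreal ((uc (?fs j) p - uc f p)^2))) ----> 0" by (rule L2lim_nn[OF L])
 moreover have "(NI (Q t) (%p. ennreal ((uc (?fs j) p - uc f p)^2)))
  = (NI M (%v. (\<integral>\<^sup>+s\<in>{0..t}. ennreal ((?fs j s v - f s v)^2) \<partial>lborel)))" for j
  unfolding set_nn_integral_lb using sqi_measurable[OF ito_sqi(1)[OF i]] sqi_measurable[OF ito_sqi(1)[OF f]] by (subst nn_integral_Q_snd) auto
 ultimately have l1: "(%j. NI M (%v. (\<integral>\<^sup>+s\<in>{0..t}. ennreal ((?fs j s v - f s v)^2) \<partial>lborel))) ----> 0" by simp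
 have "(LINT v|M. (?Zs j v - Z v)^2) = (LINT p|Q t. (uc (?fs j) p - uc f p)^2)" for j by (rule ito_isometry[OF ito_diff[OF i f]])
 then have "L2lim M ?Zs Z" using L ito_sqi(2)[OF i] ito_sqi(2)[OF f] by (auto simp: L2lim_def)
 then have l2: "(%j. NI M (%v. ennreal ((?Zs j v - Z v)^2))) ----> 0" by (rule L2lim_nn)
 show ?thesis unfolding has_ito_integral_def using si l1 l2 sqi_measurable[OF ito_sqi(2)[OF f]]
  by (intro conjI exI[of _ Suc] exI[of _ "%j. grid (Suc j) t"] exI[of _ x]) auto
qed

end

section \<open>Ito processes and the product formula\<close>

lemma lb_restrict: "s <= t ==> lb s = restrict_space (lb t) {0..s}" by (subst restrict_restrict_space) (auto simp: Int_absorb1)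

lemma lb_sub:
 fixes f :: "real => real" assumes "s <= t" shows "(LINT r|lb s. f r) = (LINT r|lb t. indicator {0..s} r * f r)"
  "integrable (lb s) f \<longleftrightarrow> integrable (lb t) (%r. indicator {0..s} r * f r)"
proof -
 have s: "{0..s} Int space (lb t) : sets (lb t)" using assms by (auto simp: sets_restrict_space_iff)
 show "(LINT r|lb s. f r) = (LINT r|lb t. indicator {0..s} r * f r)"
  "integrable (lb s) f \<longleftrightarrow> integrable (lb t) (%r. indicator {0..s} r * f r)"
  unfolding lb_restrict[OF assms] using s by (simp_all add: integral_restrict_space integrable_restrict_space)
qed

lemma integrable_lb_mono:
 fixes f :: "real => real" assumes "s <= t" "integrable (lb t) f" shows "integrable (lb s) f"
proof -
 have s: "{0..s} : sets (lb t)" using assms by (auto simp: sets_restrict_space_iff)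
 show ?thesis unfolding lb_sub(2)[OF assms(1)] using integrable_mult_indicator[OF s assms(2)] by simp
qed

lemma lb_points: "AE r in lb t. r ~= c"
proof (cases "c : {0..t}")
 case True
 then have "emeasure (lb t) {c} = 0" by (subst emeasure_restrict_space) auto
 moreover have "{c} : sets (lb t)" using True by (auto simp: sets_restrict_space_iff)
 ultimately have "{c} : null_sets (lb t)" by auto
 then show ?thesis by (rule AE_I') auto
next
 case False
 then show ?thesis by (intro AE_I2) auto
qed

text \<open>Integration by parts for absolutely continuous functions, by Fubini's theorem on the two
 triangles.\<close>

lemma integral_triangle_lb:
 fixes f g :: "real => real"
 assumes f: "integrable (lb t) f" and g: "integrable (lb t) g"
  and D: "D : sets (lb t \<Otimes>\<^sub>M lb t)" "ALL (x, y):D. y <= x" "ALL x:{0..t}. ALL y:{0..t}. y < x --> (x, y) : D"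
 shows "integrable (lb t \<Otimes>\<^sub>M lb t) (%p. f (fst p) * g (snd p))"
  "(\<integral>p. indicator D p * (f (fst p) * g (snd p)) \<partial>(lb t \<Otimes>\<^sub>M lb t)) = (LINT r|lb t. f r * (LINT x|lb r. g x))"
  "integrable (lb t) (%r. f r * (LINT x|lb r. g x))"
proof -
 have sf: "sigma_finite_measure (lb t)" using fin_lb by (rule finite_measure.axioms)
 interpret P: pair_sigma_finite "lb t" "lb t" by (intro pair_sigma_finite.intro sf)
 let ?P = "lb t \<Otimes>\<^sub>M lb t" and ?h = "%p. indicator D p * (f (fst p) * g (snd p))"
 show int: "integrable ?P (%p. f (fst p) * g (snd p))" proof (rule P.Fubini_integrable)
  show "(%p. f (fst p) * g (snd p)) : BM ?P"
  using f g by (intro borel_measurable_times measurable_compose[OF measurable_fst] measurable_compose[OF measurable_snd]) auto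
  show "integrable (lb t) (%x. LINT y|lb t. norm (f (fst (x, y)) * g (snd (x, y))))" using f by (simp add: abs_mult)
 qed (use g in simp)
 have i: "integrable ?P ?h" using integrable_mult_indicator[OF D(1) int] by simp
 have e: "(LINT y|lb t. ?h (x, y)) = f x * (LINT y|lb x. g y)" if x: "x : space (lb t)" for x proof -
  have "(LINT y|lb t. ?h (x, y)) = (LINT y|lb t. f x * (indicator {0..x} y * g y))" proof (rule integral_cong_AE)
  have "{0..x} : sets (lb t)" using x by (auto simp: sets_restrict_space_iff)
  then show "(%y. f x * (indicator {0..x} y * g y)) : BM (lb t)" using g by auto
  show "(%y. ?h (x, y)) : BM (lb t)" using x measurable_compose[OF measurable_Pair1' borel_measurable_integrable[OF i], of x] by simp
  show "AE y in lb t. ?h (x, y) = f x * (indicator {0..x} y * g y)" using lb_points[where t = t and c = x] AE_space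
  by eventually_elim (use x D(2,3) in "fastforce simp: indicator_def")
  qed
  then show ?thesis using x lb_sub(1)[of x t g] by simp
 qed
 show "(\<integral>p. ?h p \<partial>?P) = (LINT r|lb t. f r * (LINT x|lb r. g x))"
  unfolding P.integral_fst'[OF i, symmetric] using e by (rule icong[OF refl])
 show "integrable (lb t) (%r. f r * (LINT x|lb r. g x))" by (rule ible_cong[THEN iffD1, OF refl _ P.integrable_fst'[OF i]]) (rule e)
qed

lemma integral_times_lb:
 fixes f g :: "real => real"
 assumes f: "integrable (lb t) f" and g: "integrable (lb t) g" shows "(LINT r|lb t. f r) * (LINT r|lb t. g r) =
  (LINT r|lb t. f r * (LINT x|lb r. g x) + g r * (LINT x|lb r. f x))"
  and "integrable (lb t) (%r. f r * (LINT x|lb r. g x))"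
proof -
 have sf: "sigma_finite_measure (lb t)" using fin_lb by (rule finite_measure.axioms)
 interpret P: pair_sigma_finite "lb t" "lb t" by (intro pair_sigma_finite.intro sf)
 let ?P = "lb t \<Otimes>\<^sub>M lb t"
 have idm: "(%x. x) : BM (lb t)" by (rule measurable_lb) simp
 have m: "fst : BM ?P" "snd : BM ?P" by (rule measurable_compose[OF measurable_fst idm] measurable_compose[OF measurable_snd idm])+
 \<comment> \<open>The diagonal belongs to one triangle only, so that D and the mirror image of E
   partition the square.\<close>
 define D E where "D = {p : space ?P. snd p <= fst p}" and "E = {p : space ?P. snd p < fst p}"
 have DE: "D : sets ?P" "E : sets ?P" unfolding D_def E_def using borel_measurable_le[OF m(2,1)] borel_measurable_less[OF m(2,1)] by simp_all
 have "ALL (x, y):D. y <= x" "ALL x:{0..t}. ALL y:{0..t}. y < x --> (x, y) : D"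
  "ALL (x, y):E. y <= x" "ALL x:{0..t}. ALL y:{0..t}. y < x --> (x, y) : E" by (auto simp: D_def E_def space_pair_measure)
 note d = integral_triangle_lb[OF f g DE(1) this(1,2)] and e = integral_triangle_lb[OF g f DE(2) this(3,4)]
 let ?e = "%p. indicator E p * (g (fst p) * f (snd p))"
 have i: "integrable ?P (%p. indicator D p * (f (fst p) * g (snd p)))" "integrable ?P ?e"
  using integrable_mult_indicator[OF DE(1) d(1)] integrable_mult_indicator[OF DE(2) e(1)] by simp_all
 have "(LINT r|lb t. f r) * (LINT r|lb t. g r) = (\<integral>p. f (fst p) * g (snd p) \<partial>?P)"
  unfolding P.integral_fst'[OF d(1), symmetric] by simp
 also have "... = (\<integral>p. indicator D p * (f (fst p) * g (snd p)) + (case p of (x, y) => ?e (y, x)) \<partial>?P)"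
  by (intro icong) (auto simp: indicator_def D_def E_def space_pair_measure)
 also have "... = (\<integral>p. indicator D p * (f (fst p) * g (snd p)) \<partial>?P) + (\<integral>p. ?e p \<partial>?P)"
  using i P.integrable_product_swap[OF i(2)] P.integral_product_swap[OF borel_measurable_integrable[OF i(2)]] by simp
 finally show "(LINT r|lb t. f r) * (LINT r|lb t. g r) =
  (LINT r|lb t. f r * (LINT x|lb r. g x) + g r * (LINT x|lb r. f x))" using d(2,3) e(2,3) by simp
 show "integrable (lb t) (%r. f r * (LINT x|lb r. g x))" by (rule d(3))
qed

context wiener
begin

definition jm :: "real => (real => 'a => real) => bool" where
 "jm T f \<longleftrightarrow> (uc f) : BM (Q T)"

definition sqp :: "real => (real => 'a => real) => bool" where
 "sqp T f \<longleftrightarrow> (ALL t:{0..T}. f t : BM (F t)) & sqi (Q T) (uc f)"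

definition tint :: "(real => 'a => real) => real => 'a => real" where
 "tint b t w = (LINT r|lb t. b r w)"

text \<open>X is, on the interval from 0 to T, a version of the integral of b dt + s dW plus the initial value.\<close>

definition ip :: "real => (real => 'a => real) => (real => 'a => real) => (real => 'a => real) => bool" where
 "ip T X b s \<longleftrightarrow> sqp T b & sqp T s & jm T X & X 0 : BM (F 0) & sqi M (X 0) &
  (ALL t:{0..T}. ito t s (%w. X t w - X 0 w - tint b t w))"

lemma sqi_Q_sections:
 assumes b: "sqi (Q t) (uc b)" shows "AE w in M. sqi (lb t) (%r. b r w)" "AE r in lb t. sqi M (b r)"
proof -
 have m: "(uc b) : BM (Q t)" using b by (simp add: sqi_def)
 show "AE w in M. sqi (lb t) (%r. b r w)" using integral_Q_snd(2)[OF sqi_integrable[OF b]] AE_space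
  by eventually_elim (use measurable_Q_section2[OF m] in "auto simp: sqi_def")
 show "AE r in lb t. sqi M (b r)" using integral_Q_fst(2)[OF sqi_integrable[OF b]] AE_space
  by eventually_elim (use measurable_Q_section[OF m] in "auto simp: sqi_def")
qed

lemma tint_sqi:
 assumes b: "sqi (Q t) (uc b)" and t: "0 <= t" shows "sqi M (tint b t)"
  "AE w in M. (tint b t w)^2 <= t * (LINT r|lb t. (b r w)^2)"
  "EE (%w. (tint b t w)^2) <= t * (LINT p|Q t. (uc b p)^2)"
proof -
 have i: "integrable (Q t) (uc b)" using sqi_imp_integrable[OF finite_measure_Q b] .
 have m: "tint b t : BM M" using integral_Q_snd(3)[OF i] unfolding tint_def[abs_def] by simp
 have i2: "integrable M (%w. LINT r|lb t. (b r w)^2)" using integral_Q_snd(3)[OF sqi_integrable[OF b]] by simp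
 show bd: "AE w in M. (tint b t w)^2 <= t * (LINT r|lb t. (b r w)^2)" using sqi_Q_sections(1)[OF b] proof eventually_elim
  case (elim w)
  have "(LINT r|lb t. 1 * b r w)^2 <= (LINT r|lb t. 1^2) * (LINT r|lb t. (b r w)^2)"
  by (rule Cauchy_Schwarz_sqi[OF sqi_const[OF fin_lb] elim])
  then show ?case using t by (simp add: tint_def measure_lb)
 qed
 have "integrable M (%w. (tint b t w)^2)" by (rule ibound[of _ "%w. t * (LINT r|lb t. (b r w)^2)"]) (use bd m i2 in auto)
 then show "sqi M (tint b t)" using m by (simp add: sqi_def)
 have "EE (%w. (tint b t w)^2) <= EE (%w. t * (LINT r|lb t. (b r w)^2))"
  by (rule integral_mono_AE[OF \<open>integrable M (%w. (tint b t w)^2)\<close> _ bd]) (use i2 in simp)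
 also have "... = t * (LINT p|Q t. (uc b p)^2)" using integral_Q_snd(1)[OF sqi_integrable[OF b]] by simp
 finally show "EE (%w. (tint b t w)^2) <= t * (LINT p|Q t. (uc b p)^2)" .
qed

lemma tint_mult:
 assumes b: "sqi (Q t) (uc b)" and x: "sqi M x" shows "EE (%w. x w * tint b t w) = (LINT p|Q t. x (snd p) * uc b p)"
proof -
 have "integrable (Q t) (%p. x (snd p) * uc b p)" by (rule sqi_mult[OF sqi_Q_snd[OF x] b])
 from integral_Q_snd(1)[OF this] show ?thesis by (simp add: tint_def)
qed

text \<open>The variable upper limit is moved into an indicator, which leaves a parameter integral
  over a fixed interval.\<close>

lemma tint_jm:
 assumes b: "jm T b" shows "jm T (tint b)"
proof -
 have sf: "sigma_finite_measure (lb T)" using fin_lb by (rule finite_measure.axioms)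
 let ?P = "Q T \<Otimes>\<^sub>M lb T"
 have idm: "(%x. x) : BM (lb T)" by (rule measurable_lb) simp
 have f1: "(%x. fst (fst x)) : BM ?P" unfolding Q_def by (intro measurable_compose[OF measurable_fst] measurable_compose[OF measurable_fst idm])
 have f2: "(%x. snd x) : BM ?P" by (intro measurable_compose[OF measurable_snd idm])
 have "(%x. (snd x, snd (fst x))) : measurable ?P (lb T \<Otimes>\<^sub>M M)" unfolding Q_def
  by (intro measurable_Pair measurable_snd measurable_compose[OF measurable_fst])
 then have bm: "(%x. b (snd x) (snd (fst x))) : BM ?P"
  using measurable_compose[of "%x. (snd x, snd (fst x))" ?P "lb T \<Otimes>\<^sub>M M" "%p. uc b p" borel] b unfolding jm_def Q_def by simp
 have "(%x. if snd x <= fst (fst x) then b (snd x) (snd (fst x)) else 0) : BM ?P" using f1 f2 bm by (intro measurable_If borel_measurable_le) auto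
 then have "(%(p, r). if r <= fst p then b r (snd p) else 0) : BM ?P" by (simp add: split_beta')
 then have m: "(%p. LINT r|lb T. (if r <= fst p then b r (snd p) else 0)) : BM (Q T)"
  by (rule sigma_finite_measure.borel_measurable_lebesgue_integral[OF sf])
 show ?thesis unfolding jm_def proof (rule measurable_cong[THEN iffD1, OF _ m])
  fix p assume "p : space (Q T)"
  then have p: "fst p <= T" by (auto simp: space_Q)
  show "(LINT r|lb T. (if r <= fst p then b r (snd p) else 0)) = uc (tint b) p"
  unfolding tint_def lb_sub(1)[OF p] by (intro icong) (auto simp: indicator_def)
 qed
qed

text \<open>Pathwise Cauchy-Schwarz bounds the drift integral at all times by one square-integrable
  random variable.\<close>

lemma tint_sqi_Q:
 assumes b: "sqi (Q T) (uc b)" and T: "0 <= T" shows "sqi (Q T) (uc (tint b))"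
proof -
 have m: "jm T (tint b)" using b by (intro tint_jm) (simp add: jm_def sqi_def)
 define V where "V v = (LINT r|lb T. (b r v)^2)" for v
 have Vi: "integrable M V" using integral_Q_snd(3)[OF sqi_integrable[OF b]] unfolding V_def by simp
 have V0: "0 <= V v" for v unfolding V_def by (intro integral_nonneg_AE) auto
 have sV: "sqi M (%v. sqrt (T * V v))" using Vi V0 T by (auto simp: sqi_def)
 have bd: "abs (tint b t v) <= sqrt (T * V v)" if w: "sqi (lb T) (%r. b r v)" and t: "0 <= t" "t <= T" for t v proof -
  have wt: "integrable (lb t) (%r. (b r v)^2)" by (rule integrable_lb_mono[OF t(2) sqi_integrable[OF w]])
  have "(%r. b r v) : BM (lb t)" unfolding lb_restrict[OF t(2)] by (rule measurable_restrict_space1[OF sqi_measurable[OF w]])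
  then have "sqi (lb t) (%r. b r v)" using wt by (simp add: sqi_def)
  from Cauchy_Schwarz_sqi[OF sqi_const[OF fin_lb, of _ 1] this]
  have "(tint b t v)^2 <= t * (LINT r|lb t. (b r v)^2)" using t by (simp add: tint_def measure_lb)
  also have "... <= T * V v" proof (rule mult_mono)
  show "(LINT r|lb t. (b r v)^2) <= V v" unfolding V_def lb_sub(1)[OF t(2)] using wt sqi_integrable[OF w] unfolding lb_sub(2)[OF t(2)]
  by (intro integral_mono) (auto simp: indicator_def)
  qed (use t T in "auto intro!: integral_nonneg_AE")
  finally have "sqrt ((tint b t v)^2) <= sqrt (T * V v)" by (rule real_sqrt_le_mono)
  then show ?thesis by simp
 qed
 have ae: "AE p in Q T. sqi (lb T) (%r. b r (snd p))" by (rule AE_Q_snd[OF sqi_Q_sections(1)[OF b]])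
 show ?thesis proof (rule sqi_bound[OF sqi_Q_snd[OF sV]])
  show "(uc (tint b)) : BM (Q T)" using m by (simp add: jm_def)
  show "AE p in Q T. abs (uc (tint b) p) <= abs (sqrt (T * V (snd p)))" using ae AE_space proof eventually_elim
  case (elim p)
  then show ?case using bd[of "snd p" "fst p"] V0 T by (auto simp: space_Q)
  qed
 qed
qed

lemma tint_mult_tint:
 assumes b: "sqi (Q t) (uc b)" and c: "sqi (Q t) (uc c)" and t: "0 <= t" shows "EE (%w. tint b t w * tint c t w) =
  (LINT p|Q t. uc b p * uc (tint c) p + uc c p * uc (tint b) p)"
proof -
 have i: "integrable (Q t) (%p. uc b p * uc (tint c) p + uc c p * uc (tint b) p)" by (intro iadd sqi_mult tint_sqi_Q b c t)
 show ?thesis unfolding integral_Q_snd(1)[OF i] proof (rule integral_cong_AE)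
  show "(%w. tint b t w * tint c t w) : BM M" using tint_sqi(1)[OF b t] tint_sqi(1)[OF c t] by (auto simp: sqi_def)
  show "(%w. LINT s|lb t. b (fst (s, w)) (snd (s, w)) * tint c (fst (s, w)) (snd (s, w)) +
  c (fst (s, w)) (snd (s, w)) * tint b (fst (s, w)) (snd (s, w))) : BM M" using integral_Q_snd(3)[OF i] by simp
  show "AE w in M. tint b t w * tint c t w = (LINT s|lb t. b (fst (s, w)) (snd (s, w)) * tint c (fst (s, w)) (snd (s, w)) +
  c (fst (s, w)) (snd (s, w)) * tint b (fst (s, w)) (snd (s, w)))" using sqi_Q_sections(1)[OF b] sqi_Q_sections(1)[OF c] proof eventually_elim
  case (elim w)
  show ?case
  using integral_times_lb(1)[OF sqi_imp_integrable[OF fin_lb elim(1)] sqi_imp_integrable[OF fin_lb elim(2)]]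
  by (simp add: tint_def)
  qed
 qed
qed

lemma ito_sqi_Q:
 assumes Z: "jm T Z" "!!t. t : {0..T} ==> ito t s (Z t)" and T: "0 <= T" shows "sqi (Q T) (uc Z)"
proof -
 have s: "sqi (Q T) (uc s)" using ito_sqi(1)[OF Z(2)[of T]] T by simp
 let ?c = "LINT p|Q T. (uc s p)^2"
 have "(NI (Q T) (%p. ennreal ((uc Z p)^2))) = (NI (lb T) (%t. (NI M (%w. ennreal ((Z t w)^2)))))"
  using Z(1) by (subst nn_integral_Q_fst) (auto simp: jm_def)
 also have "... <= (NI (lb T) (%t. ennreal ?c))" proof (rule nn_integral_mono)
  fix t assume "t : space (lb T)"
  then have t: "t : {0..T}" by simp
  have "(NI M (%w. ennreal ((Z t w)^2))) = ennreal (LINT p|Q t. (uc s p)^2)"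
  using sqi_nn_integral[OF ito_sqi(2)[OF Z(2)[OF t]]] ito_isometry[OF Z(2)[OF t]] by simp
  also have "... <= ennreal ?c" using t by (intro ennreal_leI integral_Q_mono sqi_integrable[OF s]) auto
  finally show "(NI M (%w. ennreal ((Z t w)^2))) <= ennreal ?c" .
 qed
 also have "... < \<infinity>" using T emeasure_lb[OF T] by (simp add: ennreal_mult_less_top)
 finally show ?thesis using Z(1) by (simp add: sqi_nn_finite jm_def)
qed

lemma sqp_sqi: "sqp T b ==> t <= T ==> sqi (Q t) (uc b)" by (auto simp: sqp_def intro: sqi_Q_mono)

text \<open>At time r the factor b r is measurable with respect to F r, so the martingale property
  replaces Z t by Z r under the expectation.\<close>

lemma tint_ito:
 assumes b: "sqp t b" and Z: "jm t Z" "!!r. r : {0..t} ==> ito r s (Z r)" and t: "0 <= t"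
 shows "EE (%w. tint b t w * Z t w) = (LINT p|Q t. uc b p * uc Z p)"
proof -
 have bs: "sqi (Q t) (uc b)" using b by (simp add: sqp_def)
 have Zt: "sqi M (Z t)" using ito_sqi(2)[OF Z(2)[of t]] t by simp
 note Zq = ito_sqi_Q[OF Z t]
 have i1: "integrable (Q t) (%p. Z t (snd p) * uc b p)" by (rule sqi_mult[OF sqi_Q_snd[OF Zt] bs])
 have i2: "integrable (Q t) (%p. uc b p * uc Z p)" by (rule sqi_mult[OF bs Zq])
 have "EE (%w. tint b t w * Z t w) = (LINT p|Q t. Z t (snd p) * uc b p)" using tint_mult[OF bs Zt] by (simp add: mult.commute)
 also have "... = (LINT r|lb t. (LINT w|M. Z t w * b r w))" using integral_Q_fst(1)[OF i1] by simp
 also have "... = (LINT r|lb t. (LINT w|M. b r w * Z r w))" proof (rule integral_cong_AE)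
  show "(%r. LINT w|M. Z t w * b r w) : BM (lb t)" using integral_Q_fst(3)[OF i1] by simp
  show "(%r. LINT w|M. b r w * Z r w) : BM (lb t)" using integral_Q_fst(3)[OF i2] by simp
  show "AE r in lb t. (LINT w|M. Z t w * b r w) = (LINT w|M. b r w * Z r w)" using sqi_Q_sections(2)[OF bs] AE_space proof eventually_elim
  case (elim r)
  then have r: "0 <= r" "r <= t" by auto
  have "b r : BM (F r)" using b r by (auto simp: sqp_def)
  from ito_martingale[OF Z(2) Z(2) r this elim(1)] r t
  show ?case by (simp add: mult.commute)
  qed
 qed
 also have "... = (LINT p|Q t. uc b p * uc Z p)" using integral_Q_fst(1)[OF i2] by simp
 finally show ?thesis .
qed

lemma jm_mono: "t <= T ==> jm T f ==> jm t f" by (auto simp: jm_def intro: measurable_Q_mono)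

lemma jm_diff: "jm T f ==> jm T g ==> jm T (%t w. f t w - g t w)" by (auto simp: jm_def)

lemma ip_parts:
 assumes X: "ip T X b s" and t: "t : {0..T}" shows "sqi M (X 0)" "sqi M (tint b t)" "sqi M (%w. X t w - X 0 w - tint b t w)" "sqi M (X t)"
  "jm T (%t w. X t w - X 0 w - tint b t w)"
  "sqi (Q t) (uc X)" "sqi (Q t) (%p. uc X p - X 0 (snd p) - uc (tint b) p)"
  "sqi (Q t) (uc (tint b))" "sqi (Q t) (uc b)" "sqi (Q t) (uc s)"
proof -
 have T: "0 <= T" using t by simp
 show X0: "sqi M (X 0)" using X by (simp add: ip_def)
 show bq: "sqi (Q t) (uc b)" and "sqi (Q t) (uc s)" using X t by (auto simp: ip_def intro: sqp_sqi)
 have bT: "sqi (Q T) (uc b)" using X by (auto simp: ip_def intro: sqp_sqi)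
 show tb: "sqi M (tint b t)" using tint_sqi(1)[OF bq] t by simp
 show Z: "sqi M (%w. X t w - X 0 w - tint b t w)" using X t by (intro ito_sqi(2)[of t s]) (simp add: ip_def)
 show "sqi M (X t)" using sqi_add[OF sqi_add[OF Z tb] X0] by simp
 have "jm T (tint b)" using bT by (intro tint_jm) (simp add: sqi_def jm_def)
 moreover have "jm T (%t. X 0)" using X0 by (auto simp: jm_def sqi_def intro: measurable_Q_snd)
 ultimately show jZ: "jm T (%t w. X t w - X 0 w - tint b t w)" using X by (auto simp: ip_def intro!: jm_diff)
 show tbq: "sqi (Q t) (uc (tint b))" using t tint_sqi_Q[OF bq] by simp
 have "sqi (Q T) (%p. uc X p - X 0 (snd p) - uc (tint b) p)" by (rule ito_sqi_Q[OF jZ _ T, of s]) (use X in "simp add: ip_def")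
 then show Zq: "sqi (Q t) (%p. uc X p - X 0 (snd p) - uc (tint b) p)" using t by (auto intro: sqi_Q_mono)
 show "sqi (Q t) (uc X)" using sqi_add[OF sqi_add[OF Zq tbq] sqi_Q_snd[OF X0]] by simp
qed

text \<open>Each process is the sum of initial value, drift integral and stochastic integral. The
  nine products are evaluated separately, by the martingale property, deterministic integration by
  parts along paths, and the isometry; then the integrands are collected.\<close>

theorem ip_product:
 assumes X: "ip T X b s" and Y: "ip T Y c u" and t: "t : {0..T}" shows "EE (%w. X t w * Y t w) = EE (%w. X 0 w * Y 0 w) +
  (LINT p|Q t. uc X p * uc c p + uc Y p * uc b p
  + uc s p * uc u p)"
proof -
 have t0: "0 <= t" "t <= T" using t by auto
 let ?Z = "%t w. X t w - X 0 w - tint b t w" and ?V = "%t w. Y t w - Y 0 w - tint c t w"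
 note x = ip_parts[OF X t] and y = ip_parts[OF Y t]
 have X0F: "X 0 : BM (F 0)" "Y 0 : BM (F 0)" using X Y by (auto simp: ip_def)
 have iZ: "!!r. r : {0..t} ==> ito r s (?Z r)" and iV: "!!r. r : {0..t} ==> ito r u (?V r)" using X Y t0 by (auto simp: ip_def)
 have tt: "t : {0..t}" using t0 by simp
 have bp: "sqp t b" "sqp t c" using X Y t0 by (auto simp: ip_def sqp_def intro: sqi_Q_mono)
 have jZ: "jm t ?Z" "jm t ?V" using jm_mono[OF t0(2) x(5)] jm_mono[OF t0(2) y(5)] .
 have E1: "EE (%w. X 0 w * tint c t w) = (LINT p|Q t. X 0 (snd p) * uc c p)" by (rule tint_mult[OF y(9) x(1)])
 have E2: "EE (%w. Y 0 w * tint b t w) = (LINT p|Q t. Y 0 (snd p) * uc b p)" by (rule tint_mult[OF x(9) y(1)])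
 have E3: "EE (%w. X 0 w * ?V t w) = 0" by (rule ito_mean_zero[OF iV[OF tt] t0(1) X0F(1) x(1)])
 have E4: "EE (%w. Y 0 w * ?Z t w) = 0" by (rule ito_mean_zero[OF iZ[OF tt] t0(1) X0F(2) y(1)])
 have E5: "EE (%w. tint b t w * ?V t w) = (LINT p|Q t. uc b p * uc ?V p)" by (rule tint_ito[OF bp(1) jZ(2) iV t0(1)])
 have E6: "EE (%w. tint c t w * ?Z t w) = (LINT p|Q t. uc c p * uc ?Z p)" by (rule tint_ito[OF bp(2) jZ(1) iZ t0(1)])
 have E7: "EE (%w. tint b t w * tint c t w) =
  (LINT p|Q t. uc b p * uc (tint c) p + uc c p * uc (tint b) p)" by (rule tint_mult_tint[OF x(9) y(9) t0(1)])
 have E8: "EE (%w. ?Z t w * ?V t w) = (LINT p|Q t. uc s p * uc u p)" by (rule ito_inner[OF iZ[OF tt] iV[OF tt]])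
 have "EE (%w. X t w * Y t w) = EE (%w. X 0 w * Y 0 w + X 0 w * tint c t w + Y 0 w * tint b t w
  + X 0 w * ?V t w + Y 0 w * ?Z t w + tint b t w * ?V t w + tint c t w * ?Z t w + tint b t w * tint c t w + ?Z t w * ?V t w)"
  by (intro icong refl) (simp add: algebra_simps)
 also have "... = EE (%w. X 0 w * Y 0 w) + (LINT p|Q t. X 0 (snd p) * uc c p)
  + (LINT p|Q t. Y 0 (snd p) * uc b p) + 0 + 0 + (LINT p|Q t. uc b p * uc ?V p)
  + (LINT p|Q t. uc c p * uc ?Z p)
  + (LINT p|Q t. uc b p * uc (tint c) p + uc c p * uc (tint b) p)
  + (LINT p|Q t. uc s p * uc u p)"
  using sqi_mult[OF x(1) y(1)] sqi_mult[OF x(1) y(2)] sqi_mult[OF y(1) x(2)] sqi_mult[OF x(1) y(3)] sqi_mult[OF y(1) x(3)]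
  sqi_mult[OF x(2) y(3)] sqi_mult[OF y(2) x(3)] sqi_mult[OF x(2) y(2)] sqi_mult[OF x(3) y(3)] by (simp only: Iadd iadd E1 E2 E3 E4 E5 E6 E7 E8)
 also have "... = EE (%w. X 0 w * Y 0 w) + (LINT p|Q t. X 0 (snd p) * uc c p
  + Y 0 (snd p) * uc b p + uc b p * uc ?V p
  + uc c p * uc ?Z p
  + (uc b p * uc (tint c) p + uc c p * uc (tint b) p)
  + uc s p * uc u p)" using sqi_mult[OF sqi_Q_snd[OF x(1)] y(9)] sqi_mult[OF sqi_Q_snd[OF y(1)] x(9)] sqi_mult[OF x(9) y(7)] sqi_mult[OF y(9) x(7)]
  sqi_mult[OF x(9) y(8)] sqi_mult[OF y(9) x(8)] sqi_mult[OF x(10) y(10)] by (simp only: Iadd iadd add_0_right add.assoc)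
 also have "(LINT p|Q t. X 0 (snd p) * uc c p
  + Y 0 (snd p) * uc b p + uc b p * uc ?V p
  + uc c p * uc ?Z p
  + (uc b p * uc (tint c) p + uc c p * uc (tint b) p)
  + uc s p * uc u p)
  = (LINT p|Q t. uc X p * uc c p + uc Y p * uc b p
  + uc s p * uc u p)" by (intro icong refl) (simp add: algebra_simps)
 finally show ?thesis .
qed

end

section \<open>Gronwall estimates and uniqueness\<close>

lemma integral_exp_lb:
 assumes c: "c ~= 0" and t: "0 <= t" shows "(LINT r|lb t. exp (c * r)) = (exp (c * t) - 1) / c" "integrable (lb t) (%r. exp (c * r))"
proof -
 have d: "((%r. exp (c * r) / c) has_real_derivative exp (c * x)) (at x)" for x using c by (auto intro!: derivative_eq_intros)
 have cont: "isCont (%r. exp (c * r)) x" for x :: real by (intro continuous_intros)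
 have "(LINT r|lborel. exp (c * r) * indicator {0..t} r) = exp (c * t) / c - exp (c * 0) / c"
  by (rule integral_FTC_Icc_real[OF t]) (use d cont in auto)
 then show "(LINT r|lb t. exp (c * r)) = (exp (c * t) - 1) / c" by (simp add: integral_restrict_space diff_divide_distrib mult.commute)
 have "set_integrable lborel {0..t} (%r. exp (c * r))" by (rule borel_integrable_atLeastAtMost') (intro continuous_intros)
 then show "integrable (lb t) (%r. exp (c * r))" by (simp add: integrable_restrict_space set_integrable_def)
qed

lemma integrable_lb_bounded:
 fixes f :: "real => real"
 assumes "f : BM (lb t)" "!!s. s : {0..t} ==> abs (f s) <= B" shows "integrable (lb t) f"
 by (rule finite_measure.integrable_const_bound[OF fin_lb, of _ B]) (use assms in "auto intro!: AE_I2")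

text \<open>Starting from f <= B, each use of the inequality halves the B-part of the bound:
  integrating exp (2 c s) gains the factor 1 / (2 c), of which c consumes only half.\<close>

lemma gronwall:
 fixes f :: "real => real"
 assumes m: "f : BM (lb T)" and b: "!!t. t : {0..T} ==> 0 <= f t & f t <= B"
  and le: "!!t. t : {0..T} ==> f t <= a + c * (LINT s|lb t. f s)"
  and c: "0 < c" and a: "0 <= a" and t: "t : {0..T}" shows "f t <= 2 * a * exp (2 * c * t)"
proof -
 have B: "0 <= B" using b[OF t] by linarith
 have mt: "f : BM (lb t)" if "t <= T" for t unfolding lb_restrict[OF that] by (rule measurable_restrict_space1[OF m])
 have step: "f t <= (2 * a + B / 2 ^ n) * exp (2 * c * t)" if "t : {0..T}" for t n using that proof (induction n arbitrary: t)
  case 0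
  have "f t <= B" using b 0 by blast
  also have "... <= (2 * a + B) * 1" using a by simp
  also have "... <= (2 * a + B) * exp (2 * c * t)" using 0 c a B by (intro mult_left_mono) auto
  finally show ?case by simp
 next
  case (Suc n)
  let ?K = "2 * a + B / 2 ^ n"
  have K: "0 <= ?K" using a B by simp
  have i1: "integrable (lb t) f" using Suc.prems by (intro integrable_lb_bounded[OF mt, of _ B]) (use b in auto)
  have i2: "integrable (lb t) (%s. ?K * exp (2 * c * s))" using integral_exp_lb(2)[of "2 * c" t] c Suc.prems by simp
  have "(LINT s|lb t. f s) <= (LINT s|lb t. ?K * exp (2 * c * s))" using Suc.IH Suc.prems by (intro integral_mono[OF i1 i2]) auto
  also have "... = ?K * ((exp (2 * c * t) - 1) / (2 * c))" using integral_exp_lb(1)[of "2 * c" t] c Suc.prems by simp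
  finally have "c * (LINT s|lb t. f s) <= c * (?K * ((exp (2 * c * t) - 1) / (2 * c)))" using c by (intro mult_left_mono) auto
  also have "... = ?K / 2 * (exp (2 * c * t) - 1)" using c by (simp add: field_simps)
  also have "... <= ?K / 2 * exp (2 * c * t)" using K by (intro mult_left_mono) auto
  finally have "f t <= a * 1 + ?K / 2 * exp (2 * c * t)" using le[OF Suc.prems] by linarith
  also have "... <= a * exp (2 * c * t) + ?K / 2 * exp (2 * c * t)" using a c Suc.prems by (intro add_right_mono mult_left_mono) auto
  also have "... = (2 * a + B / 2 ^ Suc n) * exp (2 * c * t)" by (simp add: field_simps)
  finally show ?case .
 qed
 have "(%n. (2 * a + B * (1 / 2) ^ n) * exp (2 * c * t)) ----> (2 * a + B * 0) * exp (2 * c * t)" by (intro tendsto_intros LIMSEQ_power_zero) auto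
 then show ?thesis by (intro LIMSEQ_le_const[of "%n. (2 * a + B * (1 / 2) ^ n) * exp (2 * c * t)"]) (use step[OF t] in "auto simp: power_divide")
qed

text \<open>The same halving argument, with an exponential that grows away from T.\<close>

lemma gronwall_backward:
 fixes f :: "real => real"
 assumes m: "f : BM (lb T)" and b: "!!t. t : {0..T} ==> 0 <= f t & f t <= B"
  and le: "!!t. t : {0..T} ==> f t <= c * (LINT s|lb T. indicator {t<..T} s * f s)"
  and c: "0 < c" and t: "t : {0..T}" shows "f t <= 0"
proof -
 have B: "0 <= B" using b[OF t] by linarith
 have ss: "{t<..T} : sets (lb T)" if "t : {0..T}" for t using that by (auto simp: sets_restrict_space_iff)
 have step: "f t <= B / 2 ^ n * exp (2 * c * (T - t))" if "t : {0..T}" for t n using that proof (induction n arbitrary: t)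
  case 0
  have "f t <= B * 1" using b 0 by auto
  also have "... <= B * exp (2 * c * (T - t))" using 0 c B by (intro mult_left_mono) auto
  finally show ?case by simp
 next
  case (Suc n)
  let ?K = "B / 2 ^ n"
  have K: "0 <= ?K" using B by simp
  have i1: "integrable (lb T) (%s. indicator {t<..T} s * f s)"
  using integrable_mult_indicator[OF ss[OF Suc.prems] integrable_lb_bounded[OF m, of B]] b by simp
  have e: "integrable (lb T) (%s. exp (- (2 * c) * s))" "integrable (lb t) (%s. exp (- (2 * c) * s))"
  using integral_exp_lb(2)[of "- (2 * c)"] c Suc.prems by auto
  have split: "(%s. indicator {t<..T} s * exp (- (2 * c) * s)) s = exp (- (2 * c) * s) - indicator {0..t} s * exp (- (2 * c) * s)"
  if "s : space (lb T)" for s using that Suc.prems by (auto simp: indicator_def)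
  have it: "integrable (lb T) (%s. indicator {0..t} s * exp (- (2 * c) * s))" using e(2) Suc.prems lb_sub(2)[of t T "%s. exp (- (2 * c) * s)"] by simp
  have i2: "integrable (lb T) (%s. indicator {t<..T} s * exp (- (2 * c) * s))" using integrable_mult_indicator[OF ss[OF Suc.prems] e(1)] by simp
  have v: "(LINT s|lb T. indicator {t<..T} s * exp (- (2 * c) * s)) = (exp (- (2 * c) * t) - exp (- (2 * c) * T)) / (2 * c)" proof -
  have "(LINT s|lb T. indicator {t<..T} s * exp (- (2 * c) * s))
  = (LINT s|lb T. exp (- (2 * c) * s) - indicator {0..t} s * exp (- (2 * c) * s))" by (rule icong[OF refl]) (rule split)
  also have "... = (LINT s|lb T. exp (- (2 * c) * s)) - (LINT s|lb t. exp (- (2 * c) * s))"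
  using e it lb_sub(1)[of t T "%s. exp (- (2 * c) * s)"] Suc.prems by simp
  also have "... = (exp (- (2 * c) * T) - 1) / (- (2 * c)) - (exp (- (2 * c) * t) - 1) / (- (2 * c))"
  using c Suc.prems by (subst (1 2) integral_exp_lb(1)) auto
  also have "... = (exp (- (2 * c) * t) - exp (- (2 * c) * T)) / (2 * c)" using c by (simp add: field_simps)
  finally show ?thesis .
  qed
  have ex: "exp (2 * c * (T - s)) = exp (2 * c * T) * exp (- (2 * c) * s)" for s by (simp add: exp_add[symmetric] algebra_simps)
  have "(LINT s|lb T. indicator {t<..T} s * f s) <= (LINT s|lb T. ?K * exp (2 * c * T) * (indicator {t<..T} s * exp (- (2 * c) * s)))"
  proof (rule integral_mono[OF i1])
  fix s assume "s : space (lb T)"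
  then show "indicator {t<..T} s * f s <= ?K * exp (2 * c * T) * (indicator {t<..T} s * exp (- (2 * c) * s))"
  using Suc.IH[of s] ex[of s] Suc.prems by (auto simp: indicator_def mult.assoc)
  qed (use i2 in simp)
  also have "... = ?K * exp (2 * c * T) * ((exp (- (2 * c) * t) - exp (- (2 * c) * T)) / (2 * c))" unfolding v[symmetric] by simp
  also have "... = ?K * ((exp (2 * c * (T - t)) - exp (2 * c * (T - T))) / (2 * c))" unfolding ex by (simp add: field_simps)
  finally have "c * (LINT s|lb T. indicator {t<..T} s * f s) <= c * (?K * ((exp (2 * c * (T - t)) - 1) / (2 * c)))"
  using c by (intro mult_left_mono) auto
  also have "... = ?K / 2 * (exp (2 * c * (T - t)) - 1)" using c by (simp add: field_simps)
  also have "... <= ?K / 2 * exp (2 * c * (T - t))" using K by (intro mult_left_mono) auto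
  finally show ?case using le[OF Suc.prems] by (simp add: mult.commute)
 qed
 have "(%n. (B * (1 / 2) ^ n) * exp (2 * c * (T - t))) ----> (B * 0) * exp (2 * c * (T - t))" by (intro tendsto_intros LIMSEQ_power_zero) auto
 then show ?thesis by (intro LIMSEQ_le_const[of "%n. (B * (1 / 2) ^ n) * exp (2 * c * (T - t))"]) (use step[OF t] in "auto simp: power_divide")
qed

lemma set_integrable_lb: "integrable (lb t) f \<longleftrightarrow> set_integrable lborel {0..t} f" for f :: "real => real"
 by (simp add: integrable_restrict_space set_integrable_def)

text \<open>The indefinite integral is continuous, so it vanishes at all times before T, and
  Lebesgue differentiation recovers the integrand. The assumption speaks of rational times because
  for a process the exceptional null set may depend on the time.\<close>

lemma AE_zero_of_indefinite_integral:
 fixes f :: "real => real"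
 assumes f: "integrable (lb T) f" and z: "!!q. q : \<rat> ==> 0 <= q ==> q <= T ==> (LINT x|lb q. f x) = 0" shows "AE x in lb T. f x = 0"
proof -
 \<comment> \<open>Differentiation of the integral is applied on the whole line, so f is extended by
   0.\<close>
 define g where "g x = (if x : {0..T} then f x else 0)" for x
 have si: "set_integrable lborel {0..T} f" using f by (simp add: set_integrable_lb)
 have fi: "f integrable_on {0..T}" using set_borel_integral_eq_integral(1)[OF si] .
 have lbi: "(LINT x|lb t. f x) = integral {0..t} f" if "t <= T" for t using integrable_lb_mono[OF that f] unfolding set_integrable_lb
  by (simp add: set_borel_integral_eq_integral(2) set_integral_lb[symmetric])
 have cont: "continuous_on {0..T} (%t. integral {0..t} f)" by (rule indefinite_integral_continuous_1[OF fi])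
 have zero: "integral {0..t} f = 0" if t: "0 <= t" "t < T" for t proof (rule ccontr)
  assume n: "integral {0..t} f ~= 0"
  then obtain d where d: "0 < d" "!!s. s : {0..T} ==> dist s t < d ==> dist (integral {0..s} f) (integral {0..t} f) < abs (integral {0..t} f)"
  using cont t unfolding continuous_on_iff by (metis atLeastAtMost_iff less_eq_real_def zero_less_abs_iff)
  obtain q where q: "q : \<rat>" "t < q" "q < min T (t + d)" using Rats_dense_in_real[of t "min T (t + d)"] t d(1) by auto
  have "integral {0..q} f = 0" using z[OF q(1)] lbi[of q] q t by simp
  then show False using d(2)[of q] q t by (auto simp: dist_real_def)
 qed
 have gi: "g integrable_on cbox a b" for a b proof -
  have "g integrable_on UNIV" using fi unfolding g_def integrable_restrict_UNIV .
  then show ?thesis by (rule integrable_on_subcbox) simp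
 qed
 obtain N where N: "negligible N" "!!x e. x ~: N ==> 0 < e ==>
  EX d>0. ALL h. 0 < h & h < d --> norm (integral (cbox x (x + h *\<^sub>R One)) g /\<^sub>R h ^ DIM(real) - g x) < e"
  using integrable_ccontinuous_explicit[OF gi] by blast
 have gz: "g x = 0" if x: "x ~: N" "0 < x" "x < T" for x proof (rule ccontr)
  assume "g x ~= 0"
  then obtain d where d: "d > 0" "!!h. 0 < h ==> h < d ==> norm (integral (cbox x (x + h *\<^sub>R One)) g /\<^sub>R h ^ DIM(real) - g x) < abs (g x)"
  using N(2)[OF x(1), of "abs (g x)"] by auto
  define h where "h = min d (T - x) / 2"
  have h: "0 < h" "h < d" "x + h < T" using d x by (auto simp: h_def min_def field_simps)
  have "integral {0..x} f + integral {x..x + h} f = integral {0..x + h} f"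
  using h x by (intro Henstock_Kurzweil_Integration.integral_combine integrable_on_subinterval[OF fi]) auto
  then have "integral {x..x + h} f = 0" using zero[of x] zero[of "x + h"] h x by simp
  moreover have "integral {x..x + h} g = integral {x..x + h} f" using h x by (intro Henstock_Kurzweil_Integration.integral_cong) (auto simp: g_def)
  ultimately show False using d(2)[OF h(1,2)] by simp
 qed
 have "AE x in lborel. x ~: N" proof -
  have "N : null_sets lebesgue" using N(1) by (simp add: negligible_iff_null_sets)
  then have "AE x in lebesgue. x ~: N" by (rule AE_not_in)
  then show ?thesis by (simp add: AE_completion_iff)
 qed
 then have "AE x in lb T. x ~: N" by (subst AE_restrict_space_iff) auto
 with lb_points[where c = 0] lb_points[where c = T] AE_space show ?thesis proof eventually_elim
  case (elim x)
  then have "g x = 0" by (intro gz) auto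
  then show ?case using elim by (auto simp: g_def)
 qed
qed

context wiener
begin

lemma sqp_jm: "sqp T b ==> jm T b" by (simp add: sqp_def jm_def sqi_def)

lemma sqp_zero: "sqp T (%t w. 0)" by (simp add: sqp_def sqi_zero)

lemma sqp_add: "sqp T b ==> sqp T c ==> sqp T (%t w. b t w + c t w)" by (auto simp: sqp_def intro!: sqi_add borel_measurable_add)

lemma sqp_cmult: "sqp T b ==> sqp T (%t w. a * b t w)" by (auto simp: sqp_def intro: sqi_cmult)

lemma jm_add: "jm T f ==> jm T g ==> jm T (%t w. f t w + g t w)" by (auto simp: jm_def)

lemma jm_cmult: "jm T f ==> jm T (%t w. c * f t w)" by (auto simp: jm_def)

lemma tint_add_AE:
 assumes "sqi (Q t) (uc b)" "sqi (Q t) (uc c)" shows "AE w in M. tint (%r w. b r w + c r w) t w = tint b t w + tint c t w"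
 using sqi_Q_sections(1)[OF assms(1)] sqi_Q_sections(1)[OF assms(2)] by eventually_elim (simp add: tint_def sqi_imp_integrable[OF fin_lb])

lemma tint_diff_AE:
 assumes "sqi (Q t) (uc b)" "sqi (Q t) (uc c)" shows "AE w in M. tint (%r w. b r w - c r w) t w = tint b t w - tint c t w"
 using sqi_Q_sections(1)[OF assms(1)] sqi_Q_sections(1)[OF assms(2)] by eventually_elim (simp add: tint_def sqi_imp_integrable[OF fin_lb])

lemma tint_cmult: "tint (%r w. c * b r w) t w = c * tint b t w" by (simp add: tint_def)

lemma tint_zero_AE:
 assumes b: "sqi (Q t) (uc b)" and t: "0 <= t" and z: "AE p in Q t. uc b p = 0" shows "AE w in M. tint b t w = 0"
proof (rule sqi_zero_AE[OF tint_sqi(1)[OF b t]])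
 have "(LINT p|Q t. (uc b p)^2) = 0" by (rule integral_eq_zero_AE) (use z in auto)
 then show "EE (%w. (tint b t w)^2) <= 0" using tint_sqi(3)[OF b t] by simp
qed

lemma tint_cong_AE:
 assumes "sqi (Q t) (uc b)" "sqi (Q t) (uc c)" "0 <= t"
  "AE p in Q t. uc b p = uc c p" shows "AE w in M. tint b t w = tint c t w"
proof -
 have "AE w in M. tint (%r w. b r w - c r w) t w = 0" using assms by (intro tint_zero_AE sqi_diff) auto
 with tint_diff_AE[OF assms(1,2)] show ?thesis by eventually_elim simp
qed

lemma jm_section: "jm T X ==> t : {0..T} ==> X t : BM M" using measurable_Q_section[of "%p. uc X p" T t] by (simp add: jm_def)

lemma ip_cong:
 assumes X: "ip T X b s" and T: "0 <= T" and b': "sqp T b'" and s': "sqp T s'" and X': "jm T X'"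
  and eX: "!!t. t : {0..T} ==> AE w in M. X t w = X' t w"
  and eb: "AE p in Q T. uc b p = uc b' p"
  and es: "AE p in Q T. uc s p = uc s' p" shows "ip T X' b' s'"
proof -
 have z: "0 : {0..T}" using T by simp
 have X0: "X' 0 : BM (F 0)" using X by (intro measurable_F_AE[OF _ eX[OF z]]) (simp add: ip_def)
 have "sqi M (X' 0)" using X by (intro sqi_cong_AE[OF _ measurable_F_M[OF X0] eX[OF z]]) (simp add: ip_def)
 moreover have "ito t s' (%w. X' t w - X' 0 w - tint b' t w)" if t: "t : {0..T}" for t proof (rule ito_cong_AE)
  show "ito t s (%w. X t w - X 0 w - tint b t w)" using X t by (simp add: ip_def)
  have le: "0 <= t" "t <= T" using t by auto
  show "(uc s') : BM (Q t)" using sqp_sqi[OF s' le(2)] by (simp add: sqi_def)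
  have bq: "sqi (Q t) (uc b)" "sqi (Q t) (uc b')" using X b' le by (auto simp: ip_def intro: sqp_sqi)
  show "(%w. X' t w - X' 0 w - tint b' t w) : BM M" using jm_section[OF X' t] jm_section[OF X' z] tint_sqi(1)[OF bq(2) le(1)] by (auto simp: sqi_def)
  show "AE p in Q t. uc s p = uc s' p" by (rule AE_Q_mono[OF le(2) es])
  show "AE w in M. X t w - X 0 w - tint b t w = X' t w - X' 0 w - tint b' t w"
  using eX[OF t] eX[OF z] tint_cong_AE[OF bq le(1) AE_Q_mono[OF le(2) eb]] by eventually_elim simp
 qed
 ultimately show ?thesis using b' s' X' X0 by (simp add: ip_def)
qed

lemma ip_add:
 assumes X: "ip T X b s" and Y: "ip T Y c u" shows "ip T (%t w. X t w + Y t w) (%t w. b t w + c t w) (%t w. s t w + u t w)"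
proof -
 have "ito t (%t w. s t w + u t w) (%w. X t w + Y t w - (X 0 w + Y 0 w) - tint (%t w. b t w + c t w) t w)"
  if t: "t : {0..T}" for t proof (rule ito_cong_AE)
  have iX: "ito t s (%w. X t w - X 0 w - tint b t w)" and iY: "ito t u (%w. Y t w - Y 0 w - tint c t w)" using X Y t by (simp_all add: ip_def)
  note x = ip_parts[OF X t] and y = ip_parts[OF Y t]
  show i: "ito t (%t w. s t w + u t w) (%w. (X t w - X 0 w - tint b t w) + (Y t w - Y 0 w - tint c t w))" by (rule ito.add[OF iX iY])
  show "(%p. uc s p + uc u p) : BM (Q t)" using ito_sqi(1)[OF i] by (simp add: sqi_def)
  show "(%w. X t w + Y t w - (X 0 w + Y 0 w) - tint (%t w. b t w + c t w) t w) : BM M" using x(1,4) y(1,4) t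
  tint_sqi(1)[where b = "%t w. b t w + c t w", OF sqi_add[OF x(9) y(9)]] by (auto simp: sqi_def)
  show "AE w in M. (X t w - X 0 w - tint b t w) + (Y t w - Y 0 w - tint c t w)
  = X t w + Y t w - (X 0 w + Y 0 w) - tint (%t w. b t w + c t w) t w" using tint_add_AE[OF x(9) y(9)] by eventually_elim simp
 qed simp_all
 then show ?thesis using X Y by (auto simp: ip_def intro: sqp_add jm_add sqi_add)
qed

lemma ip_cmult:
 assumes X: "ip T X b s" shows "ip T (%t w. c * X t w) (%t w. c * b t w) (%t w. c * s t w)"
proof -
 have "ito t (%t w. c * s t w) (%w. c * X t w - c * X 0 w - tint (%t w. c * b t w) t w)" if t: "t : {0..T}" for t proof -
  have iX: "ito t s (%w. X t w - X 0 w - tint b t w)" using X t by (simp_all add: ip_def)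
  show ?thesis using ito_cmult[OF iX, of c] by (simp add: tint_cmult right_diff_distrib)
 qed
 then show ?thesis using X by (auto simp: ip_def intro: sqp_cmult jm_cmult sqi_cmult)
qed

lemma ip_zero: "0 <= T ==> ip T (%t w. 0) (%t w. 0) (%t w. 0)" by (auto simp: ip_def sqp_zero sqi_zero jm_def tint_def ito_zero)

lemma ip_sum:
 assumes "0 <= T" "!!i. i : I ==> ip T (X i) (b i) (s i)"
 shows "ip T (%t w. \<Sum>i\<in>I. X i t w) (%t w. \<Sum>i\<in>I. b i t w) (%t w. \<Sum>i\<in>I. s i t w)"
 using assms by (induction I rule: infinite_finite_induct) (auto intro: ip_zero ip_add)

lemma ip_diff:
 assumes X: "ip T X b s" and Y: "ip T Y c u" shows "ip T (%t w. X t w - Y t w) (%t w. b t w - c t w) (%t w. s t w - u t w)"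
 using ip_add[OF X ip_cmult[OF Y, of "-1"]] by simp

lemma ip_square_sum:
 assumes I: "finite I" and XI: "ALL i:I. ip T (X i) (b i) (s i)" and t: "t : {0..T}"
 shows "(\<Sum>i\<in>I. EE (%w. (X i t w)^2)) = (\<Sum>i\<in>I. EE (%w. (X i 0 w)^2)) +
  (LINT p|Q t. (\<Sum>i\<in>I. 2 * uc (X i) p * uc (b i) p + (uc (s i) p)^2))"
  "integrable (Q t) (%p. \<Sum>i\<in>I. 2 * uc (X i) p * uc (b i) p + (uc (s i) p)^2)"
  "integrable (Q t) (%p. \<Sum>i\<in>I. (uc (X i) p)^2)"
  "(LINT p|Q t. (\<Sum>i\<in>I. (uc (X i) p)^2)) = (LINT r|lb t. (\<Sum>i\<in>I. EE (%w. (X i r w)^2)))"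
  "(%r. \<Sum>i\<in>I. EE (%w. (X i r w)^2)) : BM (lb t)"
proof -
 note X = bspec[OF XI]
 have i1: "integrable (Q t) (%p. 2 * uc (X i) p * uc (b i) p + (uc (s i) p)^2)" if "i : I" for i
  using ip_parts[OF X[OF that] t] sqi_mult[OF ip_parts(6,9)[OF X[OF that] t]] by (auto simp: sqi_def mult.assoc)
 have i2: "integrable (Q t) (%p. (uc (X i) p)^2)" if "i : I" for i using ip_parts(6)[OF X[OF that] t] by (auto simp: sqi_def)
 show "integrable (Q t) (%p. \<Sum>i\<in>I. 2 * uc (X i) p * uc (b i) p + (uc (s i) p)^2)" by (rule isum[OF i1])
 show "integrable (Q t) (%p. \<Sum>i\<in>I. (uc (X i) p)^2)" by (rule isum[OF i2])
 have "(\<Sum>i\<in>I. EE (%w. (X i t w)^2)) = (\<Sum>i\<in>I. EE (%w. (X i 0 w)^2) +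
  (LINT p|Q t. 2 * uc (X i) p * uc (b i) p + (uc (s i) p)^2))" proof (rule sum.cong[OF refl])
  fix i assume "i : I"
  show "EE (%w. (X i t w)^2) = EE (%w. (X i 0 w)^2) +
  (LINT p|Q t. 2 * uc (X i) p * uc (b i) p + (uc (s i) p)^2)"
  using ip_product[OF X[OF \<open>i : I\<close>] X[OF \<open>i : I\<close>] t] by (simp add: power2_eq_square mult.assoc)
 qed
 also have "... = (\<Sum>i\<in>I. EE (%w. (X i 0 w)^2)) +
  (LINT p|Q t. (\<Sum>i\<in>I. 2 * uc (X i) p * uc (b i) p + (uc (s i) p)^2))" by (simp only: sum.distrib[of "%i. EE (%w. (X i 0 w)^2)"] Isum[OF i1])
 finally show "(\<Sum>i\<in>I. EE (%w. (X i t w)^2)) = (\<Sum>i\<in>I. EE (%w. (X i 0 w)^2)) +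
  (LINT p|Q t. (\<Sum>i\<in>I. 2 * uc (X i) p * uc (b i) p + (uc (s i) p)^2))" .
 have m: "integrable (lb t) (%r. EE (%w. (X i r w)^2))" if "i : I" for i using integral_Q_fst(3)[OF i2[OF that]] by simp
 then show "(%r. \<Sum>i\<in>I. EE (%w. (X i r w)^2)) : BM (lb t)" by auto
 show "(LINT p|Q t. (\<Sum>i\<in>I. (uc (X i) p)^2)) = (LINT r|lb t. (\<Sum>i\<in>I. EE (%w. (X i r w)^2)))"
  using i2 m integral_Q_fst(1)[OF i2] by (simp add: Isum)
qed

lemma sum_squares_zero:
 assumes "finite I" "!!i. i : I ==> sqi N (f i)" "(\<Sum>i\<in>I. LINT x|N. (f i x)^2) <= 0" "i : I" shows "AE x in N. f i x = 0"
proof -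
 have nn: "0 <= (LINT x|N. (f i x)^2)" for i by (intro integral_nonneg_AE) auto
 have "(LINT x|N. (f i x)^2) <= (\<Sum>i\<in>I. LINT x|N. (f i x)^2)" using assms nn by (intro member_le_sum) auto
 then show ?thesis using assms by (intro sqi_zero_AE) auto
qed

text \<open>By the product formula the summed second moment satisfies a Gronwall inequality without
  constant term.\<close>

lemma ip_forward_unique:
 assumes I: "finite I" and X: "!!i. i : I ==> ip T (X i) (b i) (s i)"
  and z: "!!i. i : I ==> AE w in M. X i 0 w = 0" and c: "0 < c"
  and bnd: "AE p in Q T. (\<Sum>i\<in>I. 2 * uc (X i) p * uc (b i) p + (uc (s i) p)^2)
  <= c * (\<Sum>i\<in>I. (uc (X i) p)^2)"
  and t: "t : {0..T}" and i: "i : I" shows "AE w in M. X i t w = 0"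
proof -
 have XI: "ALL i:I. ip T (X i) (b i) (s i)" using X by blast
 define f where "f r = (\<Sum>i\<in>I. EE (%w. (X i r w)^2))" for r
 have T: "T : {0..T}" using t by simp
 have le: "f r <= c * (LINT r|lb r. f r)" if r: "r : {0..T}" for r proof -
  note q = ip_square_sum[OF I XI r]
  have "EE (%w. (X i 0 w)^2) = 0" if "i : I" for i by (rule integral_eq_zero_AE) (use z[OF that] in auto)
  then have "f r = (LINT p|Q r. (\<Sum>i\<in>I. 2 * uc (X i) p * uc (b i) p + (uc (s i) p)^2))" using q(1) by (simp add: f_def)
  also have "... <= (LINT p|Q r. c * (\<Sum>i\<in>I. (uc (X i) p)^2))" using q(2,3) AE_Q_mono[OF _ bnd, of r] r by (intro integral_mono_AE) auto
  also have "... = c * (LINT r|lb r. f r)" using q(4) by (simp add: f_def)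
  finally show ?thesis .
 qed
 have nn: "0 <= f r" for r unfolding f_def by (intro sum_nonneg integral_nonneg_AE) auto
 define B where "B = c * (LINT p|Q T. (\<Sum>i\<in>I. (uc (X i) p)^2))"
 have B: "f r <= B" if r: "r : {0..T}" for r proof -
  have "f r <= c * (LINT p|Q r. (\<Sum>i\<in>I. (uc (X i) p)^2))" using le[OF r] ip_square_sum(4)[OF I XI r] by (simp add: f_def)
  also have "... <= B" unfolding B_def using r c ip_square_sum(3)[OF I XI T] by (intro mult_left_mono integral_Q_mono) (auto intro: sum_nonneg)
  finally show ?thesis .
 qed
 have "f t <= 2 * 0 * exp (2 * c * t)"
  by (rule gronwall[OF ip_square_sum(5)[OF I XI T, folded f_def], where B = B and a = 0 and c = c]) (use nn B le c t in auto)
 then show ?thesis using sum_squares_zero[OF I, of M "%i. X i t"] ip_parts(4)[OF X t] i by (simp add: f_def)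
qed

text \<open>In the energy identity read back from T, half of the squared diffusion has a favourable
  sign. It is first discarded, which gives X = 0 by Gronwall; with X = 0 known it is used again and
  forces the diffusion to vanish.\<close>

lemma ip_backward_unique:
 assumes I: "finite I" and X: "!!i. i : I ==> ip T (X i) (b i) (s i)" and T: "0 <= T"
  and z: "!!i. i : I ==> AE w in M. X i T w = 0" and c: "0 < c"
  and bnd: "AE p in Q T. (1/2) * (\<Sum>i\<in>I. (uc (s i) p)^2) - c * (\<Sum>i\<in>I. (uc (X i) p)^2)
  <= (\<Sum>i\<in>I. 2 * uc (X i) p * uc (b i) p + (uc (s i) p)^2)"
  and i: "i : I" shows "t : {0..T} ==> AE w in M. X i t w = 0" "AE p in Q T. uc (s i) p = 0"
proof -
 have XI: "ALL i:I. ip T (X i) (b i) (s i)" using X by blast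
 define \<phi> where "\<phi> r = (\<Sum>i\<in>I. EE (%w. (X i r w)^2))" for r
 have TT: "T : {0..T}" using T by simp
 let ?g = "%p. (\<Sum>i\<in>I. 2 * uc (X i) p * uc (b i) p + (uc (s i) p)^2)"
 let ?x = "%p. (\<Sum>i\<in>I. (uc (X i) p)^2)" and ?s = "%p. (\<Sum>i\<in>I. (uc (s i) p)^2)"
 have si: "integrable (Q T) ?s" using ip_parts(10)[OF X TT] by (intro isum) (auto simp: sqi_def)
 note qT = ip_square_sum[OF I XI TT]
 have \<phi>T: "\<phi> T = 0" unfolding \<phi>_def by (intro sum.neutral ballI integral_eq_zero_AE) (use z in auto)
 have ind: "(LINT p|Q T. f p) - (LINT p|Q r. f p) = (LINT p|Q T. indicator {r<..T} (fst p) * f p)"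
  "integrable (Q T) (%p. indicator {r<..T} (fst p) * f p)"
  if r: "r : {0..T}" and f: "integrable (Q T) f" for r and f :: "real \<times> 'a => real" proof -
  have rT: "r <= T" using r by simp
  have ir: "integrable (Q T) (%p. indicator {0..r} (fst p) * f p)" using integrable_Q_mono[OF rT f] integrable_Q_sub(1)[OF rT] by blast
  have e: "f p - indicator {0..r} (fst p) * f p = indicator {r<..T} (fst p) * f p" if "p : space (Q T)" for p
  using that r by (auto simp: space_Q indicator_def)
  show "(LINT p|Q T. f p) - (LINT p|Q r. f p) = (LINT p|Q T. indicator {r<..T} (fst p) * f p)"
  unfolding integrable_Q_sub(2)[OF rT] Bochner_Integration.integral_diff[OF f ir, symmetric] by (rule icong[OF refl e])
  show "integrable (Q T) (%p. indicator {r<..T} (fst p) * f p)"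
  by (rule ible_cong[THEN iffD1, OF refl e Bochner_Integration.integrable_diff[OF f ir]])
 qed
 have le: "\<phi> r <= c * (LINT u|lb T. indicator {r<..T} u * \<phi> u)" if r: "r : {0..T}" for r proof -
  note q = ip_square_sum[OF I XI r]
  have "- \<phi> r = (LINT p|Q T. ?g p) - (LINT p|Q r. ?g p)" using q(1) qT(1) \<phi>T by (simp add: \<phi>_def)
  also have "... = (LINT p|Q T. indicator {r<..T} (fst p) * ?g p)" by (rule ind(1)[OF r qT(2)])
  also have "... >= (LINT p|Q T. - c * (indicator {r<..T} (fst p) * ?x p))" proof (rule integral_mono_AE)
  show "AE p in Q T. - c * (indicator {r<..T} (fst p) * ?x p) <= indicator {r<..T} (fst p) * ?g p" using bnd proof eventually_elim
  case (elim p)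
  have "0 <= ?s p" by (intro sum_nonneg) auto
  then show ?case using elim by (auto simp: indicator_def)
  qed
  qed (use ind(2)[OF r qT(2)] ind(2)[OF r qT(3)] in auto)
  finally have "\<phi> r <= c * (LINT p|Q T. indicator {r<..T} (fst p) * ?x p)" by simp
  also have "(LINT p|Q T. indicator {r<..T} (fst p) * ?x p) = (LINT u|lb T. indicator {r<..T} u * \<phi> u)"
  proof (subst integral_Q_fst(1)[OF ind(2)[OF r qT(3)]], rule integral_cong_AE)
  show "(%u. LINT w|M. indicator {r<..T} (fst (u, w)) * ?x (u, w)) : BM (lb T)" using integral_Q_fst(3)[OF ind(2)[OF r qT(3)]] by simp
  have "{r<..T} : sets (lb T)" using r by (auto simp: sets_restrict_space_iff)
  then show "(%u. indicator {r<..T} u * \<phi> u) : BM (lb T)" using qT(5) by (auto simp: \<phi>_def)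
  have "AE u in lb T. ALL i:I. sqi M (X i u)" using sqi_Q_sections(2)[OF ip_parts(6)[OF X TT]] I by (simp add: AE_finite_all)
  then show "AE u in lb T. (LINT w|M. indicator {r<..T} (fst (u, w)) * ?x (u, w)) = indicator {r<..T} u * \<phi> u"
  by eventually_elim (simp add: \<phi>_def sqi_def)
  qed
  finally show ?thesis .
 qed
 have nn: "0 <= \<phi> r" for r unfolding \<phi>_def by (intro sum_nonneg integral_nonneg_AE) auto
 define B where "B = c * (LINT u|lb T. \<phi> u)"
 have i\<phi>: "integrable (lb T) \<phi>" proof -
  have "integrable (lb T) (%r. EE (%w. (X i r w)^2))" if "i : I" for i
  using integral_Q_fst(3)[OF sqi_integrable[OF ip_parts(6)[OF X[OF that] TT]]] by simp
  then show ?thesis unfolding \<phi>_def[abs_def] by (rule isum)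
 qed
 have B: "\<phi> r <= B" if r: "r : {0..T}" for r proof -
  have s: "{r<..T} : sets (lb T)" using r by (auto simp: sets_restrict_space_iff)
  have "\<phi> r <= c * (LINT u|lb T. indicator {r<..T} u * \<phi> u)" by (rule le[OF r])
  also have "... <= B" unfolding B_def using c integrable_mult_indicator[OF s i\<phi>] i\<phi> nn
  by (intro mult_left_mono integral_mono) (auto simp: indicator_def)
  finally show ?thesis .
 qed
 have \<phi>0: "\<phi> t <= 0" if t: "t : {0..T}" for t
  by (rule gronwall_backward[OF qT(5)[folded \<phi>_def], where B = B and c = c]) (use nn B le c t in auto)
 then show "t : {0..T} ==> AE w in M. X i t w = 0" for t
  using sum_squares_zero[OF I, of M "%i. X i t"] ip_parts(4)[OF X] i by (simp add: \<phi>_def)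
 have "(LINT r|lb T. \<phi> r) <= (LINT r|lb T. 0)" using \<phi>0 i\<phi> by (intro integral_mono) auto
 then have x0: "(LINT p|Q T. ?x p) <= 0" using qT(4) by (simp add: \<phi>_def)
 have "(LINT p|Q T. (1/2) * ?s p - c * ?x p) <= (LINT p|Q T. ?g p)" using si qT(2,3) bnd by (intro integral_mono_AE) auto
 also have "... = - \<phi> 0" using qT(1) \<phi>T by (simp add: \<phi>_def)
 finally have "(1/2) * (LINT p|Q T. ?s p) <= c * (LINT p|Q T. ?x p)" using nn[of 0] si qT(3) by simp
 also have "... <= 0" using x0 c by (simp add: mult_le_0_iff)
 finally have "(\<Sum>i\<in>I. LINT p|Q T. (uc (s i) p)^2) <= 0" using ip_parts(10)[OF X TT] by (simp add: Isum sqi_def)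
 then show "AE p in Q T. uc (s i) p = 0" using sum_squares_zero[OF I, of "Q T" "%i p. uc (s i) p"] ip_parts(10)[OF X TT] i by simp
qed

text \<open>Uniqueness of the decomposition into drift and martingale part.\<close>

lemma ip_null:
 assumes X: "ip T X b s" and T: "0 <= T" and X0: "AE w in M. X 0 w = 0"
  and XQ: "AE p in Q T. uc X p = 0" shows "AE p in Q T. uc s p = 0" "AE p in Q T. uc b p = 0"
  "t : {0..T} ==> AE w in M. X t w = 0"
proof -
 have TT: "T : {0..T}" using T by simp
 have sT: "sqi (Q T) (uc s)" and bT: "sqi (Q T) (uc b)" using ip_parts(9,10)[OF X TT] by auto
 define a where "a r = EE (%w. (s r w)^2)" for r
 have ia: "integrable (lb T) a" using integral_Q_fst(3)[OF sqi_integrable[OF sT]] unfolding a_def by simp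
 have X00: "EE (%w. X 0 w * X 0 w) = 0" by (rule integral_eq_zero_AE) (use X0 in auto)
 have EX: "EE (%w. (X t w)^2) = (LINT p|Q t. (uc s p)^2)" if t: "t : {0..T}" for t proof -
  have "EE (%w. (X t w)^2) = (LINT p|Q t. uc X p * uc b p + uc X p * uc b p
  + uc s p * uc s p)" using ip_product[OF X X t] X00 by (simp add: power2_eq_square)
  also have "... = (LINT p|Q t. (uc s p)^2)" proof (rule integral_cong_AE)
  note q = ip_parts[OF X t]
  show "(%p. uc X p * uc b p + uc X p * uc b p
  + uc s p * uc s p) : BM (Q t)"
  "(%p. (uc s p)^2) : BM (Q t)" using q(6,9,10) by (auto simp: sqi_def)
  show "AE p in Q t. uc X p * uc b p + uc X p * uc b p
  + uc s p * uc s p = (uc s p)^2" using AE_Q_mono[OF _ XQ, of t] t by (auto simp: power2_eq_square)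
  qed
  finally show ?thesis .
 qed
 have at: "(LINT p|Q t. (uc s p)^2) = (LINT r|lb t. a r)" if t: "t : {0..T}" for t
  using integral_Q_fst(1)[OF sqi_integrable[OF ip_parts(10)[OF X t]]] by (simp add: a_def)
 have i1: "integrable (lb T) (%r. 1 :: real)" by (simp add: finite_measure.integrable_const[OF fin_lb])
 \<comment> \<open>X vanishes only for almost every time, so \<open>EX\<close> says nothing yet at a
   single t. Integrated over all times it leaves the integral of a with weight T - r, which is
   positive before T.\<close>
 have "(LINT r|lb T. (LINT x|lb r. a x)) = (LINT r|lb T. EE (%w. (X r w)^2))" using EX at by (intro icong) auto
 also have "... = (LINT p|Q T. (uc X p)^2)" using integral_Q_fst(1)[OF sqi_integrable[OF ip_parts(6)[OF X TT]]] by simp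
 also have "... = 0" by (rule integral_eq_zero_AE) (use XQ in auto)
 finally have A0: "(LINT r|lb T. (LINT x|lb r. a x)) = 0" .
 have ir: "(LINT x|lb r. 1) = r" if "r : space (lb T)" for r using that by (simp add: measure_lb)
 have i2: "integrable (lb T) (%r. a r * r)" proof -
  have "integrable (lb T) (%r. a r * (LINT x|lb r. 1)) = integrable (lb T) (%r. a r * r)" by (rule ible_cong[OF refl]) (simp only: ir)
  then show ?thesis using integral_times_lb(2)[OF ia i1] by simp
 qed
 have "T * (LINT r|lb T. a r) = (LINT r|lb T. 1 * (LINT x|lb r. a x) + a r * (LINT x|lb r. 1))"
  using integral_times_lb(1)[OF i1 ia] ir[of T] T by simp
 also have "... = (LINT r|lb T. (LINT x|lb r. a x) + a r * r)" using ir by (intro icong) auto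
 also have "... = (LINT r|lb T. a r * r)" using integral_times_lb(2)[OF i1 ia] i2 A0 by simp
 finally have "(LINT r|lb T. a r * (T - r)) = 0" using ia i2 by (simp add: right_diff_distrib mult.commute)
 moreover have "integrable (lb T) (%r. a r * (T - r))" using ia i2 by (simp add: right_diff_distrib)
 moreover have ann: "0 <= a r" for r unfolding a_def by (intro integral_nonneg_AE) auto
 then have "AE r in lb T. 0 <= a r * (T - r)" by (intro AE_I2) auto
 ultimately have "AE r in lb T. a r * (T - r) = 0" using integral_nonneg_eq_0_iff_AE by blast
 with lb_points[where c = T] have "AE r in lb T. a r = 0" by eventually_elim auto
 then have "(LINT r|lb T. a r) = 0" by (intro integral_eq_zero_AE)
 then have s2: "(LINT p|Q T. (uc s p)^2) = 0" using at[OF TT] by simp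
 then show s0: "AE p in Q T. uc s p = 0" using sqi_zero_AE[OF sT] by simp
 have Xt: "AE w in M. X t w = 0" if t: "t : {0..T}" for t proof (rule sqi_zero_AE[OF ip_parts(4)[OF X t]])
  have "(LINT p|Q t. (uc s p)^2) <= (LINT p|Q T. (uc s p)^2)" using t by (intro integral_Q_mono sqi_integrable[OF sT]) auto
  then show "EE (%w. (X t w)^2) <= 0" using EX[OF t] s2 by simp
 qed
 then show "t : {0..T} ==> AE w in M. X t w = 0" for t .
 have tb: "AE w in M. tint b t w = 0" if t: "t : {0..T}" for t proof -
  have "ito t s (%w. X t w - X 0 w - tint b t w)" using X t by (simp add: ip_def)
  then have "AE w in M. X t w - X 0 w - tint b t w = 0" using t AE_Q_mono[OF _ s0, of t] by (intro ito_unique[OF _ ito_zero]) auto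
  with Xt[OF t] X0 show ?thesis by eventually_elim simp
 qed
 \<comment> \<open>Countably many times share one null set, so along almost every path the integral
   of b over every rational interval from 0 vanishes.\<close>
 have "AE w in M. ALL q:{q::rat. 0 <= real_of_rat q & real_of_rat q <= T}. tint b (real_of_rat q) w = 0" by (subst AE_ball_countable) (use tb in auto)
 with sqi_Q_sections(1)[OF bT] have ae: "AE w in M. AE r in lb T. b r w = 0" proof eventually_elim
  case (elim w)
  show ?case proof (rule AE_zero_of_indefinite_integral[OF sqi_imp_integrable[OF fin_lb elim(1)]])
  fix q :: real assume "q : \<rat>" "0 <= q" "q <= T"
  then show "(LINT x|lb q. b x w) = 0" using elim(2) by (auto simp: tint_def elim: Rats_cases)
  qed
 qed
 \<comment> \<open>So far the null set of times depends on the path; Fubini turns this into a null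
   set of the product.\<close>
 interpret P: pair_sigma_finite "lb T" M by (rule pair_sf)
 have bm: "(uc b) : BM (lb T \<Otimes>\<^sub>M M)" using bT by (simp add: sqi_def Q_def)
 have st: "{p : space (lb T \<Otimes>\<^sub>M M). uc b p = 0} : sets (lb T \<Otimes>\<^sub>M M)" using borel_measurable_eq[OF bm, of "%_. 0"] by simp
 show "AE p in Q T. uc b p = 0" using P.AE_commute[of "%r w. b r w = 0", OF st] P.AE_pair_iff[of "%r w. b r w = 0", OF st] ae unfolding Q_def by simp
qed

end

section \<open>Doob's inequality and continuous stochastic integrals\<close>

primrec rmax :: "(nat => real) => nat => real" where
 "rmax s 0 = abs (s 0)"
| "rmax s (Suc n) = max (rmax s n) (abs (s (Suc n)))"

lemma rmax_ge: "i <= n ==> abs (s i) <= rmax s n"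
proof (induction n)
 case (Suc n)
 then consider "i <= n" | "i = Suc n" by linarith
 then show ?case by cases (use Suc.IH in "auto simp: le_max_iff_disj")
qed simp

lemma rmax_nonneg: "0 <= rmax s n" by (induction n) auto

text \<open>The pathwise form of Doob's maximal inequality: its expectation gives the usual one, since the
 sum becomes a sum of martingale increments.\<close>

lemma rmax_pathwise:
 "(rmax s n)^2 <= 4 * (s n)^2 - 4 * (\<Sum>i<n. (rmax s i * sgn (s i)) * (s (Suc i) - s i))"
proof -
 have a: "rmax s i * sgn (s i) * (s (Suc i) - s i) <= rmax s i * (abs (s (Suc i)) - abs (s i))" for i proof -
  have "sgn (s i) * (s (Suc i) - s i) <= abs (s (Suc i)) - abs (s i)" by (auto simp: sgn_if)
  then show ?thesis using rmax_nonneg[of s i] by (simp add: mult.assoc mult_left_mono)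
 qed
 \<comment> \<open>A discrete version of integrating m d|s| by parts: the maximum m increases only
   where it meets |s|.\<close>
 have b: "(\<Sum>i<n. rmax s i * (abs (s (Suc i)) - abs (s i))) <= rmax s n * abs (s n) - (rmax s n)^2 / 2" proof (induction n)
  case 0
  show ?case by (simp add: power2_eq_square flip: abs_mult)
 next
  case (Suc n)
  let ?m = "rmax s n" and ?y = "abs (s (Suc n))"
  have "(\<Sum>i<Suc n. rmax s i * (abs (s (Suc i)) - abs (s i))) <= ?m * ?y - ?m^2 / 2" using Suc by (simp add: algebra_simps)
  also have "... <= max ?m ?y * ?y - (max ?m ?y)^2 / 2" proof (cases "?y <= ?m")
  case False
  have "0 <= (?y - ?m)^2" by simp
  then have "?m * ?y - ?m^2 / 2 <= ?y * ?y - ?y^2 / 2" by (simp add: power2_eq_square algebra_simps)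
  then show ?thesis using False by (simp add: max_def)
  qed (simp add: max_def)
  finally show ?case by simp
 qed
 have "(\<Sum>i<n. rmax s i * sgn (s i) * (s (Suc i) - s i)) <= rmax s n * abs (s n) - (rmax s n)^2 / 2"
  using sum_mono[of "{..<n}", OF a] b by (rule order_trans)
 \<comment> \<open>This is m y <= y^2 + m^2/4 with y = |s n|; it produces the constant 4.\<close>
 also have "... <= (s n)^2 - (rmax s n)^2 / 4" proof -
  have "0 <= (rmax s n / 2 - abs (s n))^2" by simp
  then show ?thesis by (simp add: power2_eq_square algebra_simps flip: abs_mult)
 qed
 finally show ?thesis by simp
qed

context wiener
begin

lemma rmax_measurable:
 assumes "!!i. i <= n ==> Z i : BM N" shows "(%w. rmax (%i. Z i w) n) : BM N" using assms by (induction n) auto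

lemma rmax_sqi:
 assumes "!!i. i <= n ==> sqi N (Z i)" shows "sqi N (%w. rmax (%i. Z i w) n)" using assms
proof (induction n)
 case 0
 then show ?case by (auto simp: sqi_def)
next
 case (Suc n)
 have 1: "sqi N (%w. rmax (%i. Z i w) n)" using Suc by auto
 have 2: "sqi N (%w. abs (Z (Suc n) w))" using Suc.prems[of "Suc n"] by (auto simp: sqi_def)
 have m: "(%w. rmax (%i. Z i w) (Suc n)) : BM N" using Suc.prems by (intro rmax_measurable) (auto simp: sqi_def)
 have "AE x in N. abs (rmax (%i. Z i x) (Suc n)) <= abs ((rmax (%i. Z i x) n + abs (Z (Suc n) x)))"
  using rmax_nonneg by (intro AE_I2) (auto simp: max_def)
 then show ?case by (rule sqi_bound[OF sqi_add[OF 1 2] m])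
qed

text \<open>Take expectations in the pathwise inequality: the factor \<open>z i\<close> is known at
  time u i, so its product with the next martingale increment has mean zero.\<close>

lemma doob_finite:
 assumes Z: "!!t. t : {0..T} ==> Z t : BM (F t)" "!!t. t : {0..T} ==> ito t s (Z t)"
  and u: "!!i. i <= n ==> u i : {0..T}" "!!i j. i <= j ==> u i <= u j" shows "EE (%w. (rmax (%i. Z (u i) w) n)^2) <= 4 * EE (%w. (Z (u n) w)^2)"
proof -
 have Zs: "sqi M (Z (u i))" if "i <= n" for i using ito_sqi(2)[OF Z(2)[OF u(1)[OF that]]] .
 define z where "z i w = rmax (%i. Z (u i) w) i * sgn (Z (u i) w)" for i w
 have zF: "z i : BM (F (u i))" if i: "i <= n" for i proof -
  have "Z (u j) : BM (F (u i))" if "j <= i" for j using measurable_F_mono[OF u(2)[OF that] Z(1)[OF u(1)]] that i by simp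
  then show ?thesis unfolding z_def[abs_def] by (intro borel_measurable_times rmax_measurable borel_measurable_sgn) auto
 qed
 have rs: "sqi M (%w. rmax (%i. Z (u i) w) i)" if "i <= n" for i using that by (intro rmax_sqi Zs) auto
 have zs: "sqi M (z i)" if i: "i <= n" for i by (rule sqi_bound[OF rs[OF i] measurable_F_M[OF zF[OF i]]]) (auto simp: z_def abs_mult sgn_if)
 have zero: "EE (%w. z i w * (Z (u (Suc i)) w - Z (u i) w)) = 0"
  and int: "integrable M (%w. z i w * (Z (u (Suc i)) w - Z (u i) w))" if i: "i < n" for i proof -
  have in': "i <= n" "Suc i <= n" using i by auto
  have "EE (%w. z i w * Z (u (Suc i)) w) = EE (%w. z i w * Z (u i) w)" using u(1)[OF in'(1)] u(1)[OF in'(2)] u(2)[of i "Suc i"]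
  by (intro ito_martingale[OF Z(2) Z(2) _ _ zF[OF in'(1)] zs[OF in'(1)]]) auto
  then show "EE (%w. z i w * (Z (u (Suc i)) w - Z (u i) w)) = 0"
  using sqi_mult[OF zs[OF in'(1)] Zs[OF in'(1)]] sqi_mult[OF zs[OF in'(1)] Zs[OF in'(2)]] by (simp add: right_diff_distrib)
  show "integrable M (%w. z i w * (Z (u (Suc i)) w - Z (u i) w))" by (intro sqi_mult sqi_diff zs Zs in')
 qed
 have i1: "integrable M (%w. \<Sum>i<n. z i w * (Z (u (Suc i)) w - Z (u i) w))" by (rule isum) (use int in auto)
 have "EE (%w. (rmax (%i. Z (u i) w) n)^2)
  <= EE (%w. 4 * (Z (u n) w)^2 - 4 * (\<Sum>i<n. z i w * (Z (u (Suc i)) w - Z (u i) w)))" proof (rule integral_mono)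
  show "integrable M (%w. (rmax (%i. Z (u i) w) n)^2)" by (rule sqi_integrable[OF rs]) simp
  show "(rmax (%i. Z (u i) w) n)^2 <= 4 * (Z (u n) w)^2 - 4 * (\<Sum>i<n. z i w * (Z (u (Suc i)) w - Z (u i) w))" for w
  unfolding z_def by (rule rmax_pathwise)
 qed (use i1 sqi_integrable[OF Zs] in auto)
 also have "... = 4 * EE (%w. (Z (u n) w)^2)
  - 4 * EE (%w. \<Sum>i<n. z i w * (Z (u (Suc i)) w - Z (u i) w))" using i1 sqi_integrable[OF Zs] by simp
 also have "EE (%w. \<Sum>i<n. z i w * (Z (u (Suc i)) w - Z (u i) w)) = 0" using zero int by (subst Isum) auto
 finally show ?thesis by simp
qed

lemma le_enn2real: "ennreal (a^2) <= v ==> v < \<infinity> ==> a^2 <= enn2real v"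
 by (metis enn2real_ennreal enn2real_mono infinity_ennreal_def zero_le_power2)

text \<open>Turns an extended-valued envelope of squares into a real square-integrable majorant.
  Where the envelope is infinite, \<open>enn2real\<close> returns 0, hence the separate statement of
  almost sure finiteness.\<close>

lemma sqrt_enn2real_sqi:
 assumes V: "V : BM M" "(NI M (%w. V w)) <= ennreal C" and C: "0 <= C" shows "AE w in M. V w < \<infinity>" "sqi M (%w. sqrt (enn2real (V w)))"
  "EE (%w. (sqrt (enn2real (V w)))^2) <= C"
proof -
 have fin: "(NI M (%w. V w)) < \<infinity>" using V(2) by (rule le_less_trans) simp
 then show "AE w in M. V w < \<infinity>" using nn_integral_PInf_AE[OF V(1)] by (auto simp: less_top)
 have le: "(NI M (%w. ennreal ((sqrt (enn2real (V w)))^2))) <= (NI M (%w. V w))" by (intro nn_integral_mono) (simp add: ennreal_enn2real_if)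
 show s: "sqi M (%w. sqrt (enn2real (V w)))" by (subst sqi_nn_finite) (use V(1) le_less_trans[OF le fin] in auto)
 show "EE (%w. (sqrt (enn2real (V w)))^2) <= C" using order_trans[OF le V(2)] C unfolding sqi_nn_integral[OF s] by (simp add: ennreal_le_iff)
qed

text \<open>A majorant instead of the supremum itself, so that no measurability of a supremum over
  uncountably many times has to be shown.\<close>

definition supb :: "real => (real => 'a => real) => real => bool" where
 "supb T X C \<longleftrightarrow> (EX w. sqi M w & (AE v in M. ALL t:{0..T}. abs (X t v) <= w v) & EE (%v. (w v)^2) <= C)"

text \<open>The finite inequality on grids with ever more points; Fatou passes to the lower limit V
  of the squared maxima, and path continuity lets grid points approach any given time.\<close>

lemma doob_sup:
 assumes Z: "!!t. t : {0..T} ==> Z t : BM (F t)" "!!t. t : {0..T} ==> ito t s (Z t)"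
  and T: "0 <= T" and c: "!!w. w : space M ==> continuous_on {0..T} (%t. Z t w)" shows "supb T Z (4 * (LINT p|Q T. (uc s p)^2))"
proof -
 define R where "R j w = ennreal ((rmax (%i. Z (grid (Suc j) T i) w) (Suc j))^2)" for j w
 define V where "V w = liminf (%j. R j w)" for w
 have gT: "grid (Suc j) T i : {0..T}" if "i <= Suc j" for i j using T that by (simp add: grid_nonneg grid_le)
 have Zs: "sqi M (Z t)" if "t : {0..T}" for t using ito_sqi(2)[OF Z(2)[OF that]] .
 have rs: "sqi M (%w. rmax (%i. Z (grid (Suc j) T i) w) (Suc j))" for j by (rule rmax_sqi) (use gT Zs in auto)
 have Rm: "R j : BM M" for j unfolding R_def[abs_def]
  by (intro measurable_compose[OF borel_measurable_power[OF sqi_measurable[OF rs]] measurable_ennreal])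
 have Vm: "V : BM M" unfolding V_def[abs_def] using Rm by simp
 have Ri: "(NI M (%w. R j w)) <= ennreal (4 * (LINT p|Q T. (uc s p)^2))" for j proof -
  have "(NI M (%w. R j w)) = ennreal (EE (%w. (rmax (%i. Z (grid (Suc j) T i) w) (Suc j))^2))" unfolding R_def by (rule sqi_nn_integral[OF rs])
  also have "... <= ennreal (4 * EE (%w. (Z (grid (Suc j) T (Suc j)) w)^2))"
  by (rule ennreal_leI, rule doob_finite[OF Z gT]) (auto intro: grid_mono T)
  also have "EE (%w. (Z (grid (Suc j) T (Suc j)) w)^2) = (LINT p|Q T. (uc s p)^2)" using ito_isometry[OF Z(2)[of T]] T by simp
  finally show ?thesis .
 qed
 have "(NI M (%w. V w)) <= liminf (%j. NI M (%w. R j w))" unfolding V_def by (rule nn_integral_liminf[OF Rm])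
 also have "... <= ennreal (4 * (LINT p|Q T. (uc s p)^2))"
  using Liminf_mono[of "%j. NI M (%w. R j w)" "%_. ennreal (4 * (LINT p|Q T. (uc s p)^2))" sequentially] Ri by (simp add: Liminf_const)
 finally have V1: "(NI M (%w. V w)) <= ennreal (4 * (LINT p|Q T. (uc s p)^2))" .
 have V2: "ennreal ((Z t w)^2) <= V w" if w: "w : space M" and t: "t : {0..T}" for w t proof -
  \<comment> \<open>Grid points converging to t; \<open>grid_index\<close> locates positive times,
    so time 0 is treated apart.\<close>
  define g where "g j = (if t = 0 then 0 else grid (Suc j) T (grid_index (Suc j) T t))" for j
  have gi: "EX i<=Suc j. g j = grid (Suc j) T i" for j proof (cases "t = 0")
  case False
  then have "0 < t" "t <= T" using t by auto
  from grid_indicator(2)[OF _ this, of "Suc j"] show ?thesis using False by (intro exI[of _ "grid_index (Suc j) T t"]) (auto simp: g_def)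
  qed (auto simp: g_def intro!: exI[of _ 0])
  have gl: "g ----> t" proof (cases "t = 0")
  case False
  then have "0 < t" "t <= T" using t by auto
  from grid_index_tendsto[OF this] show ?thesis using False by (simp add: g_def[abs_def])
  qed (simp add: g_def[abs_def])
  have g0: "g j : {0..T}" for j using gi[of j] gT by auto
  have "(%j. Z (g j) w) ----> Z t w" by (rule continuous_on_tendsto_compose[OF c[OF w] gl t]) (use g0 in auto)
  then have "(%j. ennreal ((Z (g j) w)^2)) ----> ennreal ((Z t w)^2)" by (intro tendsto_ennrealI tendsto_power)
  then have "liminf (%j. ennreal ((Z (g j) w)^2)) = ennreal ((Z t w)^2)" by (rule lim_imp_Liminf[rotated]) simp
  moreover have "liminf (%j. ennreal ((Z (g j) w)^2)) <= V w" unfolding V_def proof (rule Liminf_mono, intro always_eventually allI)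
  fix j
  obtain i where "i <= Suc j" "g j = grid (Suc j) T i" using gi by blast
  then have "abs (Z (g j) w) <= rmax (%i. Z (grid (Suc j) T i) w) (Suc j)" using rmax_ge[of i "Suc j" "%i. Z (grid (Suc j) T i) w"] by simp
  then have "(abs (Z (g j) w))^2 <= (rmax (%i. Z (grid (Suc j) T i) w) (Suc j))^2" by (intro power_mono) auto
  then show "ennreal ((Z (g j) w)^2) <= R j w" unfolding R_def by (intro ennreal_leI) simp
  qed
  ultimately show ?thesis by simp
 qed
 have C: "0 <= 4 * (LINT p|Q T. (uc s p)^2)" by simp
 note sq = sqrt_enn2real_sqi[OF Vm V1 C]
 have "AE w in M. ALL t:{0..T}. abs (Z t w) <= sqrt (enn2real (V w))" using sq(1) AE_space proof eventually_elim
  case (elim w)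
  show ?case proof
  fix t assume "t : {0..T}"
  from V2[OF elim(2) this] elim(1) have "(Z t w)^2 <= enn2real (V w)" by (rule le_enn2real)
  then show "abs (Z t w) <= sqrt (enn2real (V w))" by (rule real_le_rsqrt[of "abs _", simplified])
  qed
 qed
 then show ?thesis unfolding supb_def using sq(2,3) by blast
qed

end

section \<open>Deterministic integrals of continuous functions\<close>

lemma int_lb_cont:
 fixes f :: "real => real"
 assumes f: "continuous_on {0..T} f" and t: "t <= T" shows "integrable (lb t) f" "(LINT r|lb t. f r) = integral {0..t} f"
proof -
 have c: "continuous_on {0..t} f" by (rule continuous_on_subset[OF f]) (use t in auto)
 have s: "set_integrable lborel {0..t} f" by (rule borel_integrable_atLeastAtMost'[OF c])
 then show "integrable (lb t) f" by (simp add: set_integrable_lb)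
 show "(LINT r|lb t. f r) = integral {0..t} f" using set_borel_integral_eq_integral(2)[OF s] by (simp add: set_integral_lb)
qed

lemma continuous_on_integral_lb:
 fixes f :: "real => real"
 assumes "continuous_on {0..T} f" shows "continuous_on {0..T} (%t. LINT r|lb t. f r)"
proof -
 have "continuous_on {0..T} (%t. integral {0..t} f)" by (rule indefinite_integral_continuous_1[OF integrable_continuous_real[OF assms]])
 then show ?thesis by (rule continuous_on_eq) (use int_lb_cont(2)[OF assms] in auto)
qed

lemma ftc_lb:
 fixes g :: "real => real"
 assumes d: "!!t. t : {0..T} ==> (g has_real_derivative g' t) (at t within {0..T})"
  and c: "continuous_on {0..T} g'" and t: "t : {0..T}" shows "(LINT r|lb t. g' r) = g t - g 0"
proof -
 have "(g' has_integral (g t - g 0)) {0..t}" proof (rule fundamental_theorem_of_calculus)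
  fix x assume x: "x : {0..t}"
  then have "(g has_real_derivative g' x) (at x within {0..t})" using t by (intro DERIV_subset[OF d]) auto
  then show "(g has_vector_derivative g' x) (at x within {0..t})" by (simp add: has_real_derivative_iff_has_vector_derivative)
 qed (use t in auto)
 then show ?thesis using int_lb_cont(2)[OF c, of t] t by (simp add: integral_unique)
qed

lemma continuous_on_bounded_real:
 fixes g :: "real => real"
 assumes "continuous_on {0..T} g" shows "EX B>=0. ALL t:{0..T}. abs (g t) <= B"
proof -
 have "bounded (g ` {0..T})" by (intro compact_imp_bounded compact_continuous_image assms) simp
 then obtain B where "ALL x:g ` {0..T}. norm x <= B" by (auto simp: bounded_iff)
 then show ?thesis by (intro exI[of _ "max 0 B"]) auto
qed

context wiener
begin

text \<open>Scalar form of the space of continuous adapted processes with square-integrable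
  supremum, with the supremum replaced by a majorant.\<close>

definition cp :: "real => (real => 'a => real) => bool" where
 "cp T f \<longleftrightarrow> (ALL t:{0..T}. f t : BM (F t)) &
  (ALL v:space M. continuous_on {0..T} (%t. f t v)) &
  (EX w. sqi M w & (AE v in M. ALL t:{0..T}. abs (f t v) <= w v))"

lemma cp_F: "cp T f ==> t : {0..T} ==> f t : BM (F t)"
 and cp_cont: "cp T f ==> w : space M ==> continuous_on {0..T} (%t. f t w)" by (auto simp: cp_def)

lemma cp_jm: "cp T f ==> jm T f" unfolding jm_def by (intro jointly_measurable_continuous measurable_F_M[OF cp_F] cp_cont)

lemma cp_sqp: assumes "cp T f" shows "sqp T f"
proof -
 obtain w where w: "sqi M w" "AE v in M. ALL t:{0..T}. abs (f t v) <= w v" using assms by (auto simp: cp_def)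
 have "sqi (Q T) (uc f)" proof (rule sqi_bound[OF sqi_Q_snd[OF w(1)]])
  show "(uc f) : BM (Q T)" using cp_jm[OF assms] by (simp add: jm_def)
  show "AE p in Q T. abs (uc f p) <= abs (w (snd p))"
  using AE_Q_snd[OF w(2)] AE_space by eventually_elim (auto simp: space_Q intro: order_trans[OF _ abs_ge_self])
 qed
 then show ?thesis using assms by (simp add: sqp_def cp_def)
qed

lemma cp_sqi: assumes "cp T f" "t : {0..T}" shows "sqi M (f t)"
proof -
 obtain w where w: "sqi M w" "AE v in M. ALL t:{0..T}. abs (f t v) <= w v" using assms by (auto simp: cp_def)
 have "AE v in M. abs (f t v) <= abs (w v)" using w(2) by eventually_elim (use assms(2) order_trans[OF _ abs_ge_self] in blast)
 then show ?thesis by (rule sqi_bound[OF w(1) measurable_F_M[OF cp_F[OF assms]]])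
qed

lemma cp_add: assumes "cp T f" "cp T g" shows "cp T (%t u. f t u + g t u)"
proof -
 obtain w where w: "sqi M w" "AE u in M. ALL t:{0..T}. abs (f t u) <= w u" using assms by (auto simp: cp_def)
 obtain v where v: "sqi M v" "AE u in M. ALL t:{0..T}. abs (g t u) <= v u" using assms by (auto simp: cp_def)
 have "AE u in M. ALL t:{0..T}. abs (f t u + g t u) <= w u + v u"
  using w(2) v(2) by eventually_elim (fastforce intro: order_trans[OF abs_triangle_ineq] add_mono)
 then show ?thesis using assms sqi_add[OF w(1) v(1)] unfolding cp_def
  by (intro conjI ballI exI[of _ "%u. w u + v u"]) (auto intro!: borel_measurable_add continuous_on_add)
qed

lemma cp_det: assumes "cp T f" "continuous_on {0..T} g" shows "cp T (%t v. g t * f t v)"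
proof -
 obtain w where w: "sqi M w" "AE v in M. ALL t:{0..T}. abs (f t v) <= w v" using assms by (auto simp: cp_def)
 obtain B where B: "0 <= B" "ALL t:{0..T}. abs (g t) <= B" using continuous_on_bounded_real[OF assms(2)] by blast
 have "AE v in M. ALL t:{0..T}. abs (g t * f t v) <= B * w v" using w(2) by eventually_elim (use B in "auto simp: abs_mult intro!: mult_mono")
 then show ?thesis using assms sqi_cmult[OF w(1), of B] unfolding cp_def
  by (intro conjI ballI exI[of _ "%v. B * w v"]) (auto intro!: borel_measurable_times continuous_on_mult)
qed

lemma cp_cmult: "cp T f ==> cp T (%t w. c * f t w)" by (rule cp_det) auto

lemma cp_uminus: "cp T f ==> cp T (%t w. - f t w)" using cp_cmult[of T f "-1"] by simp

lemma cp_diff: "cp T f ==> cp T g ==> cp T (%t w. f t w - g t w)" using cp_add[OF _ cp_uminus] by simp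

lemma cp_const: "cp T (%t w. c)" unfolding cp_def using sqi_const[OF finite_measure_axioms] by (intro conjI exI[of _ "%_. abs c"]) auto

lemma cp_sum: "(!!i. i : I ==> cp T (f i)) ==> cp T (%t w. \<Sum>i\<in>I. f i t w)"
 by (induction I rule: infinite_finite_induct) (auto intro: cp_const cp_add)

lemma tint_bound:
 assumes "continuous_on {0..T} (%t. b t w)" "!!t. t : {0..T} ==> abs (b t w) <= c" "t : {0..T}" shows "abs (tint b t w) <= T * c"
proof -
 have i: "integrable (lb t) (%r. b r w)" using int_lb_cont(1)[OF assms(1)] assms(3) by auto
 have "abs (tint b t w) <= (LINT r|lb t. abs (b r w))" unfolding tint_def by (rule integral_abs_bound)
 also have "... <= (LINT r|lb t. c)" using i assms by (intro integral_mono) (auto simp: finite_measure.integrable_const[OF fin_lb])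
 also have "... = t * c" using assms(3) by (simp add: measure_lb)
 also have "... <= T * c" using assms(3) assms(2)[OF assms(3)] by (intro mult_right_mono) auto
 finally show ?thesis .
qed

text \<open>The integral up to t is a limit of left-endpoint Riemann sums, which use values of b
  only up to t; this gives adaptedness.\<close>

lemma cp_tint: assumes b: "cp T b" shows "cp T (tint b)"
proof -
 obtain w where w: "sqi M w" "AE v in M. ALL t:{0..T}. abs (b t v) <= w v" using b by (auto simp: cp_def)
 have "tint b t : BM (F t)" if t: "t : {0..T}" for t proof (rule borel_measurable_LIMSEQ_real)
  show "(%v. \<Sum>i<Suc j. b (grid (Suc j) t i) v * (t / real (Suc j))) : BM (F t)" for j
  proof (intro borel_measurable_sum borel_measurable_times borel_measurable_const)
  fix i assume i: "i : {..<Suc j}"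
  then have g: "0 <= grid (Suc j) t i" "grid (Suc j) t i <= t" using t by (auto simp: grid_nonneg grid_le)
  show "b (grid (Suc j) t i) : BM (F t)" by (rule measurable_F_mono[OF g(2) cp_F[OF b]]) (use g t in auto)
  qed
  fix v assume "v : space (F t)"
  then have v: "v : space M" by simp
  have c: "continuous_on {0..T} (%t. b t v)" by (rule cp_cont[OF b v])
  obtain B where B: "0 <= B" "ALL t:{0..T}. abs (b t v) <= B" using continuous_on_bounded_real[OF c] by blast
  let ?f = "%j s. \<Sum>i<Suc j. b (grid (Suc j) t i) v * indicator {grid (Suc j) t i<..grid (Suc j) t (Suc i)} s"
  have gi: "grid (Suc j) t (grid_index (Suc j) t s) : {0..T}" if s: "0 < s" "s <= t" for s j proof -
  have "grid_index (Suc j) t s <= Suc j" using grid_indicator(2)[OF _ s, of "Suc j"] by simp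
  then show ?thesis using t grid_le[of t "grid_index (Suc j) t s" "Suc j"] by (auto simp: grid_nonneg)
  qed
  have "(%j. LINT s|lb t. ?f j s) ----> (LINT s|lb t. b s v)" proof (rule integral_dominated_convergence[where w = "%_. B"])
  show "(%s. b s v) : BM (lb t)" using int_lb_cont(1)[OF c, of t] t by auto
  show "?f j : BM (lb t)" for j
  by (intro borel_measurable_sum borel_measurable_times borel_measurable_const measurable_lb borel_measurable_indicator) auto
  show "integrable (lb t) (%_. B)" by (simp add: finite_measure.integrable_const[OF fin_lb])
  show "AE s in lb t. (%j. ?f j s) ----> b s v" using lb_points[where c = 0] AE_space proof eventually_elim
  case (elim s)
  then have s: "0 < s" "s <= t" by auto
  have "(%j. b (grid (Suc j) t (grid_index (Suc j) t s)) v) ----> b s v"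
  by (rule continuous_on_tendsto_compose[OF c grid_index_tendsto[OF s]]) (use s t gi[OF s] in auto)
  moreover have "?f j s = b (grid (Suc j) t (grid_index (Suc j) t s)) v" for j by (rule grid_sum[OF _ s]) simp
  ultimately show ?case by presburger
  qed
  show "AE s in lb t. norm (?f j s) <= B" for j using lb_points[where c = 0] AE_space proof eventually_elim
  case (elim s)
  then have s: "0 < s" "s <= t" by auto
  have "?f j s = b (grid (Suc j) t (grid_index (Suc j) t s)) v" by (rule grid_sum[OF _ s]) simp
  then show ?case using B(2) gi[OF s, of j] by (metis real_norm_def)
  qed
  qed
  moreover have "(LINT s|lb t. ?f j s) = (\<Sum>i<Suc j. b (grid (Suc j) t i) v * (t / real (Suc j)))" for j proof -
  have a: "0 <= grid (Suc j) t i" "grid (Suc j) t i <= grid (Suc j) t (Suc i)" "grid (Suc j) t (Suc i) <= t" if "i < Suc j" for i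
  using t that by (auto simp: grid_nonneg intro: grid_le grid_mono)
  have "(LINT s|lb t. ?f j s) = (\<Sum>i<Suc j. LINT s|lb t. b (grid (Suc j) t i) v * indicator {grid (Suc j) t i<..grid (Suc j) t (Suc i)} s)"
  by (rule Isum) (use integral_indicator_Ioc_lb(2)[OF a] in auto)
  also have "... = (\<Sum>i<Suc j. b (grid (Suc j) t i) v * (t / real (Suc j)))" proof (rule sum.cong[OF refl])
  fix i assume "i : {..<Suc j}"
  then have i: "i < Suc j" by simp
  have "(LINT s|lb t. indicator {grid (Suc j) t i<..grid (Suc j) t (Suc i)} s) = t / real (Suc j)"
  using integral_indicator_Ioc_lb(1)[OF a[OF i]] by (simp add: grid_Suc)
  then show "(LINT s|lb t. b (grid (Suc j) t i) v * indicator {grid (Suc j) t i<..grid (Suc j) t (Suc i)} s)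
  = b (grid (Suc j) t i) v * (t / real (Suc j))" by simp
  qed
  finally show ?thesis .
  qed
  ultimately show "(%j. \<Sum>i<Suc j. b (grid (Suc j) t i) v * (t / real (Suc j))) ----> tint b t v" by (simp only: tint_def)
 qed
 moreover have "continuous_on {0..T} (%t. tint b t v)" if "v : space M" for v
  unfolding tint_def by (rule continuous_on_integral_lb[OF cp_cont[OF b that]])
 moreover have "AE v in M. ALL t:{0..T}. abs (tint b t v) <= T * w v" using w(2) AE_space proof eventually_elim
  case (elim v)
  show ?case proof
  fix t assume "t : {0..T}"
  then show "abs (tint b t v) <= T * w v" using tint_bound[where b = b and w = v and T = T and c = "w v", OF cp_cont[OF b elim(2)]] elim(1) by blast
  qed
 qed
 ultimately show ?thesis using sqi_cmult[OF w(1), of T] unfolding cp_def by blast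
qed

lemma cp_supb: "cp T f \<longleftrightarrow> (ALL t:{0..T}. f t : BM (F t)) &
  (ALL w:space M. continuous_on {0..T} (%t. f t w)) & (EX C. supb T f C)" unfolding cp_def supb_def by auto

lemma supb_le: "supb T X C ==> C <= C' ==> supb T X C'" unfolding supb_def using order_trans by blast

lemma supb_cong: "supb T X C ==> (!!t w. t : {0..T} ==> w : space M ==> X t w = Y t w) ==> supb T Y C"
 unfolding supb_def by (elim exE conjE) (auto intro!: exI elim!: AE_mp intro: AE_I2)

lemma supb_add:
 assumes X: "supb T X a" and Y: "supb T Y b" shows "supb T (%t u. X t u + Y t u) (2 * a + 2 * b)"
proof -
 obtain v where v: "sqi M v" "AE u in M. ALL t:{0..T}. abs (X t u) <= v u" "EE (%u. (v u)^2) <= a" using X unfolding supb_def by (elim exE conjE)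
 obtain w where w: "sqi M w" "AE u in M. ALL t:{0..T}. abs (Y t u) <= w u" "EE (%u. (w u)^2) <= b" using Y unfolding supb_def by (elim exE conjE)
 note i = sqi_integrable[OF v(1)] sqi_integrable[OF w(1)]
 have "AE u in M. ALL t:{0..T}. abs (X t u + Y t u) <= v u + w u" using v(2) w(2)
  by eventually_elim (use abs_triangle_ineq add_mono order_trans in blast)
 moreover have "EE (%u. (v u + w u)^2) <= EE (%u. 2 * (v u)^2 + 2 * (w u)^2)"
  using i sqi_integrable[OF sqi_add[OF v(1) w(1)]] by (intro integral_mono square_add_le) auto
 then have "EE (%u. (v u + w u)^2) <= 2 * a + 2 * b" using i v(3) w(3) by simp
 ultimately show ?thesis unfolding supb_def using sqi_add[OF v(1) w(1)] by (intro exI[of _ "%u. v u + w u"] conjI)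
qed

lemma supb_expectation:
 assumes X: "supb T X C" and t: "t : {0..T}" and m: "X t : BM M" shows "EE (%v. (X t v)^2) <= C"
proof -
 obtain w where w: "sqi M w" "AE v in M. ALL t:{0..T}. abs (X t v) <= w v" "EE (%v. (w v)^2) <= C" using X unfolding supb_def by (elim exE conjE)
 have le: "AE v in M. abs (X t v) <= abs (w v)" using w(2) by eventually_elim (use t abs_ge_self order_trans in blast)
 have "EE (%v. (X t v)^2) <= EE (%v. (w v)^2)" by (rule integral_mono_AE[OF sqi_integrable[OF sqi_bound[OF w(1) m le]] sqi_integrable[OF w(1)]])
  (use le in "eventually_elim, simp add: abs_le_square_iff")
 then show ?thesis using w(3) by simp
qed

lemma supb_Q:
 assumes X: "cp T X" "supb T X C" and T: "0 <= T" shows "(LINT p|Q T. (uc X p)^2) <= T * C"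
proof -
 have i: "integrable (Q T) (%p. (uc X p)^2)" by (rule sqi_integrable[OF sqp_sqi[OF cp_sqp[OF X(1)] order.refl]])
 have "(LINT p|Q T. (uc X p)^2) = (LINT s|lb T. EE (%w. (X s w)^2))" using integral_Q_fst(1)[OF i] by simp
 also have "... <= (LINT s|lb T. C)"
  by (rule integral_mono[OF integral_Q_fst(3)[OF i, simplified] finite_measure.integrable_const[OF fin_lb]])
  (use supb_expectation[OF X(2)] measurable_F_M cp_F[OF X(1)] in auto)
 finally show ?thesis using T by (simp add: measure_lb)
qed

text \<open>Weighted by 2^j the squared majorants still have summable expectations, since 2^j C/4^j
  is summable. Hence one random variable r bounds the successive differences by r q^j outside a null
  set, and the series converges uniformly in time.\<close>

lemma supb_complete:
 assumes y: "!!j. cp T (y j)" and d: "!!j. supb T (%t v. y (Suc j) t v - y j t v) (C / 4 ^ j)"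
 obtains Y C' where "cp T Y" "!!j. supb T (%t v. Y t v - y j t v) (C' * (1/2) ^ j)"
proof -
 \<comment> \<open>q^j = 1 / sqrt (2^j) is what remains after dividing by the weight 2^j and taking
   roots.\<close>
 define q :: real where "q = sqrt (1/2)"
 have q: "0 < q" "q < 1" "q^2 = 1/2" by (auto simp: q_def)
 have "EX w. ALL j. sqi M (w j) & (AE v in M. ALL t:{0..T}. abs (y (Suc j) t v - y j t v) <= w j v) & EE (%v. (w j v)^2) <= C / 4 ^ j"
  using d unfolding supb_def by (intro choice allI)
 then obtain w where w: "sqi M (w j)" "AE v in M. ALL t:{0..T}. abs (y (Suc j) t v - y j t v) <= w j v" "EE (%v. (w j v)^2) <= C / 4 ^ j" for j by blast
 have "0 <= EE (%v. (w 0 v)^2)" by simp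
 then have C: "0 <= C" using w(3)[of 0] by (simp del: Bochner_Integration.integral_nonneg)
 define R where "R v = (\<Sum>j. ennreal ((sqrt (2 ^ j) * w j v)^2))" for v
 have ws: "sqi M (%v. sqrt (2 ^ j) * w j v)" for j by (rule sqi_cmult[OF w(1)])
 note wm = measurable_compose[OF borel_measurable_power[OF sqi_measurable[OF ws]] measurable_ennreal]
 have Rm: "R : BM M" unfolding R_def[abs_def] using wm by measurable
 have "(NI M (%v. R v)) = (\<Sum>j. ennreal (EE (%v. (sqrt (2 ^ j) * w j v)^2)))"
  unfolding R_def sqi_nn_integral[OF ws, symmetric] using wm by (intro nn_integral_suminf)
 also have "... <= (\<Sum>j. ennreal (C * (1/2) ^ j))" proof (intro suminf_le ennreal_leI)
  fix j
  have "2 ^ j * EE (%v. (w j v)^2) <= 2 ^ j * (C / 4 ^ j)" using w(3) by (intro mult_left_mono) auto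
  also have "... = C * (1/2) ^ j" by (simp add: power_divide field_simps flip: power_mult_distrib)
  finally show "EE (%v. (sqrt (2 ^ j) * w j v)^2) <= C * (1/2) ^ j" by (simp add: power_mult_distrib)
 qed auto
 also have "... = ennreal (2 * C)" proof -
  have "(%j. C * (1/2) ^ j) sums (C * 2)" using geometric_sums[of "1/2::real"] by (intro sums_mult) simp
  then show ?thesis using C by (simp add: suminf_ennreal2 sums_iff mult.commute)
 qed
 finally have "(NI M (%v. R v)) <= ennreal (2 * C)" .
 note sq = sqrt_enn2real_sqi[OF Rm this mult_nonneg_nonneg[OF zero_le_numeral C]]
 define r where "r v = sqrt (enn2real (R v))" for v
 define G where "G = {v. ALL j. ALL t:{0..T}. abs (y (Suc j) t v - y j t v) <= r v * q ^ j}"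
 have "AE v in M. ALL j. ALL t:{0..T}. abs (y (Suc j) t v - y j t v) <= w j v" using w(2) by (simp add: AE_all_countable)
 then have G: "AE v in M. v : G" using sq(1) proof eventually_elim
  case (elim v)
  have "w j v <= r v * q ^ j" for j proof -
  have "ennreal ((sqrt (2 ^ j) * w j v)^2) <= R v"
  unfolding R_def using sum_le_suminf[OF summableI, of "{j}" "%j. ennreal ((sqrt (2 ^ j) * w j v)^2)"]
  by (simp only: sum.empty sum.insert finite.emptyI finite.insertI empty_iff not_False_eq_True add_0_right zero_le)
  then have "(sqrt (2 ^ j) * w j v)^2 <= enn2real (R v)" using elim(2) by (rule le_enn2real)
  then have "sqrt (2 ^ j) * w j v <= r v" unfolding r_def by (rule real_le_rsqrt)
  then have "w j v <= r v / sqrt (2 ^ j)" by (simp add: field_simps)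
  then show ?thesis by (simp add: q_def real_sqrt_power real_sqrt_divide power_divide)
  qed
  then show ?case unfolding G_def mem_Collect_eq by (intro allI ballI order_trans[OF elim(1)[rule_format]])
 qed
 have r0: "0 <= r v" for v by (simp add: r_def)
 define S where "S v t = (\<Sum>i. y (Suc i) t v - y i t v)" for v t
 \<comment> \<open>Off the good set the limit is set to 0, which keeps every path continuous;
   adaptedness survives because the filtration contains the null sets.\<close>
 define Y where "Y t v = (if v : G then y 0 t v + S v t else 0)" for t v
 have ul: "uniform_limit {0..T} (%n t. \<Sum>i<n. y (Suc i) t v - y i t v) (S v) sequentially" if "v : G" for v
  unfolding S_def[abs_def] by (rule Weierstrass_m_test[of _ _ "%i. r v * q ^ i"]) (use that q in "auto simp: G_def intro!: summable_mult summable_geometric")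
 have lim: "(%n. y n t v) ----> Y t v" if v: "v : G" and t: "t : {0..T}" for t v proof -
  have "(%n. y n t v - y 0 t v) ----> S v t" using tendsto_uniform_limitI[OF ul[OF v] t] unfolding sum_lessThan_telescope[of "%i. y i t v"] .
  from tendsto_add[OF this tendsto_const[of "y 0 t v"]] show ?thesis using v by (simp add: Y_def add.commute)
 qed
 have sup: "supb T (%t v. Y t v - y j t v) ((1 / (1 - q))^2 * (2 * C) * (1/2) ^ j)" for j unfolding supb_def
 proof (intro exI[of _ "%v. 1 / (1 - q) * q ^ j * r v"] conjI)
  show "sqi M (%v. 1 / (1 - q) * q ^ j * r v)" using sq(2) C by (intro sqi_cmult) (simp add: r_def[abs_def])
  have "EE (%v. (1 / (1 - q) * q ^ j * r v)^2) = (1 / (1 - q))^2 * (1/2) ^ j * EE (%v. (r v)^2)"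
  by (simp add: power_mult_distrib q(3) power_mult[symmetric] mult.commute[of j] power_divide) (simp add: power_mult q(3) power_divide)
  also have "... <= (1 / (1 - q))^2 * (1/2) ^ j * (2 * C)" using sq(3) C by (intro mult_left_mono) (auto simp: r_def)
  finally show "EE (%v. (1 / (1 - q) * q ^ j * r v)^2) <= (1 / (1 - q))^2 * (2 * C) * (1/2) ^ j" by (simp only: mult_ac)
  show "AE v in M. ALL t:{0..T}. abs (Y t v - y j t v) <= 1 / (1 - q) * q ^ j * r v" using G proof (eventually_elim, intro ballI)
  fix v t assume v: "v : G" and t: "t : {0..T}"
  have "abs (y n t v - y j t v) <= 1 / (1 - q) * q ^ j * r v" if n: "j <= n" for n proof -
  have "y n t v - y j t v = (\<Sum>i=j..<n. y (Suc i) t v - y i t v)" using sum_Suc_diff'[OF n, of "%i. y i t v"] by simp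
  also have "abs (...) <= (\<Sum>i=j..<n. r v * q ^ i)" by (rule order_trans[OF sum_abs sum_mono]) (use v t in "simp add: G_def")
  also have "... = (\<Sum>i<n - j. r v * q ^ j * q ^ i)"
  using n by (simp add: sum.atLeastLessThan_shift_0[of _ j n] power_add mult.assoc atLeast0LessThan)
  also have "... <= (\<Sum>i. r v * q ^ j * q ^ i)" using q r0 by (intro sum_le_suminf summable_mult summable_geometric) auto
  also have "... = 1 / (1 - q) * q ^ j * r v" using q by (simp add: suminf_mult suminf_geometric summable_geometric)
  finally show ?thesis .
  qed
  moreover have "(%n. abs (y n t v - y j t v)) ----> abs (Y t v - y j t v)" by (intro tendsto_intros lim v t)
  ultimately show "abs (Y t v - y j t v) <= 1 / (1 - q) * q ^ j * r v" by (intro LIMSEQ_le_const2) auto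
  qed
 qed
 have "cp T Y" unfolding cp_supb proof (intro conjI ballI)
  fix t assume t: "t : {0..T}"
  show "Y t : BM (F t)" proof (rule borel_measurable_LIMSEQ_real)
  show "(%v. if v : G then y n t v else 0) : BM (F t)" for n by (rule measurable_F_AE[OF cp_F[OF y t, of n]]) (use G in "eventually_elim, simp")
  show "(%n. if v : G then y n t v else 0) ----> Y t v" for v using lim[OF _ t, of v] by (cases "v : G") (auto simp: Y_def)
  qed
 next
  fix v assume v: "v : space M"
  show "continuous_on {0..T} (%t. Y t v)" proof (cases "v : G")
  case True
  have "continuous_on {0..T} (S v)"
  by (rule uniform_limit_theorem[OF _ ul[OF True]]) (auto intro!: always_eventually continuous_intros cp_cont[OF y] v)
  then show ?thesis using True cp_cont[OF y v, of 0] by (auto simp: Y_def intro!: continuous_intros)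
  qed (simp add: Y_def)
 next
  obtain C0 where "supb T (y 0) C0" using y[of 0] unfolding cp_supb by blast
  from supb_add[OF this sup[of 0]] show "EX C. supb T Y C" by (simp add: exI)
 qed
 then show ?thesis using sup that by blast
qed

text \<open>Brownian paths are continuous only almost surely; this version is continuous along every
  path and remains adapted.\<close>

definition Wc :: "real => 'a => real" where
 "Wc t w = (if continuous_on {0..} (%t. W t w) then W t w else 0)"

lemma Wc_AE: "AE w in M. ALL t. W t w = Wc t w"
proof -
 have "AE w in M. continuous_on {0..} (%t. W t w)" using bm by (simp add: brownian_motion_def)
 then show ?thesis by eventually_elim (simp add: Wc_def)
qed

lemma Wc_F: "0 <= s ==> s <= t ==> Wc s : BM (F t)" by (rule measurable_F_AE[OF W_measurable_F]) (use Wc_AE in auto)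

lemma Wc_cont: "continuous_on {0..} (%t. Wc t w)" by (cases "continuous_on {0..} (%t. W t w)") (simp_all add: Wc_def)

text \<open>A step integral as a process in t: stopping both end points at t makes its paths
  continuous.\<close>

lemma ito_step_Wc:
 assumes a: "0 <= a" "a <= b" "x : BM (F a)" "sqi M x" and t: "0 <= t"
 shows "ito t (%s w. x w * indicator {a<..b} s) (%w. x w * (Wc (min b t) w - Wc (min a t) w))"
proof -
 have m: "(%p. x (snd p) * indicator {a<..b} (fst p)) : BM (Q t)"
  using a by (intro borel_measurable_times measurable_Q_snd measurable_F_M[OF a(3)] indicator_fst_Q) auto
 have Wm: "(%w. x w * (Wc (min b t) w - Wc (min a t) w)) : BM M"
  using a t by (intro borel_measurable_times measurable_F_M[OF a(3)] borel_measurable_diff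
  measurable_F_M[OF Wc_F[of _ "max b t"]]) auto
 show ?thesis proof (cases "a < t")
  case True
  have "ito t (%s w. x w * indicator {a<..min b t} s) (%w. x w * (W (min b t) w - W a w))" using True a by (intro ito.step) auto
  then show ?thesis proof (rule ito_cong_AE[OF _ m Wm])
  show "AE p in Q t. x (snd p) * indicator {a<..min b t} (fst p) = x (snd p) * indicator {a<..b} (fst p)"
  using AE_space by eventually_elim (auto simp: space_Q indicator_def)
  show "AE w in M. x w * (W (min b t) w - W a w) = x w * (Wc (min b t) w - Wc (min a t) w)"
  using Wc_AE by eventually_elim (use True in "simp add: min_def")
  qed
 next
  case False
  then have "min b t = t" "min a t = t" using a by auto
  then have z: "Wc (min b t) = Wc (min a t)" by simp
  show ?thesis proof (rule ito_cong_AE[OF ito_zero[OF t] m Wm])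
  show "AE p in Q t. 0 = x (snd p) * indicator {a<..b} (fst p)" using AE_space by eventually_elim (use False in "auto simp: space_Q indicator_def")
  qed (simp add: z)
 qed
qed

lemma tint_square_le:
 assumes b: "cp T b" and w: "w : space M" and t: "t : {0..T}" shows "(tint b t w)^2 <= T * (LINT r|lb T. (b r w)^2)"
proof -
 have t': "t <= T" "0 <= t" "0 <= T" using t by auto
 have cb: "continuous_on {0..T} (%r. b r w)" by (rule cp_cont[OF b w])
 have cb2: "continuous_on {0..T} (%r. (b r w)^2)" by (intro continuous_intros cb)
 note i = int_lb_cont(1)[OF cb2 t'(1)] int_lb_cont(1)[OF cb2 order_refl]
 have "sqi (lb t) (%r. b r w)" using int_lb_cont(1)[OF cb t'(1)] i(1) by (simp add: sqi_def)
 from Cauchy_Schwarz_sqi[OF sqi_const[OF fin_lb, of _ 1] this]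
 have "(tint b t w)^2 <= t * (LINT r|lb t. (b r w)^2)" using t' by (simp add: tint_def measure_lb)
 also have "... <= T * (LINT r|lb T. (b r w)^2)" proof (rule mult_mono)
  show "(LINT r|lb t. (b r w)^2) <= (LINT r|lb T. (b r w)^2)" unfolding lb_sub(1)[OF t'(1)]
  using i unfolding lb_sub(2)[OF t'(1)] by (intro integral_mono) (auto simp: indicator_def)
 qed (use t' in auto)
 finally show ?thesis .
qed

lemma supb_tint:
 assumes b: "cp T b" and T: "0 <= T" shows "supb T (tint b) (T * (LINT p|Q T. (uc b p)^2))"
proof -
 let ?J = "%w. T * (LINT r|lb T. (b r w)^2)"
 have i: "integrable (Q T) (%p. (uc b p)^2)" by (rule sqi_integrable[OF sqp_sqi[OF cp_sqp[OF b] order.refl]])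
 have J: "0 <= ?J w" for w using T by simp
 have Ji: "integrable M ?J" "EE ?J = T * (LINT p|Q T. (uc b p)^2)" using integral_Q_snd(1,3)[OF i] by simp_all
 show ?thesis unfolding supb_def proof (intro exI[of _ "%w. sqrt (?J w)"] conjI)
  show "sqi M (%w. sqrt (?J w))" unfolding sqi_def real_sqrt_pow2[OF J] using Ji(1) by auto
  show "EE (%w. (sqrt (?J w))^2) <= T * (LINT p|Q T. (uc b p)^2)" unfolding real_sqrt_pow2[OF J] Ji(2) by simp
  show "AE w in M. ALL t:{0..T}. abs (tint b t w) <= sqrt (?J w)"
  using AE_space by eventually_elim (intro ballI real_le_rsqrt, simp add: tint_square_le[OF b])
 qed
qed

lemma L2lim_geometric:
 assumes fs: "!!j. sqi N (fs j)" and f: "sqi N f" and le: "!!j. (LINT x|N. (fs j x - f x)^2) <= C * q ^ j" and q: "0 <= q" "q < 1"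
 shows "L2lim N fs f"
proof -
 have "(%j. LINT x|N. (fs j x - f x)^2) ----> 0" proof (rule tendsto_sandwich[OF _ _ tendsto_const])
  show "(%j. C * q ^ j) ----> 0" using q by (intro tendsto_mult_right_zero LIMSEQ_power_zero) simp
 qed (use le in auto)
 then show ?thesis using fs f by (simp add: L2lim_def)
qed

text \<open>Stopped simple integrals have continuous paths, and Doob's inequality turns mean-square
  convergence of the integrands into uniform convergence of these paths along a fast
  subsequence.\<close>

lemma cp_ito:
 assumes f: "cp T f" and T: "0 <= T" shows "EX Z. cp T Z & (ALL t:{0..T}. ito t f (Z t))"
proof -
 obtain w where w: "sqi M w" "AE v in M. ALL t:{0..T}. abs (f t v) <= w v" using f by (auto simp: cp_def)
 define x where "x n i v = max (- real n) (min (real n) (f (grid (Suc n) T i) v))" for n i v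
 define S where "S n s v = (\<Sum>i<Suc n. x n i v * indicator {grid (Suc n) T i<..grid (Suc n) T (Suc i)} s)" for n s v
 define I where "I n t v = (\<Sum>i<Suc n. x n i v * (Wc (min (grid (Suc n) T (Suc i)) t) v - Wc (min (grid (Suc n) T i) t) v))" for n t v
 have xF: "x n i : BM (F (grid (Suc n) T i))" if "i < Suc n" for n i proof -
  have "grid (Suc n) T i : {0..T}" using that T by (simp add: grid_nonneg grid_le)
  from cp_F[OF f this] show ?thesis unfolding x_def by (intro borel_measurable_max borel_measurable_min) auto
 qed
 have xs: "sqi M (x n i)" if "i < Suc n" for n i
  by (rule sqi_bounded[OF finite_measure_axioms measurable_F_M[OF xF[OF that]], of "real n"]) (auto simp: x_def)
 have SI: "ito t (S n) (I n t)" if t: "t : {0..T}" for n t unfolding S_def[abs_def] I_def[abs_def] using t T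
  by (intro ito_sum ito_step_Wc xF xs grid_mono grid_nonneg) auto
 have IF: "I n t : BM (F t)" if t: "t : {0..T}" for n t unfolding I_def[abs_def] proof (rule borel_measurable_sum)
  fix i assume "i : {..<Suc n}"
  then have i: "i < Suc n" by simp
  have g: "0 <= grid (Suc n) T i" "0 <= grid (Suc n) T (Suc i)" "grid (Suc n) T i <= grid (Suc n) T (Suc i)"
  using T by (auto intro: grid_nonneg grid_mono)
  show "(%v. x n i v * (Wc (min (grid (Suc n) T (Suc i)) t) v - Wc (min (grid (Suc n) T i) t) v)) : BM (F t)" proof (cases "grid (Suc n) T i <= t")
  case True
  show ?thesis using g t by (intro borel_measurable_times measurable_F_mono[OF True xF[OF i]] borel_measurable_diff Wc_F) auto
  next
  case False
  then have "min (grid (Suc n) T (Suc i)) t = t" "min (grid (Suc n) T i) t = t" using g(3) by auto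
  then show ?thesis by simp
  qed
 qed
 have Ic: "continuous_on {0..T} (%t. I n t v)" for n v unfolding I_def
  by (intro continuous_on_sum continuous_on_mult continuous_on_const continuous_on_diff
  continuous_on_compose2[OF Wc_cont] continuous_on_min continuous_on_id) (use T in "auto simp: grid_nonneg")
 have fM: "!!s. s : {0..T} ==> f s : BM M" using cp_F[OF f] measurable_F_M by blast
 have L: "L2lim (Q T) (%n p. uc (S n) p) (uc f)" unfolding S_def x_def by (rule grid_L2lim[OF T fM cp_cont[OF f] w])
 have Icp: "cp T (I n)" for n unfolding cp_supb using IF Ic doob_sup[of T "I n" "S n", OF IF SI T Ic] by blast
 define e where "e n = (LINT p|Q T. (uc (S n) p - uc f p)^2)" for n
 have e0: "e ----> 0" using L by (simp add: L2lim_def e_def[abs_def])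
 have Sq: "sqi (Q T) (uc (S n))" and fq: "sqi (Q T) (uc f)" for n using L by (auto simp: L2lim_def)
 have SS: "(LINT p|Q T. (uc (S n) p - uc (S m) p)^2) <= 2 * e n + 2 * e m" for n m proof -
  have i: "integrable (Q T) (%p. (uc (S n) p - uc f p)^2)" for n by (rule sqi_integrable[OF sqi_diff[OF Sq fq]])
  have "(LINT p|Q T. (uc (S n) p - uc (S m) p)^2)
  <= (LINT p|Q T. 2 * (uc (S n) p - uc f p)^2 + 2 * (uc (S m) p - uc f p)^2)" proof (rule integral_mono)
  show "integrable (Q T) (%p. (uc (S n) p - uc (S m) p)^2)" by (rule sqi_integrable[OF sqi_diff[OF Sq Sq]])
  show "(uc (S n) p - uc (S m) p)^2
  <= 2 * (uc (S n) p - uc f p)^2 + 2 * (uc (S m) p - uc f p)^2" for p using square_add_le[of "uc (S n) p - uc f p" "- (uc (S m) p - uc f p)"]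
  by (simp add: power2_commute[of "uc f p"])
  qed (use i in auto)
  then show ?thesis using i by (simp add: e_def)
 qed
 \<comment> \<open>The subsequence is so fast that, after the triangle inequality and Doob's factor
   4, the bound 4 / 4^j required by \<open>supb_complete\<close> remains.\<close>
 have "EX n. e n < (1/4) ^ Suc j" for j :: nat proof -
  have "\<forall>\<^sub>F n in sequentially. e n < (1/4) ^ Suc j" by (rule order_tendstoD(2)[OF e0]) simp
  then show ?thesis by (auto simp: eventually_sequentially)
 qed
 then obtain n where n: "!!j. e (n j) < (1/4) ^ Suc j" by metis
 have "supb T (%t v. I (n (Suc j)) t v - I (n j) t v) (4 / 4 ^ j)" for j proof (rule supb_le)
  show "supb T (%t v. I (n (Suc j)) t v - I (n j) t v) (4 * (LINT p|Q T. (uc (S (n (Suc j))) p - uc (S (n j)) p)^2))"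
  using T by (intro doob_sup[where s = "%s v. S (n (Suc j)) s v - S (n j) s v"])
  (auto intro!: borel_measurable_diff IF ito_diff SI continuous_on_diff Ic)
  have "(1/4::real) ^ Suc (Suc j) <= (1/4) ^ Suc j" by (intro power_decreasing) auto
  then have "(LINT p|Q T. (uc (S (n (Suc j))) p - uc (S (n j)) p)^2) <= 4 * (1/4) ^ Suc j"
  using SS[of "n (Suc j)" "n j"] n[of j] n[of "Suc j"] by linarith
  then show "4 * (LINT p|Q T. (uc (S (n (Suc j))) p - uc (S (n j)) p)^2) <= 4 / 4 ^ j" by (simp add: power_divide)
 qed
 from supb_complete[OF Icp this] obtain Z c where Z: "cp T Z" and c: "!!j. supb T (%t v. Z t v - I (n j) t v) (c * (1/2) ^ j)" by blast
 have "ito t f (Z t)" if t: "t : {0..T}" for t proof (rule ito.lim[where fs = "%j. S (n j)" and Zs = "%j. I (n j) t"])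
  show "ALL j. ito t (S (n j)) (I (n j) t)" using SI[OF t] by blast
  have tT: "t <= T" using t by simp
  show "L2lim (Q t) (%j p. uc (S (n j)) p) (uc f)" proof (rule L2lim_geometric[OF sqi_Q_mono[OF tT Sq] sqi_Q_mono[OF tT fq]])
  have "(LINT p|Q t. (uc (S (n j)) p - uc f p)^2) <= e (n j)" for j
  unfolding e_def by (intro integral_Q_mono tT sqi_integrable[OF sqi_diff[OF Sq fq]]) simp
  from order_trans[OF this less_imp_le[OF n]]
  show "(LINT p|Q t. (uc (S (n j)) p - uc f p)^2) <= 1/4 * (1/4) ^ j" for j by simp
  qed simp_all
  show "L2lim M (%j. I (n j) t) (Z t)" proof (rule L2lim_geometric[OF cp_sqi[OF Icp t] cp_sqi[OF Z t]])
  show "EE (%v. (I (n j) t v - Z t v)^2) <= c * (1/2) ^ j" for j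
  using supb_expectation[OF c t borel_measurable_diff, OF sqi_measurable[OF cp_sqi[OF Z t]] sqi_measurable[OF cp_sqi[OF Icp t]]] by (simp add: power2_commute)
  qed simp_all
 qed
 then show ?thesis using Z by blast
qed

end

section \<open>Deterministic multipliers and linear stochastic differential equations\<close>

context wiener
begin

lemma sqi_Q_det:
 assumes f: "sqi (Q T) f" and g: "continuous_on {0..T} g" shows "sqi (Q T) (%p. g (fst p) * f p)"
proof -
 obtain B where B: "0 <= B" "ALL t:{0..T}. abs (g t) <= B" using continuous_on_bounded_real[OF g] by blast
 have "g : BM (lb T)" using int_lb_cont(1)[OF g order_refl] by simp
 then have gm: "(%p. g (fst p)) : BM (Q T)" unfolding Q_def by (rule measurable_compose[OF measurable_fst])
 show ?thesis proof (rule sqi_bound[OF sqi_cmult[OF f, of B]])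
  show "(%p. g (fst p) * f p) : BM (Q T)" using gm f by (auto simp: sqi_def)
  show "AE p in Q T. abs (g (fst p) * f p) <= abs (B * f p)"
  using AE_space by eventually_elim (use B in "auto simp: space_Q abs_mult intro!: mult_right_mono")
 qed
qed

lemma integrable_Q_det:
 fixes f :: "real \<times> 'a => real"
 assumes f: "integrable (Q T) f" and g: "continuous_on {0..T} g" shows "integrable (Q T) (%p. g (fst p) * f p)"
proof -
 obtain B where B: "0 <= B" "ALL t:{0..T}. abs (g t) <= B" using continuous_on_bounded_real[OF g] by blast
 have "g : BM (lb T)" using int_lb_cont(1)[OF g order_refl] by simp
 then have gm: "(%p. g (fst p)) : BM (Q T)" unfolding Q_def by (rule measurable_compose[OF measurable_fst])
 show ?thesis proof (rule ibound[of _ "%p. B * f p"])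
  show "AE p in Q T. norm (g (fst p) * f p) <= norm (B * f p)"
  using AE_space by eventually_elim (use B in "auto simp: space_Q abs_mult intro!: mult_right_mono")
 qed (use gm f in auto)
qed

lemma sqp_det: "sqp T f ==> continuous_on {0..T} g ==> sqp T (%t w. g t * f t w)" using sqi_Q_det[of T "%p. uc f p" g] by (auto simp: sqp_def)

text \<open>E[X Y] is an indefinite integral of the expected integrand in the product formula, so
  the factor g enters by integration by parts for deterministic functions.\<close>

lemma ip_product_det:
 assumes X: "ip T X b s" and Y: "ip T Y c v" and t: "t : {0..T}"
  and g: "!!t. t : {0..T} ==> (g has_real_derivative g' t) (at t within {0..T})" "continuous_on {0..T} g'"
 shows "g t * EE (%w. X t w * Y t w) = g 0 * EE (%w. X 0 w * Y 0 w) +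
  (LINT p|Q t. g' (fst p) * (uc X p * uc Y p) +
  g (fst p) * (uc X p * uc c p + uc Y p * uc b p
  + uc s p * uc v p))"
  "integrable (Q t) (%p. g' (fst p) * (uc X p * uc Y p) +
  g (fst p) * (uc X p * uc c p + uc Y p * uc b p
  + uc s p * uc v p))"
proof -
 let ?XY = "%p. uc X p * uc Y p"
 let ?\<Psi> = "%p. uc X p * uc c p + uc Y p * uc b p
  + uc s p * uc v p"
 have gc: "continuous_on {0..T} g" using g(1) by (meson DERIV_continuous continuous_on_eq_continuous_within)
 have tT: "t <= T" "0 <= t" using t by auto
 have gct: "continuous_on {0..t} g" "continuous_on {0..t} g'" using gc g(2) tT by (auto elim: continuous_on_subset)
 define f where "f r = EE (%w. X r w * Y r w)" for r
 define \<psi> where "\<psi> r = EE (%w. ?\<Psi> (r, w))" for r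
 note x = ip_parts[OF X t] and y = ip_parts[OF Y t]
 have i\<Psi>: "integrable (Q t) ?\<Psi>" by (intro iadd sqi_mult x y)
 have iXY: "integrable (Q t) ?XY" by (intro sqi_mult x y)
 show int: "integrable (Q t) (%p. g' (fst p) * ?XY p + g (fst p) * ?\<Psi> p)" by (intro iadd integrable_Q_det i\<Psi> iXY gct)
 have i\<psi>: "integrable (lb t) \<psi>" using integral_Q_fst(3)[OF i\<Psi>] by (simp add: \<psi>_def[abs_def])
 have f: "f r = f 0 + (LINT u|lb r. \<psi> u)" if r: "r : {0..t}" for r proof -
  have r': "r : {0..T}" using r tT by auto
  have "integrable (Q r) ?\<Psi>" using integrable_Q_mono[OF _ i\<Psi>, of r] r by simp
  from integral_Q_fst(1)[OF this] ip_product[OF X Y r'] show ?thesis by (simp add: f_def \<psi>_def)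
 qed
 have gg: "g r = g 0 + (LINT u|lb r. g' u)" if "r : {0..t}" for r using ftc_lb[OF g, of r] that tT by auto
 have ig': "integrable (lb t) g'" by (rule int_lb_cont(1)[OF g(2) tT(1)])
 have k: "(LINT r|lb t. g' r) * (LINT r|lb t. \<psi> r) = (LINT r|lb t. g' r * (LINT u|lb r. \<psi> u) + \<psi> r * (LINT u|lb r. g' u))"
  by (rule integral_times_lb(1)[OF ig' i\<psi>])
 note i2 = integral_times_lb(2)[OF ig' i\<psi>] integral_times_lb(2)[OF i\<psi> ig']
 have tt: "t : {0..t}" using tT by simp
 have "g t * f t = g 0 * f 0 + g 0 * (LINT r|lb t. \<psi> r) + f 0 * (LINT r|lb t. g' r) + (LINT r|lb t. g' r) * (LINT r|lb t. \<psi> r)"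
  unfolding gg[OF tt] f[OF tt] by (simp add: algebra_simps)
 also have "... = g 0 * f 0 + (LINT r|lb t. g 0 * \<psi> r + f 0 * g' r + (g' r * (LINT u|lb r. \<psi> u) + \<psi> r * (LINT u|lb r. g' u)))"
  unfolding k using i\<psi> ig' i2 by simp
 also have "(LINT r|lb t. g 0 * \<psi> r + f 0 * g' r + (g' r * (LINT u|lb r. \<psi> u) + \<psi> r * (LINT u|lb r. g' u)))
  = (LINT r|lb t. g' r * f r + g r * \<psi> r)" proof (rule icong[OF refl])
  fix r assume "r : space (lb t)"
  then have r: "r : {0..t}" by simp
  show "g 0 * \<psi> r + f 0 * g' r + (g' r * (LINT u|lb r. \<psi> u) + \<psi> r * (LINT u|lb r. g' u)) = g' r * f r + g r * \<psi> r"
  unfolding gg[OF r] f[OF r] by (simp add: algebra_simps)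
 qed
 also have "... = (LINT p|Q t. g' (fst p) * ?XY p + g (fst p) * ?\<Psi> p)" unfolding integral_Q_fst(1)[OF int] proof (rule integral_cong_AE)
  have "g' : BM (lb t)" "g : BM (lb t)" using ig' int_lb_cont(1)[OF gc tT(1)] by auto
  moreover have "f : BM (lb t)" using integral_Q_fst(3)[OF iXY] by (simp add: f_def[abs_def])
  ultimately show "(%r. g' r * f r + g r * \<psi> r) : BM (lb t)" using i\<psi> by auto
  show "(%s. LINT w|M. g' (fst (s, w)) * ?XY (s, w) + g (fst (s, w)) * ?\<Psi> (s, w)) : BM (lb t)" using integral_Q_fst(3)[OF int] by simp
  show "AE r in lb t. g' r * f r + g r * \<psi> r = (LINT w|M. g' (fst (r, w)) * ?XY (r, w) + g (fst (r, w)) * ?\<Psi> (r, w))"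
  using integral_Q_fst(2)[OF iXY] integral_Q_fst(2)[OF i\<Psi>] proof eventually_elim
  case (elim r)
  then show ?case unfolding f_def \<psi>_def by (subst Iadd) auto
  qed
 qed
 finally show "g t * EE (%w. X t w * Y t w) = g 0 * EE (%w. X 0 w * Y 0 w) +
  (LINT p|Q t. g' (fst p) * ?XY p + g (fst p) * ?\<Psi> p)" by (simp add: f_def)
qed

lemma lb_0: "(LINT r|lb 0. f r) = (0::real)"
proof (rule integral_eq_zero_AE)
 show "AE r in lb 0. f r = 0" using lb_points[where c = 0] AE_space by eventually_elim auto
qed

lemma tint_0 [simp]: "tint b 0 w = 0" unfolding tint_def by (rule lb_0)

lemma ip_exists:
 assumes T: "0 <= T" and b: "sqp T b" and s: "cp T s" and y: "y : BM (F 0)" "sqi M y"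
 obtains Z where "cp T Z" "!!t. t : {0..T} ==> ito t s (Z t)" "AE w in M. Z 0 w = 0"
  "ip T (%t w. y w + tint b t w + Z t w) b s"
proof -
 obtain Z where Z: "cp T Z" "!!t. t : {0..T} ==> ito t s (Z t)" using cp_ito[OF s T] by blast
 have z: "AE w in M. Z 0 w = 0" using ito_zero_time[OF Z(2)[of 0]] T by simp
 let ?Y = "%t w. y w + tint b t w + Z t w"
 have bq: "sqi (Q t) (uc b)" if "t <= T" for t by (rule sqp_sqi[OF b that])
 have jb: "jm T (tint b)" by (rule tint_jm[OF sqp_jm[OF b]])
 have jY: "jm T ?Y" using jb cp_jm[OF Z(1)] measurable_Q_snd[OF sqi_measurable[OF y(2)]] by (auto simp: jm_def)
 have Y0: "?Y 0 : BM (F 0)" using y(1) cp_F[OF Z(1)] T by simp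
 have Y0s: "sqi M (?Y 0)" using sqi_add[OF y(2) cp_sqi[OF Z(1)]] T by simp
 have it: "ito t s (%w. ?Y t w - ?Y 0 w - tint b t w)" if t: "t : {0..T}" for t proof (rule ito_cong_AE[OF Z(2)[OF t]])
  show "(uc s) : BM (Q t)" using ito_sqi(1)[OF Z(2)[OF t]] by (simp add: sqi_def)
  have "?Y t : BM M" by (rule jm_section[OF jY t])
  then show "(%w. ?Y t w - ?Y 0 w - tint b t w) : BM M"
  using t by (intro borel_measurable_diff sqi_measurable[OF tint_sqi(1)[OF bq]] sqi_measurable[OF Y0s]) auto
  show "AE w in M. Z t w = ?Y t w - ?Y 0 w - tint b t w" using z by eventually_elim simp
 qed simp
 have "ip T ?Y b s" unfolding ip_def using b cp_sqp[OF s] jY Y0 Y0s it by blast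
 with Z z show ?thesis by (rule that)
qed

text \<open>Some process Y has the desired differential and initial value. Expanding E (Y - g X)^2
  by the product formulas, all integrands cancel identically, so g X is a version of Y. This takes
  the place of a pathwise product rule.\<close>

lemma ip_det_mult:
 assumes T: "0 <= T" and X: "ip T X b s" and Xc: "jm T X" "sqp T X" and sc: "cp T s"
  and g: "!!t. t : {0..T} ==> (g has_real_derivative g' t) (at t within {0..T})" "continuous_on {0..T} g'"
 shows "ip T (%t w. g t * X t w) (%t w. g' t * X t w + g t * b t w) (%t w. g t * s t w)"
proof -
 have gc: "continuous_on {0..T} g" using g(1) by (meson DERIV_continuous continuous_on_eq_continuous_within)
 let ?b = "%t w. g' t * X t w + g t * b t w" and ?s = "%t w. g t * s t w"
 have bs: "sqp T ?b" using X by (intro sqp_add sqp_det g(2) gc Xc(2)) (simp add: ip_def)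
 have ss: "cp T ?s" by (rule cp_det[OF sc gc])
 have X0: "X 0 : BM (F 0)" "sqi M (X 0)" using X by (auto simp: ip_def)
 obtain Z where Z: "cp T Z" "AE w in M. Z 0 w = 0"
  "ip T (%t w. g 0 * X 0 w + tint ?b t w + Z t w) ?b ?s" by (rule ip_exists[OF T bs ss, of "%w. g 0 * X 0 w"]) (use X0 in "auto intro: sqi_cmult")
 define Y where "Y t w = g 0 * X 0 w + tint ?b t w + Z t w" for t w
 have Y: "ip T Y ?b ?s" using Z(3) unfolding Y_def[abs_def] .
 have Y0: "AE w in M. Y 0 w = g 0 * X 0 w" using Z(2) by eventually_elim (simp add: Y_def)
 have g2: "((%t. (g t)^2) has_real_derivative 2 * g t * g' t) (at t within {0..T})" if "t : {0..T}" for t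
  using g(1)[OF that] by (auto intro!: derivative_eq_intros simp: power2_eq_square)
 have g2c: "continuous_on {0..T} (%t. 2 * g t * g' t)" by (intro continuous_intros gc g(2))
 have eq: "AE w in M. Y t w = g t * X t w" if t: "t : {0..T}" for t proof -
  note x = ip_parts[OF X t] and y = ip_parts[OF Y t]
  have tt: "T : {0..T}" "0 : {0..T}" using T by auto
  have d: "sqi M (%w. Y t w - g t * X t w)" by (intro sqi_diff sqi_cmult y x)
  let ?YY = "%p. uc Y p * uc ?b p + uc Y p * uc ?b p + uc ?s p * uc ?s p"
  let ?XY = "%p. g' (fst p) * (uc X p * uc Y p) +
  g (fst p) * (uc X p * uc ?b p + uc Y p * uc b p
  + uc s p * uc ?s p)"
  let ?XX = "%p. 2 * g (fst p) * g' (fst p) * (uc X p * uc X p) +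
  (g (fst p))^2 * (uc X p * uc b p + uc X p * uc b p
  + uc s p * uc s p)"
  have iYY: "integrable (Q t) ?YY" by (intro iadd sqi_mult y)
  note PY = ip_product[OF Y Y t] and PXY = ip_product_det[OF X Y t g] and PXX = ip_product_det[OF X X t g2 g2c]
  have "EE (%w. (Y t w - g t * X t w)^2)
  = EE (%w. Y t w * Y t w - 2 * g t * (X t w * Y t w) + (g t)^2 * (X t w * X t w))" by (intro icong) (auto simp: power2_eq_square algebra_simps)
  also have "... = EE (%w. Y t w * Y t w) - 2 * (g t * EE (%w. X t w * Y t w)) + (g t)^2 * EE (%w. X t w * X t w)"
  using sqi_mult[OF x(4) x(4)] sqi_mult[OF x(4) y(4)] sqi_mult[OF y(4) y(4)] by simp
  also have "... = (EE (%w. Y 0 w * Y 0 w) - 2 * (g 0 * EE (%w. X 0 w * Y 0 w)) + (g 0)^2 * EE (%w. X 0 w * X 0 w))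
  + ((LINT p|Q t. ?YY p) - 2 * (LINT p|Q t. ?XY p) + (LINT p|Q t. ?XX p))" using PY PXY(1) PXX(1) by linarith
  also have "(LINT p|Q t. ?YY p) - 2 * (LINT p|Q t. ?XY p) + (LINT p|Q t. ?XX p) = (LINT p|Q t. ?YY p - 2 * ?XY p + ?XX p)" using iYY PXY(2) PXX(2)
  by (simp only: Iadd Bochner_Integration.integral_diff iadd
  Bochner_Integration.integrable_diff integrable_mult_right integral_mult_right_zero)
  also have "(%p. ?YY p - 2 * ?XY p + ?XX p) = (%p. 0)" by (rule ext) (simp add: power2_eq_square algebra_simps)
  also have "EE (%w. Y 0 w * Y 0 w) - 2 * (g 0 * EE (%w. X 0 w * Y 0 w)) + (g 0)^2 * EE (%w. X 0 w * X 0 w) = 0" proof -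
  have m: "Y 0 : BM M" "X 0 : BM M" using jm_section[OF _ tt(2)] X Y by (auto simp: ip_def)
  have "EE (%w. Y 0 w * Y 0 w) = EE (%w. (g 0)^2 * (X 0 w * X 0 w))" by (rule integral_cong_AE) (use m Y0 in "auto simp: power2_eq_square")
  moreover have "EE (%w. X 0 w * Y 0 w) = EE (%w. g 0 * (X 0 w * X 0 w))" by (rule integral_cong_AE) (use m Y0 in auto)
  ultimately show ?thesis by (simp add: power2_eq_square)
  qed
  finally have "EE (%w. (Y t w - g t * X t w)^2) <= 0" by simp
  from sqi_zero_AE[OF d this] show ?thesis by simp
 qed
 have "jm T (%t w. g t * X t w)" using sqp_jm[OF sqp_det[OF Xc(2) gc]] .
 then show ?thesis using eq cp_sqp[OF ss] by (intro ip_cong[OF Y T bs]) auto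
qed

end

section \<open>Picard iteration for linear stochastic differential equations\<close>

lemma continuous_matrix_bounded:
 fixes a :: "real => nat => nat => real"
 assumes "!!l j. l < k ==> j < k ==> continuous_on {0..T} (%t. a t l j)"
 shows "EX K>=0. ALL t l j. t : {0..T} --> l < k --> j < k --> abs (a t l j) <= K"
proof -
 let ?g = "%t. \<Sum>p\<in>{..<k}\<times>{..<k}. abs (uc (a t) p)"
 have "continuous_on {0..T} ?g" by (intro continuous_intros assms) auto
 then obtain B where B: "0 <= B" "ALL t:{0..T}. abs (?g t) <= B" using continuous_on_bounded_real by blast
 have "abs (a t l j) <= B" if "t : {0..T}" "l < k" "j < k" for t l j proof -
  have "abs (a t l j) <= ?g t" using member_le_sum[of "(l, j)" "{..<k}\<times>{..<k}" "%p. abs (uc (a t) p)"] that by auto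
  also have "... <= B" using B(2) that(1) abs_ge_self order_trans by blast
  finally show ?thesis .
 qed
 then show ?thesis using B(1) by blast
qed

context wiener
begin

definition lin :: "nat => (real => nat => nat => real) => (nat => real => 'a => real) => nat => real => 'a => real" where
 "lin k a x l t w = (\<Sum>j<k. a t l j * x j t w)"

lemma cp_lin:
 assumes "!!j. j < k ==> continuous_on {0..T} (%t. a t l j)" "!!j. j < k ==> cp T (x j)" shows "cp T (lin k a x l)"
 unfolding lin_def[abs_def] by (intro cp_sum cp_det) (use assms in auto)

lemma lin_diff: "lin k a x l t w - lin k a y l t w = lin k a (%j t w. x j t w - y j t w) l t w"
 by (simp add: lin_def sum_subtractf right_diff_distrib)

lemma lin_square_le:
 assumes "!!l j. l < k ==> j < k ==> abs (a t l j) <= K" "l < k" shows "(lin k a x l t w)^2 <= real k * K^2 * (\<Sum>j<k. (x j t w)^2)"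
proof -
 have "(\<Sum>j<k. a t l j * x j t w)^2 <= (\<Sum>j<k. (a t l j)^2) * (\<Sum>j<k. (x j t w)^2)" by (rule Cauchy_Schwarz_ineq_sum)
 also have "... <= (real k * K^2) * (\<Sum>j<k. (x j t w)^2)" proof (rule mult_right_mono)
  have "(\<Sum>j<k. (a t l j)^2) <= (\<Sum>j<k. K^2)" proof (rule sum_mono)
  fix j assume "j : {..<k}"
  then have "(abs (a t l j))^2 <= K^2" using assms by (intro power_mono) auto
  then show "(a t l j)^2 <= K^2" by simp
  qed
  then show "(\<Sum>j<k. (a t l j)^2) <= real k * K^2" by simp
 qed (auto intro: sum_nonneg)
 finally show ?thesis by (simp add: lin_def)
qed

lemma lin_Q_le:
 assumes x: "!!j. j < k ==> cp T (x j)" and lc: "cp T (lin k a x l)" and l: "l < k" and t: "t : {0..T}"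
  and K: "!!t l j. t : {0..T} ==> l < k ==> j < k ==> abs (a t l j) <= K"
 shows "(LINT p|Q t. (lin k a x l (fst p) (snd p))^2) <= real k * K^2 * (\<Sum>j<k. LINT p|Q t. (uc (x j) p)^2)"
proof -
 have i: "integrable (Q t) (%p. (uc f p)^2)" if "cp T f" for f by (rule sqi_integrable[OF sqp_sqi[OF cp_sqp[OF that]]]) (use t in simp)
 have "(LINT p|Q t. (lin k a x l (fst p) (snd p))^2) <= (LINT p|Q t. real k * K^2 * (\<Sum>j<k. (uc (x j) p)^2))"
  using i[OF lc] i[OF x] K l t by (intro integral_mono lin_square_le) (auto simp: space_Q)
 then show ?thesis using i[OF x] by simp
qed

lemma tint_lin_diff:
 assumes "cp T (lin k a x l)" "cp T (lin k a y l)" "t : {0..T}" "w : space M"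
 shows "tint (lin k a x l) t w - tint (lin k a y l) t w = tint (lin k a (%j t w. x j t w - y j t w) l) t w"
 using int_lb_cont(1)[OF cp_cont[OF assms(1,4)], of t] int_lb_cont(1)[OF cp_cont[OF assms(2,4)], of t] assms(3)
 by (simp add: tint_def lin_diff[symmetric])

lemma cp_mono: "cp T f ==> t <= T ==> cp t f" unfolding cp_def by (auto intro: continuous_on_subset elim!: eventually_mono)

text \<open>A chosen continuous version of the integral, so that the Picard iteration becomes a
  recursion on functions.\<close>

definition Ito :: "real => (real => 'a => real) => real => 'a => real" where
 "Ito T f = (SOME Z. cp T Z & (ALL t:{0..T}. ito t f (Z t)))"

lemma Ito_cp: "cp T f ==> 0 <= T ==> cp T (Ito T f)"
 and Ito_ito: "cp T f ==> 0 <= T ==> t : {0..T} ==> ito t f (Ito T f t)" unfolding Ito_def using someI_ex[OF cp_ito] by blast+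

primrec picard :: "real => nat => (real => nat => nat => real) => (real => nat => nat => real) => (nat => real) =>
  nat => nat => real => 'a => real" where
 "picard T k a c y0 0 = (%l t w. y0 l)"
| "picard T k a c y0 (Suc n) = (%l t w. y0 l + tint (lin k a (picard T k a c y0 n) l) t w
  + Ito T (lin k c (picard T k a c y0 n) l) t w)"

text \<open>The second moments of successive differences decay geometrically when weighted by an
  exponential in time; Doob's inequality then controls the suprema of the next differences, which
  yields a continuous limit.\<close>

theorem linear_sde_exists:
 fixes a c :: "real => nat => nat => real" and y0 :: "nat => real"
 assumes T: "0 <= T" and ac: "!!l j. l < k ==> j < k ==> continuous_on {0..T} (%t. a t l j)"
  and cc: "!!l j. l < k ==> j < k ==> continuous_on {0..T} (%t. c t l j)"
 shows "EX y. ALL l<k. cp T (y l) & (AE w in M. y l 0 w = y0 l) & ip T (y l) (lin k a y l) (lin k c y l)"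
proof -
 define x where "x = picard T k a c y0"
 have x0: "x 0 l t w = y0 l" for l t w by (simp add: x_def)
 have xS: "x (Suc n) l t w = y0 l + tint (lin k a (x n) l) t w + Ito T (lin k c (x n) l) t w" for n l t w by (simp add: x_def)
 have xcp: "cp T (x n l)" if "l < k" for n l using that proof (induction n arbitrary: l)
  case 0
  have "x 0 l = (%t w. y0 l)" by (simp add: fun_eq_iff x0)
  then show ?case by (simp add: cp_const)
 next
  case (Suc n)
  have "x (Suc n) l = (%t w. y0 l + tint (lin k a (x n) l) t w + Ito T (lin k c (x n) l) t w)" by (simp add: fun_eq_iff xS)
  then show ?case using Suc T by (auto intro!: cp_add cp_const cp_tint Ito_cp cp_lin ac cc)
 qed
 have la: "cp T (lin k a (x n) l)" and lc: "cp T (lin k c (x n) l)" if "l < k" for n l using that by (auto intro!: cp_lin ac cc xcp)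
 obtain K where K: "0 <= K" "!!t l j. t : {0..T} ==> l < k ==> j < k ==> abs (a t l j) <= K & abs (c t l j) <= K" proof -
  obtain A where A: "0 <= A" "!!t l j. t : {0..T} ==> l < k ==> j < k ==> abs (a t l j) <= A" using continuous_matrix_bounded[of k T a] ac by blast
  obtain C where C: "0 <= C" "!!t l j. t : {0..T} ==> l < k ==> j < k ==> abs (c t l j) <= C" using continuous_matrix_bounded[of k T c] cc by blast
  show ?thesis proof (rule that[of "A + C"])
  fix t l j assume "t : {0..T}" "l < k" "j < k"
  from A(2)[OF this] C(2)[OF this] A(1) C(1) show "abs (a t l j) <= A + C & abs (c t l j) <= A + C" by linarith
  qed (use A C in simp)
 qed
 define d where "d n l t w = x (Suc n) l t w - x n l t w" for n l t w
 have dcp: "cp T (d n l)" if "l < k" for n l unfolding d_def[abs_def] by (intro cp_diff xcp that)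
 let ?b = "%n l. lin k a (d n) l" and ?s = "%n l. lin k c (d n) l"
 have bcp: "cp T (?b n l)" "cp T (?s n l)" if "l < k" for n l using that by (auto intro!: cp_lin ac cc dcp)
 define u where "u = real k * K^2"
 have u0: "0 <= u" by (simp add: u_def)
 define \<phi> where "\<phi> n t = (\<Sum>l<k. EE (%w. (d n l t w)^2))" for n t
 have \<phi>nn: "0 <= \<phi> n t" for n t unfolding \<phi>_def by (intro sum_nonneg) simp
 have D\<phi>: "(\<Sum>l<k. LINT p|Q t. (d n l (fst p) (snd p))^2) = (LINT r|lb t. \<phi> n r)" "integrable (lb t) (\<phi> n)" if t: "t <= T" for n t
 proof -
  have "integrable (Q t) (%p. (d n l (fst p) (snd p))^2)" if "l < k" for l by (rule sqi_integrable[OF sqp_sqi[OF cp_sqp[OF dcp[OF that]] t]])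
  note i = integral_Q_fst(1,3)[OF this, simplified]
  show "integrable (lb t) (\<phi> n)" unfolding \<phi>_def[abs_def] by (rule isum) (use i(2) in simp)
  show "(\<Sum>l<k. LINT p|Q t. (d n l (fst p) (snd p))^2) = (LINT r|lb t. \<phi> n r)" unfolding \<phi>_def by (subst Isum) (use i in auto)
 qed
 let ?I = "%n l t w. Ito T (lin k c (x (Suc n)) l) t w - Ito T (lin k c (x n) l) t w"
 have dS: "tint (?b n l) t w + ?I n l t w = d (Suc n) l t w" if "l < k" "t : {0..T}" "w : space M" for n l t w
  using tint_lin_diff[OF la[OF that(1)] la[OF that(1)] that(2,3), of "Suc n" n] by (simp add: d_def[abs_def] xS)
 \<comment> \<open>The factor 2 comes from squaring a sum of two terms; the drift integral costs T
   by Cauchy-Schwarz, the stochastic integral 4 by Doob, and u bounds the linear maps.\<close>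
 define C where "C = (2 * T + 8) * u"
 have C0: "0 <= C" using T u0 by (simp add: C_def)
 have step: "supb t (d (Suc n) l) (C * (LINT r|lb t. \<phi> n r))" if l: "l < k" and t: "t : {0..T}" for n l t proof -
  have t': "0 <= t" "t <= T" using t by auto
  let ?J = "LINT r|lb t. \<phi> n r"
  have Icp: "cp T (?I n l)" by (intro cp_diff Ito_cp lc l T)
  have le: "(LINT p|Q t. (?b n l (fst p) (snd p))^2) <= u * ?J" "(LINT p|Q t. (?s n l (fst p) (snd p))^2) <= u * ?J"
  unfolding u_def D\<phi>(1)[OF t'(2), symmetric] using K(2) by (intro lin_Q_le[OF dcp] bcp l t; blast)+
  have "supb t (?I n l) (4 * (LINT p|Q t. (?s n l (fst p) (snd p))^2))" proof (rule doob_sup[OF _ _ t'(1)])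
  fix s assume "s : {0..t}"
  then have s: "s : {0..T}" using t by auto
  show "?I n l s : BM (F s)" by (rule cp_F[OF Icp s])
  show "ito s (?s n l) (?I n l s)"
  using ito_diff[OF Ito_ito[OF lc[OF l] T s] Ito_ito[OF lc[OF l] T s], of "Suc n" n] by (simp only: lin_diff d_def[abs_def])
  qed (rule cp_cont[OF cp_mono[OF Icp t'(2)]])
  from supb_add[OF supb_tint[OF cp_mono[OF bcp(1)[OF l] t'(2)] t'(1)] this]
  have "supb t (d (Suc n) l) (2 * (t * (LINT p|Q t. (?b n l (fst p) (snd p))^2)) + 2 * (4 * (LINT p|Q t. (?s n l (fst p) (snd p))^2)))"
  by (rule supb_cong) (use dS[OF l] t in auto)
  moreover have "2 * (t * (LINT p|Q t. (?b n l (fst p) (snd p))^2)) + 2 * (4 * (LINT p|Q t. (?s n l (fst p) (snd p))^2)) <= 2 * (T * (u * ?J)) + 2 * (4 * (u * ?J))"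
  using le T t' by (intro add_mono mult_left_mono mult_mono) auto
  ultimately show ?thesis by (rule supb_le[OF _ order_trans]) (simp add: C_def algebra_simps)
 qed
 define L where "L = real k * C + 1"
 have L: "0 < L" using C0 by (simp add: L_def add_nonneg_pos)
 have rec: "\<phi> (Suc n) t <= L * (LINT r|lb t. \<phi> n r)" if t: "t : {0..T}" for n t proof -
  have "\<phi> (Suc n) t <= (\<Sum>l<k. C * (LINT r|lb t. \<phi> n r))"
  unfolding \<phi>_def[of "Suc n"] using t cp_sqi[OF dcp t] by (intro sum_mono supb_expectation[OF step] sqi_measurable) auto
  also have "... <= L * (LINT r|lb t. \<phi> n r)" using \<phi>nn by (simp add: L_def distrib_right Bochner_Integration.integral_nonneg)
  finally show ?thesis .
 qed
 have "ALL l:{..<k}. EX g. supb T (d 0 l) g" using dcp unfolding cp_supb by blast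
 from bchoice[OF this] obtain g0 where g0: "ALL l:{..<k}. supb T (d 0 l) (g0 l)" by (elim exE)
 define g where "g = (\<Sum>l<k. abs (g0 l))"
 have g: "0 <= g" "!!t. t : {0..T} ==> \<phi> 0 t <= g" proof -
  show "0 <= g" unfolding g_def by (intro sum_nonneg) simp
  show "\<phi> 0 t <= g" if t: "t : {0..T}" for t unfolding \<phi>_def g_def proof (rule sum_mono)
  fix l assume l: "l : {..<k}"
  from supb_expectation[OF bspec[OF g0 l] t sqi_measurable[OF cp_sqi[OF dcp t]]] l
  show "EE (%w. (d 0 l t w)^2) <= abs (g0 l)" by simp
  qed
 qed
 \<comment> \<open>Integrating exp (m r) gains 1 / m, so every iteration multiplies the bound by L /
   m = 1/4.\<close>
 define m where "m = 4 * L"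
 have m: "0 < m" using L by (simp add: m_def)
 have geo: "\<phi> n t <= g / 4 ^ n * exp (m * t)" if "t : {0..T}" for n t using that proof (induction n arbitrary: t)
  case 0
  have "\<phi> 0 t <= g * 1" using g(2)[OF 0] by simp
  also have "... <= g * exp (m * t)" using g(1) m 0 by (intro mult_left_mono) auto
  finally show ?case by simp
 next
  case (Suc n)
  have t: "t <= T" "0 <= t" using Suc.prems by auto
  have ie: "integrable (lb t) (%r. g / 4 ^ n * exp (m * r))" using integral_exp_lb(2)[of m t] m t by simp
  have "(LINT r|lb t. \<phi> n r) <= (LINT r|lb t. g / 4 ^ n * exp (m * r))" using Suc.IH t by (intro integral_mono[OF D\<phi>(2)[OF t(1)] ie]) auto
  also have "... = g / 4 ^ n * ((exp (m * t) - 1) / m)" using integral_exp_lb(1)[of m t] m t by simp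
  also have "... <= g / 4 ^ n * (exp (m * t) / m)" using g(1) m by (intro mult_left_mono divide_right_mono) auto
  finally have "L * (LINT r|lb t. \<phi> n r) <= L * (g / 4 ^ n * (exp (m * t) / m))" using L by (intro mult_left_mono) auto
  also have "... = g / 4 ^ Suc n * exp (m * t)" using L by (simp add: m_def field_simps)
  finally show ?case using rec[OF Suc.prems, of n] by linarith
 qed
 define g' where "g' = T * (g * exp (m * T))"
 have J\<phi>: "(LINT r|lb T. \<phi> n r) <= g' / 4 ^ n" for n proof -
  have "(LINT r|lb T. \<phi> n r) <= (LINT r|lb T. g / 4 ^ n * exp (m * T))" proof (rule integral_mono[OF D\<phi>(2)[OF order_refl]])
  fix r assume "r : space (lb T)"
  then have r: "r : {0..T}" by simp
  have "exp (m * r) <= exp (m * T)" using r m by simp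
  then show "\<phi> n r <= g / 4 ^ n * exp (m * T)" using geo[OF r, of n] g(1)
  by (meson mult_left_mono order_trans zero_le_divide_iff zero_le_numeral zero_le_power)
  qed (simp add: finite_measure.integrable_const[OF fin_lb])
  also have "... = g' / 4 ^ n" using T by (simp add: g'_def measure_lb)
  finally show ?thesis .
 qed
 have TT: "T : {0..T}" using T by simp
 have "EX Y C'. cp T Y & (ALL j. supb T (%t w. Y t w - x (Suc j) l t w) (C' * (1/2) ^ j))" if l: "l < k" for l proof -
  have "supb T (%t w. x (Suc (Suc n)) l t w - x (Suc n) l t w) (C * g' / 4 ^ n)" for n proof (rule supb_le)
  show "supb T (%t w. x (Suc (Suc n)) l t w - x (Suc n) l t w) (C * (LINT r|lb T. \<phi> n r))"
  using step[OF l TT, of n] by (simp add: d_def[abs_def])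
  show "C * (LINT r|lb T. \<phi> n r) <= C * g' / 4 ^ n" using mult_left_mono[OF J\<phi>[of n] C0] by simp
  qed
  from supb_complete[of T "%j. x (Suc j) l", OF xcp[OF l] this] show ?thesis by blast
 qed
 then have "ALL l:{..<k}. EX Z. cp T (fst Z) & (ALL j. supb T (%t w. fst Z t w - x (Suc j) l t w) (snd Z * (1/2) ^ j))" by simp
 from bchoice[OF this] obtain Z where Z: "ALL l:{..<k}. cp T (fst (Z l)) & (ALL j. supb T (%t w. fst (Z l) t w - x (Suc j) l t w) (snd (Z l) * (1/2) ^ j))" by (elim exE)
 define Y v where "Y l = fst (Z l)" and "v l = snd (Z l)" for l
 have Y: "cp T (Y l)" "supb T (%t w. Y l t w - x (Suc j) l t w) (v l * (1/2) ^ j)" if "l < k" for l j using Z that by (simp_all add: Y_def v_def)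
 have lY: "cp T (lin k a Y l)" "cp T (lin k c Y l)" if "l < k" for l using that by (auto intro!: cp_lin ac cc Y)
 let ?e = "%j i t w. Y i t w - x (Suc j) i t w"
 define v' where "v' = u * (T * (\<Sum>l<k. v l))"
 have lin_le: "(LINT p|Q T. (lin k e (?e j) l (fst p) (snd p))^2) <= v' * (1/2) ^ j"
  if "l < k" "cp T (lin k e (?e j) l)" "!!t l j. t : {0..T} ==> l < k ==> j < k ==> abs (e t l j) <= K" for e j l proof -
  have "(LINT p|Q T. (lin k e (?e j) l (fst p) (snd p))^2) <= u * (\<Sum>i<k. LINT p|Q T. (?e j i (fst p) (snd p))^2)"
  unfolding u_def by (rule lin_Q_le[OF _ that(2,1) TT that(3)]) (intro cp_diff Y(1) xcp)
  also have "... <= u * (\<Sum>i<k. T * (v i * (1/2) ^ j))" by (intro mult_left_mono u0 sum_mono supb_Q[OF cp_diff[OF Y(1) xcp] Y(2) T]) auto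
  finally show ?thesis by (simp add: v'_def sum_distrib_left sum_distrib_right mult_ac)
 qed
 have lcp: "cp T (lin k a (?e j) l)" "cp T (lin k c (?e j) l)" if "l < k" for j l using that by (auto intro!: cp_lin ac cc cp_diff Y(1) xcp)
 have z: "AE w in M. Y l 0 w = y0 l" if l: "l < k" for l proof -
  have "0 : {0..T}" using T by simp
  note Y0 = cp_sqi[OF Y(1)[OF l] this] and x0' = cp_sqi[OF xcp[OF l] this] and E = supb_expectation[OF Y(2)[OF l] this]
  have s: "sqi M (%w. Y l 0 w - y0 l)" by (intro sqi_diff Y0 sqi_const finite_measure_axioms)
  have "EE (%w. (Y l 0 w - y0 l)^2) <= v l * (1/2) ^ j" for j proof -
  have I0: "AE w in M. Ito T (lin k c (x j) l) 0 w = 0" using ito_zero_time[OF Ito_ito[OF lc[OF l] T]] T by simp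
  have "EE (%w. (Y l 0 w - y0 l)^2) = EE (%w. (?e j l 0 w)^2)" proof (rule integral_cong_AE)
  show "AE w in M. (Y l 0 w - y0 l)^2 = (?e j l 0 w)^2" using I0 by eventually_elim (simp add: xS)
  qed (intro borel_measurable_power sqi_measurable[OF s] sqi_measurable[OF sqi_diff[OF Y0 x0']])+
  then show ?thesis using E[of j] sqi_measurable[OF sqi_diff[OF Y0 x0']] by simp
  qed
  moreover have "(%j. v l * (1/2) ^ j) ----> 0" by (intro tendsto_mult_right_zero LIMSEQ_power_zero) simp
  ultimately have "EE (%w. (Y l 0 w - y0 l)^2) <= 0" by (intro LIMSEQ_le_const) auto
  from sqi_zero_AE[OF s this] show ?thesis by eventually_elim simp
 qed
 have it: "ito t (lin k c Y l) (%w. Y l t w - Y l 0 w - tint (lin k a Y l) t w)" if l: "l < k" and t: "t : {0..T}" for l t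
 proof (rule ito.lim[where fs = "%j. lin k c (x (Suc j)) l" and Zs = "%j. Ito T (lin k c (x (Suc j)) l) t"])
  have tT: "t <= T" using t by simp
  show "ALL j. ito t (lin k c (x (Suc j)) l) (Ito T (lin k c (x (Suc j)) l) t)" using Ito_ito[OF lc[OF l] T t] by blast
  show "L2lim (Q t) (%j p. lin k c (x (Suc j)) l (fst p) (snd p)) (%p. lin k c Y l (fst p) (snd p))" proof (rule L2lim_geometric)
  show "sqi (Q t) (%p. lin k c (x (Suc j)) l (fst p) (snd p))" "sqi (Q t) (%p. lin k c Y l (fst p) (snd p))" for j
  by (intro sqp_sqi[OF _ tT] cp_sqp lc lY l)+
  have "(LINT p|Q t. (lin k c (?e j) l (fst p) (snd p))^2) <= v' * (1/2) ^ j" for j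
  by (rule order_trans[OF integral_Q_mono[OF tT sqi_integrable[OF sqp_sqi[OF cp_sqp[OF lcp(2)[OF l]] order.refl]]] lin_le[OF l lcp(2)[OF l]]])
  (use K(2) in auto)
  then show "(LINT p|Q t. (lin k c (x (Suc j)) l (fst p) (snd p) - lin k c Y l (fst p) (snd p))^2) <= v' * (1/2) ^ j" for j
  by (subst power2_commute) (simp add: lin_diff)
  qed simp_all
  show "L2lim M (%j. Ito T (lin k c (x (Suc j)) l) t) (%w. Y l t w - Y l 0 w - tint (lin k a Y l) t w)" proof (rule L2lim_geometric)
  show 1: "sqi M (Ito T (lin k c (x (Suc j)) l) t)" for j by (rule cp_sqi[OF Ito_cp[OF lc[OF l] T] t])
  show 2: "sqi M (%w. Y l t w - Y l 0 w - tint (lin k a Y l) t w)"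
  using T by (intro sqi_diff cp_sqi[OF Y(1)[OF l]] cp_sqi[OF cp_tint[OF lY(1)[OF l]]] t) auto
  fix j
  \<comment> \<open>By the recursion for the iterates, the error of the stochastic integral is, up
    to sign and null sets, an error of the state plus an error of the drift integral; both are
    already bounded.\<close>
  let ?U = "%t w. ?e (Suc j) l t w + - tint (lin k a (?e j) l) t w"
  have "supb T (%t w. - tint (lin k a (?e j) l) t w) (T * (LINT p|Q T. (lin k a (?e j) l (fst p) (snd p))^2))"
  using supb_tint[OF lcp(1)[OF l] T, of j] by (simp add: supb_def)
  note U = supb_add[OF Y(2)[OF l] this, of "Suc j"] cp_add[OF cp_diff[OF Y(1)[OF l] xcp[OF l]] cp_uminus[OF cp_tint[OF lcp(1)[OF l]]], of "Suc (Suc j)" j]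
  have "EE (%w. (Ito T (lin k c (x (Suc j)) l) t w - (Y l t w - Y l 0 w - tint (lin k a Y l) t w))^2) = EE (%w. (?U t w)^2)"
  proof (rule integral_cong_AE)
  show "AE w in M. (Ito T (lin k c (x (Suc j)) l) t w - (Y l t w - Y l 0 w - tint (lin k a Y l) t w))^2 = (?U t w)^2" using z[OF l] AE_space
  proof eventually_elim
  case (elim w)
  have "?U t w = - (Ito T (lin k c (x (Suc j)) l) t w - (Y l t w - Y l 0 w - tint (lin k a Y l) t w))"
  using tint_lin_diff[OF lY(1)[OF l] la[OF l] t elim(2), of "Suc j"] elim(1) by (simp add: xS[of "Suc j"])
  then show ?case by (simp only: power2_minus)
  qed
  qed (use sqi_integrable[OF sqi_diff[OF 1 2]] sqi_integrable[OF cp_sqi[OF U(2) t]] in auto)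
  also have "... <= 2 * (v l * (1/2) ^ Suc j) + 2 * (T * (v' * (1/2) ^ j))"
  using order_trans[OF supb_expectation[OF U(1) t sqi_measurable[OF cp_sqi[OF U(2) t]]] add_left_mono[OF mult_left_mono[OF mult_left_mono[OF lin_le[OF l lcp(1)[OF l]] T]]]] K(2) by auto
  finally show "EE (%w. (Ito T (lin k c (x (Suc j)) l) t w - (Y l t w - Y l 0 w - tint (lin k a Y l) t w))^2) <= (v l + 2 * (T * v')) * (1/2) ^ j"
  by (simp add: algebra_simps)
  qed simp_all
 qed
 have "ALL l<k. cp T (Y l) & (AE w in M. Y l 0 w = y0 l) & ip T (Y l) (lin k a Y l) (lin k c Y l)" proof (intro allI impI conjI)
  fix l assume l: "l < k"
  show "cp T (Y l)" by (rule Y(1)[OF l])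
  show "AE w in M. Y l 0 w = y0 l" by (rule z[OF l])
  show "ip T (Y l) (lin k a Y l) (lin k c Y l)"
  unfolding ip_def using cp_sqp[OF lY(1)[OF l]] cp_sqp[OF lY(2)[OF l]] cp_jm[OF Y(1)[OF l]] cp_F[OF Y(1)[OF l], of 0] cp_sqi[OF Y(1)[OF l], of 0] it[OF l] T
  by auto
 qed
 then show ?thesis by blast
qed

end

section \<open>Euler polygons\<close>

text \<open>Euler polygons rather than Picard iteration: the steps of the Riccati equation preserve
 positive semidefiniteness.\<close>

lemma euler_ode:
 fixes F E :: "('i => real) => 'i => real" and a :: "'i => real" and S :: "('i => real) set"
 defines "st == %g x i. x i + g * F x i + g^2 * E x i"
  and "d == %I x y. \<Sum>i\<in>I. abs (x i - y i)"
 assumes I: "finite I" and T: "0 < T" and aa: "0 < aa" and c: "0 <= c"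
  and inS: "!!g k. 0 < g ==> g <= aa ==> real k * g <= T ==> (st g ^^ k) a : S"
  and bF: "!!x. x : S ==> (\<Sum>i\<in>I. abs (F x i)) <= c" and bE: "!!x. x : S ==> (\<Sum>i\<in>I. abs (E x i)) <= c"
  and lip: "!!x y. x : S ==> y : S ==> d I (F x) (F y) <= c * d I x y"
  and closed: "!!G f x. G ~= bot ==> (!!j::nat. f j : S) ==> (!!i. i : I ==> ((%j. f j i) \<longlongrightarrow> x i) G) ==> x : S"
 shows "EX y. (ALL i:I. y 0 i = a i) & (ALL t:{0..T}. y t : S &
  (ALL i:I. ((%s. y s i) has_real_derivative F (y t) i) (at t within {0..T})))"
proof -
 let ?d = "d I"
 have d0: "0 <= ?d x y" for x y unfolding d_def by (intro sum_nonneg) auto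
 have dtri: "?d x z <= ?d x y + ?d y z" for x y z unfolding d_def sum.distrib[symmetric] by (intro sum_mono) auto
 have dadd: "?d (%i. x i + b * u i) (%i. y i + b * v i) <= ?d x y + b * ?d u v" if b: "0 <= b" for x y u v b
  unfolding d_def sum_distrib_left sum.distrib[symmetric] proof (rule sum_mono)
  fix i
  have "abs (x i + b * u i - (y i + b * v i)) = abs ((x i - y i) + b * (u i - v i))" by (simp add: algebra_simps)
  also have "... <= abs (x i - y i) + b * abs (u i - v i)"
  using abs_triangle_ineq[of "x i - y i" "b * (u i - v i)"] unfolding abs_mult abs_of_nonneg[OF b] .
  finally show "abs (x i + b * u i - (y i + b * v i)) <= abs (x i - y i) + b * abs (u i - v i)" .
 qed
 \<comment> \<open>The additional term is of second order in the step size, like the local error of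
   Euler's method itself.\<close>
 have err: "?d (st g x) (%i. x i + g * F x i) <= g^2 * c" if "x : S" for x g
  using mult_left_mono[OF bE[OF that], of "g^2"] by (simp add: d_def st_def abs_mult sum_distrib_left)
 have st1: "?d (st g x) x <= g * (2 * c)" if "x : S" "0 <= g" "g <= 1" for x g proof -
  have "?d (%i. x i + g * F x i) x <= g * c" using mult_left_mono[OF bF[OF that(1)] that(2)] that(2) by (simp add: d_def abs_mult sum_distrib_left)
  moreover have "g^2 * c <= g * c" using that c by (intro mult_right_mono) (auto simp: power2_eq_square mult_left_le)
  ultimately show ?thesis using err[OF that(1), of g] dtri[of "st g x" x "%i. x i + g * F x i"] by linarith
 qed
 define e where "e j = min 1 aa * inverse (real (Suc j))" for j
 have "(%j. min 1 aa * inverse (real (Suc j))) ----> min 1 aa * 0" by (intro tendsto_intros LIMSEQ_inverse_real_of_nat)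
 then have e_lim: "e ----> 0" by (simp add: e_def[abs_def])
 have e: "0 < e j" "e j <= 1" "e j <= aa" for j proof -
  have "e j <= min 1 aa * 1" unfolding e_def using aa by (intro mult_left_mono) (auto simp: inverse_le_1_iff)
  then show "e j <= 1" "e j <= aa" by auto
 qed (use aa in "simp add: e_def")
 define p where "p j k = (st (e j) ^^ k) a" for j k
 have pS: "p j k : S" if "real k * e j <= T" for j k unfolding p_def by (rule inS) (use e(1,3)[of j] that in auto)
 have p_Suc: "p j (Suc k) = st (e j) (p j k)" for j k by (simp add: p_def)
 have p0: "p j 0 = a" for j by (simp add: p_def)
 have le_T: "real k' * e j <= T" if "real k * e j <= T" "k' <= k" for k k' j
  by (rule order_trans[OF mult_right_mono that(1)]) (use that(2) e(1)[of j] in auto)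
 have shift: "?d (p j (k + m)) (p j k) <= real m * e j * (2 * c)" if "real (k + m) * e j <= T" for j k m using that proof (induction m)
  case 0
  show ?case by (simp add: d_def)
 next
  case (Suc m)
  have m: "real (k + m) * e j <= T" by (rule le_T[OF Suc.prems]) simp
  have "?d (p j (k + Suc m)) (p j k) <= e j * (2 * c) + real m * e j * (2 * c)"
  using dtri[of "p j (k + Suc m)" "p j k" "p j (k + m)"] st1[OF pS[OF m], of "e j"] e(1,2)[of j] Suc.IH[OF m] by (simp add: p_Suc)
  then show ?case by (simp add: algebra_simps)
 qed
 \<comment> \<open>Deviation from the tangent after m steps: quadratic in the elapsed time m e_j,
   plus a remainder proportional to e_j that disappears in the limit.\<close>
 have loc: "?d (p j (k + m)) (%i. p j k i + real m * e j * F (p j k) i) <= real m * e j * (2 * c^2 * (real m * e j) + c * e j)"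
  if "real (k + m) * e j <= T" for j k m using that proof (induction m)
  case 0
  show ?case by (simp add: d_def)
 next
  case (Suc m)
  have m: "real (k + m) * e j <= T" and k: "real k * e j <= T" by (rule le_T[OF Suc.prems], simp)+
  have e0: "0 <= e j" using e(1)[of j] by simp
  let ?q = "p j (k + m)"
  have "?d (F ?q) (F (p j k)) <= c * (real m * e j * (2 * c))" by (rule order_trans[OF lip[OF pS[OF m] pS[OF k]] mult_left_mono[OF shift[OF m] c]])
  then have "e j * ?d (F ?q) (F (p j k)) <= e j * (c * (real m * e j * (2 * c)))" by (rule mult_left_mono[OF _ e0])
  moreover have "?d (%i. ?q i + e j * F ?q i) (%i. p j k i + real (Suc m) * e j * F (p j k) i)
  <= ?d ?q (%i. p j k i + real m * e j * F (p j k) i) + e j * ?d (F ?q) (F (p j k))"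
  using dadd[OF e0, of ?q "F ?q" "%i. p j k i + real m * e j * F (p j k) i" "F (p j k)"] by (simp add: algebra_simps)
  ultimately have "?d (p j (k + Suc m)) (%i. p j k i + real (Suc m) * e j * F (p j k) i)
  <= (e j)^2 * c + (real m * e j * (2 * c^2 * (real m * e j) + c * e j) + e j * (c * (real m * e j * (2 * c))))"
  using err[OF pS[OF m], of "e j"] Suc.IH[OF m] dtri[of "p j (k + Suc m)" "%i. p j k i + real (Suc m) * e j * F (p j k) i" "%i. ?q i + e j * F ?q i"]
  by (simp only: p_Suc add_Suc_right)
  also have "... = real (Suc m) * e j * (2 * c^2 * (real m * e j) + c * e j)" by (simp add: algebra_simps power2_eq_square)
  also have "... <= real (Suc m) * e j * (2 * c^2 * (real (Suc m) * e j) + c * e j)"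
  using e0 by (intro mult_left_mono mult_right_mono add_right_mono) auto
  finally show ?case .
 qed
 define m where "m j t = nat \<lfloor>t / e j\<rfloor>" for j t
 have m: "real (m j t) * e j <= t" "t - e j <= real (m j t) * e j" if "0 <= t" for j t proof -
  have "0 <= t / e j" using that e(1)[of j] by auto
  then have "real (m j t) = of_int \<lfloor>t / e j\<rfloor>" unfolding m_def by (subst of_nat_nat) auto
  then have "real (m j t) <= t / e j" "t / e j - 1 <= real (m j t)" by linarith+
  then show "real (m j t) * e j <= t" "t - e j <= real (m j t) * e j" using e(1)[of j] by (auto simp: field_simps)
 qed
 have m_mono: "m j s <= m j t" if "s <= t" for j s t unfolding m_def using that e(1)[of j] by (intro nat_mono floor_mono divide_right_mono) auto
 have m_lim: "(%j. real (m j t) * e j) ----> t" if "0 <= t" for t proof (rule tendsto_sandwich)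
  show "(%j. t - e j) ----> t" using tendsto_diff[OF tendsto_const e_lim, of t] by simp
 qed (use m[OF that] in auto)
 define z where "z j t = p j (m j t)" for j t
 have zS: "z j t : S" if "t : {0..T}" for j t unfolding z_def using m(1)[of t j] that by (intro pS) auto
 have di: "abs (x i - y i) <= ?d x y" if "i : I" for i x y unfolding d_def using that I member_le_sum[of i I "%i. abs (x i - y i)"] by auto
 \<comment> \<open>All polygons are points of one product of compact intervals. By Tychonoff they
   have a cluster point, so no Arzela-Ascoli argument or subsequence is extracted.\<close>
 define Z where "Z j = (%(t, i). if t : {0..T} & i : I then z j t i else 0)" for j
 define K where "K = (\<Pi>\<^sub>E q\<in>(UNIV :: (real \<times> 'i) set). {- (abs (a (snd q)) + T * (2 * c))..abs (a (snd q)) + T * (2 * c)})"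
 have cK: "compact K" unfolding K_def using compactin_PiE[of "%_. euclidean :: real topology" UNIV "%q :: real \<times> 'i. {- (abs (a (snd q)) + T * (2 * c))..abs (a (snd q)) + T * (2 * c)}"]
  by (simp add: euclidean_product_topology)
 have ZK: "Z j : K" for j proof -
  have "abs (z j t i) <= abs (a i) + T * (2 * c)" if t: "t : {0..T}" and i: "i : I" for t i proof -
  have l: "real (m j t) * e j <= T" using m(1)[of t j] t by auto
  have "?d (z j t) a <= real (m j t) * e j * (2 * c)" using shift[of 0 "m j t" j] l by (simp add: z_def p0)
  then show ?thesis using di[OF i, of "z j t" a] mult_right_mono[OF l, of "2 * c"] c by linarith
  qed
  moreover have "0 <= T * (2 * c)" using T c by simp
  ultimately have *: "abs (Z j q) <= abs (a (snd q)) + T * (2 * c)" for q by (simp add: Z_def split_beta')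
  have "Z j q : {- (abs (a (snd q)) + T * (2 * c))..abs (a (snd q)) + T * (2 * c)}" for q
  using *[of q] unfolding abs_le_iff atLeastAtMost_iff by linarith
  then show ?thesis by (simp add: K_def PiE_iff)
 qed
 obtain w where w: "inf (nhds w) (filtermap Z sequentially) ~= bot"
  using cK[unfolded compact_filter, rule_format, of "filtermap Z sequentially"] ZK by (auto simp: eventually_filtermap filtermap_bot_iff)
 \<comment> \<open>A filter finer than \<open>sequentially\<close> along which the polygons converge
   to the cluster point w at every time.\<close>
 define G where "G = inf (filtercomap Z (nhds w)) sequentially"
 have G: "G ~= bot" proof
  assume "G = bot"
  then have "eventually (%_. False) G" by simp
  then obtain R where "eventually R (nhds w)" "eventually (%j. \<not> R (Z j)) sequentially"
  unfolding G_def eventually_inf eventually_filtercomap by (metis (mono_tags, lifting) eventually_mono)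
  then have "eventually (%_. False) (inf (nhds w) (filtermap Z sequentially))"
  unfolding eventually_inf eventually_filtermap by (intro exI[of _ R] exI[of _ "%z. \<not> R z"]) auto
  with w show False by (simp add: trivial_limit_def)
 qed
 have Gle: "G <= sequentially" unfolding G_def by simp
 note e_lim = tendsto_mono[OF Gle e_lim] and m_lim = tendsto_mono[OF Gle m_lim]
 define y where "y t i = w (t, i)" for t i
 have yl: "((%j. z j t i) \<longlongrightarrow> y t i) G" if "t : {0..T}" "i : I" for t i proof -
  have "filterlim Z (nhds w) G" unfolding filterlim_def G_def filtermap_le_iff_le_filtercomap by simp
  from tendsto_compose[OF continuous_on_product_coordinates[of "(t, i)", unfolded continuous_on_def, rule_format, OF UNIV_I, of w] this]
  show ?thesis using that by (simp add: Z_def y_def o_def)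
 qed
 have yS: "y t : S" if "t : {0..T}" for t by (rule closed[OF G, of "%j. z j t"]) (use that zS yl in auto)
 have Fl: "((%j. F (z j t) i) \<longlongrightarrow> F (y t) i) G" if t: "t : {0..T}" and i: "i : I" for t i
 proof (rule LIM_zero_cancel, rule Lim_null_comparison)
  show "\<forall>\<^sub>F j in G. norm (F (z j t) i - F (y t) i) <= c * ?d (z j t) (y t)"
  unfolding real_norm_def by (intro always_eventually allI order_trans[OF di[OF i] lip[OF zS[OF t] yS[OF t]]])
  have "((%j. c * (\<Sum>i\<in>I. abs (z j t i - y t i))) \<longlongrightarrow> c * (\<Sum>i\<in>I. abs (y t i - y t i))) G"
  by (intro tendsto_intros yl t)
  then show "((%j. c * ?d (z j t) (y t)) \<longlongrightarrow> 0) G" by (simp add: d_def)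
 qed
 have est: "?d (y s) (%i. y t i + (s - t) * F (y t) i) <= 2 * c^2 * (s - t)^2" and ylip: "?d (y s) (y t) <= (s - t) * (2 * c)"
  if t: "0 <= t" "t <= s" "s <= T" for s t proof -
  let ?r = "%j. real (m j s) * e j - real (m j t) * e j"
  have r: "(?r \<longlongrightarrow> s - t) G" using t by (intro tendsto_diff m_lim) auto
  have mm: "m n t <= m n s" "real (m n t + (m n s - m n t)) * e n <= T" for n using m_mono[OF t(2), of n] m(1)[of s n] t by auto
  have r': "real (m n s - m n t) * e n = ?r n" for n using mm(1)[of n] by (simp add: left_diff_distrib of_nat_diff)
  show "?d (y s) (%i. y t i + (s - t) * F (y t) i) <= 2 * c^2 * (s - t)^2" proof (rule tendsto_le[OF G])
  show "((%j. ?d (z j s) (%i. z j t i + ?r j * F (z j t) i)) \<longlongrightarrow> ?d (y s) (%i. y t i + (s - t) * F (y t) i)) G"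
  unfolding d_def using t by (intro tendsto_intros yl Fl m_lim) auto
  have "((%j. ?r j * (2 * c^2 * ?r j + c * e j)) \<longlongrightarrow> (s - t) * (2 * c^2 * (s - t) + c * 0)) G"
  by (intro tendsto_mult tendsto_add r tendsto_const e_lim)
  then show "((%j. ?r j * (2 * c^2 * ?r j + c * e j)) \<longlongrightarrow> 2 * c^2 * (s - t)^2) G" by (simp add: power2_eq_square mult_ac)
  show "\<forall>\<^sub>F n in G. ?d (z n s) (%i. z n t i + ?r n * F (z n t) i) <= ?r n * (2 * c^2 * ?r n + c * e n)"
  by (intro always_eventually allI) (use loc[OF mm(2)] mm(1) in "simp add: z_def flip: r'")
  qed
  show "?d (y s) (y t) <= (s - t) * (2 * c)" proof (rule tendsto_le[OF G])
  show "((%j. ?d (z j s) (z j t)) \<longlongrightarrow> ?d (y s) (y t)) G" unfolding d_def using t by (intro tendsto_intros yl) auto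
  show "((%j. ?r j * (2 * c)) \<longlongrightarrow> (s - t) * (2 * c)) G" by (intro tendsto_mult r tendsto_const)
  show "\<forall>\<^sub>F n in G. ?d (z n s) (z n t) <= ?r n * (2 * c)" by (intro always_eventually allI) (use shift[OF mm(2)] mm(1) in "simp add: z_def flip: r'")
  qed
 qed
 \<comment> \<open>\<open>est\<close> looks forward in time only. Backward it is applied at s, and
   exchanging F (y s) for F (y t) costs another 2 c^2 by the Lipschitz bound.\<close>
 define L where "L = 4 * c^2"
 have L: "abs (y s i - y t i - (s - t) * F (y t) i) <= L * (s - t)^2" if t: "t : {0..T}" and s: "s : {0..T}" and i: "i : I" for s t i
 proof (cases "t <= s")
  case True
  have "abs (y s i - (y t i + (s - t) * F (y t) i)) <= 2 * c^2 * (s - t)^2" by (rule order_trans[OF di[OF i] est]) (use True s t in auto)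
  also have "... <= L * (s - t)^2" unfolding L_def by (intro mult_right_mono) auto
  finally show ?thesis by (simp add: diff_diff_eq)
 next
  case False
  have 1: "abs (y t i - (y s i + (t - s) * F (y s) i)) <= 2 * c^2 * (t - s)^2" by (rule order_trans[OF di[OF i] est]) (use False s t in auto)
  have "abs (F (y t) i - F (y s) i) <= c * ((t - s) * (2 * c))"
  by (rule order_trans[OF order_trans[OF di[OF i] lip[OF yS[OF t] yS[OF s]]] mult_left_mono[OF ylip c]]) (use False s t in auto)
  then have 2: "abs ((t - s) * (F (y t) i - F (y s) i)) <= (t - s) * (c * ((t - s) * (2 * c)))"
  unfolding abs_mult using False by (intro mult_mono) auto
  have eq: "y s i - y t i - (s - t) * F (y t) i = - (y t i - (y s i + (t - s) * F (y s) i)) + (t - s) * (F (y t) i - F (y s) i)" by (simp add: algebra_simps)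
  have "abs (y s i - y t i - (s - t) * F (y t) i) <= 2 * c^2 * (t - s)^2 + (t - s) * (c * ((t - s) * (2 * c)))"
  unfolding eq by (rule order_trans[OF abs_triangle_ineq add_mono[OF _ 2]]) (simp only: abs_minus_cancel 1)
  then show ?thesis by (simp add: L_def power2_eq_square algebra_simps)
 qed
 have der: "((%s. y s i) has_real_derivative F (y t) i) (at t within {0..T})" if t: "t : {0..T}" and i: "i : I" for t i
  unfolding has_field_derivative_iff proof (rule LIM_zero_cancel, rule Lim_null_comparison)
  show "\<forall>\<^sub>F s in at t within {0..T}. norm ((y s i - y t i) / (s - t) - F (y t) i) <= L * abs (s - t)" unfolding eventually_at_filter
  proof (intro always_eventually allI impI)
  fix s assume s: "s ~= t" "s : {0..T}"
  then have eq: "(y s i - y t i) / (s - t) - F (y t) i = (y s i - y t i - (s - t) * F (y t) i) / (s - t)" by (simp add: field_simps)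
  show "norm ((y s i - y t i) / (s - t) - F (y t) i) <= L * abs (s - t)" unfolding eq real_norm_def abs_divide using L[OF t s(2) i] s(1)
  by (subst pos_divide_le_eq) (auto simp: power2_eq_square abs_mult_self mult.assoc)
  qed
  have "((%s. L * abs (s - t)) \<longlongrightarrow> L * abs (t - t)) (at t within {0..T})" by (intro tendsto_intros)
  then show "((%s. L * abs (s - t)) \<longlongrightarrow> 0) (at t within {0..T})" by simp
 qed
 have "y 0 i = a i" if "i : I" for i using tendsto_unique[OF G yl[OF _ that, of 0] tendsto_eventually[of _ "a i"]] T by (simp add: z_def m_def p0)
 then show ?thesis using yS der by (intro exI[of _ y]) blast
qed

section \<open>Bounded Lipschitz matrix functions in the entrywise norm\<close>

definition mn :: "real mat => real" where
 "mn X = (\<Sum>i<dim_row X. \<Sum>j<dim_col X. abs (X $$ (i, j)))"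

lemma mn_nonneg: "0 <= mn X" unfolding mn_def by (intro sum_nonneg) auto

lemma mn_entry: "i < dim_row X ==> j < dim_col X ==> abs (X $$ (i, j)) <= mn X" unfolding mn_def
 using member_le_sum[of j "{..<dim_col X}" "%j. abs (X $$ (i, j))"]
  member_le_sum[of i "{..<dim_row X}" "%i. \<Sum>j<dim_col X. abs (X $$ (i, j))"] by (auto intro!: sum_nonneg)

lemma mn_add:
 assumes "X : carrier_mat a b" "Y : carrier_mat a b" shows "mn (X + Y) <= mn X + mn Y"
proof -
 have "mn (X + Y) = (\<Sum>i<a. \<Sum>j<b. abs (X $$ (i, j) + Y $$ (i, j)))" using assms by (simp add: mn_def)
 also have "... <= (\<Sum>i<a. \<Sum>j<b. abs (X $$ (i, j)) + abs (Y $$ (i, j)))" by (intro sum_mono abs_triangle_ineq)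
 also have "... = mn X + mn Y" using assms by (simp add: mn_def sum.distrib)
 finally show ?thesis .
qed

lemma mn_transpose: "mn (tr X) = mn X" unfolding mn_def by (subst sum.swap) auto

lemma mn_mult:
 assumes "X : carrier_mat a b" "Y : carrier_mat b c" shows "mn (X * Y) <= mn X * mn Y"
proof -
 have "mn (X * Y) <= (\<Sum>i<a. \<Sum>j<c. \<Sum>k<b. abs (X $$ (i, k)) * abs (Y $$ (k, j)))" unfolding mn_def using assms
  by (auto simp: scalar_prod_def atLeast0LessThan abs_mult[symmetric] intro!: sum_mono order_trans[OF sum_abs])
 also have "... = (\<Sum>i<a. \<Sum>k<b. abs (X $$ (i, k)) * (\<Sum>j<c. abs (Y $$ (k, j))))"
  unfolding sum_distrib_left by (intro sum.cong refl sum.swap)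
 also have "... <= (\<Sum>i<a. \<Sum>k<b. abs (X $$ (i, k)) * mn Y)" using assms member_le_sum[of _ "{..<b}" "%k. \<Sum>j<c. abs (Y $$ (k, j))"]
  by (intro sum_mono mult_left_mono) (auto simp: mn_def intro!: sum_nonneg)
 also have "... = mn X * mn Y" using assms by (simp add: mn_def sum_distrib_right)
 finally show ?thesis .
qed

text \<open>Boundedness belongs to the notion because the product of Lipschitz functions is
  Lipschitz only when both factors are bounded on S.\<close>

definition lipm :: "nat => nat => real mat set => (real mat => real mat) => bool" where
 "lipm a b S f \<longleftrightarrow> (ALL X:S. f X : carrier_mat a b) &
  (EX c>=0. (ALL X:S. mn (f X) <= c) & (ALL X:S. ALL Y:S. mn (f X - f Y) <= c * mn (X - Y)))"

lemma lipmE: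
 assumes "lipm a b S f"
 obtains c where "0 <= c" "!!X. X : S ==> f X : carrier_mat a b" "!!X. X : S ==> mn (f X) <= c"
  "!!X Y. X : S ==> Y : S ==> mn (f X - f Y) <= c * mn (X - Y)" using assms unfolding lipm_def by (elim conjE exE) (rule that; blast)

lemma lipmI:
 assumes "!!X. X : S ==> f X : carrier_mat a b" "!!X. X : S ==> mn (f X) <= c1"
  "!!X Y. X : S ==> Y : S ==> mn (f X - f Y) <= c2 * mn (X - Y)" shows "lipm a b S f" unfolding lipm_def
proof (intro conjI exI[of _ "abs c1 + abs c2"] ballI)
 fix X Y assume X: "X : S" and Y: "Y : S"
 show "mn (f X) <= abs c1 + abs c2" using assms(2)[OF X] by linarith
 show "mn (f X - f Y) <= (abs c1 + abs c2) * mn (X - Y)" by (rule order_trans[OF assms(3)[OF X Y] mult_right_mono[OF _ mn_nonneg]]) simp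
qed (use assms(1) in auto)

lemma lipm_const: "X : carrier_mat a b ==> lipm a b S (%_. X)" by (rule lipmI[of _ _ _ _ "mn X" 0]) (auto simp: mn_def)

lemma lipm_id: "(!!X. X : S ==> X : carrier_mat a b & mn X <= c) ==> lipm a b S (%X. X)" by (rule lipmI[of _ _ _ _ c 1]) auto

lemma lipm_transpose:
 assumes "lipm a b S f" shows "lipm b a S (%X. tr (f X))"
proof -
 obtain c where c: "0 <= c" "!!X. X : S ==> f X : carrier_mat a b" "!!X. X : S ==> mn (f X) <= c"
  "!!X Y. X : S ==> Y : S ==> mn (f X - f Y) <= c * mn (X - Y)" by (rule lipmE[OF assms], rule that) (assumption | simp only:)+
 show ?thesis by (rule lipmI[of _ _ _ _ c c]) (use c in "auto simp: mn_transpose transpose_minus[OF c(2) c(2), symmetric]")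
qed

lemma lipm_add:
 assumes "lipm a b S f" "lipm a b S g" shows "lipm a b S (%X. f X + g X)"
proof -
 obtain c where c: "0 <= c" "!!X. X : S ==> f X : carrier_mat a b" "!!X. X : S ==> mn (f X) <= c"
  "!!X Y. X : S ==> Y : S ==> mn (f X - f Y) <= c * mn (X - Y)" by (rule lipmE[OF assms(1)], rule that) (assumption | simp only:)+
 obtain d where d: "0 <= d" "!!X. X : S ==> g X : carrier_mat a b" "!!X. X : S ==> mn (g X) <= d"
  "!!X Y. X : S ==> Y : S ==> mn (g X - g Y) <= d * mn (X - Y)" by (rule lipmE[OF assms(2)], rule that) (assumption | simp only:)+
 show ?thesis proof (rule lipmI[of _ _ _ _ "c + d" "c + d"])
  fix X assume X: "X : S"
  show "f X + g X : carrier_mat a b" using c(2) d(2) X by simp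
  show "mn (f X + g X) <= c + d" using mn_add[OF c(2)[OF X] d(2)[OF X]] c(3)[OF X] d(3)[OF X] by linarith
  fix Y assume Y: "Y : S"
  have eq: "f X + g X - (f Y + g Y) = (f X - f Y) + (g X - g Y)" using c(2)[OF X] c(2)[OF Y] d(2)[OF X] d(2)[OF Y] by (intro eq_matI) auto
  show "mn (f X + g X - (f Y + g Y)) <= (c + d) * mn (X - Y)" unfolding eq distrib_right
  using mn_add[OF minus_carrier_mat[OF c(2)[OF Y]] minus_carrier_mat[OF d(2)[OF Y]], of "f X" "g X"] c(4)[OF X Y] d(4)[OF X Y] by linarith
 qed
qed

lemma lipm_mult:
 assumes "lipm a b S f" "lipm b e S g" shows "lipm a e S (%X. f X * g X)"
proof -
 obtain c where c: "0 <= c" "!!X. X : S ==> f X : carrier_mat a b" "!!X. X : S ==> mn (f X) <= c"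
  "!!X Y. X : S ==> Y : S ==> mn (f X - f Y) <= c * mn (X - Y)" by (rule lipmE[OF assms(1)], rule that) (assumption | simp only:)+
 obtain d where d: "0 <= d" "!!X. X : S ==> g X : carrier_mat b e" "!!X. X : S ==> mn (g X) <= d"
  "!!X Y. X : S ==> Y : S ==> mn (g X - g Y) <= d * mn (X - Y)" by (rule lipmE[OF assms(2)], rule that) (assumption | simp only:)+
 show ?thesis proof (rule lipmI[of _ _ _ _ "c * d" "c * d + c * d"])
  fix X assume X: "X : S"
  have split: "U - W = (U - V) + (V - W)" if "U : carrier_mat a e" "V : carrier_mat a e" "W : carrier_mat a e" for U V W :: "real mat"
  using that by (intro eq_matI) auto
  show "f X * g X : carrier_mat a e" by (rule mult_carrier_mat[OF c(2)[OF X] d(2)[OF X]])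
  show "mn (f X * g X) <= c * d" by (rule order_trans[OF mn_mult[OF c(2)[OF X] d(2)[OF X]] mult_mono[OF c(3)[OF X] d(3)[OF X] c(1) mn_nonneg]])
  fix Y assume Y: "Y : S"
  have eq: "f X * g X - f Y * g Y = (f X - f Y) * g X + f Y * (g X - g Y)"
  unfolding minus_mult_distrib_mat[OF c(2)[OF X] c(2)[OF Y] d(2)[OF X]] mult_minus_distrib_mat[OF c(2)[OF Y] d(2)[OF X] d(2)[OF Y]]
  by (rule split[OF mult_carrier_mat[OF c(2)[OF X] d(2)[OF X]] mult_carrier_mat[OF c(2)[OF Y] d(2)[OF X]] mult_carrier_mat[OF c(2)[OF Y] d(2)[OF Y]]])
  have "mn ((f X - f Y) * g X) <= (c * mn (X - Y)) * d"
  by (rule order_trans[OF mn_mult[OF minus_carrier_mat[OF c(2)[OF Y]] d(2)[OF X]] mult_mono[OF c(4)[OF X Y] d(3)[OF X] mult_nonneg_nonneg[OF c(1) mn_nonneg] mn_nonneg]])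
  moreover have "mn (f Y * (g X - g Y)) <= c * (d * mn (X - Y))"
  by (rule order_trans[OF mn_mult[OF c(2)[OF Y] minus_carrier_mat[OF d(2)[OF Y]]] mult_mono[OF c(3)[OF Y] d(4)[OF X Y] c(1) mn_nonneg]])
  moreover have "mn (f X * g X - f Y * g Y) <= mn ((f X - f Y) * g X) + mn (f Y * (g X - g Y))"
  unfolding eq by (rule mn_add[OF mult_carrier_mat[OF minus_carrier_mat[OF c(2)[OF Y]] d(2)[OF X]] mult_carrier_mat[OF c(2)[OF Y] minus_carrier_mat[OF d(2)[OF Y]]]])
  ultimately show "mn (f X * g X - f Y * g Y) <= (c * d + c * d) * mn (X - Y)" by (simp add: algebra_simps)
 qed
qed

lemma lipm_minus:
 assumes "lipm a b S f" "lipm a b S g" shows "lipm a b S (%X. f X - g X)"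
proof -
 have g: "lipm a b S (%X. (- 1\<^sub>m a) * g X)" by (intro lipm_mult[OF lipm_const assms(2)]) simp
 have "lipm a b S (%X. f X + (- 1\<^sub>m a) * g X)" by (rule lipm_add[OF assms(1) g])
 moreover have "f X + (- 1\<^sub>m a) * g X = f X - g X" if "X : S" for X
  using assms that minus_add_uminus_mat[of "f X" a b "g X"] uminus_mult_left_mat[of "1\<^sub>m a" "g X"] by (auto simp: lipm_def)
 ultimately show ?thesis unfolding lipm_def by auto
qed

lemma lipm_continuous:
 assumes f: "lipm a b S f" and P: "!!t. t : U ==> P t : S" "!!X. X : S ==> X : carrier_mat k l"
  and c: "!!i j. i < k ==> j < l ==> continuous_on U (%t. P t $$ (i, j))" and ij: "i < a" "j < b" shows "continuous_on U (%t. f (P t) $$ (i, j))"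
proof -
 obtain c where cc: "0 <= c" "!!X. X : S ==> f X : carrier_mat a b" "!!X. X : S ==> mn (f X) <= c"
  "!!X Y. X : S ==> Y : S ==> mn (f X - f Y) <= c * mn (X - Y)" by (rule lipmE[OF f], rule that) (assumption | simp only:)+
 show ?thesis unfolding continuous_on_def proof
  fix t assume t: "t : U"
  show "((%t. f (P t) $$ (i, j)) \<longlongrightarrow> f (P t) $$ (i, j)) (at t within U)" proof (rule LIM_zero_cancel, rule Lim_null_comparison)
  show "\<forall>\<^sub>F s in at t within U. norm (f (P s) $$ (i, j) - f (P t) $$ (i, j)) <= c * (\<Sum>i<k. \<Sum>j<l. abs (P s $$ (i, j) - P t $$ (i, j)))"
  unfolding eventually_at_filter proof (intro always_eventually allI impI)
  fix s assume s: "s : U"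
  note car = cc(2)[OF P(1)[OF s]] cc(2)[OF P(1)[OF t]] P(2)[OF P(1)[OF s]] P(2)[OF P(1)[OF t]]
  have "mn (P s - P t) = (\<Sum>i<k. \<Sum>j<l. abs (P s $$ (i, j) - P t $$ (i, j)))" unfolding mn_def using car by auto
  then show "norm (f (P s) $$ (i, j) - f (P t) $$ (i, j)) <= c * (\<Sum>i<k. \<Sum>j<l. abs (P s $$ (i, j) - P t $$ (i, j)))"
  using mn_entry[of i "f (P s) - f (P t)" j] cc(4)[OF P(1)[OF s] P(1)[OF t]] car ij by auto
  qed
  have "((%s. c * (\<Sum>i<k. \<Sum>j<l. abs (P s $$ (i, j) - P t $$ (i, j)))) \<longlongrightarrow> c * (\<Sum>i<k. \<Sum>j<l. abs (P t $$ (i, j) - P t $$ (i, j)))) (at t within U)"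
  using c t by (intro tendsto_intros) (auto simp: continuous_on_def)
  then show "((%s. c * (\<Sum>i<k. \<Sum>j<l. abs (P s $$ (i, j) - P t $$ (i, j)))) \<longlongrightarrow> 0) (at t within U)" by simp
  qed
 qed
qed

section \<open>Inverses and quadratic forms of definite matrices\<close>

lemma minv_props:
 assumes X: "X : carrier_mat k k" and ker: "!!v. v : carrier_vec k ==> X *v v = 0v k ==> v = 0v k"
 shows "minv X : carrier_mat k k" "X * minv X = 1\<^sub>m k" "minv X * X = 1\<^sub>m k"
proof -
 have "det X ~= 0" using det_0_iff_vec_prod_zero_field[OF X] ker by blast
 from det_non_zero_imp_unit[OF X this, of "()"] mat_inverse(1)[OF X, of "()"] obtain Y where "mat_inverse X = Some Y" by (cases "mat_inverse X") auto
 then show "minv X : carrier_mat k k" "X * minv X = 1\<^sub>m k" "minv X * X = 1\<^sub>m k" using mat_inverse(2)[OF X] by auto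
qed

lemma pos_def_minv:
 assumes X: "pos_def k X" shows "minv X : carrier_mat k k" "X * minv X = 1\<^sub>m k" "minv X * X = 1\<^sub>m k" "tr (minv X) = minv X"
proof -
 have c: "X : carrier_mat k k" and s: "tr X = X" using X by (auto simp: pos_def_def)
 have "v = 0v k" if "v : carrier_vec k" "X *v v = 0v k" for v proof (rule ccontr)
  assume "v ~= 0v k"
  then have "0 < v *. (X *v v)" using X that(1) by (auto simp: pos_def_def)
  then show False using that by simp
 qed
 note * = minv_props[OF c this]
 show 1: "minv X : carrier_mat k k" "X * minv X = 1\<^sub>m k" "minv X * X = 1\<^sub>m k" using * by blast+
 have "tr (minv X) * X = 1\<^sub>m k" using transpose_mult[OF c 1(1)] by (simp add: s 1(2) transpose_one)
 then have "tr (minv X) * X * minv X = minv X" using 1(1) by simp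
 then show "tr (minv X) = minv X" using 1 c by (simp add: assoc_mult_mat[of _ k k X k _ k])
qed

lemma scalar_prod_transpose_mult:
 assumes "X : carrier_mat a b" "Y : carrier_mat a c" "v : carrier_vec b" "w : carrier_vec c"
 shows "v *. ((tr X * Y) *v w) = (X *v v) *. (Y *v (w :: real vec))"
proof -
 have "v *. ((tr X * Y) *v w) = v *. (tr X *v (Y *v w))" using assms by simp
 also have "... = (tr X *v (Y *v w)) *. v" using assms by (intro comm_scalar_prod[of _ b]) auto
 also have "... = (Y *v w) *. (X *v v)" using assms by (intro transpose_vec_mult_scalar) auto
 also have "... = (X *v v) *. (Y *v w)" using assms by (intro comm_scalar_prod[of _ a]) auto
 finally show ?thesis .
qed

lemma sp_sym:
 assumes "X : carrier_mat a a" "tr X = X" "v : carrier_vec a" "w : carrier_vec a" shows "v *. (X *v w) = w *. (X *v (v :: real vec))"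
 using scalar_prod_transpose_mult[of X a a "1\<^sub>m a" a v w] assms comm_scalar_prod[of "X *v v" a w] by simp

text \<open>Evaluate the nonnegative form at v + w and at v - w.\<close>

lemma pos_semidef_polar:
 assumes X: "pos_semidef k X" and v: "v : carrier_vec k" and w: "w : carrier_vec k" shows "2 * abs (v *. (X *v w)) <= v *. (X *v v) + w *. (X *v w)"
proof -
 have c: "X : carrier_mat k k" and s: "tr X = X"
  and p: "!!v. v : carrier_vec k ==> 0 <= v *. (X *v v)" using X by (auto simp: pos_semidef_def)
 note d = add_scalar_prod_distrib[of _ k] scalar_prod_add_distrib[of _ k] minus_scalar_prod_distrib[of _ k] scalar_prod_minus_distrib[of _ k]
 have sy: "w *. (X *v v) = v *. (X *v w)" by (rule sp_sym[OF c s w v])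
 have "0 <= (v + w) *. (X *v (v + w))" using v w by (intro p) simp
 also have "... = v *. (X *v v) + w *. (X *v w) + 2 * (v *. (X *v w))" using c v w sy by (simp add: d mult_add_distrib_mat_vec[OF c])
 finally have 1: "0 <= v *. (X *v v) + w *. (X *v w) + 2 * (v *. (X *v w))" .
 have "0 <= (v - w) *. (X *v (v - w))" using v w by (intro p) simp
 also have "... = v *. (X *v v) + w *. (X *v w) - 2 * (v *. (X *v w))" using c v w sy by (simp add: d mult_minus_distrib_mat_vec[OF c])
 finally show ?thesis using 1 by linarith
qed

lemma pd_imp_psd: "pos_def k X ==> pos_semidef k X"
 unfolding pos_def_def pos_semidef_def by (metis less_imp_le order.refl mult_mat_vec_carrier scalar_prod_left_zero)

lemma unit_vec_entry:
 assumes "X : carrier_mat k k" "i < k" "j < k" shows "unit_vec k i *. (X *v unit_vec k j) = (X $$ (i, j) :: real)"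
 using assms by (simp add: scalar_prod_left_unit[of _ k] scalar_prod_right_unit[of _ k])

text \<open>By polarization at unit vectors each entry is at most the trace in absolute value. A
  bound on the trace thus confines a semidefinite solution to a bounded set.\<close>

lemma pos_semidef_mn_le_trace:
 assumes X: "pos_semidef k X" shows "mn X <= real k * real k * (\<Sum>i<k. X $$ (i, i))"
proof -
 have c: "X : carrier_mat k k" and p: "!!v. v : carrier_vec k ==> 0 <= v *. (X *v v)" using X by (auto simp: pos_semidef_def)
 have d: "0 <= X $$ (i, i)" if "i < k" for i using p[of "unit_vec k i"] unit_vec_entry[OF c that that] by simp
 have t: "X $$ (i, i) <= (\<Sum>i<k. X $$ (i, i))" if "i < k" for i using that d by (intro member_le_sum) auto
 have "abs (X $$ (i, j)) <= (\<Sum>i<k. X $$ (i, i))" if ij: "i < k" "j < k" for i j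
  using pos_semidef_polar[OF X, of "unit_vec k i" "unit_vec k j"] ij t[OF ij(1)] t[OF ij(2)] by (simp add: unit_vec_entry[OF c])
 then have "(\<Sum>i<k. \<Sum>j<k. abs (X $$ (i, j))) <= (\<Sum>i<k. \<Sum>j<k. \<Sum>i<k. X $$ (i, i))" by (intro sum_mono) auto
 then show ?thesis using c by (simp add: mn_def)
qed

lemma trace_le_mn:
 assumes "X : carrier_mat k k" shows "(\<Sum>i<k. X $$ (i, i)) <= mn X" unfolding mn_def
proof -
 have "X $$ (i, i) <= (\<Sum>j<k. abs (X $$ (i, j)))" if "i < k" for i using member_le_sum[of i "{..<k}" "%j. abs (X $$ (i, j))"] that by auto
 then show "(\<Sum>i<k. X $$ (i, i)) <= (\<Sum>i<dim_row X. \<Sum>j<dim_col X. abs (X $$ (i, j)))" using assms by (auto intro!: sum_mono)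
qed

(* With y = R^-1 e_j one has x_j = x.(R y), which the form of R controls. *)
lemma minv_bound:
 assumes R: "pos_def k R" and G: "pos_def k G" and le: "!!v. v : carrier_vec k ==> v *. (R *v v) <= v *. (G *v v)"
 shows "mn (minv G) <= (\<Sum>j<k. \<Sum>i<k. minv R $$ (i, i) + minv R $$ (j, j))"
proof -
 note Ri = pos_def_minv[OF R] and Gi = pos_def_minv[OF G]
 have Rc: "R : carrier_mat k k" and Gc: "G : carrier_mat k k" and Rs: "tr R = R" using R G by (auto simp: pos_def_def)
 let ?e = "unit_vec k" let ?y = "%i. minv R *v unit_vec k i" let ?x = "%i. minv G *v unit_vec k i"
 have yc: "?y i : carrier_vec k" and xc: "?x i : carrier_vec k" for i using Ri(1) Gi(1) by auto
 have Ry: "R *v ?y i = ?e i" and Gx: "G *v ?x i = ?e i" for i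
  using assoc_mult_mat_vec[OF Rc Ri(1) unit_vec_carrier, of i] assoc_mult_mat_vec[OF Gc Gi(1) unit_vec_carrier, of i] by (simp_all add: Ri(2) Gi(2))
 have yy: "?y i *. (R *v ?y i) = minv R $$ (i, i)" if "i < k" for i
  unfolding Ry using that yc[of i] unit_vec_entry[OF Ri(1) that that] comm_scalar_prod[OF yc[of i], of "?e i"] by simp
 have pol: "2 * abs (?x i *. ?e j) <= ?x i *. (R *v ?x i) + minv R $$ (j, j)" if "j < k" for i j
  using pos_semidef_polar[OF pd_imp_psd[OF R] xc[of i] yc[of j]] unfolding yy[OF that] unfolding Ry .
 have xx: "?x i *. (R *v ?x i) <= minv R $$ (i, i)" if "i < k" for i using le[OF xc[of i]] pol[OF that, of i] unfolding Gx by linarith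
 have ent: "abs (minv G $$ (j, i)) <= minv R $$ (i, i) + minv R $$ (j, j)" if ij: "i < k" "j < k" for i j proof -
  have "minv G $$ (j, i) = ?x i *. ?e j" using unit_vec_entry[OF Gi(1) ij(2,1)] comm_scalar_prod[OF xc[of i], of "?e j"] by simp
  moreover have "0 <= minv R $$ (l, l)" if "l < k" for l using yy[OF that] pd_imp_psd[OF R] yc[of l] by (auto simp: pos_semidef_def)
  ultimately show ?thesis using pol[OF ij(2), of i] xx[OF ij(1)] ij by fastforce
 qed
 have "(\<Sum>i<k. \<Sum>j<k. abs (minv G $$ (i, j))) <= (\<Sum>j<k. \<Sum>i<k. minv R $$ (i, i) + minv R $$ (j, j))" by (intro sum_mono ent) auto
 then show ?thesis using Gi(1) by (simp only: mn_def carrier_matD)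
qed

text \<open>The difference of two inverses is the product of one inverse, the difference of the
  matrices and the other inverse; R bounds all the inverses uniformly.\<close>

lemma lipm_minv:
 assumes R: "pos_def k R" and f: "lipm k k S f" and pd: "!!X. X : S ==> pos_def k (f X)"
  and le: "!!X v. X : S ==> v : carrier_vec k ==> v *. (R *v v) <= v *. (f X *v v)" shows "lipm k k S (%X. minv (f X))"
proof -
 obtain c where c: "0 <= c" "!!X. X : S ==> f X : carrier_mat k k" "!!X. X : S ==> mn (f X) <= c"
  "!!X Y. X : S ==> Y : S ==> mn (f X - f Y) <= c * mn (X - Y)" by (rule lipmE[OF f], rule that) (assumption | simp only:)+
 define B where "B = (\<Sum>j<k. \<Sum>i<k. minv R $$ (i, i) + minv R $$ (j, j))"
 have B: "mn (minv (f X)) <= B" if "X : S" for X unfolding B_def by (rule minv_bound[OF R pd[OF that] le[OF that]])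
 show ?thesis proof (rule lipmI[of _ _ _ _ B "B * c * B"])
  fix X assume X: "X : S"
  note x = pos_def_minv[OF pd[OF X]] B[OF X]
  show "minv (f X) : carrier_mat k k" "mn (minv (f X)) <= B" using x by auto
  fix Y assume Y: "Y : S"
  note y = pos_def_minv[OF pd[OF Y]] B[OF Y]
  have B0: "0 <= B" using order_trans[OF mn_nonneg x(5)] .
  have "minv (f X) * (f Y - f X) * minv (f Y) = minv (f X) * f Y * minv (f Y) - minv (f X) * f X * minv (f Y)"
  using mult_minus_distrib_mat[OF x(1) c(2)[OF Y] c(2)[OF X]]
  minus_mult_distrib_mat[OF mult_carrier_mat[OF x(1) c(2)[OF Y]] mult_carrier_mat[OF x(1) c(2)[OF X]] y(1)] by simp
  also have "... = minv (f X) - minv (f Y)" using x y assoc_mult_mat[OF x(1) c(2)[OF Y] y(1)] by simp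
  finally have eq: "minv (f X) - minv (f Y) = minv (f X) * (f Y - f X) * minv (f Y)" ..
  have "mn (minv (f X) * (f Y - f X) * minv (f Y)) <= mn (minv (f X) * (f Y - f X)) * mn (minv (f Y))"
  by (rule mn_mult[OF mult_carrier_mat[OF x(1) minus_carrier_mat[OF c(2)[OF X]]] y(1)])
  also have "... <= (mn (minv (f X)) * mn (f Y - f X)) * mn (minv (f Y))"
  by (rule mult_right_mono[OF mn_mult[OF x(1) minus_carrier_mat[OF c(2)[OF X]]] mn_nonneg])
  also have "mn (f Y - f X) = mn (f X - f Y)" unfolding mn_def using c(2)[OF X] c(2)[OF Y] by (auto simp: abs_minus_commute intro!: sum.cong)
  also have "mn (minv (f X)) * mn (f X - f Y) * mn (minv (f Y)) <= (B * (c * mn (X - Y))) * B"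
  by (intro mult_mono x(5) y(5) c(4)[OF X Y] B0 mn_nonneg mult_nonneg_nonneg c(1))
  finally show "mn (minv (f X) - minv (f Y)) <= B * c * B * mn (X - Y)" unfolding eq by (simp add: mult_ac)
 qed
qed

(* carrier_matD as a conditional simplification rule would loop with carrier_mat_iff. *)
declare carrier_matD[simp del] carrier_vecD[simp del]

lemma carrier_mat_iff[simp]: "X : carrier_mat a b \<longleftrightarrow> dim_row X = a & dim_col X = b"
 and carrier_vec_iff[simp]: "v : carrier_vec a \<longleftrightarrow> dim_vec v = a" by (auto simp: carrier_mat_def carrier_vec_def)

(* The ring laws of matrices with equations between dimensions as premises, which the simplifier can discharge. *)
lemma mat_laws:
 fixes X Y :: "real mat" and v w z :: "real vec" shows "dim_row Y = dim_col X ==> dim_vec v = dim_col Y ==> (X * Y) *v v = X *v (Y *v v)"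
  and "dim_row X = dim_row Y ==> dim_col X = dim_col Y ==> dim_vec v = dim_col Y ==> (X + Y) *v v = X *v v + Y *v v"
  and "dim_row X = dim_row Y ==> dim_col X = dim_col Y ==> dim_vec v = dim_col Y ==> (X - Y) *v v = X *v v - Y *v v"
  and "dim_vec v = dim_col X ==> (k \<cdot>\<^sub>m X) *v v = k \<cdot>\<^sub>v (X *v v)"
  and "dim_vec v = dim_col X ==> (- X) *v v = - (X *v v)"
  and "dim_vec v = dim_col X ==> dim_vec w = dim_col X ==> X *v (v + w) = X *v v + X *v w"
  and "dim_vec v = dim_col X ==> dim_vec w = dim_col X ==> X *v (v - w) = X *v v - X *v w"
  and "dim_vec v = dim_col X ==> X *v (k \<cdot>\<^sub>v v) = k \<cdot>\<^sub>v (X *v v)"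
  and "dim_vec v = dim_col X ==> X *v (- v) = - (X *v v)"
 subgoal by (rule assoc_mult_mat_vec[of X "dim_row X" "dim_col X" Y "dim_col Y"]) auto
 subgoal by (rule add_mult_distrib_mat_vec[of X "dim_row Y" "dim_col Y"]) auto
 subgoal by (rule minus_mult_distrib_mat_vec[of X "dim_row Y" "dim_col Y"]) auto
 subgoal by (intro eq_vecI) (auto simp: scalar_prod_def sum_distrib_left mult.assoc)
 subgoal by (rule uminus_mult_mat_vec)
 subgoal by (rule mult_add_distrib_mat_vec[of X "dim_row X" "dim_col X"]) auto
 subgoal by (rule mult_minus_distrib_mat_vec[of X "dim_row X" "dim_col X"]) auto
 subgoal by (rule mult_mat_vec[of X "dim_row X" "dim_col X"]) auto
 subgoal by (intro eq_vecI) (auto simp: scalar_prod_def sum_negf)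
 done

lemma scalar_laws:
 fixes v w z :: "real vec" shows "dim_vec v = dim_vec z ==> dim_vec w = dim_vec z ==> (v + w) *. z = v *. z + w *. z"
  and "dim_vec v = dim_vec z ==> dim_vec w = dim_vec z ==> (v - w) *. z = v *. z - w *. z"
  and "dim_vec v = dim_vec z ==> (- v) *. z = - (v *. z)"
  and "dim_vec v = dim_vec z ==> (k \<cdot>\<^sub>v v) *. z = k * (v *. z)"
  and "dim_vec v = dim_vec z ==> dim_vec w = dim_vec z ==> z *. (v + w) = z *. v + z *. w"
  and "dim_vec v = dim_vec z ==> dim_vec w = dim_vec z ==> z *. (v - w) = z *. v - z *. w"
  and "dim_vec v = dim_vec z ==> z *. (- v) = - (z *. v)"
  and "dim_vec v = dim_vec z ==> z *. (k \<cdot>\<^sub>v v) = k * (z *. v)"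
 by (simp_all add: scalar_prod_def sum.distrib sum_subtractf sum_negf sum_distrib_left algebra_simps)

lemma scalar_prod_commute: "dim_vec v = dim_vec w ==> v *. w = w *. (v :: real vec)" by (rule comm_scalar_prod[of _ "dim_vec v"]) auto

lemma sp_tr:
 assumes "dim_vec v = dim_col X" "dim_vec w = dim_row X" shows "v *. (tr X *v w) = (X *v v) *. (w :: real vec)"
 using transpose_vec_mult_scalar[of X "dim_row X" "dim_col X" v w] assms scalar_prod_commute[of v "tr X *v w"] scalar_prod_commute[of w "X *v v"]
 by simp

lemma transpose_laws:
 fixes X Y :: "real mat" shows "dim_row Y = dim_col X ==> tr (X * Y) = tr Y * tr X"
  and "dim_row X = dim_row Y ==> dim_col X = dim_col Y ==> tr (X + Y) = tr X + tr Y"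
  and "dim_row X = dim_row Y ==> dim_col X = dim_col Y ==> tr (X - Y) = tr X - tr Y"
  and "tr (k \<cdot>\<^sub>m X) = k \<cdot>\<^sub>m tr X"
 subgoal by (rule transpose_mult[of X "dim_row X" "dim_col X" Y "dim_col Y"]) auto
 subgoal by (rule transpose_add[of X "dim_row Y" "dim_col Y"]) auto
 subgoal by (rule transpose_minus[of X "dim_row Y" "dim_col Y"]) auto
 subgoal by (intro eq_matI) auto
 done

lemma mat_assoc: "dim_row Y = dim_col X ==> dim_row Z = dim_col Y ==> (X * Y) * Z = X * (Y * (Z :: real mat))"
 by (rule assoc_mult_mat[of _ "dim_row X" "dim_col X" _ "dim_col Y" _ "dim_col Z"]) auto

section \<open>The Riccati equation\<close>

locale riccati =
 fixes h r :: nat and A C B D Q R :: "real mat"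
 assumes A[simp]: "A : carrier_mat h h" and C[simp]: "C : carrier_mat h h"
  and B[simp]: "B : carrier_mat h r" and D[simp]: "D : carrier_mat h r"
  and Q: "pos_semidef h Q" and R: "pos_def r R"
begin

definition G where "G P = R + tr D * (P * D)"
definition L where "L P = tr B * P + tr D * (P * C)"
definition gain where "gain P = minv (G P) * L P"
definition AG where "AG P = A - B * gain P"
definition CG where "CG P = C - D * gain P"
text \<open>The closed-loop form of the Riccati expression: besides the two terms linear in
  \<open>AG P\<close> and the weight Q it consists of congruences of P and R, whose semidefiniteness
  is visible.\<close>

definition ric where
 "ric P = tr (AG P) * P + P * AG P + tr (CG P) * (P * CG P) + Q + tr (gain P) * (R * gain P)"
text \<open>This second-order term completes the two linear ones to the congruence of P by 1 + d
  \<open>AG P\<close>, so that an Euler step preserves semidefiniteness for every d >= 0.\<close>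

definition err where "err P = tr (AG P) * (P * AG P)"
definition step where "step d P = P + d \<cdot>\<^sub>m ric P + d^2 \<cdot>\<^sub>m err P"

lemma dims[simp]: "dim_row A = h" "dim_col A = h" "dim_row C = h" "dim_col C = h" "dim_row B = h" "dim_col B = r"
 "dim_row D = h" "dim_col D = r" "dim_row Q = h" "dim_col Q = h" "dim_row R = r" "dim_col R = r"
 and QR: "tr Q = Q" "tr R = R" using A B C D Q R by (auto simp: pos_semidef_def pos_def_def)

lemma quad_R: "dim_vec v = r ==> 0 <= v *. (R *v v)" and quad_Q: "dim_vec w = h ==> 0 <= w *. (Q *v w)"
 using pd_imp_psd[OF R] Q by (auto simp: pos_semidef_def)

context
 fixes P assumes P: "pos_semidef h P"
begin

lemma Pd[simp]: "dim_row P = h" "dim_col P = h" and Ps: "tr P = P" using P by (auto simp: pos_semidef_def)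

lemma quad_P: "dim_vec v = h ==> 0 <= v *. (P *v v)" using P by (auto simp: pos_semidef_def)

lemma sym_P: "dim_vec v = h ==> dim_vec w = h ==> v *. (P *v w) = w *. (P *v v)" using sp_sym[of P h v w] Ps by simp

lemma GL_dims[simp]: "dim_row (G P) = r" "dim_col (G P) = r" "dim_row (L P) = r" "dim_col (L P) = h" by (simp_all add: G_def L_def)

lemma quad_G: "dim_vec v = r ==> dim_vec w = r ==> v *. (G P *v w) = v *. (R *v w) + (D *v v) *. (P *v (D *v w))"
 by (simp add: G_def mat_laws scalar_laws sp_tr)

lemma quad_L: "dim_vec v = r ==> dim_vec w = h ==> v *. (L P *v w) = (B *v v) *. (P *v w) + (D *v v) *. (P *v (C *v w))"
 by (simp add: L_def mat_laws scalar_laws sp_tr)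

lemma G_ge: "dim_vec v = r ==> v *. (R *v v) <= v *. (G P *v v)" using quad_P[of "D *v v"] by (simp add: quad_G)

lemma G_pos_def: "pos_def r (G P)" unfolding pos_def_def
proof (intro conjI ballI impI)
 show "tr (G P) = G P" by (simp add: G_def transpose_laws QR Ps mat_assoc)
 fix v :: "real vec" assume v: "v : carrier_vec r" "v ~= 0v r"
 then have "0 < v *. (R *v v)" using R by (auto simp: pos_def_def)
 then show "0 < v *. (G P *v v)" using G_ge[of v] v by simp
qed simp

lemma gain_dims[simp]: "dim_row (gain P) = r" "dim_col (gain P) = h"
 and G_gain: "G P * gain P = L P" using pos_def_minv[OF G_pos_def] mat_assoc[of "minv (G P)" "G P" "L P"] by (auto simp: gain_def)

lemma AG_dims[simp]: "dim_row (AG P) = h" "dim_col (AG P) = h" "dim_row (CG P) = h" "dim_col (CG P) = h" by (simp_all add: AG_def CG_def)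

lemma ric_dims[simp]: "dim_row (ric P) = h" "dim_col (ric P) = h" "dim_row (err P) = h" "dim_col (err P) = h" by (simp_all add: ric_def err_def)

lemma quad_ric:
 assumes v[simp]: "dim_vec v = h" shows "v *. (ric P *v v) = 2 * ((AG P *v v) *. (P *v v)) + (CG P *v v) *. (P *v (CG P *v v))
  + v *. (Q *v v) + (gain P *v v) *. (R *v (gain P *v v))"
 using sym_P[of v "AG P *v v"] by (simp add: ric_def mat_laws scalar_laws sp_tr)

lemma quad_err: "dim_vec v = h ==> v *. (err P *v v) = (AG P *v v) *. (P *v (AG P *v v))"
 by (simp add: err_def mat_laws scalar_laws sp_tr)

lemma symmetric_err: "tr (err P) = err P" by (simp add: err_def transpose_laws Ps mat_assoc)

lemma symmetric_ric: "tr (ric P) = ric P"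
proof -
 have "tr (ric P) = P * AG P + tr (AG P) * P + tr (CG P) * (P * CG P) + Q + tr (gain P) * (R * gain P)"
  by (simp add: ric_def transpose_laws QR Ps mat_assoc)
 also have "P * AG P + tr (AG P) * P = tr (AG P) * P + P * AG P" by (rule comm_add_mat[of _ h h]) simp_all
 finally show ?thesis by (simp only: ric_def)
qed

lemma step_pos_semidef:
 assumes d: "0 <= d" shows "pos_semidef h (step d P)" unfolding pos_semidef_def
proof (intro conjI ballI)
 show "step d P : carrier_mat h h" by (simp add: step_def)
 show "tr (step d P) = step d P" by (simp add: step_def transpose_laws symmetric_ric symmetric_err Ps)
 fix v :: "real vec" assume "v : carrier_vec h"
 then have v[simp]: "dim_vec v = h" by simp
 let ?a = "AG P *v v"
 have "(v + d \<cdot>\<^sub>v ?a) *. (P *v (v + d \<cdot>\<^sub>v ?a)) = v *. (P *v v) + 2 * d * (?a *. (P *v v)) + d^2 * (?a *. (P *v ?a))"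
  using sym_P[of v ?a] by (simp add: mat_laws scalar_laws power2_eq_square algebra_simps)
 moreover have "v *. (step d P *v v) = v *. (P *v v) + d * (v *. (ric P *v v)) + d^2 * (v *. (err P *v v))"
  by (simp add: step_def mat_laws scalar_laws)
 ultimately have "v *. (step d P *v v) = (v + d \<cdot>\<^sub>v ?a) *. (P *v (v + d \<cdot>\<^sub>v ?a))
  + d * ((CG P *v v) *. (P *v (CG P *v v)) + v *. (Q *v v) + (gain P *v v) *. (R *v (gain P *v v)))" by (simp add: quad_ric quad_err distrib_left)
 then show "0 <= v *. (step d P *v v)"
  using quad_P[of "v + d \<cdot>\<^sub>v ?a"] quad_P[of "CG P *v v"] quad_Q[OF v] quad_R[of "gain P *v v"] d by simp
qed

(* Completing the square: the optimal gain does not increase the right-hand side above its value for zero gain. *)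
lemma quad_ric_le:
 assumes v[simp]: "dim_vec v = h" shows "v *. (ric P *v v) <= 2 * ((A *v v) *. (P *v v)) + (C *v v) *. (P *v (C *v v)) + v *. (Q *v v)"
proof -
 let ?y = "gain P *v v"
 have Gy: "G P *v ?y = L P *v v" by (simp add: mat_laws(1)[symmetric] G_gain)
 have AGv: "AG P *v v = A *v v - B *v ?y" and CGv: "CG P *v v = C *v v - D *v ?y" by (simp_all add: AG_def CG_def mat_laws)
 have "v *. (ric P *v v) = 2 * ((A *v v) *. (P *v v)) + (C *v v) *. (P *v (C *v v)) + v *. (Q *v v)
  - 2 * (?y *. (L P *v v)) + ?y *. (G P *v ?y)" using sym_P[of "C *v v" "D *v ?y"] by (simp add: quad_ric quad_L quad_G AGv CGv mat_laws scalar_laws)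
 then show ?thesis using G_ge[of ?y] quad_R[of ?y] by (simp add: Gy)
qed

text \<open>Linear growth in P of the trace is the a priori bound that prevents the quadratic
  equation from blowing up.\<close>

lemma trace_ric_le: "(\<Sum>i<h. ric P $$ (i, i)) <= (2 * mn A + mn C * mn C) * mn P + mn Q"
proof -
 let ?Z = "tr A * P + tr A * P + tr C * (P * C) + Q"
 have "ric P $$ (i, i) <= ?Z $$ (i, i)" if i: "i < h" for i proof -
  let ?e = "unit_vec h i :: real vec"
  have "?e *. (?Z *v ?e) = 2 * ((A *v ?e) *. (P *v ?e)) + (C *v ?e) *. (P *v (C *v ?e)) + ?e *. (Q *v ?e)"
  by (simp add: mat_laws scalar_laws sp_tr del: scalar_prod_left_unit scalar_prod_right_unit)
  then have "?e *. (ric P *v ?e) <= ?e *. (?Z *v ?e)" using quad_ric_le[of ?e] by simp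
  then show ?thesis using unit_vec_entry[of "ric P" h i i] unit_vec_entry[of ?Z h i i] i by simp
 qed
 then have "(\<Sum>i<h. ric P $$ (i, i)) <= (\<Sum>i<h. ?Z $$ (i, i))" by (intro sum_mono) auto
 also have "... <= mn ?Z" by (rule trace_le_mn) simp
 also have "... <= mn A * mn P + mn A * mn P + mn C * (mn P * mn C) + mn Q" proof -
  have 1: "mn (tr A * P) <= mn A * mn P" using mn_mult[of "tr A" h h P h] by (simp add: mn_transpose)
  have 2: "mn (tr C * (P * C)) <= mn C * (mn P * mn C)"
  using order_trans[OF mn_mult[of "tr C" h h "P * C" h] mult_left_mono[OF mn_mult[of P h h C h] mn_nonneg]] by (simp add: mn_transpose)
  have "mn ?Z <= mn (tr A * P) + mn (tr A * P) + mn (tr C * (P * C)) + mn Q" using mn_add[of "tr A * P + tr A * P + tr C * (P * C)" h h Q]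
  mn_add[of "tr A * P + tr A * P" h h "tr C * (P * C)"] mn_add[of "tr A * P" h h "tr A * P"] by simp
  then show ?thesis using 1 2 by linarith
 qed
 finally show ?thesis by (simp add: algebra_simps)
qed

end

text \<open>On such a set \<open>gain\<close> and \<open>ric\<close> are bounded and Lipschitz: R
  bounds \<open>G P\<close> from below and hence its inverse from above.\<close>

definition K where "K b = {P. pos_semidef h P & mn P <= b}"

lemma lipm_K:
 "lipm r h (K b) gain" "lipm h h (K b) ric" "lipm h h (K b) err"
proof -
 have id: "lipm h h (K b) (%P. P)" by (rule lipm_id[of _ h h b]) (simp only: K_def pos_semidef_def mem_Collect_eq)
 have c: "lipm r h (K b) (%P. tr D)" "lipm r h (K b) (%P. tr B)" "lipm h r (K b) (%P. D)" "lipm h r (K b) (%P. B)"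
  "lipm h h (K b) (%P. A)" "lipm h h (K b) (%P. C)" "lipm r r (K b) (%P. R)" by (rule lipm_const; simp)+
 have G: "lipm r r (K b) G" unfolding G_def[abs_def] by (rule lipm_add[OF c(7) lipm_mult[OF c(1) lipm_mult[OF id c(3)]]])
 have L: "lipm r h (K b) L" unfolding L_def[abs_def] by (rule lipm_add[OF lipm_mult[OF c(2) id] lipm_mult[OF c(1) lipm_mult[OF id c(6)]]])
 have "lipm r r (K b) (%P. minv (G P))" by (rule lipm_minv[OF R G]) (auto simp: K_def G_pos_def G_ge)
 then show g: "lipm r h (K b) gain" unfolding gain_def[abs_def] by (rule lipm_mult[OF _ L])
 have A: "lipm h h (K b) AG" and C: "lipm h h (K b) CG" unfolding AG_def[abs_def] CG_def[abs_def]
  by (rule lipm_minus[OF c(5) lipm_mult[OF c(4) g]] lipm_minus[OF c(6) lipm_mult[OF c(3) g]])+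
 have PA: "lipm h h (K b) (%P. P * AG P)" and PC: "lipm h h (K b) (%P. P * CG P)" by (rule lipm_mult[OF id A] lipm_mult[OF id C])+
 show "lipm h h (K b) err" unfolding err_def[abs_def] by (rule lipm_mult[OF lipm_transpose[OF A] PA])
 have Rg: "lipm r h (K b) (%P. R * gain P)" by (rule lipm_mult[OF lipm_const g]) simp
 have Qc: "lipm h h (K b) (%P. Q)" by (rule lipm_const) simp
 show "lipm h h (K b) ric" unfolding ric_def[abs_def]
  by (rule lipm_add lipm_mult[OF lipm_transpose[OF A] id] PA lipm_mult[OF lipm_transpose[OF C] PC] Qc lipm_mult[OF lipm_transpose[OF g] Rg])+
qed

end

context riccati
begin

lemma trace_nonneg: "pos_semidef h P ==> 0 <= (\<Sum>i<h. P $$ (i, i))"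
proof (rule sum_nonneg)
 fix i assume P: "pos_semidef h P" and "i : {..<h}"
 then show "0 <= P $$ (i, i)" using unit_vec_entry[of P h i i] quad_P[OF P, of "unit_vec h i"] by (simp add: Pd[OF P])
qed

lemma step_dims: "pos_semidef h P ==> dim_row (step d P) = h" "pos_semidef h P ==> dim_col (step d P) = h" by (simp_all add: step_def)

lemma step_entry:
 assumes P: "pos_semidef h P" and "i < h" "j < h" shows "step d P $$ (i, j) = P $$ (i, j) + d * ric P $$ (i, j) + d^2 * err P $$ (i, j)"
 using assms by (simp add: step_def Pd[OF P] ric_dims[OF P])

text \<open>A discrete Gronwall argument for 1 + trace confines the iterates to one set
  \<open>K b\<close>, uniformly in the step size.\<close>

lemma step_iterates:
 assumes H: "pos_semidef h H" and T: "0 <= T" shows "EX b e. 0 < e & (ALL d k. 0 < d --> d <= e --> real k * d <= T --> (step d ^^ k) H : K b)"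
proof -
 define c where "c = 2 * mn A + mn C * mn C"
 define w where "w = c * (real h * real h) + mn Q + 1"
 define tr where "tr P = (\<Sum>i<h. P $$ (i, i))" for P :: "real mat"
 have c0: "0 <= c" unfolding c_def using mn_nonneg by simp
 have w: "0 <= w" using c0 mn_nonneg[of Q] by (simp add: w_def)
 have tr0: "0 <= tr P" if "pos_semidef h P" for P unfolding tr_def by (rule trace_nonneg[OF that])
 define M where "M = (1 + tr H) * exp (w * T)"
 define b where "b = real h * real h * M"
 obtain ce where ce: "0 <= ce" "!!X. X : K b ==> mn (err X) <= ce" using lipm_K(3)[of b] by (rule lipmE) (rule that)
 \<comment> \<open>The growth rate w has to be fixed before b. The bound ce of the second-order term
   depends on b and is therefore absorbed by the step size: d (ce + 1) <= 1, which costs only the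
   summand 1 in w.\<close>
 define e where "e = 1 / (ce + 1)"
 have e: "0 < e" using ce(1) by (simp add: e_def)
 have "(step d ^^ k) H : K b & 1 + tr ((step d ^^ k) H) <= (1 + tr H) * exp (w * d * real k)"
  if d: "0 < d" "d <= e" and "real k * d <= T" for d k using that(3) proof (induction k)
  case 0
  have "tr H <= M" proof -
  have "(1 + tr H) * 1 <= M" unfolding M_def using w T tr0[OF H] by (intro mult_left_mono) auto
  then show ?thesis by simp
  qed
  then have "mn H <= b" using pos_semidef_mn_le_trace[OF H] mult_left_mono[of "tr H" M "real h * real h"] by (simp add: b_def tr_def)
  then show ?case using H by (simp add: K_def)
 next
  case (Suc k)
  let ?P = "(step d ^^ k) H"
  have "real k * d <= T" using Suc.prems d by (simp add: algebra_simps)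
  note IH = Suc.IH[OF this]
  have P: "pos_semidef h ?P" using IH by (simp add: K_def)
  have ps: "pos_semidef h (step d ?P)" by (rule step_pos_semidef[OF P]) (use d in simp)
  have "tr (step d ?P) = tr ?P + d * (\<Sum>i<h. ric ?P $$ (i, i)) + d^2 * (\<Sum>i<h. err ?P $$ (i, i))"
  unfolding tr_def using step_entry[OF P] by (simp add: sum.distrib sum_distrib_left)
  also have "... <= tr ?P + d * (c * (real h * real h * tr ?P) + mn Q) + d * 1" proof (intro add_mono mult_left_mono order.refl)
  show "(\<Sum>i<h. ric ?P $$ (i, i)) <= c * (real h * real h * tr ?P) + mn Q"
  using trace_ric_le[OF P] mult_left_mono[OF pos_semidef_mn_le_trace[OF P] c0] unfolding c_def tr_def by linarith
  have "(\<Sum>i<h. err ?P $$ (i, i)) <= ce" by (rule order_trans[OF trace_le_mn ce(2)]) (use IH in "simp_all add: ric_dims[OF P]")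
  then have "d * (\<Sum>i<h. err ?P $$ (i, i)) <= e * (ce + 1)"
  using d ce(1) by (intro order_trans[OF mult_left_mono[of _ "ce + 1" d] mult_right_mono]) auto
  also have "... = 1" using ce(1) by (simp add: e_def)
  finally show "d^2 * (\<Sum>i<h. err ?P $$ (i, i)) <= d * 1" unfolding power2_eq_square mult.assoc using d by (intro mult_left_mono) auto
  qed (use d in auto)
  also have "... <= tr ?P + d * (w * (1 + tr ?P))" proof -
  have "0 <= c * (real h * real h) + (mn Q * tr ?P + tr ?P)" using c0 mn_nonneg[of Q] tr0[OF P] by simp
  then have "c * (real h * real h * tr ?P) + mn Q + 1 <= w * (1 + tr ?P)" by (simp add: w_def algebra_simps)
  from mult_left_mono[OF this, of d] d show ?thesis by (simp add: algebra_simps)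
  qed
  finally have "1 + tr (step d ?P) <= (1 + w * d) * (1 + tr ?P)" by (simp add: algebra_simps)
  also have "... <= exp (w * d) * ((1 + tr H) * exp (w * d * real k))"
  using IH w d tr0[OF P] exp_ge_add_one_self[of "w * d"] by (intro mult_mono) auto
  also have "... = (1 + tr H) * exp (w * d * real (Suc k))" by (simp add: exp_add[symmetric] algebra_simps)
  finally have 1: "1 + tr (step d ?P) <= (1 + tr H) * exp (w * d * real (Suc k))" .
  also have "... <= M" unfolding M_def using mult_left_mono[OF Suc.prems w] tr0[OF H] by (intro mult_left_mono) (auto simp: mult_ac)
  finally have "mn (step d ?P) <= b"
  using pos_semidef_mn_le_trace[OF ps] mult_left_mono[of "tr (step d ?P)" M "real h * real h"] by (simp add: b_def tr_def)
  then show ?case using ps 1 by (simp add: K_def)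
 qed
 then show ?thesis using e by (intro exI[of _ b] exI[of _ e]) simp
qed

lemma riccati_exists:
 assumes H: "pos_semidef h H" and T: "0 < T" shows "EX P. (ALL t:{0..T}. pos_semidef h (P t)) & P T = H &
  (ALL i<h. ALL j<h. ALL t:{0..T}. ((%t. P t $$ (i, j)) has_real_derivative - ric (P t) $$ (i, j)) (at t within {0..T})) &
  (ALL i<h. ALL j<h. continuous_on {0..T} (%t. ric (P t) $$ (i, j))) &
  (ALL i<r. ALL j<h. continuous_on {0..T} (%t. gain (P t) $$ (i, j)))"
proof -
 from step_iterates[OF H less_imp_le[OF T]] obtain b w
  where *: "0 < w & (ALL e k. 0 < e --> e <= w --> real k * e <= T --> (step e ^^ k) H : K b)" by (elim exE)
 then have w: "0 < w" by (rule conjunct1)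
 have it: "(step e ^^ k) H : K b" if "0 < e" "e <= w" "real k * e <= T" for e k using conjunct2[OF *, rule_format, OF that] .
 let ?m = "%x :: nat \<times> nat => real. mat h h x"
 let ?I = "{..<h} \<times> {..<h}"
 define F where "F x = (%ij. ric (?m x) $$ ij)" for x
 define E where "E x = (%ij. err (?m x) $$ ij)" for x
 define S where "S = {x. ?m x : K b}"
 have KD: "pos_semidef h P" "mn P <= b" "dim_row P = h" "dim_col P = h" if "P : K b" for P proof -
  show P: "pos_semidef h P" "mn P <= b" using that by (simp_all only: K_def mem_Collect_eq)
  show "dim_row P = h" "dim_col P = h" by (rule Pd[OF P(1)])+
 qed
 have KS: "pos_semidef h (?m x)" if "x : S" for x using that KD(1) by (simp add: S_def)
 obtain c1 where c1: "0 <= c1" "!!X. X : K b ==> mn (ric X) <= c1"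
  "!!X Y. X : K b ==> Y : K b ==> mn (ric X - ric Y) <= c1 * mn (X - Y)" using lipm_K(2)[of b] by (rule lipmE) (rule that)
 obtain c2 where c2: "0 <= c2" "!!X. X : K b ==> mn (err X) <= c2" using lipm_K(3)[of b] by (rule lipmE) (rule that)
 have sum_mn: "(\<Sum>ij\<in>?I. abs (X $$ ij)) = mn X" if "dim_row X = h" "dim_col X = h" for X
  using that by (simp add: mn_def sum.cartesian_product)
 have sum_mn2: "(\<Sum>ij\<in>?I. abs (X $$ ij - Y $$ ij)) = mn (X - Y)" if "dim_row X = h" "dim_col X = h" "dim_row Y = h" "dim_col Y = h" for X Y
  unfolding mn_def sum.cartesian_product using that by (auto intro!: sum.cong)
 have iter: "?m (((%x ij. x ij + e * F x ij + e^2 * E x ij) ^^ k) (%ij. H $$ ij)) = (step e ^^ k) H"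
  if e: "0 < e" "e <= w" and "real k * e <= T" for e k using that(3) proof (induction k)
  case 0
  show ?case using Pd[OF H] by (intro eq_matI) auto
 next
  case (Suc k)
  have "real k * e <= T" using Suc.prems e by (simp add: algebra_simps)
  note IH = Suc.IH[OF this] and P = KD(1)[OF it[OF e this]]
  show ?case proof (rule eq_matI)
  fix i j assume "i < dim_row ((step e ^^ Suc k) H)" "j < dim_col ((step e ^^ Suc k) H)"
  then have ij: "i < h" "j < h" using step_dims[OF P] by auto
  let ?x = "((%x ij. x ij + e * F x ij + e^2 * E x ij) ^^ k) (%ij. H $$ ij)"
  have FE: "F ?x (i, j) = ric ((step e ^^ k) H) $$ (i, j)" "E ?x (i, j) = err ((step e ^^ k) H) $$ (i, j)"
  by (simp_all only: F_def[of ?x] E_def[of ?x] IH)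
  have "?x (i, j) = (step e ^^ k) H $$ (i, j)" using ij unfolding IH[symmetric] by simp
  then show "?m (((%x ij. x ij + e * F x ij + e^2 * E x ij) ^^ Suc k) (%ij. H $$ ij)) $$ (i, j) = (step e ^^ Suc k) H $$ (i, j)"
  using ij step_entry[OF P ij] by (simp add: FE)
  qed (use step_dims[OF P] in auto)
 qed
 have "EX y. (ALL ij:?I. y 0 ij = H $$ ij) & (ALL t:{0..T}. y t : S & (ALL ij:?I. ((%s. y s ij) has_real_derivative F (y t) ij) (at t within {0..T})))"
 proof (rule euler_ode[where E = E and aa = w and c = "c1 + c2"])
  show "finite ?I" "0 < T" "0 < w" "0 <= c1 + c2" using T w c1(1) c2(1) by auto
  show "((%x i. x i + e * F x i + e^2 * E x i) ^^ k) (($$) H) : S" if "0 < e" "e <= w" "real k * e <= T" for e k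
  using iter[OF that] it[OF that] by (simp add: S_def)
  fix x assume x: "x : S"
  then have xK: "?m x : K b" by (simp add: S_def)
  show "(\<Sum>i\<in>?I. abs (F x i)) <= c1 + c2" "(\<Sum>i\<in>?I. abs (E x i)) <= c1 + c2"
  unfolding F_def E_def using c1(1) c2(1) c1(2)[OF xK] c2(2)[OF xK] sum_mn ric_dims[OF KS[OF x]] by simp_all
  fix y assume y: "y : S"
  then have yK: "?m y : K b" by (simp add: S_def)
  have "(\<Sum>i\<in>?I. abs (F x i - F y i)) <= c1 * mn (?m x - ?m y)"
  unfolding F_def using sum_mn2[of "ric (?m x)" "ric (?m y)"] c1(3)[OF xK yK] ric_dims[OF KS[OF x]] ric_dims[OF KS[OF y]] by simp
  also have "mn (?m x - ?m y) = (\<Sum>i\<in>?I. abs (x i - y i))" using sum_mn2[of "?m x" "?m y", symmetric] by (simp, intro sum.cong, auto)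
  also have "c1 * (\<Sum>i\<in>?I. abs (x i - y i)) <= (c1 + c2) * (\<Sum>i\<in>?I. abs (x i - y i))"
  using c2(1) by (intro mult_right_mono sum_nonneg) auto
  finally show "(\<Sum>i\<in>?I. abs (F x i - F y i)) <= (c1 + c2) * (\<Sum>i\<in>?I. abs (x i - y i))" .
 next
  fix G and f :: "nat => nat \<times> nat => real" and x
  assume G: "G ~= bot" and f: "!!j. f j : S" and l: "!!i. i : ?I ==> ((%j. f j i) \<longlongrightarrow> x i) G"
  have fK: "?m (f j) : K b" for j using f by (simp add: S_def)
  have "mn (?m x) <= b" proof (rule tendsto_upperbound[OF _ _ G])
  show "((%j. mn (?m (f j))) \<longlongrightarrow> mn (?m x)) G" unfolding mn_def using l by (auto intro!: tendsto_intros)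
  qed (use KD(2)[OF fK] in simp)
  moreover have "pos_semidef h (?m x)" unfolding pos_semidef_def proof (intro conjI ballI)
  show "tr (?m x) = ?m x" proof (rule eq_matI)
  fix i j assume ij: "i < dim_row (?m x)" "j < dim_col (?m x)"
  have "f n (i, j) = f n (j, i)" for n using Ps[OF KD(1)[OF fK[of n]]] ij index_transpose_mat(1)[of j "?m (f n)" i] by simp
  then have "x (i, j) = x (j, i)" using tendsto_unique[OF G l[of "(i, j)"], of "x (j, i)"] l[of "(j, i)"] ij by simp
  then show "tr (?m x) $$ (i, j) = ?m x $$ (i, j)" using ij by simp
  qed auto
  fix v :: "real vec" assume v: "v : carrier_vec h"
  show "0 <= v *. (?m x *v v)" proof (rule tendsto_lowerbound[OF _ _ G])
  show "((%j. v *. (?m (f j) *v v)) \<longlongrightarrow> v *. (?m x *v v)) G" using v l by (auto simp: scalar_prod_def intro!: tendsto_intros)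
  qed (use KD(1)[OF fK] v in "auto simp: pos_semidef_def")
  qed simp
  ultimately show "x : S" by (simp add: S_def K_def)
 qed
 then obtain y where y: "(ALL ij:?I. y 0 ij = H $$ ij) & (ALL t:{0..T}. y t : S & (ALL ij:?I. ((%s. y s ij) has_real_derivative F (y t) ij) (at t within {0..T})))"
  by (elim exE)
 have y0: "y 0 ij = H $$ ij" if "ij : ?I" for ij using y that by blast
 have yS: "y t : S" if "t : {0..T}" for t using conjunct2[OF y, rule_format, OF that] by (rule conjunct1)
 have yd: "((%s. y s ij) has_real_derivative F (y t) ij) (at t within {0..T})" if "t : {0..T}" "ij : ?I" for t ij
  using conjunct2[OF conjunct2[OF y, rule_format, OF that(1)]] that(2) by (rule bspec)
 \<comment> \<open>The Euler scheme runs forward from H; reversing time gives the terminal value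
   problem.\<close>
 define P where "P t = ?m (y (T - t))" for t
 have PK: "P t : K b" if "t : {0..T}" for t using yS[of "T - t"] that by (simp add: P_def S_def)
 have PT: "P T = H" unfolding P_def using y0 Pd[OF H] by (intro eq_matI) auto
 have d: "((%t. P t $$ (i, j)) has_real_derivative - ric (P t) $$ (i, j)) (at t within {0..T})" if ij: "i < h" "j < h" and t: "t : {0..T}" for i j t
 proof -
  have im: "(%t. T - t) ` {0..T} = {0..T}" by (force simp: image_iff intro!: bexI[of _ "T - _"])
  have "((%s. y s (i, j)) has_real_derivative F (y (T - t)) (i, j)) (at (T - t) within (%t. T - t) ` {0..T})"
  unfolding im using ij t by (intro yd) auto
  moreover have "((%t. T - t) has_real_derivative - 1) (at t within {0..T})" by (auto intro!: derivative_eq_intros)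
  ultimately have "((%s. y s (i, j)) \<circ> (%t. T - t) has_real_derivative F (y (T - t)) (i, j) * - 1) (at t within {0..T})"
  by (rule DERIV_image_chain)
  then show ?thesis using ij by (simp add: o_def P_def F_def)
 qed
 have Pc: "continuous_on {0..T} (%t. P t $$ (i, j))" if "i < h" "j < h" for i j using DERIV_continuous_on[OF d[OF that]] .
 have car: "X : carrier_mat h h" if "X : K b" for X using KD(3,4)[OF that] by simp
 have "continuous_on {0..T} (%t. ric (P t) $$ (i, j))" if "i < h" "j < h" for i j by (rule lipm_continuous[OF lipm_K(2) PK car Pc that])
 moreover have "continuous_on {0..T} (%t. gain (P t) $$ (i, j))" if "i < r" "j < h" for i j by (rule lipm_continuous[OF lipm_K(1) PK car Pc that])
 ultimately show ?thesis using KD(1)[OF PK] PT d by (intro exI[of _ P]) simp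
qed

end

section \<open>Square-integrable vector functions and elementary inequalities\<close>

definition vsq :: "'b measure => nat => ('b => real vec) => bool" where
 "vsq N k f \<longleftrightarrow> (ALL x:space N. dim_vec (f x) = k) & (ALL i<k. sqi N (%x. f x $ i))"

lemma sp_sum: "dim_vec w = k ==> v *. w = (\<Sum>i<k. v $ i * w $ i)" by (simp add: scalar_prod_def atLeast0LessThan)

lemma vsq_integrable:
 assumes "vsq N k f" "vsq N k g" shows "integrable N (%x. f x *. g x)"
proof -
 have "integrable N (%x. \<Sum>i<k. f x $ i * g x $ i)" using assms by (intro isum sqi_mult) (auto simp: vsq_def)
 then show ?thesis by (rule ible_cong[THEN iffD1, rotated -1]) (use assms in "auto simp: vsq_def sp_sum")
qed

lemma sqi_cong: "(!!x. x : space N ==> f x = g x) ==> sqi N f \<longleftrightarrow> sqi N g"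
 unfolding sqi_def by (metis (no_types, lifting) measurable_cong ible_cong)

lemma vsq_mult:
 assumes "vsq N k f" "dim_col A = k" "dim_row A = m" shows "vsq N m (%x. A *v f x)" unfolding vsq_def
proof (intro conjI allI impI ballI)
 fix i assume i: "i < m"
 have "sqi N (%x. \<Sum>j<k. A $$ (i, j) * f x $ j)" using assms by (intro sqi_sum sqi_cmult) (auto simp: vsq_def)
 then show "sqi N (%x. (A *v f x) $ i)" by (rule sqi_cong[THEN iffD1, rotated]) (use assms i in "auto simp: vsq_def sp_sum")
qed (use assms in auto)

lemma vsq_integral_zero:
 assumes f: "vsq N k f" and R: "pos_def k R" and z: "(LINT x|N. f x *. (R *v f x)) <= 0" shows "AE x in N. f x = 0v k"
proof -
 have R': "dim_row R = k" "dim_col R = k" using R by (auto simp: pos_def_def)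
 have nn: "0 <= f x *. (R *v f x)" if "x : space N" for x using pd_imp_psd[OF R] f that by (auto simp: pos_semidef_def vsq_def)
 have "(LINT x|N. f x *. (R *v f x)) = 0" using z by (intro antisym integral_nonneg_AE AE_I2 nn)
 then have "AE x in N. f x *. (R *v f x) = 0" using integral_nonneg_eq_0_iff_AE[OF vsq_integrable[OF f vsq_mult[OF f R'(2,1)]] AE_I2[OF nn]] by simp
 then show ?thesis using AE_space proof eventually_elim
  case (elim x)
  then have "f x : carrier_vec k" using f by (auto simp: vsq_def)
  then show ?case using R elim(1) unfolding pos_def_def by (metis less_irrefl)
 qed
qed

lemma mult_vec_bound: "dim_vec x = dim_col A ==> (A *v x) *. (A *v x) <= (mn A)^2 * (x *. x)"
proof -
 assume x: "dim_vec x = dim_col A"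
 define s where "s = sqrt (x *. x)"
 have xx: "x *. x = (\<Sum>j<dim_col A. (x $ j)^2)" using x by (simp add: sp_sum power2_eq_square)
 have xj: "abs (x $ j) <= s" if "j < dim_col A" for j proof -
  have "(x $ j)^2 <= x *. x" unfolding xx using that by (intro member_le_sum) auto
  then show ?thesis unfolding s_def by (metis real_sqrt_abs real_sqrt_le_iff)
 qed
 have s0: "0 <= s" "s^2 = x *. x" unfolding s_def xx by (auto intro!: sum_nonneg)
 define a where "a i = (\<Sum>j<dim_col A. abs (A $$ (i, j)))" for i
 have a0: "0 <= a i" for i unfolding a_def by (intro sum_nonneg) auto
 have "abs ((A *v x) $ i) <= a i * s" if "i < dim_row A" for i proof -
  have "abs ((A *v x) $ i) <= (\<Sum>j<dim_col A. abs (A $$ (i, j) * x $ j))" using that x by (simp add: sp_sum sum_abs)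
  also have "... <= (\<Sum>j<dim_col A. abs (A $$ (i, j)) * s)" unfolding abs_mult by (intro sum_mono mult_left_mono xj) auto
  finally show ?thesis by (simp add: a_def sum_distrib_right)
 qed
 then have e: "((A *v x) $ i)^2 <= (a i)^2 * s^2" if "i < dim_row A" for i
  using that abs_le_square_iff[of "(A *v x) $ i" "a i * s"] a0[of i] s0(1) by (simp add: power_mult_distrib)
 have "(A *v x) *. (A *v x) = (\<Sum>i<dim_row A. ((A *v x) $ i)^2)" by (subst sp_sum[of _ "dim_row A"]) (auto simp: power2_eq_square)
 also have "... <= (\<Sum>i<dim_row A. (a i)^2 * s^2)" by (intro sum_mono e) auto
 also have "... = (\<Sum>i<dim_row A. (a i)^2) * s^2" by (simp add: sum_distrib_right)
 also have "(\<Sum>i<dim_row A. (a i)^2) <= (mn A)^2" proof -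
  have "a i <= mn A" if "i < dim_row A" for i unfolding mn_def a_def[symmetric] using a0 that by (intro member_le_sum) auto
  then have "(\<Sum>i<dim_row A. (a i)^2) <= (\<Sum>i<dim_row A. mn A * a i)"
  unfolding power2_eq_square using a0 by (intro sum_mono mult_right_mono) auto
  also have "... = (mn A)^2" by (simp add: sum_distrib_left[symmetric] power2_eq_square mn_def a_def)
  finally show ?thesis .
 qed
 then have "(\<Sum>i<dim_row A. (a i)^2) * s^2 <= (mn A)^2 * s^2" by (rule mult_right_mono) simp
 finally show ?thesis by (simp add: s0(2))
qed

lemma scalar_prod_young: "dim_vec x = dim_vec y ==> 2 * abs (x *. y) <= x *. x + y *. (y :: real vec)"
 using pos_semidef_polar[of "dim_vec y" "1\<^sub>m (dim_vec y)" x y]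
 by (simp add: pos_semidef_def sp_sum sum_nonneg one_mult_mat_vec[of _ "dim_vec y"])

text \<open>A bound at rational times holds on their closure by continuity. Density is taken inside
  the open interval, which is empty for T = 0.\<close>

lemma continuous_on_Rats_le:
 fixes f :: "real => real"
 assumes T: "0 <= T" and c: "continuous_on {0..T} f" and le: "!!q. q : \<rat> Int {0..T} ==> f q <= B" and t: "t : {0..T}" shows "f t <= B"
proof (cases "T = 0")
 case True
 then show ?thesis using t by (intro le) auto
next
 case False
 have cl: "closure ({0<..<T} Int \<rat>) = {0..T}" using closure_open_Int_superset[of "{0<..<T}" "\<rat>"] Rats_closure_real False T by simp
 have "f t : {..B}" proof (rule image_closure_subset[THEN subsetD, of "{0<..<T} Int \<rat>" f "{..B}"])
  show "continuous_on (closure ({0<..<T} Int \<rat>)) f" unfolding cl by (rule c)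
  show "f ` ({0<..<T} Int \<rat>) <= {..B}" using le by auto
  show "f t : f ` closure ({0<..<T} Int \<rat>)" unfolding cl using t by (rule imageI)
 qed auto
 then show ?thesis by simp
qed

context wiener
begin

section \<open>Vector-valued processes\<close>

definition vproc :: "real => ((real => 'a => real) => bool) => nat => 'a vproc => bool" where
 "vproc T P k X \<longleftrightarrow> (ALL t:{0..T}. ALL w:space M. dim_vec (X t w) = k) & (ALL i<k. P (%t w. X t w $ i))"

text \<open>What \<open>sqp\<close> and \<open>cp\<close> have in common. The last clause ignores
  values outside [0, T] and \<open>space M\<close>, where dimensions are not controlled; it lets
  entries of matrix products be rewritten as sums.\<close>

definition linear_class :: "real => ((real => 'a => real) => bool) => bool" where
 "linear_class T P \<longleftrightarrow> P (%t w. 0) & (ALL f g. P f --> P g --> P (%t w. f t w + g t w)) & (ALL c f. P f --> P (%t w. c * f t w)) &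
  (ALL f g. (ALL t:{0..T}. ALL w:space M. f t w = g t w) --> P f --> P g)"

abbreviation "vp T == vproc T (sqp T)"
abbreviation "vc T == vproc T (cp T)"

lemma linear_classD:
 assumes "linear_class T P" shows "P (%t w. 0)" "P f ==> P g ==> P (%t w. f t w + g t w)" "P f ==> P (%t w. c * f t w)"
  "P f ==> (!!t w. t : {0..T} ==> w : space M ==> f t w = g t w) ==> P g" using assms unfolding linear_class_def by blast+

lemma jm_cong:
 assumes "jm T f" "!!t w. t : {0..T} ==> w : space M ==> f t w = g t w" shows "jm T g"
 using assms unfolding jm_def by (subst measurable_cong[where g = "%p. uc f p"]) (auto simp: space_Q)

lemma linear_class_sqp: "linear_class T (sqp T)" unfolding linear_class_def
proof (intro conjI allI impI)
 show "sqp T g" if e: "ALL t:{0..T}. ALL w:space M. f t w = g t w" and f: "sqp T f" for f g unfolding sqp_def proof (intro conjI ballI)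
  fix t assume t: "t : {0..T}"
  have "f t : BM (F t)" using f t by (simp add: sqp_def)
  then show "g t : BM (F t)" by (rule measurable_cong[THEN iffD1, rotated]) (use e t in "simp add: space_F")
 next
  have "sqi (Q T) (uc f)" using f by (simp add: sqp_def)
  then show "sqi (Q T) (uc g)" by (rule sqi_cong[THEN iffD1, rotated]) (use e in "auto simp: space_Q")
 qed
qed (auto intro: sqp_zero sqp_add sqp_cmult)

lemma linear_class_cp: "linear_class T (cp T)" unfolding linear_class_def
proof (intro conjI allI impI)
 show "cp T g" if e: "ALL t:{0..T}. ALL v:space M. f t v = g t v" and f: "cp T f" for f g unfolding cp_def proof (intro conjI ballI)
  fix t assume t: "t : {0..T}"
  show "g t : BM (F t)" using cp_F[OF f t] by (rule measurable_cong[THEN iffD1, rotated]) (use e t in "simp add: space_F")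
 next
  fix v assume "v : space M"
  then show "continuous_on {0..T} (%t. g t v)" using cp_cont[OF f] e by (subst continuous_on_cong[of _ _ _ "%t. f t v"]) auto
 next
  obtain w where w: "sqi M w" "AE v in M. ALL t:{0..T}. abs (f t v) <= w v" using f unfolding cp_def by (elim conjE exE)
  have "AE v in M. ALL t:{0..T}. abs (g t v) <= w v" using w(2) AE_space by eventually_elim (use e in auto)
  then show "EX w. sqi M w & (AE v in M. ALL t:{0..T}. abs (g t v) <= w v)" using w(1) by (intro exI[of _ w] conjI)
 qed
qed (auto intro: cp_const cp_add cp_cmult)

lemma linear_class_sum:
 assumes "linear_class T P" "!!i. i : I ==> P (f i)" shows "P (%t w. \<Sum>i\<in>I. f i t w)"
 using assms(2) by (induction I rule: infinite_finite_induct) (auto intro: linear_classD(1,2)[OF assms(1)])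

lemma vproc_mult:
 assumes "vproc T P k X" and l: "linear_class T P" and "dim_col A = k" "dim_row A = m" shows "vproc T P m (%t w. A *v X t w)" unfolding vproc_def
proof (intro conjI allI impI ballI)
 fix i assume i: "i < m"
 have "P (%t w. \<Sum>j<k. A $$ (i, j) * X t w $ j)" using assms by (intro linear_class_sum[OF l] linear_classD(3)[OF l]) (auto simp: vproc_def)
 then show "P (%t w. (A *v X t w) $ i)" by (rule linear_classD(4)[OF l]) (use assms i in "auto simp: vproc_def sp_sum")
qed (use assms in auto)

lemma vproc_add:
 assumes "vproc T P k X" "vproc T P k Y" and l: "linear_class T P" shows "vproc T P k (%t w. X t w + Y t w)" unfolding vproc_def
proof (intro conjI allI impI ballI)
 fix i assume i: "i < k"
 have "P (%t w. X t w $ i + Y t w $ i)" using assms i by (intro linear_classD(2)[OF l]) (auto simp: vproc_def)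
 then show "P (%t w. (X t w + Y t w) $ i)" by (rule linear_classD(4)[OF l]) (use assms i in "auto simp: vproc_def")
qed (use assms in "auto simp: vproc_def")

lemma vproc_diff:
 assumes "vproc T P k X" "vproc T P k Y" and l: "linear_class T P" shows "vproc T P k (%t w. X t w - Y t w)" unfolding vproc_def
proof (intro conjI allI impI ballI)
 fix i assume i: "i < k"
 have "P (%t w. X t w $ i + (-1) * Y t w $ i)" using assms i by (intro linear_classD(2,3)[OF l]) (auto simp: vproc_def)
 then show "P (%t w. (X t w - Y t w) $ i)" by (rule linear_classD(4)[OF l]) (use assms i in "auto simp: vproc_def")
qed (use assms in "auto simp: vproc_def")

lemma vproc_append:
 assumes "vproc T P k X" "vproc T P l Y" and lc: "linear_class T P" shows "vproc T P (k + l) (%t w. X t w @v Y t w)" unfolding vproc_def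
proof (intro conjI allI impI ballI)
 fix i assume i: "i < k + l"
 show "P (%t w. (X t w @v Y t w) $ i)" proof (cases "i < k")
  case True
  then have "P (%t w. X t w $ i)" using assms by (simp add: vproc_def)
  then show ?thesis by (rule linear_classD(4)[OF lc]) (use assms i True in "auto simp: vproc_def")
 next
  case False
  then have "P (%t w. Y t w $ (i - k))" using assms i by (simp add: vproc_def)
  then show ?thesis by (rule linear_classD(4)[OF lc]) (use assms i False in "auto simp: vproc_def")
 qed
qed (use assms in "auto simp: vproc_def")

lemma vproc_cong:
 assumes "vproc T P k X" and l: "linear_class T P" and e: "!!t w. t : {0..T} ==> w : space M ==> X t w = Y t w" shows "vproc T P k Y"
 unfolding vproc_def
proof (intro conjI allI impI ballI)
 fix i assume i: "i < k"
 have "P (%t w. X t w $ i)" using assms(1) i by (simp add: vproc_def)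
 then show "P (%t w. Y t w $ i)" by (rule linear_classD(4)[OF l]) (simp add: e)
qed (use assms(1) e in "auto simp: vproc_def")

lemmas vp_intros = vproc_mult[OF _ linear_class_sqp] vproc_add[OF _ _ linear_class_sqp] vproc_diff[OF _ _ linear_class_sqp]
lemmas vc_intros = vproc_mult[OF _ linear_class_cp] vproc_add[OF _ _ linear_class_cp] vproc_diff[OF _ _ linear_class_cp]

lemma vc_vp: "vc T k X ==> vp T k X" by (simp add: vproc_def cp_sqp)

lemma vproc_dim: "vproc T P k X ==> t : {0..T} ==> w : space M ==> dim_vec (X t w) = k" by (simp add: vproc_def)

lemma vp_vsq: "vp T k X ==> t <= T ==> vsq (Q t) k (uc X)" using sqp_sqi[of T "%t w. X t w $ i" t for i] by (auto simp: vproc_def vsq_def space_Q)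

lemma vp_F: "vp T k X ==> t : {0..T} ==> i < k ==> (%w. X t w $ i) : BM (F t)" by (simp add: vproc_def sqp_def)

text \<open>The squared norm is a finite sum of squares of entries, so its finite integral splits
  into square integrability of the components.\<close>

lemma L2_proc_iff: "X : L2_proc M W T k \<longleftrightarrow> vp T k X"
proof -
 have *: "(NI M (%w. (\<integral>\<^sup>+t\<in>{0..T}. ennreal (X t w *. X t w) \<partial>lborel))) = (\<Sum>i<k. NI (Q T) (%p. ennreal ((uc X p $ i)^2)))"
  if d: "!!t w. t : {0..T} ==> w : space M ==> dim_vec (X t w) = k"
  and m: "!!i. i < k ==> (%p. uc X p $ i) : BM (Q T)" proof -
  have "(\<Sum>i<k. NI (Q T) (%p. ennreal ((uc X p $ i)^2))) = (NI (Q T) (%p. (\<Sum>i<k. ennreal ((uc X p $ i)^2))))"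
  using m by (subst nn_integral_sum) auto
  also have "... = (NI M (%w. (NI (lb T) (%t. (\<Sum>i<k. ennreal ((X t w $ i)^2))))))" using m by (subst nn_integral_Q_snd) auto
  also have "... = (NI M (%w. (NI (lb T) (%t. ennreal (X t w *. X t w)))))"
  by (intro nn_integral_cong) (simp add: d sp_sum[OF d] power2_eq_square[symmetric] sum_ennreal)
  finally show ?thesis by (simp add: set_nn_integral_lb)
 qed
 show ?thesis proof
  assume X: "X : L2_proc M W T k"
  then have d: "!!t w. t : {0..T} ==> w : space M ==> dim_vec (X t w) = k"
  and a: "!!t i. t : {0..T} ==> i < k ==> (%w. X t w $ i) : BM (F t)"
  and m: "!!i. i < k ==> (%p. uc X p $ i) : BM (Q T)"
  and fin: "(NI M (%w. (\<integral>\<^sup>+t\<in>{0..T}. ennreal (X t w *. X t w) \<partial>lborel))) < \<infinity>"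
  unfolding L2_proc_def adapted_def by (auto simp: measurable_Q_borel case_prod_beta)
  have S: "(\<Sum>i<k. NI (Q T) (%p. ennreal ((uc X p $ i)^2))) < \<infinity>" using fin by (simp only: *[OF d m])
  have s: "sqi (Q T) (%p. uc X p $ i)" if i: "i < k" for i proof (rule sqi_nn_finite[THEN iffD2, OF m[OF i]])
  have "(NI (Q T) (%p. ennreal ((uc X p $ i)^2))) <= (\<Sum>i<k. NI (Q T) (%p. ennreal ((uc X p $ i)^2)))"
  using i by (intro member_le_sum[of i "{..<k}"]) auto
  then show "(NI (Q T) (%p. ennreal ((uc X p $ i)^2))) < \<infinity>" using S by (rule le_less_trans)
  qed
  show "vp T k X" unfolding vproc_def proof (intro conjI allI impI ballI)
  fix i assume i: "i < k"
  show "sqp T (%t w. X t w $ i)" unfolding sqp_def using a[OF _ i] s[OF i] by (intro conjI ballI)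
  qed (rule d)
 next
  assume X: "vp T k X"
  then have d: "!!t w. t : {0..T} ==> w : space M ==> dim_vec (X t w) = k" by (auto simp: vproc_def)
  have s: "sqi (Q T) (%p. uc X p $ i)" if "i < k" for i using X that by (auto simp: vproc_def sqp_def)
  then have m: "!!i. i < k ==> (%p. uc X p $ i) : BM (Q T)" by (auto simp: sqi_def)
  have "(NI M (%w. (\<integral>\<^sup>+t\<in>{0..T}. ennreal (X t w *. X t w) \<partial>lborel))) < \<infinity>"
  by (simp only: *[OF d m]) (use s in "simp add: sqi_nn_integral")
  then show "X : L2_proc M W T k" unfolding L2_proc_def adapted_def using d vp_F[OF X] m by (auto simp: measurable_Q_borel case_prod_beta)
 qed
qed

text \<open>The supremum over rational times is measurable and lies below the supremum in the
  definition; by path continuity its root is a majorant at all times.\<close>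

lemma L2_cont_iff:
 assumes T: "0 <= T" shows "X : L2_cont M W T k \<longleftrightarrow> vc T k X"
proof
 assume X: "X : L2_cont M W T k"
 then have d: "!!t v. t : {0..T} ==> v : space M ==> dim_vec (X t v) = k"
  and a: "!!t i. t : {0..T} ==> i < k ==> (%v. X t v $ i) : BM (F t)"
  and c: "!!v i. v : space M ==> i < k ==> continuous_on {0..T} (%t. X t v $ i)"
  and fin: "(NI M (%v. (SUP t\<in>{0..T}. ennreal (X t v *. X t v)))) < \<infinity>" unfolding L2_cont_def adapted_def by auto
 have "cp T (%t v. X t v $ i)" if i: "i < k" for i unfolding cp_def proof (intro conjI ballI a c i)
  define V where "V v = (SUP t\<in>(\<rat> Int {0..T}). ennreal ((X t v $ i)^2))" for v
  have Vm: "V : BM M" unfolding V_def[abs_def] proof (rule borel_measurable_SUP)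
  show "countable (\<rat> Int {0..T} :: real set)" using countable_rat by blast
  fix t assume t: "t : \<rat> Int {0..T}"
  then have "(%v. X t v $ i) : BM M" using a[of t i] i by (auto intro: measurable_F_M)
  then show "(%v. ennreal ((X t v $ i)^2)) : BM M" by auto
  qed
  have "V v <= (SUP t\<in>{0..T}. ennreal (X t v *. X t v))" if v: "v : space M" for v unfolding V_def proof (rule SUP_mono)
  fix t assume "t : \<rat> Int {0..T}"
  then have t: "t : {0..T}" by auto
  have "(X t v $ i)^2 <= X t v *. X t v" unfolding sp_sum[OF d[OF t v]] power2_eq_square using i by (intro member_le_sum) auto
  then show "EX s:{0..T}. ennreal ((X t v $ i)^2) <= ennreal (X s v *. X s v)" using t by (intro bexI[of _ t] ennreal_leI)
  qed
  then have Vf: "(NI M (%v. V v)) < \<infinity>" by (rule le_less_trans[OF nn_integral_mono fin])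
  then have "(NI M (%v. V v)) <= ennreal (enn2real (NI M (%v. V v)))" by simp
  note K = sqrt_enn2real_sqi[OF Vm this enn2real_nonneg]
  have "AE v in M. ALL t:{0..T}. abs (X t v $ i) <= sqrt (enn2real (V v))" using K(1) AE_space proof eventually_elim
  case (elim v)
  show ?case proof
  fix t assume t: "t : {0..T}"
  have rat: "abs (X s v $ i) <= sqrt (enn2real (V v))" if "s : \<rat> Int {0..T}" for s
  by (rule real_le_rsqrt, unfold power2_abs, rule le_enn2real[OF _ elim(1)]) (use that in "auto simp: V_def intro!: SUP_upper")
  show "abs (X t v $ i) <= sqrt (enn2real (V v))" by (rule continuous_on_Rats_le[OF T continuous_on_rabs[OF c[OF elim(2) i]] rat t])
  qed
  qed
  then show "EX w. sqi M w & (AE v in M. ALL t:{0..T}. abs (X t v $ i) <= w v)" using K(2) by blast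
 qed
 then show "vc T k X" using d by (auto simp: vproc_def)
next
 assume X: "vc T k X"
 then have d: "!!t v. t : {0..T} ==> v : space M ==> dim_vec (X t v) = k" and c: "!!i. i < k ==> cp T (%t v. X t v $ i)" by (auto simp: vproc_def)
 have "ALL i. EX w. i < k --> sqi M w & (AE v in M. ALL t:{0..T}. abs (X t v $ i) <= w v)" using c unfolding cp_def by blast
 from choice[OF this] obtain w where w: "ALL i. i < k --> sqi M (w i) & (AE v in M. ALL t:{0..T}. abs (X t v $ i) <= w i v)" by (elim exE)
 have "AE v in M. ALL i:{..<k}. ALL t:{0..T}. abs (X t v $ i) <= w i v" using w by (subst AE_finite_all) auto
 then have "AE v in M. (SUP t\<in>{0..T}. ennreal (X t v *. X t v)) <= (\<Sum>i<k. ennreal ((w i v)^2))" using AE_space proof eventually_elim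
  case (elim v)
  show ?case proof (rule SUP_least)
  fix t assume t: "t : {0..T}"
  have "X t v *. X t v <= (\<Sum>i<k. (w i v)^2)" unfolding sp_sum[OF d[OF t elim(2)]] power2_eq_square[symmetric] proof (rule sum_mono)
  fix i assume "i : {..<k}"
  then have "abs (X t v $ i) <= w i v" using elim(1) t by blast
  from power_mono[OF this abs_ge_zero, of 2] show "(X t v $ i)^2 <= (w i v)^2" by (simp only: power2_abs)
  qed
  then show "ennreal (X t v *. X t v) <= (\<Sum>i<k. ennreal ((w i v)^2))" by (simp add: sum_ennreal ennreal_leI)
  qed
 qed
 then have "(NI M (%v. (SUP t\<in>{0..T}. ennreal (X t v *. X t v)))) <= (NI M (%v. (\<Sum>i<k. ennreal ((w i v)^2))))" by (rule nn_integral_mono_AE)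
 also have "... = (\<Sum>i<k. NI M (%v. ennreal ((w i v)^2)))" using w by (subst nn_integral_sum) (auto simp: sqi_def)
 also have "... < \<infinity>" using w by (simp add: sqi_nn_integral)
 finally show "X : L2_cont M W T k" unfolding L2_cont_def adapted_def using d cp_F[OF c] cp_cont[OF c] by auto
qed

end

section \<open>Vector-valued Ito processes\<close>

context wiener
begin

definition vip :: "real => nat => 'a vproc => 'a vproc => 'a vproc => bool" where
 "vip T k X b s \<longleftrightarrow> (ALL t:{0..T}. ALL w:space M. dim_vec (X t w) = k) & vp T k b & vp T k s &
  (ALL i<k. ip T (%t w. X t w $ i) (%t w. b t w $ i) (%t w. s t w $ i))"

lemma vipD:
 assumes "vip T k X b s" shows "t : {0..T} ==> w : space M ==> dim_vec (X t w) = k" "vp T k b" "vp T k s"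
  "i < k ==> ip T (%t w. X t w $ i) (%t w. b t w $ i) (%t w. s t w $ i)" using assms by (simp_all add: vip_def)

lemma vip_cong:
 assumes X: "vip T k X b s" and T: "0 <= T" and b': "vp T k b'" and s': "vp T k s'"
  and X': "!!t w. t : {0..T} ==> w : space M ==> dim_vec (X' t w) = k" "!!i. i < k ==> jm T (%t w. X' t w $ i)"
  and eX: "!!t. t : {0..T} ==> AE w in M. X t w = X' t w"
  and eb: "AE p in Q T. uc b p = uc b' p" and es: "AE p in Q T. uc s p = uc s' p" shows "vip T k X' b' s'" unfolding vip_def
proof (intro conjI allI impI ballI b' s' X'(1))
 fix i assume i: "i < k"
 show "ip T (%t w. X' t w $ i) (%t w. b' t w $ i) (%t w. s' t w $ i)" proof (rule ip_cong[OF vipD(4)[OF X i] T])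
  show "sqp T (%t w. b' t w $ i)" "sqp T (%t w. s' t w $ i)" using b' s' i by (simp_all add: vproc_def)
  show "jm T (%t w. X' t w $ i)" by (rule X'(2)[OF i])
  show "AE w in M. X t w $ i = X' t w $ i" if "t : {0..T}" for t using eX[OF that] by eventually_elim simp
  show "AE p in Q T. uc b p $ i = uc b' p $ i" using eb by eventually_elim simp
  show "AE p in Q T. uc s p $ i = uc s' p $ i" using es by eventually_elim simp
 qed
qed

lemma vip_cong_drift:
 assumes X: "vip T k X b s" and T: "0 <= T" and b': "vp T k b'" and s': "vp T k s'"
  and eb: "AE p in Q T. uc b p = uc b' p" and es: "AE p in Q T. uc s p = uc s' p" shows "vip T k X b' s'"
 by (rule vip_cong[OF X T b' s' vipD(1)[OF X] _ _ eb es]) (use vipD(4)[OF X] in "auto simp: ip_def")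

lemma vip_cong_pointwise:
 assumes X: "vip T k X b s" and T: "0 <= T"
  and "!!t w. t : {0..T} ==> w : space M ==> X t w = X' t w & b t w = b' t w & s t w = s' t w" shows "vip T k X' b' s'"
proof (rule vip_cong[OF X T])
 have AE: "AE p in Q T. fst p : {0..T} & snd p : space M" by (rule AE_I2) (auto simp: space_Q)
 show "AE p in Q T. uc b p = uc b' p" "AE p in Q T. uc s p = uc s' p" using AE by (eventually_elim, use assms(3) in blast)+
 show "AE w in M. X t w = X' t w" if "t : {0..T}" for t using AE_space by eventually_elim (use assms(3) that in blast)
 show "vp T k b'" by (rule vproc_cong[OF vipD(2)[OF X] linear_class_sqp]) (use assms(3) in blast)
 show "vp T k s'" by (rule vproc_cong[OF vipD(3)[OF X] linear_class_sqp]) (use assms(3) in blast)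
 show "dim_vec (X' t w) = k" if "t : {0..T}" "w : space M" for t w using assms(3)[OF that] vipD(1)[OF X that] by simp
 show "jm T (%t w. X' t w $ i)" if "i < k" for i by (rule jm_cong[of _ "%t w. X t w $ i"]) (use vipD(4)[OF X that] assms(3) in "auto simp: ip_def")
qed

lemma vip_mult:
 assumes X: "vip T k X b s" and T: "0 <= T" and A: "dim_col A = k" "dim_row A = m"
 shows "vip T m (%t w. A *v X t w) (%t w. A *v b t w) (%t w. A *v s t w)" unfolding vip_def
proof (intro conjI allI impI ballI)
 note b = vipD(2)[OF X] and s = vipD(3)[OF X]
 show b': "vp T m (%t w. A *v b t w)" and s': "vp T m (%t w. A *v s t w)" by (rule vp_intros(1)[OF b A] vp_intros(1)[OF s A])+
 fix i assume i: "i < m"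
 have e: "(A *v v) $ i = (\<Sum>j<k. A $$ (i, j) * v $ j)" if "dim_vec v = k" for v using i A that by (simp add: sp_sum)
 have AE: "AE p in Q T. fst p : {0..T} & snd p : space M" by (rule AE_I2) (auto simp: space_Q)
 show "ip T (%t w. (A *v X t w) $ i) (%t w. (A *v b t w) $ i) (%t w. (A *v s t w) $ i)" proof (rule ip_cong[OF ip_sum[OF T, of "{..<k}"] T])
  fix j assume "j : {..<k}"
  then show "ip T (%t w. A $$ (i, j) * X t w $ j) (%t w. A $$ (i, j) * b t w $ j) (%t w. A $$ (i, j) * s t w $ j)"
  by (intro ip_cmult vipD(4)[OF X]) simp
 next
  show "sqp T (%t w. (A *v b t w) $ i)" "sqp T (%t w. (A *v s t w) $ i)" using b' s' i by (simp_all add: vproc_def)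
  show "jm T (%t w. (A *v X t w) $ i)" proof (rule jm_cong)
  show "jm T (%t w. \<Sum>j<k. A $$ (i, j) * X t w $ j)"
  using ip_sum[OF T, of "{..<k}" "%j t w. A $$ (i, j) * X t w $ j", OF ip_cmult[OF vipD(4)[OF X]]] by (auto simp: ip_def)
  qed (use e vipD(1)[OF X] in auto)
  show "AE w in M. (\<Sum>j<k. A $$ (i, j) * X t w $ j) = (A *v X t w) $ i" if t: "t : {0..T}" for t
  using AE_space by eventually_elim (use e vipD(1)[OF X t] in auto)
  show "AE p in Q T. (\<Sum>j<k. A $$ (i, j) * uc b p $ j) = (A *v uc b p) $ i" using AE by eventually_elim (use e vproc_dim[OF b] in auto)
  show "AE p in Q T. (\<Sum>j<k. A $$ (i, j) * uc s p $ j) = (A *v uc s p) $ i" using AE by eventually_elim (use e vproc_dim[OF s] in auto)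
 qed
qed (use A in auto)

lemma vip_diff:
 assumes X: "vip T k X b s" and Y: "vip T k Y c d" and T: "0 <= T" shows "vip T k (%t w. X t w - Y t w) (%t w. b t w - c t w) (%t w. s t w - d t w)"
 unfolding vip_def
proof (intro conjI allI impI ballI)
 show b': "vp T k (%t w. b t w - c t w)" and s': "vp T k (%t w. s t w - d t w)"
  by (rule vp_intros(3)[OF vipD(2)[OF X] vipD(2)[OF Y]] vp_intros(3)[OF vipD(3)[OF X] vipD(3)[OF Y]])+
 fix i assume i: "i < k"
 have AE: "AE p in Q T. fst p : {0..T} & snd p : space M" by (rule AE_I2) (auto simp: space_Q)
 note ii = ip_diff[OF vipD(4)[OF X i] vipD(4)[OF Y i]]
 show "ip T (%t w. (X t w - Y t w) $ i) (%t w. (b t w - c t w) $ i) (%t w. (s t w - d t w) $ i)" proof (rule ip_cong[OF ii T])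
  show "sqp T (%t w. (b t w - c t w) $ i)" "sqp T (%t w. (s t w - d t w) $ i)" using b' s' i by (simp_all add: vproc_def)
  show "jm T (%t w. (X t w - Y t w) $ i)" by (rule jm_cong[of _ "%t w. X t w $ i - Y t w $ i"]) (use ii vipD(1)[OF Y] i in "auto simp: ip_def")
  show "AE w in M. X t w $ i - Y t w $ i = (X t w - Y t w) $ i" if t: "t : {0..T}" for t
  using AE_space by eventually_elim (use i vipD(1)[OF Y t] in auto)
  show "AE p in Q T. uc b p $ i - uc c p $ i = (uc b p - uc c p) $ i" using AE by eventually_elim (use i vproc_dim[OF vipD(2)[OF Y]] in auto)
  show "AE p in Q T. uc s p $ i - uc d p $ i = (uc s p - uc d p) $ i" using AE by eventually_elim (use i vproc_dim[OF vipD(3)[OF Y]] in auto)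
 qed
qed (use vipD(1)[OF Y] in auto)

lemma vip_vsq:
 assumes X: "vip T k X b s" and t: "t : {0..T}" shows "vsq M k (X t)" "vsq (Q t) k (uc X)" "vsq (Q t) k (uc b)" "vsq (Q t) k (uc s)"
proof -
 show "vsq M k (X t)" "vsq (Q t) k (uc X)" unfolding vsq_def using vipD(1)[OF X] t ip_parts(4,6)[OF vipD(4)[OF X] t] by (auto simp: space_Q)
 show "vsq (Q t) k (uc b)" "vsq (Q t) k (uc s)" using vp_vsq[OF vipD(2)[OF X]] vp_vsq[OF vipD(3)[OF X]] t by auto
qed

lemma vip_product:
 assumes X: "vip T k X b s" and Y: "vip T k Y c d" and t: "t : {0..T}" shows "EE (%w. X t w *. Y t w) = EE (%w. X 0 w *. Y 0 w) +
  (LINT p|Q t. uc X p *. c (fst p) (snd p) + uc Y p *. b (fst p) (snd p) + uc s p *. d (fst p) (snd p))"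
proof -
 have t0: "0 : {0..T}" using t by auto
 have E: "EE (%w. X r w *. Y r w) = (\<Sum>i<k. EE (%w. X r w $ i * Y r w $ i))" if r: "r : {0..T}" for r proof -
  have "EE (%w. X r w *. Y r w) = EE (%w. \<Sum>i<k. X r w $ i * Y r w $ i)" by (intro icong refl sp_sum vipD(1)[OF Y] r)
  also have "... = (\<Sum>i<k. EE (%w. X r w $ i * Y r w $ i))"
  using vip_vsq(1)[OF X r] vip_vsq(1)[OF Y r] by (intro Isum sqi_mult) (auto simp: vsq_def)
  finally show ?thesis .
 qed
 let ?f = "%i p. uc X p $ i * uc c p $ i + uc Y p $ i * uc b p $ i + uc s p $ i * uc d p $ i"
 have int: "integrable (Q t) (?f i)" if "i < k" for i using vip_vsq[OF X t] vip_vsq[OF Y t] that by (intro iadd sqi_mult) (auto simp: vsq_def)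
 have "(\<Sum>i<k. LINT p|Q t. ?f i p) = (LINT p|Q t. (\<Sum>i<k. ?f i p))" using int by (intro Isum[symmetric]) auto
 also have "... = (LINT p|Q t. uc X p *. c (fst p) (snd p) + uc Y p *. b (fst p) (snd p) + uc s p *. d (fst p) (snd p))" proof (intro icong refl)
  fix p assume "p : space (Q t)"
  then have "dim_vec (uc c p) = k" "dim_vec (uc b p) = k" "dim_vec (uc d p) = k" using vip_vsq(3,4)[OF Y t] vip_vsq(3)[OF X t] by (auto simp: vsq_def)
  then show "(\<Sum>i<k. ?f i p) = uc X p *. c (fst p) (snd p) + uc Y p *. b (fst p) (snd p) + uc s p *. d (fst p) (snd p)"
  by (simp add: sp_sum sum.distrib)
 qed
 finally have "(\<Sum>i<k. LINT p|Q t. ?f i p) = ..." .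
 moreover have "(\<Sum>i<k. EE (%w. X t w $ i * Y t w $ i)) = (\<Sum>i<k. EE (%w. X 0 w $ i * Y 0 w $ i) + (LINT p|Q t. ?f i p))"
  by (intro sum.cong refl ip_product[OF vipD(4)[OF X] vipD(4)[OF Y] t]) auto
 ultimately show ?thesis unfolding E[OF t] E[OF t0] by (simp only: sum.distrib)
qed

lemma AE_vec_eqI:
 assumes "!!i. i < k ==> AE x in N. f x $ i = g x $ i" "AE x in N. dim_vec (f x) = k" "AE x in N. dim_vec (g x) = k"
 shows "AE x in N. f x = (g x :: real vec)"
proof -
 have "AE x in N. ALL i:{..<k}. f x $ i = g x $ i" using assms(1) by (subst AE_finite_all) auto
 then show ?thesis using assms(2,3) by eventually_elim (auto intro: eq_vecI)
qed

lemma vip_forward_unique: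
 assumes X: "vip T k X b s" and T: "0 <= T" and z: "AE w in M. X 0 w = 0v k"
  and A: "dim_row A = k" "dim_col A = k" and C: "dim_row C = k" "dim_col C = k"
  and b: "AE p in Q T. uc b p = A *v uc X p" and s: "AE p in Q T. uc s p = C *v uc X p"
  and t: "t : {0..T}" shows "AE w in M. X t w = 0v k"
proof -
 \<comment> \<open>From 2 x.(A x) <= |x|^2 + |A x|^2, with |A x| and |C x| bounded through the
   entrywise norms.\<close>
 define c where "c = 1 + (mn A)^2 + (mn C)^2"
 have "AE p in Q T. (\<Sum>i\<in>{..<k}. 2 * uc X p $ i * uc b p $ i + (uc s p $ i)^2) <= c * (\<Sum>i\<in>{..<k}. (uc X p $ i)^2)" using b s AE_space
 proof eventually_elim
  case (elim p)
  define x where "x = uc X p"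
  have x: "dim_vec x = k" using vipD(1)[OF X] elim(3) by (auto simp: x_def space_Q)
  have "(\<Sum>i\<in>{..<k}. 2 * x $ i * (A *v x) $ i + ((C *v x) $ i)^2) = 2 * (x *. (A *v x)) + (C *v x) *. (C *v x)"
  using A C by (simp add: sp_sum[of _ k] sum.distrib sum_distrib_left power2_eq_square mult.assoc)
  also have "... <= c * (x *. x)"
  using scalar_prod_young[of x "A *v x"] mult_vec_bound[of x A] mult_vec_bound[of x C] x A C by (simp add: c_def algebra_simps)
  also have "x *. x = (\<Sum>i\<in>{..<k}. (x $ i)^2)" using x by (simp add: sp_sum[of _ k] power2_eq_square)
  finally show ?case unfolding elim(1,2) x_def .
 qed
 moreover have "0 < c" by (simp add: c_def add_pos_nonneg)
 moreover have zi: "AE w in M. X 0 w $ i = 0" if "i < k" for i using z by eventually_elim (use that in simp)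
 ultimately have "AE w in M. X t w $ i = 0v k $ i" if "i < k" for i
  using ip_forward_unique[OF finite_lessThan, of k T "%i t w. X t w $ i" "%i t w. b t w $ i" "%i t w. s t w $ i" c t i, OF vipD(4)[OF X] zi] t that by simp
 then show ?thesis by (rule AE_vec_eqI) (use vipD(1)[OF X t] in auto)
qed

lemma vip_backward_unique:
 assumes X: "vip T k X b s" and T: "0 <= T" and z: "AE w in M. X T w = 0v k"
  and A: "dim_row A = k" "dim_col A = k" and C: "dim_row C = k" "dim_col C = k"
  and b: "AE p in Q T. uc b p = - (A *v uc X p + tr C *v uc s p)" shows "t : {0..T} ==> AE w in M. X t w = 0v k" "AE p in Q T. uc s p = 0v k"
proof -
 \<comment> \<open>Young's inequality for 2 C x and y gives 2 |(C x).y| <= 2 |C x|^2 + |y|^2/2,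
   leaving the half of |y|^2 that the backward estimate requires.\<close>
 define c where "c = 1 + (mn A)^2 + 2 * (mn C)^2"
 have c: "0 < c" by (simp add: c_def add_pos_nonneg)
 have bnd: "AE p in Q T. (1/2) * (\<Sum>i\<in>{..<k}. (uc s p $ i)^2) - c * (\<Sum>i\<in>{..<k}. (uc X p $ i)^2)
  <= (\<Sum>i\<in>{..<k}. 2 * uc X p $ i * uc b p $ i + (uc s p $ i)^2)" using b AE_space proof eventually_elim
  case (elim p)
  define x where "x = uc X p"
  define y where "y = uc s p"
  have x: "dim_vec x = k" using vipD(1)[OF X] elim(2) by (auto simp: x_def space_Q)
  have y: "dim_vec y = k" using vproc_dim[OF vipD(3)[OF X]] elim(2) by (auto simp: y_def space_Q)
  let ?b = "- (A *v x + tr C *v y)"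
  have "(\<Sum>i\<in>{..<k}. 2 * x $ i * ?b $ i + (y $ i)^2) = 2 * (x *. ?b) + y *. y" proof -
  have "dim_vec ?b = k" using A C by simp
  from sp_sum[OF this] sp_sum[OF y] show ?thesis by (simp only: sum.distrib sum_distrib_left power2_eq_square mult.assoc)
  qed
  also have "x *. ?b = - (x *. (A *v x)) - (C *v x) *. y" using A C x y by (simp add: scalar_laws sp_tr)
  also have "(1/2) * (y *. y) - c * (x *. x) <= 2 * (- (x *. (A *v x)) - (C *v x) *. y) + y *. y"
  using scalar_prod_young[of x "A *v x"] scalar_prod_young[of "2 \<cdot>\<^sub>v (C *v x)" y] mult_vec_bound[of x A] mult_vec_bound[of x C] x y A C
  by (simp add: c_def algebra_simps scalar_laws)
  finally show ?case unfolding elim(1) x_def[symmetric] y_def[symmetric] using x y by (simp add: sp_sum[of _ k] power2_eq_square)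
 qed
 note U = ip_backward_unique[OF finite_lessThan, of k T "%i t w. X t w $ i" "%i t w. b t w $ i" "%i t w. s t w $ i", OF _ T _ c bnd]
 have zi: "AE w in M. X T w $ i = 0" if "i < k" for i using z by eventually_elim (use that in simp)
 have TT: "AE p in Q T. fst p : {0..T} & snd p : space M" by (rule AE_I2) (auto simp: space_Q)
 show "AE w in M. X t w = 0v k" if t: "t : {0..T}" proof (rule AE_vec_eqI[of k])
  show "AE w in M. X t w $ i = 0v k $ i" if "i < k" for i using U(1)[OF vipD(4)[OF X] zi _ t, of i] that by simp
 qed (use vipD(1)[OF X t] in auto)
 show "AE p in Q T. uc s p = 0v k" proof (rule AE_vec_eqI[of k])
  show "AE p in Q T. uc s p $ i = 0v k $ i" if "i < k" for i using U(2)[OF vipD(4)[OF X] zi, of i] that by simp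
  show "AE p in Q T. dim_vec (uc s p) = k" using TT by eventually_elim (use vproc_dim[OF vipD(3)[OF X]] in blast)
 qed auto
qed

lemma has_differential_imp_vip:
 assumes d: "has_differential M W T k X b s" and T: "0 <= T" and b: "vp T k b" and s: "vp T k s"
  and X: "!!t w. t : {0..T} ==> w : space M ==> dim_vec (X t w) = k" "!!i. i < k ==> jm T (%t w. X t w $ i)"
  and X0: "!!i. i < k ==> (%w. X 0 w $ i) : BM (F 0)" "!!i. i < k ==> sqi M (%w. X 0 w $ i)" shows "vip T k X b s" unfolding vip_def ip_def
proof (intro conjI allI impI ballI X X0 b s)
 fix i assume i: "i < k"
 show bi: "sqp T (%t w. b t w $ i)" and si: "sqp T (%t w. s t w $ i)" using b s i by (simp_all add: vproc_def)
 fix t assume t: "t : {0..T}"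
 then have t': "0 <= t" "t <= T" by auto
 obtain Z where Z: "has_ito_integral M W t (%r w. s r w $ i) Z"
  and e: "AE w in M. X t w $ i = X 0 w $ i + (LINT r:{0..t}|lborel. b r w $ i) + Z w" using d t i unfolding has_differential_def by blast
 have sm: "(%p. uc s p $ i) : BM (Q t)" using sqp_sqi[OF si t'(2)] by (simp add: sqi_def)
 show "ito t (%t w. s t w $ i) (%w. X t w $ i - X 0 w $ i - tint (%t w. b t w $ i) t w)"
 proof (rule ito_cong_AE[OF has_ito_imp_ito[OF Z t'(1) sm] sm])
  show "(%w. X t w $ i - X 0 w $ i - tint (%t w. b t w $ i) t w) : BM M"
  using jm_section[OF X(2)[OF i] t] X0(2)[OF i] tint_sqi(1)[OF sqp_sqi[OF bi t'(2)] t'(1)] by (auto simp: sqi_def)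
  show "AE w in M. Z w = X t w $ i - X 0 w $ i - tint (%t w. b t w $ i) t w" using e by eventually_elim (simp add: tint_def set_integral_lb)
 qed simp
qed (use b s in "auto simp: vproc_def")

text \<open>Continuity of the diffusion coefficient and its majorant supply the simple approximants
  demanded by the strict integral.\<close>

lemma vip_imp_has_differential:
 assumes X: "vip T k X b s" and s: "vc T k s" shows "has_differential M W T k X b s" unfolding has_differential_def
proof (intro ballI allI impI)
 fix t i assume t: "t : {0..T}" and i: "i < k"
 let ?Z = "%v. X t v $ i - X 0 v $ i - tint (%t v. b t v $ i) t v"
 have si: "cp T (%t v. s t v $ i)" using s i by (simp add: vproc_def)
 obtain w where w: "sqi M w" "AE v in M. ALL t:{0..T}. abs (s t v $ i) <= w v" using si unfolding cp_def by (elim conjE exE)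
 have "has_ito_integral M W t (%r v. s r v $ i) ?Z" proof (rule ito_imp_has_ito)
  show "0 <= t" using t by simp
  show "ito t (%r v. s r v $ i) ?Z" using vipD(4)[OF X i] t by (simp add: ip_def)
  show "(%v. s r v $ i) : BM (F r)" if "r : {0..t}" for r using cp_F[OF si, of r] that t by simp
  show "continuous_on {0..t} (%r. s r v $ i)" if "v : space M" for v by (rule continuous_on_subset[OF cp_cont[OF si that]]) (use t in auto)
  show "AE v in M. ALL r:{0..t}. abs (s r v $ i) <= w v" using w(2) by eventually_elim (use t in auto)
 qed (rule w(1))
 then show "EX Z. has_ito_integral M W t (%r v. s r v $ i) Z & (AE v in M. X t v $ i = X 0 v $ i + (LINT r:{0..t}|lborel. b r v $ i) + Z v)"
  by (intro exI[of _ ?Z] conjI) (auto simp: tint_def set_integral_lb)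
qed

text \<open>The rational times share one null set, off which continuity extends the equality to all
  times.\<close>

lemma vc_indist:
 assumes X: "vc T k X" and Y: "vc T k Y" and T: "0 <= T" and e: "!!t. t : {0..T} ==> AE w in M. X t w = Y t w" shows "indist M T X Y"
proof -
 have "AE w in M. ALL q:\<rat> Int {0..T}. X q w = Y q w" using e countable_rat by (subst AE_ball_countable) auto
 then show ?thesis unfolding indist_def using AE_space proof eventually_elim
  case (elim w)
  show ?case proof
  fix t assume t: "t : {0..T}"
  show "X t w = Y t w" proof (rule eq_vecI)
  fix i assume "i < dim_vec (Y t w)"
  then have i: "i < k" using vproc_dim[OF Y t elim(2)] by simp
  have c: "continuous_on {0..T} (%t. abs (X t w $ i - Y t w $ i))" using X Y i by (intro continuous_intros cp_cont elim(2)) (auto simp: vproc_def)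
  have "abs (X t w $ i - Y t w $ i) <= 0" by (rule continuous_on_Rats_le[OF T c _ t]) (use elim(1) in simp)
  then show "X t w $ i = Y t w $ i" by simp
  qed (simp add: vproc_dim[OF X t elim(2)] vproc_dim[OF Y t elim(2)])
  qed
 qed
qed

end

text \<open>Testing with a vector z turns matrix identities into identities of real numbers, which
  follow from the laws of the scalar product by simplification.\<close>

lemma sp_eqI:
 fixes v w :: "real vec"
 assumes "dim_vec v = k" "dim_vec w = k" "!!z. dim_vec z = k ==> z *. v = z *. w" shows "v = w"
proof (rule eq_vecI)
 fix i assume "i < dim_vec w"
 then show "v $ i = w $ i" using assms(3)[of "unit_vec k i"] assms(1,2) by simp
qed (use assms in simp)

lemma mult_zero_vec [simp]: "dim_col A = k ==> A *v 0v k = (0v (dim_row A) :: real vec)"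
 and uminus_zero_vec' [simp]: "- 0v k = (0v k :: real vec)" by (auto simp: scalar_prod_def)

lemma pos_def_one: "pos_def k (1\<^sub>m k)" unfolding pos_def_def
proof (intro conjI ballI impI)
 fix v :: "real vec" assume v: "v : carrier_vec k" "v ~= 0v k"
 have "EX i<k. v $ i ~= 0" proof (rule ccontr)
  assume "\<not> (EX i<k. v $ i ~= 0)"
  then have "v = 0v k" using v(1) by (intro eq_vecI) auto
  then show False using v(2) by simp
 qed
 then obtain i where i: "i < k" "v $ i ~= 0" by blast
 have "0 < (\<Sum>i<k. v $ i * v $ i)" by (rule sum_pos2[of _ i]) (use i in "auto simp: zero_less_mult_iff")
 then show "0 < v *. (1\<^sub>m k *v v)" using v(1) by (simp add: sp_sum[of _ k] one_mult_mat_vec[of _ k])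
qed simp_all

lemma pos_semidef_nonneg: "pos_semidef k X ==> dim_vec v = k ==> 0 <= v *. (X *v v)"
 unfolding pos_semidef_def by (elim conjE bspec) (simp only: carrier_vec_iff)

section \<open>The feedback solution of the forward-backward equation\<close>

context riccati
begin

context
 fixes P x p q assumes P: "pos_semidef h P" and x[simp]: "dim_vec x = h"
  and p: "p = - (P *v x)" and q: "q = - (P *v (CG P *v x))"
begin

text \<open>For p = - P x and q = - P (CG x) the stationarity condition is the defining equation of
  the gain, \<open>G P\<close> times \<open>gain P\<close> equals \<open>L P\<close>, tested with
  z.\<close>

lemma scalar_prod_feedback:
 "dim_vec z = r ==> z *. (tr B *v p + tr D *v q) = - (z *. (R *v (gain P *v x)))"
proof -
 assume z[simp]: "dim_vec z = r"
 note [simp] = Pd[OF P] gain_dims[OF P] GL_dims[OF P]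
 have "G P *v (gain P *v x) = L P *v x" by (simp add: mat_laws(1)[symmetric] G_gain[OF P])
 then have "z *. (G P *v (gain P *v x)) = z *. (L P *v x)" by simp
 then show ?thesis by (simp add: quad_G[OF P] quad_L[OF P] p q CG_def mat_laws scalar_laws sp_tr)
qed

lemma feedback: "hv R B D p q = - (gain P *v x)"
proof -
 note [simp] = Pd[OF P] gain_dims[OF P]
 note Ri = pos_def_minv[OF R]
 have "tr B *v p + tr D *v q = - (R *v (gain P *v x))" proof (rule sp_eqI[of _ r])
  fix z :: "real vec" assume "dim_vec z = r"
  then show "z *. (tr B *v p + tr D *v q) = z *. - (R *v (gain P *v x))"
  unfolding scalar_prod_feedback[OF \<open>dim_vec z = r\<close>] by (simp add: scalar_laws)
 qed simp_all
 moreover have "minv R *v (R *v (gain P *v x)) = gain P *v x"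
  using Ri(1,3) mat_laws(1)[of R "minv R" "gain P *v x"] one_mult_mat_vec[of "gain P *v x" r] by simp
 ultimately show ?thesis using Ri(1) by (simp add: mat_laws)
qed

text \<open>The third identity is what the differential of - P x requires: the contribution of the
  Riccati derivative minus P times the closed-loop drift is the adjoint drift.\<close>

lemma closed_loop:
 "A *v x + B *v (hv R B D p q) = AG P *v x"
 "C *v x + D *v (hv R B D p q) = CG P *v x"
 "ric P *v x - P *v (AG P *v x) = - (tr A *v p + tr C *v q - Q *v x)"
proof -
 note [simp] = Pd[OF P] gain_dims[OF P] AG_dims[OF P] ric_dims[OF P]
 show "A *v x + B *v (hv R B D p q) = AG P *v x"
  "C *v x + D *v (hv R B D p q) = CG P *v x" unfolding feedback by (rule sp_eqI[of _ h]; simp add: AG_def CG_def mat_laws scalar_laws)+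
 show "ric P *v x - P *v (AG P *v x) = - (tr A *v p + tr C *v q - Q *v x)" proof (rule sp_eqI[of _ h])
  fix z :: "real vec" assume z[simp]: "dim_vec z = h"
  have AGz: "AG P *v z = A *v z - B *v (gain P *v z)" and CGz: "CG P *v z = C *v z - D *v (gain P *v z)" by (simp_all add: AG_def CG_def mat_laws)
  have "z *. (ric P *v x) = (AG P *v z) *. (P *v x) + z *. (P *v (AG P *v x)) + (CG P *v z) *. (P *v (CG P *v x))
  + z *. (Q *v x) + (gain P *v z) *. (R *v (gain P *v x))" by (simp add: ric_def mat_laws scalar_laws sp_tr)
  moreover have "(B *v (gain P *v z)) *. (P *v x) + (D *v (gain P *v z)) *. (P *v (CG P *v x)) = (gain P *v z) *. (R *v (gain P *v x))"
  using scalar_prod_feedback[of "gain P *v z"] by (simp add: p q scalar_laws sp_tr mat_laws)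
  ultimately show "z *. (ric P *v x - P *v (AG P *v x)) = z *. (- (tr A *v p + tr C *v q - Q *v x))"
  by (simp add: p q AGz CGz[symmetric] scalar_laws sp_tr mat_laws) (simp add: CGz scalar_laws)
 qed (simp_all add: p q)
qed

end

end

context wiener
begin

text \<open>With the Riccati gain the forward equation decouples into a linear equation with
  continuous coefficients; p and q are then read off from its solution, which makes q
  continuous.\<close>

lemma fbsde_exists:
 assumes ric: "riccati h r A C B D Qm R" and H: "pos_semidef h H" and T: "0 < T" shows "EX x p q. vc T h x & vc T h p & vc T h q &
  vip T h x (%t w. A *v x t w + B *v (hv R B D (p t w) (q t w)))
  (%t w. C *v x t w + D *v (hv R B D (p t w) (q t w))) &
  vip T h p (%t w. - (tr A *v p t w + tr C *v q t w - Qm *v x t w)) q &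
  (AE w in M. x 0 w = vec h (%l. y0 l)) & (ALL w. p T w = - (H *v x T w))"
proof -
 interpret R: riccati h r A C B D Qm R by (rule ric)
 have T0: "0 <= T" using T by simp
 from R.riccati_exists[OF H T] obtain P where PP: "(ALL t:{0..T}. pos_semidef h (P t)) & P T = H &
  (ALL i<h. ALL j<h. ALL t:{0..T}. ((%t. P t $$ (i, j)) has_real_derivative - R.ric (P t) $$ (i, j)) (at t within {0..T})) &
  (ALL i<h. ALL j<h. continuous_on {0..T} (%t. R.ric (P t) $$ (i, j))) &
  (ALL i<r. ALL j<h. continuous_on {0..T} (%t. R.gain (P t) $$ (i, j)))" by (elim exE)
 have P: "pos_semidef h (P t)" if "t : {0..T}" for t using PP that by blast
 have PT: "P T = H" using PP by (elim conjE)
 have dP: "((%t. P t $$ (i, j)) has_real_derivative - R.ric (P t) $$ (i, j)) (at t within {0..T})" if "i < h" "j < h" "t : {0..T}" for i j t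
  using PP that by blast
 have cr: "continuous_on {0..T} (%t. R.ric (P t) $$ (i, j))" if "i < h" "j < h" for i j using PP that by blast
 have cg: "continuous_on {0..T} (%t. R.gain (P t) $$ (i, j))" if "i < r" "j < h" for i j using PP that by blast
 have Pd: "dim_row (P t) = h" "dim_col (P t) = h" "dim_row (R.gain (P t)) = r" "dim_col (R.gain (P t)) = h"
  "dim_row (R.AG (P t)) = h" "dim_col (R.AG (P t)) = h" "dim_row (R.CG (P t)) = h" "dim_col (R.CG (P t)) = h"
  "dim_row (R.ric (P t)) = h" "dim_col (R.ric (P t)) = h" if "t : {0..T}" for t
  using R.Pd[OF P[OF that]] R.gain_dims[OF P[OF that]] R.AG_dims[OF P[OF that]] R.ric_dims[OF P[OF that]] by auto
 define a where "a t l j = R.AG (P t) $$ (l, j)" for t l j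
 define c where "c t l j = R.CG (P t) $$ (l, j)" for t l j
 have cl: "continuous_on {0..T} (%t. (X - Y * R.gain (P t)) $$ (l, j))"
  if "l < h" "j < h" "dim_row Y = h" "dim_col Y = r" for l j and X Y :: "real mat" proof (rule continuous_on_eq)
  show "continuous_on {0..T} (%t. X $$ (l, j) - (\<Sum>i<r. Y $$ (l, i) * R.gain (P t) $$ (i, j)))" using that by (intro continuous_intros cg) auto
  show "X $$ (l, j) - (\<Sum>i<r. Y $$ (l, i) * R.gain (P t) $$ (i, j)) = (X - Y * R.gain (P t)) $$ (l, j)" if "t : {0..T}" for t
  using \<open>l < h\<close> \<open>j < h\<close> \<open>dim_row Y = h\<close> \<open>dim_col Y = r\<close> Pd[OF that] by (simp add: sp_sum[of _ r])
 qed
 have ac: "continuous_on {0..T} (%t. a t l j)" "continuous_on {0..T} (%t. c t l j)" if "l < h" "j < h" for l j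
  unfolding a_def c_def R.AG_def R.CG_def using that by (intro cl; simp)+
 have "EX y. ALL l<h. cp T (y l) & (AE w in M. y l 0 w = y0 l) & ip T (y l) (lin h a y l) (lin h c y l)"
  by (rule linear_sde_exists[OF T0]) (rule ac; assumption)+
 then obtain y
  where yy: "ALL l<h. cp T (y l) & (AE w in M. y l 0 w = y0 l) & ip T (y l) (lin h a y l) (lin h c y l)" by (elim exE)
 have y: "cp T (y l)" "AE w in M. y l 0 w = y0 l" "ip T (y l) (lin h a y l) (lin h c y l)" if "l < h" for l
  using yy[rule_format, OF that] by (simp_all only:)
 define x where "x t w = vec h (%l. y l t w)" for t w
 define p where "p t w = - (P t *v x t w)" for t w
 define q where "q t w = - (P t *v (R.CG (P t) *v x t w))" for t w
 have xd: "dim_vec (x t w) = h" for t w by (simp add: x_def)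
 have lin: "lin h a y l t w = (R.AG (P t) *v x t w) $ l" "lin h c y l t w = (R.CG (P t) *v x t w) $ l"
  if "l < h" "t : {0..T}" for l t w using that Pd[OF that(2)] by (auto simp: lin_def a_def c_def x_def sp_sum[of _ h])
 have lc: "cp T (lin h c y l)" if "l < h" for l using that by (intro cp_lin ac y)
 have xi: "vip T h x (%t w. vec h (%l. lin h a y l t w)) (%t w. vec h (%l. lin h c y l t w))"
  unfolding vip_def vproc_def using y(3) by (auto simp: x_def ip_def)
 \<comment> \<open>Copies of p, q and of the drift of p as sums of scalar terms, because
   multiplication by a deterministic factor is available entry by entry.\<close>
 define p' where "p' t w = vec h (%l. \<Sum>j<h. - P t $$ (l, j) * y j t w)" for t w
 define q' where "q' t w = vec h (%l. \<Sum>j<h. - P t $$ (l, j) * lin h c y j t w)" for t w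
 define b' where "b' t w = vec h (%l. \<Sum>j<h. R.ric (P t) $$ (l, j) * y j t w + - P t $$ (l, j) * lin h a y j t w)" for t w
 have Pc: "continuous_on {0..T} (%t. - P t $$ (l, j))" if "l < h" "j < h" for l j
  using DERIV_continuous_on[OF dP[OF that]] by (intro continuous_intros)
 have pi: "ip T (%t w. - P t $$ (l, j) * y j t w) (%t w. R.ric (P t) $$ (l, j) * y j t w + - P t $$ (l, j) * lin h a y j t w)
  (%t w. - P t $$ (l, j) * lin h c y j t w)" if lj: "l < h" "j < h" for l j
 proof (rule ip_det_mult[OF T0 y(3)[OF lj(2)] cp_jm[OF y(1)[OF lj(2)]] cp_sqp[OF y(1)[OF lj(2)]] lc[OF lj(2)] _ cr[OF lj]])
  show "((%t. - P t $$ (l, j)) has_real_derivative R.ric (P t) $$ (l, j)) (at t within {0..T})" if "t : {0..T}" for t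
  using DERIV_minus[OF dP[OF lj that]] by simp
 qed
 have p'i: "vip T h p' b' q'" unfolding vip_def vproc_def proof (intro conjI allI impI ballI)
  fix l assume l: "l < h"
  have *: "ip T (%t w. \<Sum>j<h. - P t $$ (l, j) * y j t w) (%t w. \<Sum>j<h. R.ric (P t) $$ (l, j) * y j t w + - P t $$ (l, j) * lin h a y j t w)
  (%t w. \<Sum>j<h. - P t $$ (l, j) * lin h c y j t w)" by (rule ip_sum[OF T0 pi]) (use l in auto)
  then show "ip T (%t w. p' t w $ l) (%t w. b' t w $ l) (%t w. q' t w $ l)" using l by (simp add: p'_def b'_def q'_def)
  then show "sqp T (%t w. b' t w $ l)" "sqp T (%t w. q' t w $ l)" by (simp_all add: ip_def)
 qed (simp_all add: p'_def b'_def q'_def)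
 have p'c: "vc T h p'" and q'c: "vc T h q'" proof -
  have "cp T (%t w. \<Sum>j<h. - P t $$ (l, j) * y j t w)" "cp T (%t w. \<Sum>j<h. - P t $$ (l, j) * lin h c y j t w)" if "l < h" for l
  by (intro cp_sum cp_det y(1) lc Pc that; simp)+
  then show "vc T h p'" "vc T h q'" by (simp_all add: vproc_def p'_def q'_def)
 qed
 have eqs: "p' t w = p t w" "q' t w = q t w" "b' t w = R.ric (P t) *v x t w - P t *v (R.AG (P t) *v x t w)"
  if t: "t : {0..T}" for t w proof -
  note d = Pd[OF t]
  show "p' t w = p t w" unfolding p'_def p_def x_def using d by (intro eq_vecI) (auto simp: sp_sum[of _ h] sum_negf)
  have PX: "(P t *v (X *v x t w)) $ l = (\<Sum>j<h. P t $$ (l, j) * (X *v x t w) $ j)" if "l < h" "dim_row X = h" for X l proof -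
  have "(P t *v (X *v x t w)) $ l = row (P t) l *. (X *v x t w)" using that d by (intro index_mult_mat_vec) simp
  also have "... = (\<Sum>j<h. P t $$ (l, j) * (X *v x t w) $ j)"
  using that d by (subst sp_sum[of _ h]) (auto intro!: sum.cong simp del: index_mult_mat_vec)
  finally show ?thesis .
  qed
  have s: "(P t *v (R.CG (P t) *v x t w)) $ l = (\<Sum>j<h. P t $$ (l, j) * lin h c y j t w)"
  "(P t *v (R.AG (P t) *v x t w)) $ l = (\<Sum>j<h. P t $$ (l, j) * lin h a y j t w)" if "l < h" for l
  unfolding PX[OF that d(7)] PX[OF that d(5)] by (intro sum.cong refl arg_cong2[where f = "(*)"] lin(1,2)[OF _ t, symmetric]; simp)+
  show "q' t w = q t w" proof (rule eq_vecI)
  fix l assume "l < dim_vec (q t w)"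
  then have l: "l < h" using d by (simp add: q_def)
  then have "q t w $ l = - (P t *v (R.CG (P t) *v x t w)) $ l" using d unfolding q_def by (intro index_uminus_vec(1)) simp
  then show "q' t w $ l = q t w $ l" using l by (simp add: q'_def s(1) sum_negf del: index_mult_mat_vec)
  qed (simp add: q'_def q_def d)
  show "b' t w = R.ric (P t) *v x t w - P t *v (R.AG (P t) *v x t w)" proof (rule eq_vecI)
  fix l assume "l < dim_vec (R.ric (P t) *v x t w - P t *v (R.AG (P t) *v x t w))"
  then have l: "l < h" using d by simp
  have "(R.ric (P t) *v x t w) $ l = (\<Sum>j<h. R.ric (P t) $$ (l, j) * y j t w)" using d l by (simp add: sp_sum[of _ h] x_def)
  then show "b' t w $ l = (R.ric (P t) *v x t w - P t *v (R.AG (P t) *v x t w)) $ l"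
  using l d by (simp add: b'_def s(2) sum.distrib sum_subtractf sum_negf del: index_mult_mat_vec)
  qed (simp add: b'_def d)
 qed
 note cl = R.closed_loop[OF P xd p_def q_def]
 have "vc T h x" unfolding vproc_def using y(1) by (auto simp: x_def)
 moreover have "vc T h p" "vc T h q" by (rule vproc_cong[OF p'c linear_class_cp] vproc_cong[OF q'c linear_class_cp], rule eqs, assumption)+
 moreover have "vip T h x (%t w. A *v x t w + B *v (hv R B D (p t w) (q t w)))
  (%t w. C *v x t w + D *v (hv R B D (p t w) (q t w)))" proof (rule vip_cong_pointwise[OF xi T0], intro conjI)
  fix t w assume t: "t : {0..T}"
  show "vec h (%l. lin h a y l t w) = A *v x t w + B *v (hv R B D (p t w) (q t w))"
  unfolding cl(1)[OF t] using lin(1)[OF _ t] Pd[OF t] by (intro eq_vecI) (auto simp del: index_mult_mat_vec)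
  show "vec h (%l. lin h c y l t w) = C *v x t w + D *v (hv R B D (p t w) (q t w))"
  unfolding cl(2)[OF t] using lin(2)[OF _ t] Pd[OF t] by (intro eq_vecI) (auto simp del: index_mult_mat_vec)
 qed simp
 moreover have "vip T h p (%t w. - (tr A *v p t w + tr C *v q t w - Qm *v x t w)) q" proof (rule vip_cong_pointwise[OF p'i T0])
  fix t w assume t: "t : {0..T}"
  show "p' t w = p t w & b' t w = - (tr A *v p t w + tr C *v q t w - Qm *v x t w) & q' t w = q t w" using eqs[OF t] cl(3)[OF t] by simp
 qed
 moreover have "AE w in M. x 0 w = vec h (%l. y0 l)" by (rule AE_vec_eqI[of h]) (use y(2) in "auto simp: x_def")
 moreover have "ALL w. p T w = - (H *v x T w)" by (simp add: p_def PT)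
 ultimately show ?thesis by (intro exI[of _ x] exI[of _ p] exI[of _ q] conjI)
qed

text \<open>By Fubini, null sets that depend on the time assemble to a null set of the product; the
  squared norm makes one integral out of the components.\<close>

lemma AE_Q_zero:
 assumes y: "vsq (Q T) k (uc y)" and z: "!!t. t : {0..T} ==> AE w in M. y t w = 0v k" shows "AE p in Q T. uc y p = 0v k"
proof (rule vsq_integral_zero[OF y pos_def_one])
 have vs: "vsq (Q T) k (%p. 1\<^sub>m k *v uc y p)" by (rule vsq_mult[OF y]) simp_all
 have "(LINT p|Q T. uc y p *. (1\<^sub>m k *v uc y p)) = (LINT s|lb T. (LINT w|M. y s w *. (1\<^sub>m k *v y s w)))"
  using integral_Q_fst(1)[OF vsq_integrable[OF y vs]] by simp
 also have "... = (LINT s|lb T. 0)" proof (intro icong refl)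
  fix s assume "s : space (lb T)"
  then have "AE w in M. y s w *. (1\<^sub>m k *v y s w) = 0" using z[of s] by (auto elim!: eventually_mono)
  then show "(LINT w|M. y s w *. (1\<^sub>m k *v y s w)) = 0" by (rule integral_eq_zero_AE)
 qed
 finally show "(LINT p|Q T. uc y p *. (1\<^sub>m k *v uc y p)) <= 0" by simp
qed

end

section \<open>Block vectors, inverses and nilpotent Jordan blocks\<close>

lemma append_laws:
 fixes a b c d :: "real vec" shows "dim_vec a = dim_vec b ==> dim_vec c = dim_vec d ==> (a @v c) + (b @v d) = (a + b) @v (c + d)"
  and "dim_vec a = dim_vec b ==> dim_vec c = dim_vec d ==> (a @v c) *. (b @v d) = a *. b + c *. d"
  and "dim_vec a = dim_vec b ==> a @v c = b @v d \<longleftrightarrow> a = b & c = d"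
 subgoal by (rule append_vec_add[of _ "dim_vec a" _ _ "dim_vec c"]) auto
 subgoal by (rule scalar_prod_append[of _ "dim_vec a" _ "dim_vec c"]) auto
 subgoal by (rule append_vec_eq[of _ "dim_vec a"]) auto
 done

lemma four_block_mult_vec:
 fixes a b :: "real vec"
 assumes "dim_row Y = dim_row X" "dim_col Z = dim_col X" "dim_row V = dim_row Z" "dim_col V = dim_col Y" "dim_vec a = dim_col X" "dim_vec b = dim_col Y"
 shows "four_block_mat X Y Z V *v (a @v b) = (X *v a + Y *v b) @v (Z *v a + V *v b)"
 by (rule four_block_mat_mult_vec[of _ "dim_row X" "dim_col X" _ "dim_col Y" _ "dim_row Z"]) (use assms in auto)

lemma rows_mult_vec:
 fixes v :: "real vec"
 assumes "dim_col X = dim_vec v" "dim_col Y = dim_vec v" shows "(X @\<^sub>r Y) *v v = (X *v v) @v (Y *v v)"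
 by (rule mat_mult_append[of _ "dim_row X" "dim_vec v" _ "dim_row Y"]) (use assms in auto)

lemma append_rows_dims[simp]: "dim_row (X @\<^sub>r Y) = dim_row X + dim_row Y" "dim_col (X @\<^sub>r Y) = dim_col X"
 by (simp_all add: append_rows_def)

lemma vec_laws[simp]:
 fixes v w :: "real vec"
 shows "dim_vec v = k ==> v + 0v k = v" "dim_vec v = k ==> 0v k + v = v" "dim_vec v = k ==> 0\<^sub>m m k *v v = 0v m" "dim_vec v = k ==> 1\<^sub>m k *v v = v"
 by (auto intro!: eq_vecI simp: scalar_prod_def one_mult_mat_vec[of _ k])

lemma inverse_mult_vec:
 assumes "X * Y = 1\<^sub>m k" "dim_row Y = dim_col X" "dim_col Y = k" "dim_vec v = k" shows "X *v (Y *v v) = (v :: real vec)"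
proof -
 have "X *v (Y *v v) = (X * Y) *v v" using assms by (intro mat_laws(1)[symmetric]) simp_all
 then show ?thesis unfolding assms(1) using assms(4) by simp
qed

text \<open>The inverse provided by \<open>invertible_mat\<close> makes the kernel trivial; then the
  determinant is nonzero and \<open>mat_inverse\<close> returns a value, so that \<open>minv\<close>
  is meaningful.\<close>

lemma invertible_mat_minv:
 assumes X: "invertible_mat X" "dim_row X = k"
 shows "dim_row (minv X) = k" "dim_col (minv X) = k" "dim_vec v = k ==> X *v (minv X *v v) = v" "dim_vec v = k ==> minv X *v (X *v v) = v"
proof -
 obtain Y where sq: "dim_col X = k" and Y: "X * Y = 1\<^sub>m k" "Y * X = 1\<^sub>m (dim_row Y)"
  using X by (auto simp: invertible_mat_def inverts_mat_def)
 have d: "dim_row Y = k" "dim_col Y = k" using arg_cong[OF Y(1), of dim_col] arg_cong[OF Y(2), of dim_col] sq by auto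
 have ker: "v = 0v k" if "v : carrier_vec k" "X *v v = 0v k" for v proof -
  have "v = (Y * X) *v v" using that(1) by (simp add: Y(2) d)
  also have "... = Y *v (X *v v)" using that d sq X(2) by (intro mat_laws) simp_all
  finally show ?thesis using that d by simp
 qed
 have Xc: "X : carrier_mat k k" using X(2) sq by simp
 note m = minv_props[OF Xc ker]
 show dd: "dim_row (minv X) = k" "dim_col (minv X) = k" using m(1) by simp_all
 show "X *v (minv X *v v) = v" "minv X *v (X *v v) = v" if "dim_vec v = k"
  using inverse_mult_vec[OF m(2)] inverse_mult_vec[OF m(3)] dd X(2) sq that by simp_all
qed

declare diag_block_mat.simps(2)[simp del]

abbreviation jordan_blocks :: "nat list => real mat" where
 "jordan_blocks ms == diag_block_mat (map (%k. jordan_block k 0) ms)"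

lemma jordan_blocks_dims: "dim_row (jordan_blocks ms) = sum_list ms" "dim_col (jordan_blocks ms) = sum_list ms"
 unfolding dim_diag_block_mat map_map o_def by (simp_all add: jordan_block_index)

text \<open>Besides lying on the superdiagonal, a nonzero entry never sits in the first column of a
  block; this is the counterpart of the first-row condition on \<open>B2\<close>.\<close>

lemma jordan_blocks_index:
 "i < sum_list ms ==> j < sum_list ms ==> jordan_blocks ms $$ (i, j) ~= 0 ==>
  j = Suc i & (EX k<length ms. EX i'. 0 < i' & i' < ms ! k & j = sum_list (take k ms) + i')"
proof (induction ms arbitrary: i j)
 case (Cons m ms)
 let ?G = "jordan_blocks ms"
 have G: "jordan_blocks (m # ms) = four_block_mat (jordan_block m 0) (0\<^sub>m m (sum_list ms)) (0\<^sub>m (sum_list ms) m) ?G"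
  using jordan_blocks_dims[of ms] by (simp only: list.map diag_block_mat.simps Let_def jordan_block_index)
 have e: "jordan_blocks (m # ms) $$ (i, j) = (if i < m then if j < m then jordan_block m 0 $$ (i, j) else 0 else if j < m then 0 else ?G $$ (i - m, j - m))"
  unfolding G using Cons.prems(1,2) jordan_blocks_dims[of ms] by (subst index_mat_four_block) auto
 show ?case proof (cases "i < m")
  case True
  then have j: "j < m & jordan_block m 0 $$ (i, j) ~= (0::real)" using Cons.prems(3) unfolding e by (auto split: if_splits)
  then have "j = Suc i" using True by (auto split: if_splits)
  then show ?thesis using j by (intro conjI exI[of _ 0] exI[of _ j]) simp_all
 next
  case False
  then have j: "\<not> j < m" and g: "?G $$ (i - m, j - m) ~= 0" using Cons.prems(3) unfolding e by (auto split: if_splits)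
  have "i - m < sum_list ms" "j - m < sum_list ms" using Cons.prems(1,2) False j by auto
  from Cons.IH[OF this g] obtain k i' where k: "j - m = Suc (i - m)" "k < length ms" "0 < i'" "i' < ms ! k" "j - m = sum_list (take k ms) + i'" by blast
  then show ?thesis using False j by (intro conjI exI[of _ "Suc k"] exI[of _ i']) auto
 qed
qed simp

section \<open>The slow and the fast subsystem\<close>

text \<open>The algebraic side without any probability space, so that the matrix in the conclusion
  visibly depends on the coefficients only.\<close>

locale slq =
 fixes E A C B D Qm H R K F :: "real mat"
  and M1 N1 A1 B1 B2 C11 C12 C22 D1 D2 Dt Theta Qh S Rh Hh :: "real mat"
  and n r h :: nat and ms :: "nat list"
 assumes dims: "E : carrier_mat n n" "A : carrier_mat n n" "C : carrier_mat n n"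
  "B : carrier_mat n r" "D : carrier_mat n r"
  "Qm : carrier_mat n n" "H : carrier_mat n n" "R : carrier_mat r r" "K : carrier_mat r n"
  and S_trans: "M1 : carrier_mat n n" "invertible_mat M1" "N1 : carrier_mat n n" "invertible_mat N1"
  and S_dims: "h <= n" "A1 : carrier_mat h h" "C11 : carrier_mat h h"
  "C12 : carrier_mat h (n - h)" "C22 : carrier_mat (n - h) (n - h)"
  "B1 : carrier_mat h r" "D1 : carrier_mat h r"
  "B2 : carrier_mat (n - h) r" "D2 : carrier_mat (n - h) r"
  and S_ms: "sum_list ms = n - h"
  and S_E: "M1 * E * N1 = diag_block_mat [1\<^sub>m h, diag_block_mat (map (%k. jordan_block k 0) ms)]"
  and S_A: "M1 * (A + B * K) * N1 = diag_block_mat [A1, 1\<^sub>m (n - h)]"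
  and S_B: "M1 * B = B1 @\<^sub>r B2"
  and S_C: "M1 * (C + D * K) * N1 = four_block_mat C11 C12 (0\<^sub>m (n - h) h) C22"
  and S_D: "M1 * D = D1 @\<^sub>r D2"
  and S_CBD: "C22 * B2 = D2"
  and S_B2: "only_first_rows ms B2"
  and Dt_def: "Dt = D1 - C12 * B2"
  and Theta_def: "Theta = four_block_mat N1 (0\<^sub>m n r) (K * N1) (1\<^sub>m r)
  * four_block_mat (1\<^sub>m h @\<^sub>r 0\<^sub>m (n - h) h) (0\<^sub>m h r @\<^sub>r (- B2)) (0\<^sub>m r h) (1\<^sub>m r)"
  and hat_dims: "Qh : carrier_mat h h" "S : carrier_mat r h" "Rh : carrier_mat r r"
  and hat_def: "four_block_mat Qh (transpose_mat S) S Rh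
  = transpose_mat Theta * diag_block_mat [Qm, R] * Theta"
  and Hh_def: "Hh = transpose_mat (1\<^sub>m h @\<^sub>r 0\<^sub>m (n - h) h)
  * (transpose_mat (minv M1) * H * minv M1) * (1\<^sub>m h @\<^sub>r 0\<^sub>m (n - h) h)"
  and H1: "(pos_def n Qm & pos_def r R & pos_semidef n H & F = K) \<or>
  (pos_semidef n Qm & mat_rank r (1\<^sub>m r + K * N1 * (0\<^sub>m h r @\<^sub>r (- B2))) = r &
  pos_def r R & pos_semidef n H & F : {K, 0\<^sub>m r n})"
begin

abbreviation "l == n - h"
abbreviation "G == jordan_blocks ms"
abbreviation "Mi == minv M1"
abbreviation "Ni == minv N1"
definition J1 where "J1 = tr (1\<^sub>m h @\<^sub>r 0\<^sub>m l h :: real mat)"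
definition J2 where "J2 = tr (0\<^sub>m h l @\<^sub>r 1\<^sub>m l :: real mat)"
text \<open>The state reconstructed from the slow part y and the input v, with the fast part already
  set to the value that the equation forces on it.\<close>

definition xx where "xx y v = N1 *v (y @v - (B2 *v v))"
definition uu where "uu y v = K *v xx y v + v"

lemma hl[simp]: "h + l = n" using S_dims(1) by simp

lemma dd[simp]: "dim_row E = n" "dim_col E = n" "dim_row A = n" "dim_col A = n" "dim_row C = n" "dim_col C = n" "dim_row B = n" "dim_col B = r"
 "dim_row D = n" "dim_col D = r" "dim_row Qm = n" "dim_col Qm = n" "dim_row H = n" "dim_col H = n" "dim_row R = r" "dim_col R = r"
 "dim_row K = r" "dim_col K = n" "dim_row M1 = n" "dim_col M1 = n" "dim_row N1 = n" "dim_col N1 = n"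
 "dim_row A1 = h" "dim_col A1 = h" "dim_row C11 = h" "dim_col C11 = h" "dim_row C12 = h" "dim_col C12 = l" "dim_row C22 = l" "dim_col C22 = l"
 "dim_row B1 = h" "dim_col B1 = r" "dim_row D1 = h" "dim_col D1 = r" "dim_row B2 = l" "dim_col B2 = r" "dim_row D2 = l" "dim_col D2 = r"
 "dim_row Qh = h" "dim_col Qh = h" "dim_row S = r" "dim_col S = h" "dim_row Rh = r" "dim_col Rh = r"
 by ((rule carrier_matD(1), rule dims S_trans S_dims hat_dims) | (rule carrier_matD(2), rule dims S_trans S_dims hat_dims))+

lemma dd2[simp]: "dim_row Dt = h" "dim_col Dt = r" "dim_row G = l" "dim_col G = l"
 by (simp_all add: Dt_def jordan_blocks_dims S_ms del: diag_block_mat.simps)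

lemma minv_dims[simp]: "dim_row Mi = n" "dim_col Mi = n" "dim_row Ni = n" "dim_col Ni = n"
 and minv_vec[simp]: "dim_vec v = n ==> M1 *v (Mi *v v) = v" "dim_vec v = n ==> Mi *v (M1 *v v) = v"
  "dim_vec v = n ==> N1 *v (Ni *v v) = v" "dim_vec v = n ==> Ni *v (N1 *v v) = v"
 using invertible_mat_minv[OF S_trans(2) dd(19)] invertible_mat_minv[OF S_trans(4) dd(21)] by simp_all

lemma J_dims[simp]: "dim_row J1 = h" "dim_col J1 = n" "dim_row J2 = l" "dim_col J2 = n" by (simp_all add: J1_def J2_def)

lemma J_append[simp]:
 assumes "dim_vec a = h" "dim_vec b = l" shows "J1 *v (a @v b) = a" "J2 *v (a @v b) = b"
proof -
 show "J1 *v (a @v b) = a"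
  by (rule sp_eqI[of _ h]) (use assms in "simp_all add: J1_def sp_tr rows_mult_vec append_laws")
 show "J2 *v (a @v b) = b"
  by (rule sp_eqI[of _ l]) (use assms in "simp_all add: J2_def sp_tr rows_mult_vec append_laws")
qed

lemma J_split: "dim_vec v = n ==> (J1 *v v) @v (J2 *v v) = v"
proof -
 assume v: "dim_vec v = n"
 have "v = vec_first v h @v vec_last v l" using vec_first_last_append[of v h l] v by simp
 then show ?thesis using J_append[of "vec_first v h" "vec_last v l"] by (metis dim_vec_first dim_vec_last)
qed

lemma J_first_last: "dim_vec v = n ==> vec_first v h = J1 *v v" "dim_vec v = n ==> vec_last v l = J2 *v v"
 using vec_first_last_append[of v h l] J_append[of "vec_first v h" "vec_last v l"] by simp_all

lemma diag2: "dim_vec a = dim_col X ==> dim_vec b = dim_col Y ==> diag_block_mat [X, Y] *v (a @v b) = (X *v a) @v (Y *v (b :: real vec))"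
proof -
 assume [simp]: "dim_vec a = dim_col X" "dim_vec b = dim_col Y"
 have "diag_block_mat [X, Y] = four_block_mat X (0\<^sub>m (dim_row X) (dim_col Y)) (0\<^sub>m (dim_row Y) (dim_col X)) Y"
  by (simp only: diag_block_mat.simps(2)[of X "[Y]"] diag_block_mat_singleton Let_def)
 then show ?thesis by (simp add: four_block_mult_vec)
qed

lemma system:
 assumes y[simp]: "dim_vec y = h" and z[simp]: "dim_vec z = l" and v[simp]: "dim_vec v = r"
 defines "x == N1 *v (y @v z)"
 defines "u == K *v x + v" shows "M1 *v (E *v x) = y @v (G *v z)"
  and "M1 *v (A *v x + B *v u) = (A1 *v y + B1 *v v) @v (z + B2 *v v)"
  and "M1 *v (C *v x + D *v u) = (C11 *v y + C12 *v z + D1 *v v) @v (C22 *v z + D2 *v v)"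
proof -
 have [simp]: "dim_vec x = n" by (simp add: x_def)
 have yz[simp]: "dim_vec (y @v z) = n" by simp
 have "(M1 * E * N1) *v (y @v z) = y @v (G *v z)" unfolding S_E by (subst diag2) simp_all
 then show "M1 *v (E *v x) = y @v (G *v z)" by (simp add: x_def mat_laws del: index_append_vec)
 have "(M1 * (A + B * K) * N1) *v (y @v z) = (A1 *v y) @v z" unfolding S_A by (subst diag2) simp_all
 then have a: "M1 *v (A *v x) + M1 *v (B *v (K *v x)) = (A1 *v y) @v z" by (simp add: x_def mat_laws)
 have "(M1 * B) *v v = (B1 *v v) @v (B2 *v v)" unfolding S_B by (rule rows_mult_vec) simp_all
 then have b: "M1 *v (B *v v) = (B1 *v v) @v (B2 *v v)" by (simp add: mat_laws)
 have "M1 *v (A *v x + B *v u) = (M1 *v (A *v x) + M1 *v (B *v (K *v x))) + M1 *v (B *v v)" by (simp add: u_def mat_laws)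
 then show "M1 *v (A *v x + B *v u) = (A1 *v y + B1 *v v) @v (z + B2 *v v)" unfolding a b by (simp add: append_laws)
 have "(M1 * (C + D * K) * N1) *v (y @v z) = (C11 *v y + C12 *v z) @v (C22 *v z)" unfolding S_C by (subst four_block_mult_vec) simp_all
 then have c: "M1 *v (C *v x) + M1 *v (D *v (K *v x)) = (C11 *v y + C12 *v z) @v (C22 *v z)" by (simp add: x_def mat_laws)
 have "(M1 * D) *v v = (D1 *v v) @v (D2 *v v)" unfolding S_D by (rule rows_mult_vec) simp_all
 then have d: "M1 *v (D *v v) = (D1 *v v) @v (D2 *v v)" by (simp add: mat_laws)
 have "M1 *v (C *v x + D *v u) = (M1 *v (C *v x) + M1 *v (D *v (K *v x))) + M1 *v (D *v v)" by (simp add: u_def mat_laws)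
 then show "M1 *v (C *v x + D *v u) = (C11 *v y + C12 *v z + D1 *v v) @v (C22 *v z + D2 *v v)" unfolding c d by (simp add: append_laws)
qed

lemma G_row: "i < l ==> j < l ==> G $$ (i, j) ~= 0 ==> j = Suc i & (ALL k<r. B2 $$ (j, k) = 0)"
 using jordan_blocks_index[of i ms j] S_B2 unfolding only_first_rows_def S_ms by fastforce

text \<open>A nonzero column of G stands at a position that is not the first of its block, and there
  the row of \<open>B2\<close> vanishes.\<close>

lemma G_B2: "dim_vec v = r ==> G *v (B2 *v v) = 0v l"
proof (rule eq_vecI)
 fix i assume v: "dim_vec v = r" and "i < dim_vec (0v l :: real vec)"
 then have i: "i < l" by simp
 have "(G *v (B2 *v v)) $ i = (\<Sum>j<l. G $$ (i, j) * (B2 *v v) $ j)"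
  using i by (subst index_mult_mat_vec) (auto simp: sp_sum[of _ l] simp del: index_mult_mat_vec)
 also have "... = 0" proof (rule sum.neutral, rule ballI)
  fix j assume "j : {..<l}"
  then have j: "j < l" by simp
  show "G $$ (i, j) * (B2 *v v) $ j = 0" proof (cases "G $$ (i, j) = 0")
  case False
  have "(B2 *v v) $ j = (\<Sum>k<r. B2 $$ (j, k) * v $ k)" using j v by (simp add: sp_sum[of v r])
  also have "... = 0" using G_row[OF i j False] by (intro sum.neutral) auto
  finally show ?thesis by simp
  qed simp
 qed
 finally show "(G *v (B2 *v v)) $ i = 0v l $ i" using i by simp
qed simp

lemma CBD: "dim_vec v = r ==> C22 *v (B2 *v v) = D2 *v v" using mat_laws(1)[of B2 C22 v] by (simp add: S_CBD)

lemma xu_dims[simp]: "dim_vec y = h ==> dim_vec v = r ==> dim_vec (xx y v) = n" "dim_vec y = h ==> dim_vec v = r ==> dim_vec (uu y v) = r"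
 by (simp_all add: xx_def uu_def)

text \<open>With the fast part - B2 v every fast component drops out: G annihilates it, the drift
  cancels against B2 v, and C22 B2 = D2 removes the noise.\<close>

lemma closed_system:
 assumes [simp]: "dim_vec y = h" "dim_vec v = r" shows "E *v xx y v = Mi *v (y @v 0v l)"
  "A *v xx y v + B *v uu y v = Mi *v ((A1 *v y + B1 *v v) @v 0v l)"
  "C *v xx y v + D *v uu y v = Mi *v ((C11 *v y + Dt *v v) @v 0v l)"
proof -
 note s = system[of y "- (B2 *v v)" v, folded xx_def, folded uu_def]
 have e: "dim_vec w = n ==> M1 *v w = w' ==> w = Mi *v w'" for w w' by auto
 show "E *v xx y v = Mi *v (y @v 0v l)" by (rule e) (use s(1) in "simp_all add: mat_laws G_B2")
 have "- (B2 *v v) + B2 *v v = 0v l" by (intro eq_vecI) auto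
 then show "A *v xx y v + B *v uu y v = Mi *v ((A1 *v y + B1 *v v) @v 0v l)" by (intro e) (use s(2) in simp_all)
 have "C22 *v - (B2 *v v) + D2 *v v = 0v l" by (intro eq_vecI) (simp_all add: mat_laws CBD del: index_mult_mat_vec)
 moreover have "C11 *v y + C12 *v - (B2 *v v) + D1 *v v = C11 *v y + Dt *v v"
  by (rule sp_eqI[of _ h]) (simp_all add: Dt_def mat_laws scalar_laws)
 ultimately show "C *v xx y v + D *v uu y v = Mi *v ((C11 *v y + Dt *v v) @v 0v l)" by (intro e) (use s(3) in simp_all)
qed

lemma Theta_dims[simp]: "dim_row Theta = n + r" "dim_col Theta = h + r" by (simp_all add: Theta_def)

lemma Theta_vec: "dim_vec y = h ==> dim_vec v = r ==> Theta *v (y @v v) = xx y v @v uu y v"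
 by (simp add: Theta_def mat_laws four_block_mult_vec rows_mult_vec append_laws xx_def uu_def)

text \<open>\<open>Theta\<close> maps (y, v) to state and control, so the transformed weights are a
  congruence. The polarized form is stated because comparing costs needs the cross terms.\<close>

lemma hat_quad:
 assumes [simp]: "dim_vec y = h" "dim_vec v = r" "dim_vec y' = h" "dim_vec v' = r"
 shows "y *. (Qh *v y') + (S *v y) *. v' + v *. (S *v y') + v *. (Rh *v v') = xx y v *. (Qm *v xx y' v') + uu y v *. (R *v uu y' v')"
proof -
 have "(y @v v) *. (four_block_mat Qh (tr S) S Rh *v (y' @v v')) = y *. (Qh *v y') + (S *v y) *. v' + v *. (S *v y') + v *. (Rh *v v')"
  by (simp add: four_block_mult_vec append_laws scalar_laws sp_tr)
 moreover have "(y @v v) *. (four_block_mat Qh (tr S) S Rh *v (y' @v v'))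
  = (Theta *v (y @v v)) *. (diag_block_mat [Qm, R] *v (Theta *v (y' @v v')))" proof -
  have "dim_row (diag_block_mat [Qm, R]) = n + r" "dim_col (diag_block_mat [Qm, R]) = n + r" unfolding dim_diag_block_mat by simp_all
  then show ?thesis unfolding hat_def by (simp add: mat_laws sp_tr del: diag_block_mat.simps)
 qed
 moreover have "... = xx y v *. (Qm *v xx y' v') + uu y v *. (R *v uu y' v')"
  unfolding Theta_vec[OF assms(1,2)] Theta_vec[OF assms(3,4)] by (subst diag2) (simp_all add: append_laws)
 ultimately show ?thesis by simp
qed

lemma QRH: "pos_semidef n Qm" "pos_def r R" "pos_semidef n H" "tr Qm = Qm" "tr R = R" "tr H = H"
proof -
 show "pos_semidef n Qm" "pos_def r R" "pos_semidef n H" using H1 pd_imp_psd by blast+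
 then show "tr Qm = Qm" "tr R = R" "tr H = H" by (simp_all only: pos_semidef_def pos_def_def simp_thms)
qed

lemma transpose_eqI:
 assumes X: "dim_row X = k" "dim_col X = k" and s: "!!v w :: real vec. dim_vec v = k ==> dim_vec w = k ==> v *. (X *v w) = w *. (X *v v)"
 shows "tr X = X"
proof (rule eq_matI)
 fix i j assume ij: "i < dim_row X" "j < dim_col X"
 then show "tr X $$ (i, j) = X $$ (i, j)" using s[of "unit_vec k i" "unit_vec k j"] unit_vec_entry[of X k i j] unit_vec_entry[of X k j i] X by simp
qed (use X in simp_all)

lemma xu_nonneg: "dim_vec a = n ==> dim_vec b = r ==> 0 <= a *. (Qm *v a) + b *. (R *v b)"
 using pos_semidef_nonneg[OF QRH(1)] pos_semidef_nonneg[OF pd_imp_psd[OF QRH(2)]] by simp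

lemma sym_QR: "dim_vec a = n ==> dim_vec a' = n ==> a *. (Qm *v a') = a' *. (Qm *v a)"
 "dim_vec b = r ==> dim_vec b' = r ==> b *. (R *v b') = b' *. (R *v b)"
 by (rule sp_sym[of _ n]; simp add: QRH) (rule sp_sym[of _ r]; simp add: QRH)

lemma hat_sym: "tr Qh = Qh" "tr Rh = Rh"
proof -
 show "tr Qh = Qh" proof (rule transpose_eqI)
  fix v w :: "real vec" assume [simp]: "dim_vec v = h" "dim_vec w = h"
  show "v *. (Qh *v w) = w *. (Qh *v v)"
  using hat_quad[of v "0v r" w "0v r"] hat_quad[of w "0v r" v "0v r"] sym_QR(1)[of "xx v (0v r)" "xx w (0v r)"] sym_QR(2)[of "uu v (0v r)" "uu w (0v r)"]
  by simp
 qed simp_all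
 show "tr Rh = Rh" proof (rule transpose_eqI)
  fix v w :: "real vec" assume [simp]: "dim_vec v = r" "dim_vec w = r"
  show "v *. (Rh *v w) = w *. (Rh *v v)"
  using hat_quad[of "0v h" v "0v h" w] hat_quad[of "0v h" w "0v h" v] sym_QR(1)[of "xx (0v h) v" "xx (0v h) w"] sym_QR(2)[of "uu (0v h) v" "uu (0v h) w"]
  by simp
 qed simp_all
qed

text \<open>The linear dependence of the control on v for fixed slow part; the rank condition says
  that it is invertible.\<close>

definition L where "L = 1\<^sub>m r + K * N1 * (0\<^sub>m h r @\<^sub>r (- B2))"

lemma uu_L: "dim_vec y = h ==> dim_vec v = r ==> uu y v = L *v v + K *v (N1 *v (y @v 0v l))"
proof -
 assume [simp]: "dim_vec y = h" "dim_vec v = r"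
 have "y @v - (B2 *v v) = (0v h @v - (B2 *v v)) + (y @v 0v l)" by (simp add: append_laws)
 then have "xx y v = N1 *v (0v h @v - (B2 *v v)) + N1 *v (y @v 0v l)" unfolding xx_def by (simp add: mat_laws)
 then show ?thesis unfolding uu_def L_def by (simp add: mat_laws rows_mult_vec) (intro eq_vecI, auto)
qed

text \<open>Zero control means L v = - K N1 (y, 0), which can be solved for v because L is
  invertible.\<close>

lemma uu_zero:
 assumes "mat_rank r (1\<^sub>m r + K * N1 * (0\<^sub>m h r @\<^sub>r (- B2))) = r"
 shows "EX Z. dim_row Z = r & dim_col Z = h & (ALL y v. dim_vec y = h --> dim_vec v = r --> uu y v = 0v r --> v = Z *v y)"
proof -
 have Ld[simp]: "dim_row L = r" "dim_col L = r" by (simp_all add: L_def)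
 have Lc: "L : carrier_mat r r" by simp
 have "det L ~= 0" using assms vec_space.det_rank_iff[OF Lc] by (simp add: L_def)
 then have ker: "v = 0v r" if "v : carrier_vec r" "L *v v = 0v r" for v using det_0_iff_vec_prod_zero_field[OF Lc] that by blast
 note Li = minv_props[OF Lc ker]
 have Lid[simp]: "dim_row (minv L) = r" "dim_col (minv L) = r" using Li(1) by simp_all
 define Z0 where "Z0 = - (minv L * (K * (N1 * tr J1)))"
 have "v = Z0 *v y" if [simp]: "dim_vec y = h" "dim_vec v = r" and u: "uu y v = 0v r" for y v proof -
  have J: "tr J1 *v y = y @v 0v l" by (simp add: J1_def rows_mult_vec)
  have "L *v v = - (K *v (N1 *v (y @v 0v l)))" proof (rule sp_eqI[of _ r])
  fix z :: "real vec" assume [simp]: "dim_vec z = r"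
  have "z *. (L *v v + K *v (N1 *v (y @v 0v l))) = 0" using u by (simp add: uu_L[symmetric])
  then show "z *. (L *v v) = z *. - (K *v (N1 *v (y @v 0v l)))" by (simp add: scalar_laws)
  qed simp_all
  then have "minv L *v (L *v v) = - (minv L *v (K *v (N1 *v (y @v 0v l))))" by (simp add: mat_laws)
  moreover have "minv L *v (L *v v) = v" by (rule inverse_mult_vec[OF Li(3)]) simp_all
  moreover have "Z0 *v y = - (minv L *v (K *v (N1 *v (y @v 0v l))))" by (simp add: Z0_def mat_laws J)
  ultimately show ?thesis by simp
 qed
 then show ?thesis by (intro exI[of _ Z0]) (simp add: Z0_def)
qed

lemma quad_zero:
 assumes [simp]: "dim_vec y = h" "dim_vec v = r" and z: "xx y v *. (Qm *v xx y v) + uu y v *. (R *v uu y v) = 0"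
 shows "uu y v = 0v r" "pos_def n Qm ==> xx y v = 0v n"
proof -
 have nn: "0 <= xx y v *. (Qm *v xx y v)" "0 <= uu y v *. (R *v uu y v)"
  using pos_semidef_nonneg[OF QRH(1)] pos_semidef_nonneg[OF pd_imp_psd[OF QRH(2)]] by simp_all
 show "uu y v = 0v r" proof (rule ccontr)
  assume "uu y v ~= 0v r"
  then have "0 < uu y v *. (R *v uu y v)" using QRH(2) by (simp add: pos_def_def)
  then show False using z nn by linarith
 qed
 show "xx y v = 0v n" if Q: "pos_def n Qm" proof (rule ccontr)
  assume "xx y v ~= 0v n"
  then have "0 < xx y v *. (Qm *v xx y v)" using Q by (simp add: pos_def_def)
  then show False using z nn by linarith
 qed
qed

(* Gives the uniqueness of the optimal control: along a null direction of the cost, v is a linear function of y. *)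
lemma quad_zero_linear:
 "EX Z. dim_row Z = r & dim_col Z = h & (ALL y v. dim_vec y = h --> dim_vec v = r -->
  xx y v *. (Qm *v xx y v) + uu y v *. (R *v uu y v) = 0 --> v = Z *v y)" using H1
proof
 assume a: "pos_def n Qm & pos_def r R & pos_semidef n H & F = K"
 have "v = 0\<^sub>m r h *v y" if [simp]: "dim_vec y = h" "dim_vec v = r" and z: "xx y v *. (Qm *v xx y v) + uu y v *. (R *v uu y v) = 0" for y v
  using quad_zero[OF that] a by (simp add: uu_def)
 then show ?thesis by (intro exI[of _ "0\<^sub>m r h"]) simp
next
 assume "pos_semidef n Qm & mat_rank r (1\<^sub>m r + K * N1 * (0\<^sub>m h r @\<^sub>r (- B2))) = r & pos_def r R & pos_semidef n H & F : {K, 0\<^sub>m r n}"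
 then have rk: "mat_rank r (1\<^sub>m r + K * N1 * (0\<^sub>m h r @\<^sub>r (- B2))) = r" by (elim conjE)
 from uu_zero[OF rk] obtain Z where Z: "dim_row Z = r & dim_col Z = h & (ALL y v. dim_vec y = h --> dim_vec v = r --> uu y v = 0v r --> v = Z *v y)"
  by (elim exE)
 then show ?thesis using quad_zero(1) by (intro exI[of _ Z]) blast
qed

(* Gives the uniqueness of the state for a given control. *)
lemma gain_linear:
 "EX Z. dim_row Z = r & dim_col Z = h & (ALL y v. dim_vec y = h --> dim_vec v = r --> v = F *v xx y v - K *v xx y v --> v = Z *v y)"
proof (cases "F = K")
 case True
 have "v = 0\<^sub>m r h *v y" if [simp]: "dim_vec y = h" "dim_vec v = r" and v: "v = F *v xx y v - K *v xx y v" for y v proof -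
  have "K *v xx y v - K *v xx y v = 0v r" by (intro eq_vecI) simp_all
  then show ?thesis using v True by simp
 qed
 then show ?thesis by (intro exI[of _ "0\<^sub>m r h"]) simp
next
 case False
 then have F0: "F = 0\<^sub>m r n" and rk: "mat_rank r (1\<^sub>m r + K * N1 * (0\<^sub>m h r @\<^sub>r (- B2))) = r" using H1 by auto
 from uu_zero[OF rk] obtain Z where Z: "dim_row Z = r & dim_col Z = h & (ALL y v. dim_vec y = h --> dim_vec v = r --> uu y v = 0v r --> v = Z *v y)"
  by (elim exE)
 have "uu y v = 0v r" if [simp]: "dim_vec y = h" "dim_vec v = r" and v: "v = F *v xx y v - K *v xx y v" for y v proof (rule eq_vecI)
  fix i assume "i < dim_vec (0v r :: real vec)"
  then have i: "i < r" by simp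
  have "v $ i = (F *v xx y v - K *v xx y v) $ i" using v by simp
  also have "... = - (K *v xx y v) $ i" using i by (simp add: F0 del: index_mult_mat_vec)
  finally show "uu y v $ i = 0v r $ i" using i by (simp add: uu_def del: index_mult_mat_vec)
 qed simp
 then show ?thesis using Z by (intro exI[of _ Z]) blast
qed

text \<open>A null vector v of \<open>Rh\<close> is a null direction of the cost with y = 0. Along
  null directions v is linear in y, so v = 0.\<close>

lemma Rh_pos_def: "pos_def r Rh" unfolding pos_def_def
proof (intro conjI ballI impI hat_sym(2))
 fix v :: "real vec" assume v: "v : carrier_vec r" "v ~= 0v r"
 then have [simp]: "dim_vec v = r" by simp
 have q: "v *. (Rh *v v) = xx (0v h) v *. (Qm *v xx (0v h) v) + uu (0v h) v *. (R *v uu (0v h) v)" using hat_quad[of "0v h" v "0v h" v] by simp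
 have nz: "v *. (Rh *v v) ~= 0" proof
  assume "v *. (Rh *v v) = 0"
  then have z: "xx (0v h) v *. (Qm *v xx (0v h) v) + uu (0v h) v *. (R *v uu (0v h) v) = 0" by (simp add: q)
  from quad_zero_linear obtain Z where Z: "dim_row Z = r & dim_col Z = h & (ALL y v. dim_vec y = h --> dim_vec v = r -->
  xx y v *. (Qm *v xx y v) + uu y v *. (R *v uu y v) = 0 --> v = Z *v y)" by (elim exE)
  have "v = Z *v 0v h" using conjunct2[OF conjunct2[OF Z], rule_format, OF _ _ z] by simp
  then show False using Z v(2) by simp
 qed
 show "0 < v *. (Rh *v v)" using nz xu_nonneg[of "xx (0v h) v" "uu (0v h) v"] unfolding q by simp
qed simp

lemma Rhi[simp]: "dim_row (minv Rh) = r" "dim_col (minv Rh) = r" "dim_vec v = r ==> Rh *v (minv Rh *v v) = v"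
 and Rhi_sym: "tr (minv Rh) = minv Rh" using pos_def_minv[OF Rh_pos_def] inverse_mult_vec[OF pos_def_minv(2)[OF Rh_pos_def], of v] by simp_all

abbreviation "A' == A1 - B1 * minv Rh * S"
abbreviation "C' == C11 - Dt * minv Rh * S"
text \<open>The weight of y after completing the square in v; together with A' and C' it removes the
  cross term S from the problem.\<close>

definition "Qp = Qh - tr S * minv Rh * S"

lemma Qp_dims[simp]: "dim_row Qp = h" "dim_col Qp = h" by (simp_all add: Qp_def)

text \<open>This Schur complement is the value of the nonnegative cost integrand at the minimizing
  v.\<close>

lemma Qp_pos_semidef: "pos_semidef h Qp" unfolding pos_semidef_def
proof (intro conjI ballI)
 show "tr Qp = Qp" by (simp add: Qp_def transpose_laws hat_sym Rhi_sym mat_assoc)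
 fix y :: "real vec" assume "y : carrier_vec h"
 then have [simp]: "dim_vec y = h" by simp
 define v where "v = - (minv Rh *v (S *v y))"
 have [simp]: "dim_vec v = r" by (simp add: v_def)
 have Rv: "Rh *v v = - (S *v y)" by (simp add: v_def mat_laws)
 have "y *. (Qp *v y) = y *. (Qh *v y) + (S *v y) *. v" by (simp add: Qp_def v_def mat_laws scalar_laws sp_tr)
 also have "... = y *. (Qh *v y) + (S *v y) *. v + v *. (S *v y) + v *. (Rh *v v)" by (simp add: Rv scalar_laws)
 also have "... = xx y v *. (Qm *v xx y v) + uu y v *. (R *v uu y v)" by (rule hat_quad) simp_all
 also have "0 <= ..." by (rule xu_nonneg) simp_all
 finally show "0 <= y *. (Qp *v y)" .
qed simp

lemma Hh_dims[simp]: "dim_row Hh = h" "dim_col Hh = h" by (simp_all add: Hh_def)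

lemma Hh_quad: "dim_vec y = h ==> dim_vec y' = h ==> y *. (Hh *v y') = (Mi *v (y @v 0v l)) *. (H *v (Mi *v (y' @v 0v l)))"
 by (simp add: Hh_def mat_laws sp_tr rows_mult_vec)

lemma Hh_pos_semidef: "pos_semidef h Hh" unfolding pos_semidef_def
proof (intro conjI ballI)
 show "tr Hh = Hh" proof (rule transpose_eqI)
  fix v w :: "real vec" assume [simp]: "dim_vec v = h" "dim_vec w = h"
  show "v *. (Hh *v w) = w *. (Hh *v v)"
  unfolding Hh_quad[OF \<open>dim_vec v = h\<close> \<open>dim_vec w = h\<close>] Hh_quad[OF \<open>dim_vec w = h\<close> \<open>dim_vec v = h\<close>]
  by (rule sp_sym[of _ n]) (simp_all add: QRH)
 qed simp_all
 fix y :: "real vec" assume "y : carrier_vec h"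
 then show "0 <= y *. (Hh *v y)" by (simp add: Hh_quad pos_semidef_nonneg[OF QRH(3)])
qed simp

lemma riccati: "riccati h r A' C' B1 Dt Qp Rh" by unfold_locales (simp_all add: Qp_pos_semidef Rh_pos_def)

end

section \<open>Reduction of the state equation to its slow part\<close>

locale lq = wiener M W + slq E A C B D Qm H R K Fg M1 N1 A1 B1 B2 C11 C12 C22 D1 D2 Dt Theta Qh S Rh Hh n r h ms
 for M :: "'a measure" and W :: "real => 'a => real"
  and E A C B D Qm H R K Fg M1 N1 A1 B1 B2 C11 C12 C22 D1 D2 Dt Theta Qh S Rh Hh :: "real mat"
  and n r h :: nat and ms :: "nat list" +
 fixes T :: real and x0 :: "real vec"
 assumes T: "0 < T" and x0: "dim_vec x0 = n" and consistent: "J2 *v (M1 *v x0) = 0v l"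
begin

lemma T0: "0 <= T" and TT: "T : {0..T}" "0 : {0..T}" using T by auto

lemma AE_Q_space: "AE p in Q T. fst p : {0..T} & snd p : space M" by (rule AE_I2) (auto simp: space_Q)

definition reduced :: "'a vproc => 'a vproc => bool" where
 "reduced y v \<longleftrightarrow> vp T r v & vip T h y (%t w. A1 *v y t w + B1 *v v t w) (%t w. C11 *v y t w + Dt *v v t w)"

lemma reducedD:
 assumes "reduced y v" shows "vp T r v" "vip T h y (%t w. A1 *v y t w + B1 *v v t w) (%t w. C11 *v y t w + Dt *v v t w)"
  "t : {0..T} ==> w : space M ==> dim_vec (y t w) = h" "t : {0..T} ==> w : space M ==> dim_vec (v t w) = r"
  "vsq (Q T) h (uc y)" "vsq (Q T) r (uc v)" "t : {0..T} ==> vsq M h (y t)"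
proof -
 show 1: "vp T r v" "vip T h y (%t w. A1 *v y t w + B1 *v v t w) (%t w. C11 *v y t w + Dt *v v t w)" using assms unfolding reduced_def by simp_all
 show "t : {0..T} ==> w : space M ==> dim_vec (y t w) = h" "t : {0..T} ==> w : space M ==> dim_vec (v t w) = r"
  by (rule vipD(1)[OF 1(2)] vproc_dim[OF 1(1)], assumption+)+
 show "vsq (Q T) h (uc y)" "vsq (Q T) r (uc v)" "t : {0..T} ==> vsq M h (y t)" using vip_vsq[OF 1(2)] vp_vsq[OF 1(1)] TT by simp_all
qed

lemma reduced_diff:
 assumes y: "reduced y v" and y': "reduced y' v'" shows "reduced (%t w. y t w - y' t w) (%t w. v t w - v' t w)" unfolding reduced_def
proof
 show "vp T r (%t w. v t w - v' t w)" by (rule vp_intros(3)[OF reducedD(1)[OF y] reducedD(1)[OF y']])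
 show "vip T h (%t w. y t w - y' t w) (%t w. A1 *v (y t w - y' t w) + B1 *v (v t w - v' t w))
  (%t w. C11 *v (y t w - y' t w) + Dt *v (v t w - v' t w))"
 proof (rule vip_cong_pointwise[OF vip_diff[OF reducedD(2)[OF y] reducedD(2)[OF y'] T0] T0], intro conjI refl)
  fix t w assume "t : {0..T}" "w : space M"
  note [simp] = reducedD(3,4)[OF y this] reducedD(3,4)[OF y' this]
  show "A1 *v y t w + B1 *v v t w - (A1 *v y' t w + B1 *v v' t w) = A1 *v (y t w - y' t w) + B1 *v (v t w - v' t w)"
  by (rule sp_eqI[of _ h]) (simp_all add: mat_laws scalar_laws)
  show "C11 *v y t w + Dt *v v t w - (C11 *v y' t w + Dt *v v' t w) = C11 *v (y t w - y' t w) + Dt *v (v t w - v' t w)"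
  by (rule sp_eqI[of _ h]) (simp_all add: mat_laws scalar_laws)
 qed
qed

text \<open>When v is a linear function of y, the slow equation is homogeneous and linear, and
  forward uniqueness applies.\<close>

lemma reduced_zero:
 assumes y: "reduced y v" and y0: "AE w in M. y 0 w = 0v h" and Z: "dim_row Z = r" "dim_col Z = h"
  and v: "AE p in Q T. uc v p = Z *v uc y p" shows "t : {0..T} ==> AE w in M. y t w = 0v h" "AE p in Q T. uc y p = 0v h" "AE p in Q T. uc v p = 0v r"
proof -
 show 1: "AE w in M. y t w = 0v h" if t: "t : {0..T}" for t proof (rule vip_forward_unique[OF reducedD(2)[OF y] T0 y0 _ _ _ _ _ _ t])
  show "AE p in Q T. A1 *v uc y p + B1 *v uc v p = (A1 + B1 * Z) *v uc y p"
  using v AE_Q_space by eventually_elim (use reducedD(3)[OF y] Z in "simp add: mat_laws")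
  show "AE p in Q T. C11 *v uc y p + Dt *v uc v p = (C11 + Dt * Z) *v uc y p"
  using v AE_Q_space by eventually_elim (use reducedD(3)[OF y] Z in "simp add: mat_laws")
 qed (use Z in simp_all)
 show 2: "AE p in Q T. uc y p = 0v h" by (rule AE_Q_zero[OF reducedD(5)[OF y] 1])
 show "AE p in Q T. uc v p = 0v r" using v 2 by eventually_elim (use Z in simp)
qed

lemma state_vip:
 assumes x: "vp T n x" and u: "vp T r u" and s: "state_solution M W T n E A B C D x0 u x"
 shows "vip T n (%t w. E *v x t w) (%t w. A *v x t w + B *v u t w) (%t w. C *v x t w + D *v u t w)"
  "AE w in M. E *v x 0 w = x0"
proof -
 show e0: "AE w in M. E *v x 0 w = x0" using s unfolding state_solution_def by (elim conjE)
 have hd: "has_differential M W T n (%t w. E *v x t w) (%t w. A *v x t w + B *v u t w) (%t w. C *v x t w + D *v u t w)"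
  using s unfolding state_solution_def by (elim conjE)
 have Ex: "vp T n (%t w. E *v x t w)" by (rule vp_intros(1)[OF x]) simp_all
 show "vip T n (%t w. E *v x t w) (%t w. A *v x t w + B *v u t w) (%t w. C *v x t w + D *v u t w)" proof (rule has_differential_imp_vip[OF hd T0])
  show "vp T n (%t w. A *v x t w + B *v u t w)" "vp T n (%t w. C *v x t w + D *v u t w)"
  by (intro vp_intros(2) vp_intros(1)[OF x] vp_intros(1)[OF u]; simp)+
  fix i assume i: "i < n"
  show "jm T (%t w. (E *v x t w) $ i)" using Ex i by (intro sqp_jm) (simp add: vproc_def)
  show m: "(%w. (E *v x 0 w) $ i) : BM (F 0)" using vp_F[OF Ex TT(2) i] .
  show "sqi M (%w. (E *v x 0 w) $ i)" proof (rule sqi_cong_AE[OF sqi_const[OF finite_measure_axioms, of "x0 $ i"]])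
  show "(%w. (E *v x 0 w) $ i) : BM M" using m by (rule measurable_F_M)
  show "AE w in M. x0 $ i = (E *v x 0 w) $ i" using e0 by eventually_elim simp
  qed
 qed simp
qed

(* The fast subsystem: its nilpotent part forces the drift to vanish, row by row from the end of each Jordan block. *)
lemma nilpotent_zero:
 assumes z: "vp T l z" and X: "vip T l (%t w. G *v z t w) z s" and X0: "AE w in M. G *v z 0 w = 0v l"
 shows "AE p in Q T. uc z p = 0v l" "t : {0..T} ==> AE w in M. G *v z t w = 0v l"
proof -
 have row: "AE p in Q T. (G *v uc z p) $ i = 0"
  if i: "i < l" and nx: "!!j. j = Suc i ==> j < l ==> AE p in Q T. uc z p $ j = 0" for i proof -
  have "AE p in Q T. Suc i < l --> z (fst p) (snd p) $ Suc i = 0" using nx by (cases "Suc i < l") simp_all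
  then show ?thesis using AE_Q_space proof eventually_elim
  case (elim p)
  have d: "dim_vec (uc z p) = l" using vproc_dim[OF z] elim(2) by blast
  have "(G *v uc z p) $ i = (\<Sum>j<l. G $$ (i, j) * uc z p $ j)" using i d by (simp add: sp_sum[OF d])
  also have "... = 0" proof (rule sum.neutral, rule ballI)
  fix j assume "j : {..<l}"
  then show "G $$ (i, j) * uc z p $ j = 0" using G_row[OF i, of j] elim(1) by (cases "G $$ (i, j) = 0") auto
  qed
  finally show ?case .
  qed
 qed
 have ip: "ip T (%t w. (G *v z t w) $ i) (%t w. z t w $ i) (%t w. s t w $ i)" if "i < l" for i by (rule vipD(4)[OF X that])
 have z0: "AE w in M. (G *v z 0 w) $ i = 0" if "i < l" for i using X0 by eventually_elim (use that in simp)
 have zi: "AE p in Q T. uc z p $ i = 0" if i: "i < l" for i using i proof (induction "l - i" arbitrary: i rule: less_induct)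
  case less
  show ?case by (rule ip_null(2)[OF ip[OF less.prems] T0 z0[OF less.prems] row[OF less.prems]]) (use less in auto)
 qed
 show "AE p in Q T. uc z p = 0v l" proof (rule AE_vec_eqI[of l])
  show "AE p in Q T. dim_vec (uc z p) = l" using AE_Q_space by eventually_elim (use vproc_dim[OF z] in blast)
 qed (use zi in auto)
 show "AE w in M. G *v z t w = 0v l" if t: "t : {0..T}" proof (rule AE_vec_eqI[of l])
  show "AE w in M. (G *v z t w) $ i = 0v l $ i" if i: "i < l" for i using ip_null(3)[OF ip[OF i] T0 z0[OF i] row[OF i zi] t] i by simp
 qed auto
qed

lemma reduce:
 assumes x: "vp T n x" and u: "vp T r u"
  and X: "vip T n (%t w. E *v x t w) (%t w. A *v x t w + B *v u t w) (%t w. C *v x t w + D *v u t w)"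
  and e0: "AE w in M. E *v x 0 w = x0"
 defines "y == %t w. J1 *v (Ni *v x t w)" and "v == %t w. u t w - K *v x t w" shows "reduced y v" "AE w in M. y 0 w = J1 *v (M1 *v x0)"
  "AE p in Q T. uc x p = xx (uc y p) (uc v p) & u (fst p) (snd p) = uu (uc y p) (uc v p)"
  "t : {0..T} ==> AE w in M. E *v x t w = Mi *v (y t w @v 0v l)"
proof -
 define z where "z t w = J2 *v (Ni *v x t w)" for t w
 \<comment> \<open>The drift of the fast equation. As G annihilates B2 v, the process G z is also G
   c, so c is at once the drift and the argument of G; the nilpotent argument then gives c =
   0.\<close>
 define c where "c t w = z t w + B2 *v v t w" for t w
 have Nx: "vp T n (%t w. Ni *v x t w)" by (rule vp_intros(1)[OF x]) simp_all
 have y: "vp T h y" unfolding y_def by (rule vp_intros(1)[OF Nx]) simp_all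
 have z: "vp T l z" unfolding z_def[abs_def] by (rule vp_intros(1)[OF Nx]) simp_all
 have v: "vp T r v" unfolding v_def by (rule vp_intros(3)[OF u vp_intros(1)[OF x]]) simp_all
 have c: "vp T l c" unfolding c_def[abs_def] by (rule vp_intros(2)[OF z vp_intros(1)[OF v]]) simp_all
 have sys: "dim_vec (y t w) = h" "dim_vec (z t w) = l" "dim_vec (v t w) = r" "x t w = N1 *v (y t w @v z t w)" "u t w = K *v x t w + v t w"
  "M1 *v (E *v x t w) = y t w @v (G *v z t w)"
  "M1 *v (A *v x t w + B *v u t w) = (A1 *v y t w + B1 *v v t w) @v c t w"
  "M1 *v (C *v x t w + D *v u t w) = (C11 *v y t w + C12 *v z t w + D1 *v v t w) @v (C22 *v z t w + D2 *v v t w)"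
  "G *v z t w = G *v c t w"
  if t: "t : {0..T}" "w : space M" for t w proof -
  have xd: "dim_vec (x t w) = n" "dim_vec (u t w) = r" using vproc_dim[OF x t] vproc_dim[OF u t] .
  show d: "dim_vec (y t w) = h" "dim_vec (z t w) = l" "dim_vec (v t w) = r" by (simp_all add: y_def z_def v_def)
  have "y t w @v z t w = Ni *v x t w" unfolding y_def z_def by (rule J_split) simp
  then show xe: "x t w = N1 *v (y t w @v z t w)" using xd by simp
  show ue: "u t w = K *v x t w + v t w" unfolding v_def using xd by (intro eq_vecI) (simp_all del: index_mult_mat_vec)
  note s = system[OF d, folded xe, folded ue]
  show "M1 *v (E *v x t w) = y t w @v (G *v z t w)" by (rule s(1))
  show "M1 *v (A *v x t w + B *v u t w) = (A1 *v y t w + B1 *v v t w) @v c t w" unfolding c_def by (rule s(2))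
  show "M1 *v (C *v x t w + D *v u t w) = (C11 *v y t w + C12 *v z t w + D1 *v v t w) @v (C22 *v z t w + D2 *v v t w)" by (rule s(3))
  show "G *v z t w = G *v c t w" unfolding c_def using d by (simp add: mat_laws G_B2)
 qed
 note MX = vip_mult[OF X T0 dd(20,19)]
 have Gz: "vip T l (%t w. G *v c t w) c (%t w. C22 *v z t w + D2 *v v t w)" proof (rule vip_cong_pointwise[OF vip_mult[OF MX T0 J_dims(4,3)] T0])
  fix t w assume t: "t : {0..T}" "w : space M"
  note s = sys[OF t]
  show "J2 *v (M1 *v (E *v x t w)) = G *v c t w & J2 *v (M1 *v (A *v x t w + B *v u t w)) = c t w
  & J2 *v (M1 *v (C *v x t w + D *v u t w)) = C22 *v z t w + D2 *v v t w" unfolding s(6,7,8) s(9)[symmetric] using s(1-3) by (simp add: c_def)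
 qed
 have G0: "AE w in M. G *v c 0 w = 0v l" using e0 AE_space proof eventually_elim
  case (elim w)
  note s = sys[OF TT(2) elim(2)]
  have "J2 *v (M1 *v (E *v x 0 w)) = G *v c 0 w" unfolding s(6) s(9)[symmetric] using s(1,2) by simp
  then show ?case using consistent unfolding elim(1) by simp
 qed
 note nil = nilpotent_zero[OF c Gz G0]
 have z_eq: "AE p in Q T. uc z p = - (B2 *v uc v p)" using nil(1) AE_Q_space proof eventually_elim
  case (elim p)
  then have s: "dim_vec (uc z p) = l" "dim_vec (uc v p) = r" using sys(2,3) by blast+
  show ?case proof (rule eq_vecI)
  fix i assume "i < dim_vec (- (B2 *v uc v p))"
  then have i: "i < l" by simp
  have "uc c p $ i = 0" using elim(1) i by simp
  then show "uc z p $ i = (- (B2 *v uc v p)) $ i" using i s by (simp add: c_def del: index_mult_mat_vec)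
  qed (simp add: s)
 qed
 have vy: "vip T h y (%t w. A1 *v y t w + B1 *v v t w) (%t w. C11 *v y t w + C12 *v z t w + D1 *v v t w)"
 proof (rule vip_cong_pointwise[OF vip_mult[OF MX T0 J_dims(2,1)] T0])
  fix t w assume t: "t : {0..T}" "w : space M"
  note s = sys[OF t]
  show "J1 *v (M1 *v (E *v x t w)) = y t w & J1 *v (M1 *v (A *v x t w + B *v u t w)) = A1 *v y t w + B1 *v v t w
  & J1 *v (M1 *v (C *v x t w + D *v u t w)) = C11 *v y t w + C12 *v z t w + D1 *v v t w" unfolding s(6,7,8) using s(1-3) by (simp add: c_def)
 qed
 show "reduced y v" unfolding reduced_def proof (intro conjI v vip_cong_drift[OF vy T0])
  show "vp T h (%t w. A1 *v y t w + B1 *v v t w)" by (rule vipD(2)[OF vy])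
  show "vp T h (%t w. C11 *v y t w + Dt *v v t w)" by (intro vp_intros(2) vp_intros(1)[OF y] vp_intros(1)[OF v]) simp_all
  show "AE p in Q T. C11 *v uc y p + C12 *v uc z p + D1 *v uc v p = C11 *v uc y p + Dt *v uc v p" using z_eq AE_Q_space proof eventually_elim
  case (elim p)
  then have [simp]: "dim_vec (uc y p) = h" "dim_vec (uc v p) = r" using sys(1,3) by blast+
  show ?case unfolding elim(1) by (rule sp_eqI[of _ h]) (simp_all add: Dt_def mat_laws scalar_laws)
  qed
 qed simp
 show "AE w in M. y 0 w = J1 *v (M1 *v x0)" using e0 AE_space proof eventually_elim
  case (elim w)
  note s = sys[OF TT(2) elim(2)]
  have "J1 *v (M1 *v (E *v x 0 w)) = y 0 w" unfolding s(6) using s(1,2) by simp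
  then show ?case unfolding elim(1) ..
 qed
 show "AE p in Q T. uc x p = xx (uc y p) (uc v p) & u (fst p) (snd p) = uu (uc y p) (uc v p)" using z_eq AE_Q_space proof eventually_elim
  case (elim p)
  then have s: "uc x p = N1 *v (uc y p @v uc z p)" "uc u p = K *v uc x p + uc v p" using sys(4,5) by blast+
  have "uc x p = xx (uc y p) (uc v p)" using s(1) unfolding elim(1) xx_def .
  then show ?case using s(2) unfolding uu_def by simp
 qed
 show "AE w in M. E *v x t w = Mi *v (y t w @v 0v l)" if t: "t : {0..T}" using nil(2)[OF t] AE_space proof eventually_elim
  case (elim w)
  note s = sys[OF t elim(2)]
  have "Mi *v (M1 *v (E *v x t w)) = Mi *v (y t w @v 0v l)" unfolding s(6,9) elim(1) ..
  then show ?case by simp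
 qed
qed

text \<open>The way back, for continuous y and v: the state equation demands the strict integral of
  its diffusion coefficient, which is then continuous.\<close>

lemma construct:
 assumes y: "reduced y v" and yc: "vc T h y" and vc: "vc T r v" and y0: "AE z in M. y 0 z = J1 *v (M1 *v x0)"
 defines "x == %t z. xx (y t z) (v t z)" and "u == %t z. uu (y t z) (v t z)" shows "vc T n x" "vc T r u" "AE z in M. E *v x 0 z = x0"
  "has_differential M W T n (%t z. E *v x t z) (%t z. A *v x t z + B *v u t z) (%t z. C *v x t z + D *v u t z)"
proof -
 have a: "vc T (h + l) (%t z. y t z @v ((- B2) *v v t z))" by (rule vproc_append[OF yc vc_intros(1)[OF vc] linear_class_cp]) simp_all
 have "vc T n (%t z. N1 *v (y t z @v ((- B2) *v v t z)))" by (rule vc_intros(1)[OF a]) simp_all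
 then show x: "vc T n x" by (rule vproc_cong[OF _ linear_class_cp]) (simp add: x_def xx_def mat_laws reducedD(4)[OF y])
 show u: "vc T r u" unfolding u_def uu_def using vc_intros(2)[OF vc_intros(1)[OF x, of K r] vc] by (simp add: x_def)
 have J: "tr J1 *v w = w @v 0v l" if "dim_vec w = h" for w :: "real vec" using that by (simp add: J1_def rows_mult_vec)
 have "vip T n (%t z. E *v x t z) (%t z. A *v x t z + B *v u t z) (%t z. C *v x t z + D *v u t z)"
 proof (rule vip_cong_pointwise[OF vip_mult[OF vip_mult[OF reducedD(2)[OF y] T0, of "tr J1" n] T0, of Mi n] T0])
  fix t z assume t: "t : {0..T}" "z : space M"
  note d[simp] = reducedD(3,4)[OF y t]
  show "Mi *v (tr J1 *v y t z) = E *v x t z &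
  Mi *v (tr J1 *v (A1 *v y t z + B1 *v v t z)) = A *v x t z + B *v u t z &
  Mi *v (tr J1 *v (C11 *v y t z + Dt *v v t z)) = C *v x t z + D *v u t z" unfolding x_def u_def closed_system[OF d] by (simp add: J)
 qed simp_all
 then show "has_differential M W T n (%t z. E *v x t z) (%t z. A *v x t z + B *v u t z) (%t z. C *v x t z + D *v u t z)"
  by (rule vip_imp_has_differential) (intro vc_intros(2) vc_intros(1)[OF x] vc_intros(1)[OF u]; simp)
 show "AE z in M. E *v x 0 z = x0" using y0 AE_space proof eventually_elim
  case (elim z)
  note d = reducedD(3,4)[OF y TT(2) elim(2)]
  have "y 0 z @v 0v l = M1 *v x0" using J_split[of "M1 *v x0"] consistent elim(1) by simp
  then show ?case unfolding x_def closed_system(1)[OF d] using x0 by simp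
 qed
qed

end

section \<open>The reduced cost and its stationary point\<close>

lemma zero_diff_eq:
 fixes v w :: "real vec"
 assumes z: "v - w = 0v k" and d: "dim_vec v = k" "dim_vec w = k" shows "v = w"
proof (rule eq_vecI)
 fix i assume i: "i < dim_vec w"
 then have "(v - w) $ i = 0" using z d by simp
 then show "v $ i = w $ i" using i by (simp add: index_minus_vec(1))
qed (use d in simp)

context slq
begin

definition qf where "qf y v y' v' = y *. (Qh *v y') + (S *v y) *. v' + v *. (S *v y') + v *. (Rh *v v')"

lemma qf_expand:
 assumes [simp]: "dim_vec y = h" "dim_vec v = r" "dim_vec a = h" "dim_vec b = r"
 shows "qf y v y v = qf a b a b + 2 * qf (y - a) (v - b) a b + qf (y - a) (v - b) (y - a) (v - b)"
proof -
 have "y *. (Qh *v a) = a *. (Qh *v y)" by (rule sp_sym[of _ h]) (simp_all add: hat_sym)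
 moreover have "v *. (Rh *v b) = b *. (Rh *v v)" by (rule sp_sym[of _ r]) (simp_all add: hat_sym)
 moreover have "(S *v y) *. b = b *. (S *v y)" "(S *v a) *. v = v *. (S *v a)" "(S *v y) *. v = v *. (S *v y)" "(S *v a) *. b = b *. (S *v a)"
  by (rule scalar_prod_commute; simp)+
 ultimately show ?thesis by (simp add: qf_def mat_laws scalar_laws)
qed

lemma Hh_expand:
 assumes [simp]: "dim_vec y = h" "dim_vec a = h" shows "y *. (Hh *v y) = a *. (Hh *v a) + 2 * ((y - a) *. (Hh *v a)) + (y - a) *. (Hh *v (y - a))"
proof -
 have "tr Hh = Hh" using Hh_pos_semidef unfolding pos_semidef_def by (elim conjE)
 then have "y *. (Hh *v a) = a *. (Hh *v y)" by (intro sp_sym[of _ h]) simp_all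
 then show ?thesis by (simp add: mat_laws scalar_laws)
qed

lemma qf_nonneg: "dim_vec y = h ==> dim_vec v = r ==> 0 <= qf y v y v" unfolding qf_def by (simp add: hat_quad xu_nonneg)

lemma qf_integrable:
 assumes "vsq N h y" "vsq N r v" "vsq N h y'" "vsq N r v'" shows "integrable N (%x. qf (y x) (v x) (y' x) (v' x))" unfolding qf_def
 by (intro iadd vsq_integrable assms vsq_mult[OF assms(1)] vsq_mult[OF assms(3)] vsq_mult[OF assms(4)]
  vsq_integrable[OF _ assms(4)] vsq_integrable[OF assms(2)] vsq_integrable[OF assms(1)]; simp)

text \<open>The input at which the Hamiltonian, with cost integrand weighted by 1/2, is stationary
  in v.\<close>

definition opt where "opt y p q = minv Rh *v (tr B1 *v p + tr Dt *v q - S *v y)"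

lemma opt_dim[simp]: "dim_vec (opt y p q) = r" by (simp add: opt_def)

lemma stationary: "dim_vec y = h ==> dim_vec p = h ==> dim_vec q = h ==>
  tr B1 *v p + tr Dt *v q = S *v y + Rh *v opt y p q" unfolding opt_def by (rule sp_eqI[of _ r]) (simp_all add: scalar_laws)

text \<open>Three guises of one system, all expressed through \<open>opt\<close>: the first three
  equations concern the form without cross term that the Riccati equation solves, the last three the
  form of the forward-backward equation in the theorem.\<close>

lemma hamiltonian:
 assumes [simp]: "dim_vec y = h" "dim_vec p = h" "dim_vec q = h" shows "A' *v y + B1 *v (hv Rh B1 Dt p q) = A1 *v y + B1 *v opt y p q"
  "C' *v y + Dt *v (hv Rh B1 Dt p q) = C11 *v y + Dt *v opt y p q"
  "- (tr A' *v p + tr C' *v q - Qp *v y) =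
  - (tr A1 *v p + tr C11 *v q - Qh *v y - tr S *v opt y p q)"
  "A' *v y + (B1 * minv Rh * tr B1) *v p + (B1 * minv Rh * tr Dt) *v q = A1 *v y + B1 *v opt y p q"
  "C' *v y + (Dt * minv Rh * tr B1) *v p + (Dt * minv Rh * tr Dt) *v q = C11 *v y + Dt *v opt y p q"
  "- (tr A' *v p + tr C' *v q + (tr S * minv Rh * S - Qh) *v y) =
  - (tr A1 *v p + tr C11 *v q - Qh *v y - tr S *v opt y p q)" unfolding opt_def Qp_def
 by (rule sp_eqI[of _ h]; simp add: mat_laws scalar_laws transpose_laws Rhi_sym mat_assoc)+

text \<open>\<open>Theta\<close> composed with the map from (y, p, q) to (y, v), where v =
  \<open>opt\<close> y p q is written out as a block row.\<close>

definition Gam where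
 "Gam = Theta * four_block_mat (1\<^sub>m h) (0\<^sub>m h (h + h)) (- (minv Rh * S)) (minv Rh * tr (B1 @\<^sub>r Dt))"

lemma Gam_dims: "Gam : carrier_mat (n + r) (3 * h)" by (simp add: Gam_def)

lemma Gam_vec:
 assumes [simp]: "dim_vec y = h" "dim_vec p = h" "dim_vec q = h" shows "Gam *v (y @v p @v q) = xx y (opt y p q) @v uu y (opt y p q)"
proof -
 have "tr (B1 @\<^sub>r Dt) *v (p @v q) = tr B1 *v p + tr Dt *v q"
  by (rule sp_eqI[of _ r]) (simp_all add: scalar_laws sp_tr rows_mult_vec append_laws)
 then have "- (minv Rh * S) *v y + (minv Rh * tr (B1 @\<^sub>r Dt)) *v (p @v q) = opt y p q"
  by (intro sp_eqI[of _ r]) (simp_all add: opt_def mat_laws scalar_laws)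
 then show ?thesis unfolding Gam_def by (simp add: mat_laws(1) four_block_mult_vec Theta_vec)
qed

end

context lq
begin

definition jj where
 "jj y v = 1/2 * (LINT p|Q T. qf (uc y p) (uc v p) (uc y p) (uc v p)) + 1/2 * EE (%w. y T w *. (Hh *v y T w))"

lemma vsq_Hh: "vsq M h f ==> vsq M h (%x. Hh *v f x)" by (rule vsq_mult) simp_all

text \<open>The terminal cost sees x only through E x, which is known almost surely at time T,
  whereas x itself is known only for almost every time.\<close>

lemma cost_reduced:
 assumes x: "vp T n x" and u: "vp T r u" and y: "reduced y v"
  and xu: "AE p in Q T. uc x p = xx (uc y p) (uc v p) & u (fst p) (snd p) = uu (uc y p) (uc v p)"
  and xT: "AE w in M. E *v x T w = Mi *v (y T w @v 0v l)" and m: "vsq M n (%w. E *v x T w)" shows "cost M T E Qm R H u x = jj y v"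
proof -
 let ?f = "%p. uc x p *. (Qm *v uc x p) + uc u p *. (R *v uc u p)"
 let ?g = "%p. qf (uc y p) (uc v p) (uc y p) (uc v p)"
 note xQ = vp_vsq[OF x order.refl] and uQ = vp_vsq[OF u order.refl]
 have f: "integrable (Q T) ?f" by (intro iadd vsq_integrable[OF xQ vsq_mult[OF xQ]] vsq_integrable[OF uQ vsq_mult[OF uQ]]; simp)
 have g: "integrable (Q T) ?g" by (rule qf_integrable[OF reducedD(5,6)[OF y] reducedD(5,6)[OF y]])
 have "(LINT w|M. (LINT t:{0..T}|lborel. x t w *. (Qm *v x t w) + u t w *. (R *v u t w))) = (LINT p|Q T. ?f p)"
  unfolding integral_Q_snd(1)[OF f] set_integral_lb by simp
 also have "... = (LINT p|Q T. ?g p)" proof (rule integral_cong_AE)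
  show "AE p in Q T. ?f p = ?g p" using xu AE_Q_space proof eventually_elim
  case (elim p)
  then have "dim_vec (uc y p) = h" "dim_vec (uc v p) = r" using reducedD(3,4)[OF y] by blast+
  then show ?case using elim(1) by (simp add: qf_def hat_quad)
  qed
 qed (use f g in auto)
 finally have 1: "(LINT w|M. (LINT t:{0..T}|lborel. x t w *. (Qm *v x t w) + u t w *. (R *v u t w))) = (LINT p|Q T. ?g p)" .
 have "(LINT w|M. x T w *. ((tr E * H * E) *v x T w)) = (LINT w|M. (E *v x T w) *. (H *v (E *v x T w)))" proof (rule icong[OF refl])
  fix w assume "w : space M"
  then have "dim_vec (x T w) = n" by (rule vproc_dim[OF x TT(1)])
  then show "x T w *. ((tr E * H * E) *v x T w) = (E *v x T w) *. (H *v (E *v x T w))" by (simp add: mat_laws sp_tr)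
 qed
 also have "... = EE (%w. y T w *. (Hh *v y T w))" proof (rule integral_cong_AE)
  show "AE w in M. (E *v x T w) *. (H *v (E *v x T w)) = y T w *. (Hh *v y T w)" using xT AE_space proof eventually_elim
  case (elim w)
  then show ?case unfolding elim(1) using reducedD(3)[OF y TT(1) elim(2)] by (simp add: Hh_quad)
  qed
  show "(%w. (E *v x T w) *. (H *v (E *v x T w))) : BM M" by (rule borel_measurable_integrable[OF vsq_integrable[OF m vsq_mult[OF m]]]) simp_all
  show "(%w. y T w *. (Hh *v y T w)) : BM M"
  by (rule borel_measurable_integrable[OF vsq_integrable[OF reducedD(7)[OF y TT(1)] vsq_Hh[OF reducedD(7)[OF y TT(1)]]]])
 qed
 finally show ?thesis unfolding cost_def jj_def 1 by simp
qed

lemma jj_nonneg: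
 assumes y: "reduced y v" shows "0 <= (LINT p|Q T. qf (uc y p) (uc v p) (uc y p) (uc v p))" "0 <= EE (%w. y T w *. (Hh *v y T w))"
proof -
 have "0 <= qf (uc y p) (uc v p) (uc y p) (uc v p)" if "p : space (Q T)" for p
  using reducedD(3,4)[OF y] that by (intro qf_nonneg) (auto simp: space_Q)
 then show "0 <= (LINT p|Q T. qf (uc y p) (uc v p) (uc y p) (uc v p))" by (rule Bochner_Integration.integral_nonneg)
 show "0 <= EE (%w. y T w *. (Hh *v y T w))"
  by (rule Bochner_Integration.integral_nonneg) (rule pos_semidef_nonneg[OF Hh_pos_semidef reducedD(3)[OF y TT(1)]])
qed

text \<open>Both parts of the cost are nonnegative, so the integrand vanishes almost everywhere.
  There v is linear in y, and the pair solves a homogeneous equation with initial value 0.\<close>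

lemma jj_zero:
 assumes y: "reduced y v" and y0: "AE w in M. y 0 w = 0v h" and z: "jj y v <= 0"
 shows "AE p in Q T. uc y p = 0v h & v (fst p) (snd p) = 0v r" "t : {0..T} ==> AE w in M. y t w = 0v h"
proof -
 let ?g = "%p. qf (uc y p) (uc v p) (uc y p) (uc v p)"
 have g: "integrable (Q T) ?g" by (rule qf_integrable[OF reducedD(5,6)[OF y] reducedD(5,6)[OF y]])
 have g0: "AE p in Q T. 0 <= ?g p" using AE_Q_space by eventually_elim (use reducedD(3,4)[OF y] in "blast intro: qf_nonneg")
 have "(LINT p|Q T. ?g p) = 0" using jj_nonneg[OF y] z unfolding jj_def by linarith
 then have "AE p in Q T. ?g p = 0" using integral_nonneg_eq_0_iff_AE[OF g g0] by simp
 obtain Z where Z: "dim_row Z = r & dim_col Z = h & (ALL y v. dim_vec y = h --> dim_vec v = r -->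
  xx y v *. (Qm *v xx y v) + uu y v *. (R *v uu y v) = 0 --> v = Z *v y)" using quad_zero_linear by (elim exE)
 have Zd: "dim_row Z = r" "dim_col Z = h" using Z by simp_all
 have v: "AE p in Q T. uc v p = Z *v uc y p" using \<open>AE p in Q T. ?g p = 0\<close> AE_Q_space proof eventually_elim
  case (elim p)
  then have d: "dim_vec (uc y p) = h" "dim_vec (uc v p) = r" using reducedD(3,4)[OF y] by blast+
  then have "xx (uc y p) (uc v p) *. (Qm *v xx (uc y p) (uc v p)) + uu (uc y p) (uc v p) *. (R *v uu (uc y p) (uc v p)) = 0"
  using elim(1) by (simp add: qf_def hat_quad)
  then show ?case using Z d by blast
 qed
 show "AE p in Q T. uc y p = 0v h & v (fst p) (snd p) = 0v r" using reduced_zero(2,3)[OF y y0 Zd v] by eventually_elim simp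
 show "t : {0..T} ==> AE w in M. y t w = 0v h" by (rule reduced_zero(1)[OF y y0 Zd v])
qed

section \<open>Optimality\<close>

text \<open>Duality: the product formula for d = y - a and the adjoint process p, together with
  stationarity, shows that the terminal cross term cancels the running cross term. Of the quadratic
  expansion only the cost of the difference remains.\<close>

lemma comparison:
 assumes y: "reduced y v" and a: "reduced a b" and p: "vip T h p (%t u. - (tr A1 *v p t u + tr C11 *v q t u - Qh *v a t u - tr S *v b t u)) q"
  and y0: "AE u in M. y 0 u = a 0 u" and pT: "AE u in M. p T u = - (Hh *v a T u)"
  and st: "!!t u. t : {0..T} ==> u : space M ==> tr B1 *v p t u + tr Dt *v q t u = S *v a t u + Rh *v b t u"
 shows "jj y v = jj a b + jj (%t u. y t u - a t u) (%t u. v t u - b t u)"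
proof -
 define d where "d t u = y t u - a t u" for t u
 define w where "w t u = v t u - b t u" for t u
 have d: "reduced d w" unfolding d_def[abs_def] w_def[abs_def] by (rule reduced_diff[OF y a])
 note dim = reducedD(3,4)
 let ?q = "%y v y' v' p. qf (uc y p) (uc v p) (uc y' p) (uc v' p)"
 have "EE (%u. d T u *. p T u) = EE (%u. d 0 u *. p 0 u) + (LINT p|Q T. ?q d w a b p)" unfolding vip_product[OF reducedD(2)[OF d] p TT(1)]
 proof (rule arg_cong2[where f = "(+)", OF refl icong[OF refl]])
  fix z assume "z : space (Q T)"
  then have z: "fst z : {0..T}" "snd z : space M" by (auto simp: space_Q)
  define X V P' Q' Y U where X: "X = uc d z" "V = uc w z" "P' = uc p z" "Q' = uc q z" "Y = uc a z" "U = uc b z"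
  have [simp]: "dim_vec X = h" "dim_vec V = r" "dim_vec P' = h" "dim_vec Q' = h" "dim_vec Y = h" "dim_vec U = r"
  unfolding X using dim[OF d z] dim[OF a z] vipD(1)[OF p z] vproc_dim[OF vipD(3)[OF p] z] by simp_all
  have "V *. (tr B1 *v P' + tr Dt *v Q') = V *. (S *v Y + Rh *v U)" unfolding X st[OF z] ..
  then have "X *. - (tr A1 *v P' + tr C11 *v Q' - Qh *v Y - tr S *v U) + P' *. (A1 *v X + B1 *v V) + (C11 *v X + Dt *v V) *. Q' = qf X V Y U"
  by (simp add: qf_def scalar_laws sp_tr scalar_prod_commute[of P' "A1 *v X"] scalar_prod_commute[of P' "B1 *v V"])
  then show "uc d z *. - (tr A1 *v uc p z + tr C11 *v uc q z - Qh *v uc a z - tr S *v uc b z) +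
  uc p z *. (A1 *v uc d z + B1 *v uc w z) + (C11 *v uc d z + Dt *v uc w z) *. q (fst z) (snd z) = ?q d w a b z" unfolding X .
 qed
 also have "EE (%u. d 0 u *. p 0 u) = EE (%u. 0)" proof (rule integral_cong_AE)
  show "AE u in M. d 0 u *. p 0 u = 0" using y0 AE_space proof eventually_elim
  case (elim u)
  have "dim_vec (a 0 u) = h" "dim_vec (p 0 u) = h" using dim(1)[OF a TT(2) elim(2)] vipD(1)[OF p TT(2) elim(2)] .
  then show ?case unfolding d_def elim(1) by (simp add: scalar_laws)
  qed
 qed (use vsq_integrable[OF reducedD(7)[OF d TT(2)] vip_vsq(1)[OF p TT(2)]] in auto)
 also have "EE (%u. d T u *. p T u) = EE (%u. - (d T u *. (Hh *v a T u)))" proof (rule integral_cong_AE)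
  show "AE u in M. d T u *. p T u = - (d T u *. (Hh *v a T u))" using pT AE_space
  by eventually_elim (use dim(1)[OF d TT(1)] in "simp add: scalar_laws")
 qed (use vsq_integrable[OF reducedD(7)[OF d TT(1)] vip_vsq(1)[OF p TT(1)]] vsq_integrable[OF reducedD(7)[OF d TT(1)] vsq_Hh[OF reducedD(7)[OF a TT(1)]]] in auto)
 finally have cross: "EE (%u. d T u *. (Hh *v a T u)) + (LINT p|Q T. ?q d w a b p) = 0" by simp
 note i = qf_integrable[OF reducedD(5,6)[OF a] reducedD(5,6)[OF a]] qf_integrable[OF reducedD(5,6)[OF d] reducedD(5,6)[OF a]] qf_integrable[OF reducedD(5,6)[OF d] reducedD(5,6)[OF d]]
 have "(LINT p|Q T. ?q y v y v p) = (LINT p|Q T. ?q a b a b p + 2 * ?q d w a b p + ?q d w d w p)" proof (rule icong[OF refl])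
  fix z assume "z : space (Q T)"
  then have z: "fst z : {0..T}" "snd z : space M" by (auto simp: space_Q)
  show "?q y v y v z = ?q a b a b z + 2 * ?q d w a b z + ?q d w d w z" unfolding d_def w_def by (rule qf_expand[OF dim[OF y z] dim[OF a z]])
 qed
 also have "... = (LINT p|Q T. ?q a b a b p) + 2 * (LINT p|Q T. ?q d w a b p) + (LINT p|Q T. ?q d w d w p)" using i by simp
 finally have 1: "(LINT p|Q T. ?q y v y v p) = ..." .
 note j = vsq_integrable[OF reducedD(7)[OF a TT(1)] vsq_Hh[OF reducedD(7)[OF a TT(1)]]] vsq_integrable[OF reducedD(7)[OF d TT(1)] vsq_Hh[OF reducedD(7)[OF a TT(1)]]]
  vsq_integrable[OF reducedD(7)[OF d TT(1)] vsq_Hh[OF reducedD(7)[OF d TT(1)]]]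
 have "EE (%u. y T u *. (Hh *v y T u)) = EE (%u. a T u *. (Hh *v a T u) + 2 * (d T u *. (Hh *v a T u)) + d T u *. (Hh *v d T u))"
  unfolding d_def by (rule icong[OF refl]) (rule Hh_expand[OF dim(1)[OF y TT(1)] dim(1)[OF a TT(1)]])
 also have "... = EE (%u. a T u *. (Hh *v a T u)) + 2 * EE (%u. d T u *. (Hh *v a T u)) + EE (%u. d T u *. (Hh *v d T u))" using j by simp
 finally have 2: "EE (%u. y T u *. (Hh *v y T u)) = ..." .
 have "1/2 * (s1 + 2 * s2 + s3) + 1/2 * (e1 + 2 * e2 + e3) = 1/2 * s1 + 1/2 * e1 + (1/2 * s3 + 1/2 * e3)" if "e2 + s2 = 0" for s1 s2 s3 e1 e2 e3 :: real
  using that by argo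
 then show ?thesis unfolding d_def[symmetric] w_def[symmetric] jj_def 1 2 using cross .
qed

abbreviation "ov y p q == %t w. opt (y t w) (p t w) (q t w)"
abbreviation "adj p q a b == %t w. - (tr A1 *v p t w + tr C11 *v q t w - Qh *v a t w - tr S *v b t w)"

lemma ov_vproc:
 assumes l: "linear_class T P" and y: "vproc T P h y" and p: "vproc T P h p" and q: "vproc T P h q" shows "vproc T P r (ov y p q)" unfolding opt_def
 by (rule vproc_mult[OF vproc_diff[OF vproc_add[OF vproc_mult[OF p l] vproc_mult[OF q l] l] vproc_mult[OF y l] l] l]) simp_all

lemma adj_vproc:
 assumes l: "linear_class T P" and y: "vproc T P h y" and p: "vproc T P h p" and q: "vproc T P h q" and v: "vproc T P r v"
 shows "vproc T P h (adj p q y v)"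
proof (rule vproc_cong[OF _ l])
 show "vproc T P h (%t w. tr S *v v t w + Qh *v y t w - tr C11 *v q t w - tr A1 *v p t w)"
  by (intro vproc_add[OF _ _ l] vproc_diff[OF _ _ l] vproc_mult[OF y l] vproc_mult[OF p l] vproc_mult[OF q l] vproc_mult[OF v l]; simp)
 fix t w assume "t : {0..T}" "w : space M"
 note [simp] = vproc_dim[OF y this] vproc_dim[OF p this] vproc_dim[OF q this] vproc_dim[OF v this]
 show "tr S *v v t w + Qh *v y t w - tr C11 *v q t w - tr A1 *v p t w = adj p q y v t w"
  by (rule sp_eqI[of _ h]) (simp_all add: scalar_laws)
qed

text \<open>For an arbitrary solution q is only square integrable in time, and so is the resulting
  input; the uniqueness argument works with reduced pairs of this regularity.\<close>

lemma fbsde_imp_reduced: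
 assumes "fbsde_solution M W T h A1 B1 C11 Dt Qh Rh S Hh x10 y p q"
 shows "vc T h y" "vc T h p" "vp T h q" "reduced y (ov y p q)" "vip T h p (adj p q y (ov y p q)) q"
  "AE w in M. y 0 w = x10" "AE w in M. p T w = - (Hh *v y T w)"
proof -
 note fb = assms[unfolded fbsde_solution_def Let_def L2_cont_iff[OF T0] L2_proc_iff]
 show y: "vc T h y" and p: "vc T h p" and q: "vp T h q"
  and "AE w in M. y 0 w = x10" "AE w in M. p T w = - (Hh *v y T w)" by (simp_all only: fb)
 note d = vproc_dim[OF y] vproc_dim[OF p] vproc_dim[OF q]
 have v: "vp T r (ov y p q)" by (rule ov_vproc[OF linear_class_sqp vc_vp[OF y] vc_vp[OF p] q])
 have init: "vip T h X b' s'" if X: "vc T h X" and hd: "has_differential M W T h X b s" and b: "vp T h b'" and s: "vp T h s'"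
  and e: "!!t w. t : {0..T} ==> w : space M ==> b' t w = b t w & s' t w = s t w" for X b s b' s'
 proof (rule vip_cong_pointwise[OF has_differential_imp_vip[OF hd T0 vproc_cong[OF b linear_class_sqp] vproc_cong[OF s linear_class_sqp]] T0])
  fix i assume "i < h"
  then have "cp T (%t w. X t w $ i)" using X by (simp add: vproc_def)
  then show "jm T (%t w. X t w $ i)" "sqi M (%w. X 0 w $ i)" by (rule cp_jm, rule cp_sqi[OF _ TT(2)])
 qed (use e vproc_dim[OF X] vp_F[OF vc_vp[OF X] TT(2)] in auto)
 show "reduced y (ov y p q)" unfolding reduced_def proof (rule conjI[OF v init[OF y]])
  show "has_differential M W T h y (%t w. A' *v y t w + (B1 * minv Rh * tr B1) *v p t w + (B1 * minv Rh * tr Dt) *v q t w)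
  (%t w. C' *v y t w + (Dt * minv Rh * tr B1) *v p t w + (Dt * minv Rh * tr Dt) *v q t w)" using fb by (elim conjE)
 qed ((intro vp_intros(2) vp_intros(1)[OF vc_vp[OF y]] vp_intros(1)[OF v]; simp)+, use d in "simp only: hamiltonian(4,5)")
 show "vip T h p (adj p q y (ov y p q)) q" proof (rule init[OF p _ adj_vproc[OF linear_class_sqp vc_vp[OF y] vc_vp[OF p] q v] q])
  show "has_differential M W T h p (%t w. - (tr A' *v p t w + tr C' *v q t w + (tr S * minv Rh * S - Qh) *v y t w)) q" using fb by (elim conjE)
 qed (use d in "simp only: hamiltonian(6)")
qed

text \<open>Here q is continuous, as both diffusion coefficients must be to pass to the strict
  integral.\<close>

lemma reduced_imp_fbsde:
 assumes y: "vc T h y" and p: "vc T h p" and q: "vc T h q"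
  and yi: "reduced y (ov y p q)" and pi: "vip T h p (adj p q y (ov y p q)) q"
  and "AE w in M. y 0 w = x10" "AE w in M. p T w = - (Hh *v y T w)" shows "fbsde_solution M W T h A1 B1 C11 Dt Qh Rh S Hh x10 y p q"
 unfolding fbsde_solution_def Let_def L2_cont_iff[OF T0] L2_proc_iff
proof (intro conjI y p assms(6,7) vc_vp[OF q])
 note d = vproc_dim[OF y] vproc_dim[OF p] vproc_dim[OF q]
 show "has_differential M W T h y (%t w. A' *v y t w + (B1 * minv Rh * tr B1) *v p t w + (B1 * minv Rh * tr Dt) *v q t w)
  (%t w. C' *v y t w + (Dt * minv Rh * tr B1) *v p t w + (Dt * minv Rh * tr Dt) *v q t w)"
  by (rule vip_imp_has_differential[OF vip_cong_pointwise[OF reducedD(2)[OF yi] T0]], rule conjI[OF refl conjI[OF hamiltonian(4,5)[symmetric]]]; (rule d; assumption)?)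
  (intro vc_intros(2) vc_intros(1)[OF y] vc_intros(1)[OF p] vc_intros(1)[OF q]; simp)+
 show "has_differential M W T h p (%t w. - (tr A' *v p t w + tr C' *v q t w + (tr S * minv Rh * S - Qh) *v y t w)) q"
  by (rule vip_imp_has_differential[OF vip_cong_pointwise[OF pi T0] q], rule conjI[OF refl conjI[OF hamiltonian(6)[symmetric] refl]]; rule d; assumption)
qed

text \<open>Two solutions give state-control pairs of which each costs at least as much as the other.\<close>

lemma fbsde_solution_unique:
 assumes a: "fbsde_solution M W T h A1 B1 C11 Dt Qh Rh S Hh x10 y p q" and b: "fbsde_solution M W T h A1 B1 C11 Dt Qh Rh S Hh x10 y' p' q'"
 shows "indist M T y' y" "indist M T p' p" "eq_L2 M T q' q"
proof -
 let ?v = "ov y p q" and ?v' = "ov y' p' q'"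
 note fa = fbsde_imp_reduced[OF a] and fb = fbsde_imp_reduced[OF b]
 note da = vproc_dim[OF fa(1)] vproc_dim[OF fa(2)] vproc_dim[OF fa(3)] and db = vproc_dim[OF fb(1)] vproc_dim[OF fb(2)] vproc_dim[OF fb(3)]
 note d = da db
 have 0: "AE w in M. y' 0 w = y 0 w" "AE w in M. y 0 w = y' 0 w" using fa(6) fb(6) by (eventually_elim, simp)+
 have z0: "AE w in M. y' 0 w - y 0 w = 0v h" using 0(1) AE_space by eventually_elim (use d(1)[OF TT(2)] in auto)
 have c: "jj y' ?v' = jj y ?v + jj (%t w. y' t w - y t w) (%t w. ?v' t w - ?v t w)"
  by (rule comparison[OF fb(4) fa(4,5) 0(1) fa(7) stationary]) (erule (1) da)+
 have c': "jj y ?v = jj y' ?v' + jj (%t w. y t w - y' t w) (%t w. ?v t w - ?v' t w)"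
  by (rule comparison[OF fa(4) fb(4,5) 0(2) fb(7) stationary]) (erule (1) db)+
 have "0 <= jj (%t w. y t w - y' t w) (%t w. ?v t w - ?v' t w)" using jj_nonneg[OF reduced_diff[OF fa(4) fb(4)]] by (simp add: jj_def)
 then have "jj (%t w. y' t w - y t w) (%t w. ?v' t w - ?v t w) <= 0" using c c' by linarith
 note z = jj_zero[OF reduced_diff[OF fb(4) fa(4)] z0 this]
 have y: "AE w in M. y' t w = y t w" if "t : {0..T}" for t using z(2)[OF that] AE_space by eventually_elim (use d that zero_diff_eq in blast)
 then show "indist M T y' y" by (rule vc_indist[OF fb(1) fa(1) T0])
 have pT: "AE w in M. p' T w - p T w = 0v h" using fa(7) fb(7) y[OF TT(1)] AE_space by eventually_elim (use d(2)[OF TT(1)] in auto)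
 \<comment> \<open>With y and the input already identified, the difference of the adjoint processes
   solves a homogeneous backward equation.\<close>
 have b: "AE z in Q T. adj p' q' y' ?v' (fst z) (snd z) - adj p q y ?v (fst z) (snd z)
  = - (tr A1 *v (uc p' z - uc p z) + tr C11 *v (uc q' z - uc q z))" using z(1) AE_Q_space proof eventually_elim
  case (elim z)
  then have t: "fst z : {0..T}" "snd z : space M" by auto
  note [simp] = da[OF t] db[OF t]
  have e: "uc y' z = uc y z" "uc ?v' z = uc ?v z" using elim(1) by (auto intro: zero_diff_eq[of _ _ h] zero_diff_eq[of _ _ r])
  show ?case unfolding e(2) unfolding e(1) by (rule sp_eqI[of _ h]) (simp_all add: mat_laws scalar_laws)
 qed
 note U = vip_backward_unique[OF vip_diff[OF fb(5) fa(5) T0] T0 pT _ _ _ _ b]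
 have p: "AE w in M. p' t w - p t w = 0v h" if "t : {0..T}" for t by (rule U(1)) (simp_all add: that[simplified])
 have q: "AE z in Q T. uc q' z - uc q z = 0v h" by (rule U(2)) simp_all
 have "AE w in M. p' t w = p t w" if "t : {0..T}" for t using p[OF that] AE_space by eventually_elim (use d that zero_diff_eq in blast)
 then show "indist M T p' p" by (rule vc_indist[OF fb(2) fa(2) T0])
 have "AE z in Q T. uc q' z = uc q z" using q AE_Q_space by eventually_elim (use d zero_diff_eq in blast)
 then show "eq_L2 M T q' q" unfolding Q_def eq_L2_def case_prod_unfold .
qed

end

section \<open>Admissible pairs and the optimal pair\<close>

context slq
begin

lemma xx_add:
 assumes [simp]: "dim_vec y = h" "dim_vec v = r" "dim_vec a = h" "dim_vec b = r" shows "xx y v = xx (y - a) (v - b) + xx a b"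
proof -
 have 1: "(y - a) + a = y" "(v - b) + b = v" by (auto intro: eq_vecI)
 have "- (B2 *v ((v - b) + b)) = - (B2 *v (v - b)) + - (B2 *v b)" by (intro sp_eqI[of _ l]) (simp_all add: mat_laws scalar_laws)
 then have "((y - a) @v - (B2 *v (v - b))) + (a @v - (B2 *v b)) = y @v - (B2 *v v)" unfolding 1(2) by (simp add: append_laws 1(1))
 from this[symmetric] have "N1 *v (y @v - (B2 *v v)) = N1 *v (((y - a) @v - (B2 *v (v - b))) + (a @v - (B2 *v b)))" by (rule arg_cong)
 then show ?thesis by (simp add: xx_def mat_laws)
qed

lemma F_dims[simp]: "dim_row F = r" "dim_col F = n" using H1 by auto

end

context lq
begin

lemma vc_vsq: "vc T k X ==> t : {0..T} ==> vsq M k (X t)" using cp_sqi[of T "%t w. X t w $ i" t for i] by (simp add: vproc_def vsq_def)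

lemma state_reduced:
 assumes x: "vp T n x" and u: "vp T r u" and s: "state_solution M W T n E A B C D x0 u x"
 shows "EX y v. reduced y v & (AE w in M. y 0 w = J1 *v (M1 *v x0)) &
  (AE p in Q T. uc x p = xx (uc y p) (uc v p) & u (fst p) (snd p) = uu (uc y p) (uc v p)) &
  cost M T E Qm R H u x = jj y v"
proof -
 note sv = state_vip[OF x u s]
 note re = reduce[OF x u sv]
 show ?thesis by (intro exI conjI, rule re(1), rule re(2), rule re(3), rule cost_reduced[OF x u re(1) re(3) re(4)[OF TT(1)] vip_vsq(1)[OF sv(1) TT(1)]])
qed

lemma admissible_reduced:
 assumes "(u, x) : J_ad M W T n r E A B C D x0 Fg" shows "EX y v. reduced y v & (AE z in M. y 0 z = J1 *v (M1 *v x0)) &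
  (AE p in Q T. uc x p = xx (uc y p) (uc v p) & u (fst p) (snd p) = uu (uc y p) (uc v p)) &
  cost M T E Qm R H u x = jj y v"
proof -
 have u: "vp T r u" and x: "vp T n x" using assms unfolding J_ad_def L2_proc_iff by auto
 obtain w where w: "ALL t:{0..T}. ALL z:space M. u t z = Fg *v x t z + w t z"
  and s: "state_solution M W T n E A B C D x0 (%t z. Fg *v x t z + w t z) x" using assms unfolding J_ad_def by auto
 have u': "vp T r (%t z. Fg *v x t z + w t z)" by (rule vproc_cong[OF u linear_class_sqp]) (use w in blast)
 obtain y v where yv: "reduced y v" "AE z in M. y 0 z = J1 *v (M1 *v x0)"
  and xu: "AE p in Q T. uc x p = xx (uc y p) (uc v p) & Fg *v uc x p + uc w p = uu (uc y p) (uc v p)"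
  and c: "cost M T E Qm R H (%t z. Fg *v x t z + w t z) x = jj y v" using state_reduced[OF x u' s] by (elim exE conjE)
 have "AE p in Q T. uc x p = xx (uc y p) (uc v p) & u (fst p) (snd p) = uu (uc y p) (uc v p)" using xu AE_Q_space by eventually_elim (use w in auto)
 moreover have "cost M T E Qm R H u x = cost M T E Qm R H (%t z. Fg *v x t z + w t z) x" unfolding cost_def set_integral_lb
  by (rule arg_cong2[where f = "(+)", OF _ refl], rule arg_cong2[where f = "(*)", OF refl], intro icong refl) (use w in simp)
 ultimately show ?thesis using yv c by auto
qed

lemma xu_eq_L2:
 assumes y: "reduced y v" and a: "reduced a b" and z: "AE p in Q T. uc y p - uc a p = 0v h & v (fst p) (snd p) - uc b p = 0v r"
  and xu: "AE p in Q T. uc x p = xx (uc y p) (uc v p) & u (fst p) (snd p) = uu (uc y p) (uc v p)"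
 shows "eq_L2 M T x (%t w. xx (a t w) (b t w))" "eq_L2 M T u (%t w. uu (a t w) (b t w))"
proof -
 have "AE p in Q T. uc x p = xx (uc a p) (uc b p) & u (fst p) (snd p) = uu (uc a p) (uc b p)" using z xu AE_Q_space proof eventually_elim
  case (elim p)
  then have t: "fst p : {0..T}" "snd p : space M" by auto
  note d = reducedD(3,4)[OF y t] reducedD(3,4)[OF a t]
  have e: "uc y p = uc a p" "uc v p = uc b p" using elim(1) zero_diff_eq d by blast+
  show ?case using elim(2) unfolding e .
 qed
 note e = this
 show "eq_L2 M T x (%t w. xx (a t w) (b t w))" unfolding eq_L2_def case_prod_unfold Q_def[symmetric] using e by eventually_elim simp
 show "eq_L2 M T u (%t w. uu (a t w) (b t w))" unfolding eq_L2_def case_prod_unfold Q_def[symmetric] using e by eventually_elim simp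
qed

text \<open>Admissibility includes uniqueness of the state for the fixed input of the gain Fg. For a
  competing state the difference of the reduced inputs equals (Fg - K) applied to the difference of
  the states, which makes it linear in the slow part, so the difference vanishes.\<close>

lemma construct_admissible:
 assumes y: "reduced y v" and yc: "vc T h y" and vc: "vc T r v" and y0: "AE g in M. y 0 g = J1 *v (M1 *v x0)"
  and d: "!!t g. dim_vec (v t g) = r"
 defines "x == %t g. xx (y t g) (v t g)" and "u == %t g. uu (y t g) (v t g)"
 shows "(u, x) : J_ad M W T n r E A B C D x0 Fg" "cost M T E Qm R H u x = jj y v"
proof -
 have con: "vc T n x" "vc T r u" "AE g in M. E *v x 0 g = x0"
  "has_differential M W T n (%t g. E *v x t g) (%t g. A *v x t g + B *v u t g) (%t g. C *v x t g + D *v u t g)"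
  unfolding x_def u_def by (rule construct[OF y yc vc y0])+
 have xd[simp]: "dim_vec (x t g) = n" "dim_vec (u t g) = r" for t g by (simp_all add: x_def u_def xx_def uu_def d)
 \<comment> \<open>The input that produces the same control u under the gain Fg.\<close>
 define w where "w t g = u t g - Fg *v x t g" for t g
 have wd[simp]: "dim_vec (w t g) = r" for t g by (simp add: w_def)
 have w: "vp T r w" unfolding w_def[abs_def] by (intro vp_intros(3) vc_vp[OF con(2)] vp_intros(1)[OF vc_vp[OF con(1)]]) simp_all
 have uw: "u t g = Fg *v x t g + w t g" for t g unfolding w_def by (intro eq_vecI) simp_all
 have s: "state_solution M W T n E A B C D x0 u x" unfolding state_solution_def L2_proc_iff by (intro conjI vc_vp[OF con(1)] con(3,4))
 have uniq: "eq_L2 M T x' x" if s': "state_solution M W T n E A B C D x0 (%t g. Fg *v x' t g + w t g) x'" for x' proof -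
  have x': "vp T n x'" using s' unfolding state_solution_def L2_proc_iff by (elim conjE)
  have u': "vp T r (%t g. Fg *v x' t g + w t g)" by (intro vp_intros(2) vp_intros(1)[OF x'] w) simp_all
  obtain y' v' where y': "reduced y' v'" and y0': "AE g in M. y' 0 g = J1 *v (M1 *v x0)"
  and xu: "AE p in Q T. uc x' p = xx (uc y' p) (uc v' p) & Fg *v uc x' p + uc w p = uu (uc y' p) (uc v' p)"
  using state_reduced[OF x' u' s'] by (elim exE conjE)
  note dl = reduced_diff[OF y' y]
  obtain Z where Z: "dim_row Z = r & dim_col Z = h & (ALL y v. dim_vec y = h --> dim_vec v = r --> v = Fg *v xx y v - K *v xx y v --> v = Z *v y)"
  using gain_linear by (elim exE)
  have Zd: "dim_row Z = r" "dim_col Z = h" using Z by simp_all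
  have "AE p in Q T. uc v' p - uc v p = Z *v (uc y' p - uc y p)" using xu AE_Q_space proof eventually_elim
  case (elim p)
  then have t: "fst p : {0..T}" "snd p : space M" by auto
  define a b a' b' c where ab: "a = uc y p" "b = uc v p" "a' = uc y' p" "b' = uc v' p" "c = uc w p"
  have [simp]: "dim_vec a = h" "dim_vec b = r" "dim_vec a' = h" "dim_vec b' = r" "dim_vec c = r"
  unfolding ab using reducedD(3,4)[OF y t] reducedD(3,4)[OF y' t] by simp_all
  have 1: "Fg *v xx a' b' + c = K *v xx a' b' + b'" using elim(1) unfolding ab uu_def by auto
  have 2: "Fg *v xx a b + c = K *v xx a b + b" using uw[of "fst p" "snd p"] unfolding ab x_def u_def uu_def by simp
  have e: "xx a' b' = xx (a' - a) (b' - b) + xx a b" by (rule xx_add) simp_all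
  have "b' - b = Fg *v xx (a' - a) (b' - b) - K *v xx (a' - a) (b' - b)" proof (rule sp_eqI[of _ r])
  fix z :: "real vec" assume [simp]: "dim_vec z = r"
  have "z *. (Fg *v xx a' b' + c) = z *. (K *v xx a' b' + b')" "z *. (Fg *v xx a b + c) = z *. (K *v xx a b + b)" unfolding 1 2 by (rule refl)+
  then show "z *. (b' - b) = z *. (Fg *v xx (a' - a) (b' - b) - K *v xx (a' - a) (b' - b))" unfolding e by (simp add: mat_laws scalar_laws)
  qed simp_all
  then have "b' - b = Z *v (a' - a)" using Z[THEN conjunct2, THEN conjunct2, rule_format, of "a' - a" "b' - b"] by simp
  then show ?case unfolding ab .
  qed
  moreover have "AE g in M. y' 0 g - y 0 g = 0v h" using y0 y0' by eventually_elim auto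
  ultimately have z: "AE p in Q T. uc y' p - uc y p = 0v h" "AE p in Q T. uc v' p - uc v p = 0v r" using reduced_zero(2,3)[OF dl _ Zd] by blast+
  have "AE p in Q T. uc y' p - uc y p = 0v h & v' (fst p) (snd p) - uc v p = 0v r" using z by eventually_elim simp
  then show ?thesis unfolding x_def by (rule xu_eq_L2(1)[OF y' y _ xu])
 qed
 show "(u, x) : J_ad M W T n r E A B C D x0 Fg" unfolding J_ad_def L2_proc_iff
  by (intro CollectI case_prodI conjI bexI[of _ w] vc_vp[OF con(1)] vc_vp[OF con(2)] ballI allI impI uw uniq)
  (use s w in "simp_all add: uw[symmetric] L2_proc_iff")
 show "cost M T E Qm R H u x = jj y v" proof (rule cost_reduced[OF vc_vp[OF con(1)] vc_vp[OF con(2)] y])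
  show "AE g in M. E *v x T g = Mi *v (y T g @v 0v l)" using AE_space
  by eventually_elim (use closed_system(1)[OF reducedD(3)[OF y TT(1)] d] in "simp add: x_def")
  show "vsq M n (%g. E *v x T g)" by (rule vc_vsq[OF vc_intros(1)[OF con(1)] TT(1)]) simp_all
 qed (simp add: x_def u_def)
qed

theorem main:
 "EX u x y p q.
  optimal_pair M T E Qm R H (J_ad M W T n r E A B C D x0 Fg) u x &
  (ALL u' x'. optimal_pair M T E Qm R H (J_ad M W T n r E A B C D x0 Fg) u' x' --> eq_L2 M T u' u & eq_L2 M T x' x) &
  fbsde_solution M W T h A1 B1 C11 Dt Qh Rh S Hh (J1 *v (M1 *v x0)) y p q &
  (ALL y' p' q'. fbsde_solution M W T h A1 B1 C11 Dt Qh Rh S Hh (J1 *v (M1 *v x0)) y' p' q'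
  --> indist M T y' y & indist M T p' p & eq_L2 M T q' q) &
  eq_L2 M T (%t w. x t w @v u t w) (%t w. Gam *v (y t w @v p t w @v q t w))"
proof -
 define x10 where "x10 = J1 *v (M1 *v x0)"
 have v10: "vec h (%l. x10 $ l) = x10" by (rule eq_vecI) (simp_all add: x10_def del: index_mult_mat_vec)
 obtain y p q where y: "vc T h y" and p: "vc T h p" and q: "vc T h q"
  and yi: "vip T h y (%t w. A' *v y t w + B1 *v (hv Rh B1 Dt (p t w) (q t w)))
  (%t w. C' *v y t w + Dt *v (hv Rh B1 Dt (p t w) (q t w)))"
  and pi: "vip T h p (%t w. - (tr A' *v p t w + tr C' *v q t w - Qp *v y t w)) q"
  and y0: "AE w in M. y 0 w = vec h (%l. x10 $ l)" and pT: "ALL w. p T w = - (Hh *v y T w)"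
  using fbsde_exists[OF riccati Hh_pos_semidef T, of "%l. x10 $ l"] by (elim exE conjE)
 let ?v = "ov y p q"
 define v where "v = ?v"
 have vd: "dim_vec (v t w) = r" for t w by (simp add: v_def)
 note d = vproc_dim[OF y] vproc_dim[OF p] vproc_dim[OF q]
 have v: "vc T r v" unfolding v_def by (rule ov_vproc[OF linear_class_cp y p q])
 have red: "reduced y v" unfolding reduced_def
  by (rule conjI[OF vc_vp[OF v] vip_cong_pointwise[OF yi T0]], unfold v_def, rule conjI[OF refl conjI[OF hamiltonian(1,2)]]) (erule (1) d)+
 have pv: "vip T h p (adj p q y v) q"
  unfolding v_def by (rule vip_cong_pointwise[OF pi T0], rule conjI[OF refl conjI[OF hamiltonian(3) refl]]; rule d; assumption)
 have pT': "AE w in M. p T w = - (Hh *v y T w)" using pT by simp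
 have y0': "AE w in M. y 0 w = J1 *v (M1 *v x0)" using y0 unfolding v10 unfolding x10_def .
 define x where "x t w = xx (y t w) (v t w)" for t w
 define u where "u t w = uu (y t w) (v t w)" for t w
 have ux: "(u, x) : J_ad M W T n r E A B C D x0 Fg" "cost M T E Qm R H u x = jj y v"
  unfolding x_def[abs_def] u_def[abs_def] by (rule construct_admissible[OF red y v y0' vd])+
 let ?J = "J_ad M W T n r E A B C D x0 Fg"
 let ?c = "%(u', x'). cost M T E Qm R H u' x'"
 have cmp: "cost M T E Qm R H u x <= cost M T E Qm R H u' x' & (cost M T E Qm R H u' x' <= cost M T E Qm R H u x --> eq_L2 M T u' u & eq_L2 M T x' x)"
  if J: "(u', x') : ?J" for u' x' proof -
  obtain y' v' where red': "reduced y' v'" and y0'': "AE w in M. y' 0 w = J1 *v (M1 *v x0)"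
  and xu: "AE p in Q T. uc x' p = xx (uc y' p) (uc v' p) & u' (fst p) (snd p) = uu (uc y' p) (uc v' p)"
  and c: "cost M T E Qm R H u' x' = jj y' v'" using admissible_reduced[OF J] by (elim exE conjE)
  have e0: "AE w in M. y' 0 w = y 0 w" using y0' y0'' by eventually_elim simp
  note dl = reduced_diff[OF red' red]
  have st: "tr B1 *v p t w + tr Dt *v q t w = S *v y t w + Rh *v v t w" if "t : {0..T}" "w : space M" for t w
  unfolding v_def by (rule stationary) (rule d[OF that])+
  have cp: "jj y' v' = jj y v + jj (%t w. y' t w - y t w) (%t w. v' t w - v t w)" by (rule comparison[OF red' red pv e0 pT' st])
  have "0 <= jj (%t w. y' t w - y t w) (%t w. v' t w - v t w)" using jj_nonneg[OF dl] unfolding jj_def by simp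
  moreover have "eq_L2 M T u' u & eq_L2 M T x' x" if "jj (%t w. y' t w - y t w) (%t w. v' t w - v t w) <= 0" proof -
  have z0: "AE w in M. y' 0 w - y 0 w = 0v h" using y0' y0'' by eventually_elim auto
  show ?thesis unfolding x_def[abs_def] u_def[abs_def] by (rule conjI) (rule xu_eq_L2[OF red' red jj_zero(1)[OF dl z0 that] xu])+
  qed
  ultimately show ?thesis unfolding c ux(2) cp by simp
 qed
 \<comment> \<open>The infimum is attained at the candidate, so it is a genuine minimum and not a
   default value of the infimum on the reals.\<close>
 have inf: "(INF (u', x') \<in> ?J. cost M T E Qm R H u' x') = cost M T E Qm R H u x" by (rule cInf_eq_minimum) (use ux(1) cmp in force)+
 have opt: "optimal_pair M T E Qm R H ?J u x" unfolding optimal_pair_def inf using ux(1) by simp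
 have uni: "eq_L2 M T u' u & eq_L2 M T x' x" if o: "optimal_pair M T E Qm R H ?J u' x'" for u' x' proof -
  have "(u', x') : ?J" "cost M T E Qm R H u' x' = cost M T E Qm R H u x" using o unfolding optimal_pair_def inf by simp_all
  then show ?thesis using cmp[of u' x'] by simp
 qed
 have fb: "fbsde_solution M W T h A1 B1 C11 Dt Qh Rh S Hh (J1 *v (M1 *v x0)) y p q"
  by (rule reduced_imp_fbsde[OF y p q red[unfolded v_def] pv[unfolded v_def] y0' pT'])
 have gam: "eq_L2 M T (%t w. x t w @v u t w) (%t w. Gam *v (y t w @v p t w @v q t w))"
  unfolding eq_L2_def case_prod_unfold Q_def[symmetric] x_def u_def v_def using AE_Q_space by eventually_elim (rule Gam_vec[symmetric]; rule d; simp)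
 show ?thesis by (rule exI[of _ u], rule exI[of _ x], rule exI[of _ y], rule exI[of _ p], rule exI[of _ q], rule conjI[OF opt], rule conjI,
  intro allI impI, erule uni, rule conjI[OF fb], rule conjI[OF _ gam], intro allI impI conjI; erule fbsde_solution_unique[OF fb])
qed

end

theorem theorem4p1:
  fixes E A C B D Q H R K F :: "real mat"
    and M1 N1 A1 B1 B2 C11 C12 C22 D1 D2 Dt Theta Qh S Rh Hh :: "real mat"
    and n m r h :: nat and ms :: "nat list"
  assumes dims: "E \<in> carrier_mat n n" "A \<in> carrier_mat n n" "C \<in> carrier_mat n n"
      "B \<in> carrier_mat n r" "D \<in> carrier_mat n r"
      "Q \<in> carrier_mat n n" "H \<in> carrier_mat n n" "R \<in> carrier_mat r r" "K \<in> carrier_mat r n"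
    and rank_E: "mat_rank n E = m" "m < n"
    \<comment> \<open>conditions (S)\<close>
    and S_trans: "M1 \<in> carrier_mat n n" "invertible_mat M1" "N1 \<in> carrier_mat n n" "invertible_mat N1"
    and S_dims: "h \<le> n" "A1 \<in> carrier_mat h h" "C11 \<in> carrier_mat h h"
      "C12 \<in> carrier_mat h (n - h)" "C22 \<in> carrier_mat (n - h) (n - h)"
      "B1 \<in> carrier_mat h r" "D1 \<in> carrier_mat h r"
      "B2 \<in> carrier_mat (n - h) r" "D2 \<in> carrier_mat (n - h) r"
    and S_ms: "\<forall>k \<in> set ms. 0 < k" "sum_list ms = n - h"
    and S_E: "M1 * E * N1 = diag_block_mat [1\<^sub>m h, diag_block_mat (map (\<lambda>k. jordan_block k 0) ms)]"
    and S_A: "M1 * (A + B * K) * N1 = diag_block_mat [A1, 1\<^sub>m (n - h)]"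
    and S_B: "M1 * B = B1 @\<^sub>r B2"
    and S_C: "M1 * (C + D * K) * N1 = four_block_mat C11 C12 (0\<^sub>m (n - h) h) C22"
    and S_D: "M1 * D = D1 @\<^sub>r D2"
    and S_CBD: "C22 * B2 = D2"
    and S_B2: "only_first_rows ms B2"
    \<comment> \<open>notation\<close>
    and Dt_def: "Dt = D1 - C12 * B2"
    and Theta_def: "Theta = four_block_mat N1 (0\<^sub>m n r) (K * N1) (1\<^sub>m r)
        * four_block_mat (1\<^sub>m h @\<^sub>r 0\<^sub>m (n - h) h) (0\<^sub>m h r @\<^sub>r (- B2)) (0\<^sub>m r h) (1\<^sub>m r)"
    and hat_dims: "Qh \<in> carrier_mat h h" "S \<in> carrier_mat r h" "Rh \<in> carrier_mat r r"
    and hat_def: "four_block_mat Qh (transpose_mat S) S Rh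
        = transpose_mat Theta * diag_block_mat [Q, R] * Theta"
    and Hh_def: "Hh = transpose_mat (1\<^sub>m h @\<^sub>r 0\<^sub>m (n - h) h)
        * (transpose_mat (minv M1) * H * minv M1) * (1\<^sub>m h @\<^sub>r 0\<^sub>m (n - h) h)"
    \<comment> \<open>(H1) or (H1)'; F is the gain in the admissible controls u = F x + v\<close>
    and H1: "(pos_def n Q \<and> pos_def r R \<and> pos_semidef n H \<and> F = K) \<or>
      (pos_semidef n Q \<and> mat_rank r (1\<^sub>m r + K * N1 * (0\<^sub>m h r @\<^sub>r (- B2))) = r \<and>
       pos_def r R \<and> pos_semidef n H \<and> F \<in> {K, 0\<^sub>m r n})"
  shows "\<exists>\<Gamma> \<in> carrier_mat (n + r) (3 * h).
    \<forall>(M :: 'a measure) W T x0.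
      complete_measure M \<longrightarrow> brownian_motion M W \<longrightarrow> 0 < T \<longrightarrow> x0 \<in> carrier_vec n \<longrightarrow>
      vec_last (M1 *\<^sub>v x0) (n - h) = 0\<^sub>v (n - h) \<longrightarrow>
      (\<exists>u x x1 p q.
         optimal_pair M T E Q R H (J_ad M W T n r E A B C D x0 F) u x \<and>
         (\<forall>u' x'. optimal_pair M T E Q R H (J_ad M W T n r E A B C D x0 F) u' x'
            \<longrightarrow> eq_L2 M T u' u \<and> eq_L2 M T x' x) \<and>
         fbsde_solution M W T h A1 B1 C11 Dt Qh Rh S Hh (vec_first (M1 *\<^sub>v x0) h) x1 p q \<and>
         (\<forall>x1' p' q'.
            fbsde_solution M W T h A1 B1 C11 Dt Qh Rh S Hh (vec_first (M1 *\<^sub>v x0) h) x1' p' q'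
            \<longrightarrow> indist M T x1' x1 \<and> indist M T p' p \<and> eq_L2 M T q' q) \<and>
         eq_L2 M T (\<lambda>t \<omega>. x t \<omega> @\<^sub>v u t \<omega>) (\<lambda>t \<omega>. \<Gamma> *\<^sub>v (x1 t \<omega> @\<^sub>v p t \<omega> @\<^sub>v q t \<omega>)))"
proof -
  interpret slq E A C B D Q H R K F M1 N1 A1 B1 B2 C11 C12 C22 D1 D2 Dt Theta Qh S Rh Hh n r h ms
    by (rule slq.intro) (fact dims S_trans S_dims S_ms(2) S_E S_A S_B S_C S_D S_CBD S_B2 Dt_def Theta_def hat_dims hat_def Hh_def H1)+
  show ?thesis
  \<comment> \<open>The matrix is supplied before the probability space, the horizon and the initial
    value are introduced, which expresses its dependence on the coefficients alone.\<close>
  proof (rule bexI[OF _ Gam_dims], intro allI impI, goal_cases)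
    case (1 M W T x0)
    have d: "dim_vec (M1 *\<^sub>v x0) = n" by simp
    interpret wiener M W by (rule wiener.intro[OF 1(2,1)])
    interpret lq M W E A C B D Q H R K F M1 N1 A1 B1 B2 C11 C12 C22 D1 D2 Dt Theta Qh S Rh Hh n r h ms T x0
      by (intro lq.intro lq_axioms.intro wiener_axioms slq_axioms 1(3)) (use 1(4,5) J_first_last(2)[OF d] in simp_all)
    show ?case
      unfolding J_first_last(1)[OF d] by (rule main)
  qed
qed

end
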